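(* For every $\varepsilon>0$ there exist positive constants $C_0$ and $C_1$ such that for every $V>\overline{V}$, for every minimizer $\tilde h_V$ of $G_V$, and for all $s\ge\varepsilon$, $$\|\tilde h_V-\overline{h}_s\|_{L^1(\tilde I_s)}\le C_0\exp(-C_1V^{1/3}).$$
   Context: For $h:\mathbb{R}\to[0,\infty)$ lower semicontinuous, let $\Omega_h:=\{(x,y)\in\mathbb{R}^2:0<y<h(x)\}$ and let $\int_{\mathbb{R}}|h'|$ denote the pointwise variation $\sup\{\sum_{i}|h(x_i)-h(x_{i-1})|: x_1<\dots<x_n\}$. For $V>0$, let $\mathcal{A}^\ell_V$ be the set of pairs $(u,h)$ with $h\in BV(\mathbb{R})$ lower semicontinuous, $h\ge0$, $u\in H^1(\Omega_h)$ real-valued, $\int_{\mathbb{R}}h\,dx=V$, and $u(x,0)=x$ (in the sense of traces) for $x\in\operatorname{supp}h$. Set $$F_\ell(V):=\inf\left\{\int_{\Omega_h}|\nabla u|^2\,dx\,dy+\int_{\mathbb{R}}|h'| : (u,h)\in\mathcal{A}^\ell_V\right\}.$$ One always has $F_\ell(V)\le V$. Here $\overline{V}:=\sup\{V>0:F_\ell(V)=V\}$ (with $\overline V:=0$ if this set is empty), so that $F_\ell(V)<V$ for $V>\overline{V}$. For $(u,h)\in\mathcal{A}^\ell_V$ with $u$ minimizing the Dirichlet energy in $\Omega_h$ subject to the boundary condition, put $\tilde h(x):=V^{-2/3}h(V^{1/3}x)$ (so $\int_{\mathbb{R}}\tilde h\,dx=1$) and $$G_V(\tilde h):=V^{-2/3}\int_{\Omega_h}|\nabla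 u|^2\,dx\,dy+\int_{\mathbb{R}}|\tilde h'|;$$ thus minimizers $\tilde h_V$ of $G_V$ are exactly the rescaled profiles of minimizers of $F_\ell(V)$. Given a minimizer $\tilde h_V$ and $s>0$, $\tilde I_s$ denotes the largest connected component of $\{\tilde h_V>s\}$, and $\overline{h}_s$ denotes the function that agrees with $\tilde h_V$ outside $\tilde I_s$, has the same volume as $\tilde h_V$ (i.e. $\int_{\mathbb{R}}\overline{h}_s\,dx=\int_{\mathbb{R}}\tilde h_V\,dx$), and minimizes the surface energy $\int_{\mathbb{R}}|h'|$ among such functions (nothing is asserted if $\{\tilde h_V>s\}=\emptyset$). *)

theory Defs
  imports "HOL-Analysis.Analysis"
begin

text \<open>
  \<^term>\<open>\<phi>\<close> is a compactly supported continuously differentiable function on the open set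
  \<^term>\<open>S\<close>, extended by zero, and \<^term>\<open>\<psi>\<close> is its gradient.
\<close>
definition test_function :: "'a::euclidean_space set \<Rightarrow> ('a \<Rightarrow> real) \<Rightarrow> ('a \<Rightarrow> 'a) \<Rightarrow> bool" where
  "test_function S \<phi> \<psi> \<longleftrightarrow>
     (\<forall>z. (\<phi> has_derivative (\<lambda>v. \<psi> z \<bullet> v)) (at z)) \<and>
     continuous_on UNIV \<psi> \<and>
     (\<exists>K. compact K \<and> K \<subseteq> S \<and> (\<forall>z. z \<notin> K \<longrightarrow> \<phi> z = 0))"

definition BV :: "(real \<Rightarrow> real) \<Rightarrow> bool" where
  "BV h \<longleftrightarrow> integrable lborel h \<and>
     (\<exists>C. \<forall>\<phi> \<psi>. test_function UNIV \<phi> \<psi> \<and> (\<forall>x. \<bar>\<phi> x\<bar> \<le> 1) \<longrightarrow>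
        (LINT x|lborel. h x * \<psi> x) \<le> C)"

definition lower_semicontinuous :: "(real \<Rightarrow> real) \<Rightarrow> bool" where
  "lower_semicontinuous h \<longleftrightarrow> (\<forall>a. open {x. a < h x})"

text \<open>
  The pointwise variation depends on the chosen representative and may be infinite even if
  \<^term>\<open>BV h\<close> holds; hence it takes values in the extended nonnegative reals.
\<close>
definition pointwise_variation :: "(real \<Rightarrow> real) \<Rightarrow> ennreal" where
  "pointwise_variation h =
     (SUP (n, x) \<in> {(n::nat, x::nat \<Rightarrow> real). strict_mono_on {..n} x}.
        ennreal (\<Sum>i<n. \<bar>h (x (Suc i)) - h (x i)\<bar>))"

definition profile :: "(real \<Rightarrow> real) \<Rightarrow> bool" where
  "profile h \<longleftrightarrow> BV h \<and> lower_semicontinuous h \<and> (\<forall>x. 0 \<le> h x)"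

definition subgraph :: "(real \<Rightarrow> real) \<Rightarrow> (real \<times> real) set" where
  "subgraph h = {(x, y). 0 < y \<and> y < h x}"


definition L2_on :: "'a::euclidean_space set \<Rightarrow> ('a \<Rightarrow> 'b::euclidean_space) \<Rightarrow> bool" where
  "L2_on S f \<longleftrightarrow> set_borel_measurable lborel S f \<and> set_integrable lborel S (\<lambda>z. (norm (f z))\<^sup>2)"

definition has_weak_gradient ::
    "'a::euclidean_space set \<Rightarrow> ('a \<Rightarrow> real) \<Rightarrow> ('a \<Rightarrow> 'a) \<Rightarrow> bool" where
  "has_weak_gradient S u g \<longleftrightarrow>
     (\<forall>\<phi> \<psi>. test_function S \<phi> \<psi> \<longrightarrow>
        (LINT z:S|lborel. u z *\<^sub>R \<psi> z) = - (LINT z:S|lborel. \<phi> z *\<^sub>R g z))"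

definition H1_on :: "'a::euclidean_space set \<Rightarrow> ('a \<Rightarrow> real) \<Rightarrow> bool" where
  "H1_on S u \<longleftrightarrow> L2_on S u \<and> (\<exists>g. L2_on S g \<and> has_weak_gradient S u g)"

text \<open>
  For \<^term>\<open>u\<close> in \<open>H\<^sup>1\<close> the weak gradient is unique up to null sets, so the choice below does not
  affect the Dirichlet energy.
\<close>
definition weak_gradient :: "'a::euclidean_space set \<Rightarrow> ('a \<Rightarrow> real) \<Rightarrow> 'a \<Rightarrow> 'a" where
  "weak_gradient S u = (SOME g. L2_on S g \<and> has_weak_gradient S u g)"

definition dirichlet_energy :: "'a::euclidean_space set \<Rightarrow> ('a \<Rightarrow> real) \<Rightarrow> ennreal" where
  "dirichlet_energy S u = (\<integral>\<^sup>+z\<in>S. ennreal ((norm (weak_gradient S u z))\<^sup>2) \<partial>lborel)"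

text \<open>
  The trace at a boundary point \<open>p\<close> is the number \<open>c\<close> for which the averages of \<open>|u - c|\<close> over
  \<open>\<Omega> \<inter> B(p,r)\<close> tend to \<open>0\<close>. The averages are normalised by \<open>r\<^sup>2\<close>: at a point \<open>(x,0)\<close> with
  \<open>h x > 0\<close> the subgraph of \<open>h\<close> is locally a half disc, by lower semicontinuity, and this is the
  usual average up to the factor \<open>\<pi>/2\<close>. Almost everywhere on the rest of the support of \<open>h\<close>,
  where no trace is defined, the subgraph has density \<open>0\<close> at \<open>(x,0)\<close>, and for an \<open>H\<^sup>1\<close> function
  having the trace \<open>x\<close> on \<open>{h > 0}\<close> the condition holds there automatically.
\<close>
definition trace_at :: "(real \<times> real) set \<Rightarrow> (real \<times> real \<Rightarrow> real) \<Rightarrow> real \<times> real \<Rightarrow> real \<Rightarrow> bool" where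
  "trace_at S u p c \<longleftrightarrow>
     ((\<lambda>r. (LINT z:(S \<inter> ball p r)|lborel. \<bar>u z - c\<bar>) / r\<^sup>2) \<longlongrightarrow> 0) (at_right 0)"

definition admissible_displacement :: "(real \<Rightarrow> real) \<Rightarrow> (real \<times> real \<Rightarrow> real) \<Rightarrow> bool" where
  "admissible_displacement h u \<longleftrightarrow>
     H1_on (subgraph h) u \<and>
     (AE x in lborel. x \<in> closure {t. h t \<noteq> 0} \<longrightarrow> trace_at (subgraph h) u (x, 0) x)"

definition admissible_pairs :: "real \<Rightarrow> ((real \<times> real \<Rightarrow> real) \<times> (real \<Rightarrow> real)) set" where
  "admissible_pairs V =
     {(u, h). profile h \<and> admissible_displacement h u \<and> (LINT x|lborel. h x) = V}"

definition F_ell :: "real \<Rightarrow> ennreal" where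
  "F_ell V = (INF (u, h) \<in> admissible_pairs V.
     dirichlet_energy (subgraph h) u + pointwise_variation h)"

text \<open>
  In \<^typ>\<open>ennreal\<close> the supremum of the empty set is \<open>0\<close> and that of an unbounded set is \<open>\<infinity>\<close>.
\<close>
definition V_bar :: ennreal where
  "V_bar = (SUP V \<in> {V. 0 < V \<and> F_ell V = ennreal V}. ennreal V)"

definition dirichlet_minimizer :: "(real \<Rightarrow> real) \<Rightarrow> (real \<times> real \<Rightarrow> real) \<Rightarrow> bool" where
  "dirichlet_minimizer h u \<longleftrightarrow> admissible_displacement h u \<and>
     (\<forall>v. admissible_displacement h v \<longrightarrow>
        dirichlet_energy (subgraph h) u \<le> dirichlet_energy (subgraph h) v)"

definition rescale :: "real \<Rightarrow> (real \<Rightarrow> real) \<Rightarrow> real \<Rightarrow> real" where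
  "rescale V h x = V powr (- 2 / 3) * h (V powr (1 / 3) * x)"

definition unrescale :: "real \<Rightarrow> (real \<Rightarrow> real) \<Rightarrow> real \<Rightarrow> real" where
  "unrescale V k x = V powr (2 / 3) * k (V powr (- 1 / 3) * x)"

lemma unrescale_rescale: "0 < V \<Longrightarrow> unrescale V (rescale V h) = h"
  by (simp add: rescale_def unrescale_def fun_eq_iff mult.assoc[symmetric] powr_add[symmetric])

lemma rescale_unrescale: "0 < V \<Longrightarrow> rescale V (unrescale V k) = k"
  by (simp add: rescale_def unrescale_def fun_eq_iff mult.assoc[symmetric] powr_add[symmetric])

definition rescaled_profiles :: "real \<Rightarrow> (real \<Rightarrow> real) set" where
  "rescaled_profiles V =
     {rescale V h | h u. (u, h) \<in> admissible_pairs V \<and> dirichlet_minimizer h u}"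

definition G :: "real \<Rightarrow> (real \<Rightarrow> real) \<Rightarrow> ennreal" where
  "G V k = (let h = unrescale V k; u = (SOME u. dirichlet_minimizer h u) in
     ennreal (V powr (- 2 / 3)) * dirichlet_energy (subgraph h) u + pointwise_variation k)"

definition G_minimizer :: "real \<Rightarrow> (real \<Rightarrow> real) \<Rightarrow> bool" where
  "G_minimizer V k \<longleftrightarrow> k \<in> rescaled_profiles V \<and> (\<forall>g \<in> rescaled_profiles V. G V k \<le> G V g)"

text \<open>
  A largest component is one of maximal length. In case of a tie every such component qualifies.
\<close>
definition largest_component :: "(real \<Rightarrow> real) \<Rightarrow> real \<Rightarrow> real set \<Rightarrow> bool" where
  "largest_component k s I \<longleftrightarrow> I \<in> components {x. s < k x} \<and>
     (\<forall>J \<in> components {x. s < k x}. emeasure lborel J \<le> emeasure lborel I)"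

definition surface_competitors :: "(real \<Rightarrow> real) \<Rightarrow> real set \<Rightarrow> (real \<Rightarrow> real) set" where
  "surface_competitors k I =
     {g. profile g \<and> (\<forall>x. x \<notin> I \<longrightarrow> g x = k x) \<and> (LINT x|lborel. g x) = (LINT x|lborel. k x)}"

definition surface_minimizer :: "(real \<Rightarrow> real) \<Rightarrow> real set \<Rightarrow> (real \<Rightarrow> real) \<Rightarrow> bool" where
  "surface_minimizer k I hb \<longleftrightarrow> hb \<in> surface_competitors k I \<and>
     (\<forall>g \<in> surface_competitors k I. pointwise_variation hb \<le> pointwise_variation g)"

end

theory Submission
  imports Defs
begin

text \<open>
  Fix \<open>\<epsilon>\<close>, put \<open>X = V powr (1/3)\<close>, let \<open>k\<close> minimize \<open>G\<close> for the volume \<open>V\<close>, let \<open>I\<close> be a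
  component of \<open>{x. s < k x}\<close> with \<open>s \<ge> \<epsilon>\<close>, and let \<open>A\<close> be the mean of \<open>k\<close> over \<open>I\<close>. Replacing \<open>k\<close>
  by the constant \<open>A\<close> on \<open>I\<close> keeps the volume. It changes the two parts of the energy as follows.

  The surface part drops. The values of \<open>k\<close> at the ends of \<open>I\<close> are at most \<open>s \<le> A\<close>, so a profile
  that rises to the height \<open>m\<close> inside \<open>I\<close> pays \<open>2 (m - A)\<close> more than the levelled one
  (\<open>variation_levelled\<close>). In particular the levelled profile is the surface minimizer on \<open>I\<close>, up to a
  null set (\<open>surface_minimizer_le_mean\<close>).

  The elastic part grows by an exponentially small amount only (\<open>elastic_cost_of_levelling\<close>). In the
  original scale the level is at least \<open>\<epsilon> X\<^sup>2\<close>, while the volume \<open>X\<^sup>3\<close> forces every component of a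
  superlevel set above half that height to have width at most \<open>l = 2 X / \<epsilon>\<close>. Below the level there is
  thus room for about \<open>\<epsilon>\<^sup>2 X / 8\<close> layers of height \<open>l\<close> that are no wider than they are high. At the top
  \<open>\<tau>\<close> of any of these layers the displacement above \<open>\<tau>\<close> can be discarded and replaced by the mirror
  image of the displacement in the layer, cut off to a constant; by the Poincare inequality this costs
  at most \<open>50\<close> times the energy of the layer and saves the energy above \<open>\<tau>\<close>
  (\<open>energy_comparison\<close>). The result lives on any profile that agrees with the old one up to height
  \<open>\<tau>\<close>, the levelled one included. If the net cost exceeded \<open>\<delta>\<close> at each of \<open>N\<close> layers, then the energy
  above \<open>\<tau>\<close> would grow by the factor \<open>51/50\<close> from layer to layer, which bounds \<open>\<delta>\<close> by the total energy
  divided by \<open>(51/50) ^ N - 1\<close> (\<open>good_level\<close>). The total energy is polynomial in \<open>X\<close>, by comparison with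
  a rectangle (\<open>rectangular_island\<close>).

  Since \<open>k\<close> is minimal, twice its excess over \<open>A\<close> on \<open>I\<close> is at most the elastic cost, hence
  exponentially small in \<open>X\<close>. A function with mean \<open>A\<close> that exceeds \<open>A\<close> nowhere by much is close to \<open>A\<close>
  in \<open>L\<^sup>1\<close> (\<open>L1_distance_to_level\<close>), and both \<open>k\<close> and the surface minimizer are such functions.

  Much of the work is in making the competitor admissible. A displacement has the trace \<open>x\<close> on the
  bottom edge exactly if it equals \<open>x\<close> plus the integral of its vertical derivative from the bottom edge
  (\<open>displacement_representation\<close>, \<open>clamped_imp_admissible\<close>). As \<open>G\<close> evaluates the energy of a
  Dirichlet minimizer on the levelled profile, such a minimizer must exist
  (\<open>dirichlet_minimizer_exists\<close>).
\<close>

section \<open>Smooth cutoffs and test functions\<close>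

text \<open>
  Second primitives of step functions are the simplest building blocks for continuously differentiable
  cutoffs.
\<close>
definition sq_pos :: "real \<Rightarrow> real" where
  "sq_pos t = (max 0 t)\<^sup>2"

lemma sq_pos_deriv: "(sq_pos has_real_derivative 2 * max 0 t) (at t)"
proof -
  consider "t < 0" | "t > 0" | "t = 0" by linarith
  then show ?thesis
  proof cases
    case 1
    have "((\<lambda>t. 0) has_real_derivative 0) (at t)" by simp
    then have "(sq_pos has_real_derivative 0) (at t)"
      by (rule has_field_derivative_transform_within_open[where S="{..<0}"])
         (use 1 in \<open>auto simp: sq_pos_def\<close>)
    with 1 show ?thesis by simp
  next
    case 2
    have "((\<lambda>t. t\<^sup>2) has_real_derivative 2 * t) (at t)"
      by (auto intro!: derivative_eq_intros)
    then have "(sq_pos has_real_derivative 2 * t) (at t)"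
      by (rule has_field_derivative_transform_within_open[where S="{0<..}"])
         (use 2 in \<open>auto simp: sq_pos_def\<close>)
    with 2 show ?thesis by simp
  next
    case 3
    have "((\<lambda>h. (sq_pos (0 + h) - sq_pos 0) / h) \<longlongrightarrow> 0) (at 0)"
    proof (rule Lim_null_comparison)
      show "\<forall>\<^sub>F h in at 0. norm ((sq_pos (0 + h) - sq_pos 0) / h) \<le> \<bar>h\<bar>"
        by (rule always_eventually) (auto simp: sq_pos_def max_def power2_eq_square)
      show "((\<lambda>h. \<bar>h\<bar>) \<longlongrightarrow> 0) (at (0::real))"
        by (rule tendsto_rabs_zero) simp
    qed
    with 3 show ?thesis by (simp add: DERIV_def)
  qed
qed

definition smoothstep :: "real \<Rightarrow> real" where
  "smoothstep t = 2 * sq_pos t - 4 * sq_pos (t - 1/2) + 2 * sq_pos (t - 1)"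

definition smoothstep' :: "real \<Rightarrow> real" where
  "smoothstep' t = 4 * max 0 t - 8 * max 0 (t - 1/2) + 4 * max 0 (t - 1)"

lemma smoothstep_deriv: "(smoothstep has_real_derivative smoothstep' t) (at t)"
proof -
  have *: "((\<lambda>t. sq_pos (t - c)) has_real_derivative 2 * max 0 (t - c)) (at t)" for c
    using DERIV_shift[of sq_pos "2 * max 0 (t - c)" t "- c"] sq_pos_deriv[of "t - c"]
    by simp
  show ?thesis unfolding smoothstep_def smoothstep'_def
    by (rule derivative_eq_intros sq_pos_deriv * refl | simp)+
qed

lemma smoothstep_chain [derivative_intros]:
  assumes "(f has_real_derivative f') (at x within A)"
  shows "((\<lambda>x. smoothstep (f x)) has_real_derivative smoothstep' (f x) * f') (at x within A)"
  using DERIV_chain2[OF smoothstep_deriv assms] .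

lemma continuous_smoothstep' [continuous_intros]:
  "continuous_on A f \<Longrightarrow> continuous_on A (\<lambda>x. smoothstep' (f x))"
  unfolding smoothstep'_def by (intro continuous_intros)

lemma continuous_smoothstep [continuous_intros]:
  "continuous_on A f \<Longrightarrow> continuous_on A (\<lambda>x. smoothstep (f x))"
  unfolding smoothstep_def sq_pos_def by (intro continuous_intros)

lemma borel_measurable_smoothstep [measurable]: "smoothstep \<in> borel_measurable borel"
  by (rule borel_measurable_continuous_onI) (intro continuous_intros)

lemma borel_measurable_smoothstep' [measurable]: "smoothstep' \<in> borel_measurable borel"
  by (rule borel_measurable_continuous_onI) (intro continuous_intros)

lemma smoothstep_eq_0 [simp]: "t \<le> 0 \<Longrightarrow> smoothstep t = 0" "t \<le> 0 \<Longrightarrow> smoothstep' t = 0"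
  by (auto simp: smoothstep_def smoothstep'_def sq_pos_def)

lemma smoothstep_eq_1 [simp]: "1 \<le> t \<Longrightarrow> smoothstep t = 1" "1 \<le> t \<Longrightarrow> smoothstep' t = 0"
  by (auto simp: smoothstep_def smoothstep'_def sq_pos_def power2_eq_square algebra_simps)

lemma smoothstep'_bounds: "0 \<le> smoothstep' t" "smoothstep' t \<le> 2"
  by (auto simp: smoothstep'_def max_def)

lemma smoothstep_bounds: "0 \<le> smoothstep t" "smoothstep t \<le> 1"
proof -
  have mono: "a \<le> b \<Longrightarrow> smoothstep a \<le> smoothstep b" for a b
    by (rule DERIV_nonneg_imp_nondecreasing) (auto intro: smoothstep_deriv smoothstep'_bounds)
  show "0 \<le> smoothstep t" using mono[of "min t 0" t] by simp
  show "smoothstep t \<le> 1" using mono[of t "max t 1"] by simp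
qed

text \<open>
  A plateau supported at distance \<open>1 / (n + 1)\<close> from the ends of the interval and tending to its
  indicator.
\<close>

definition bump :: "nat \<Rightarrow> real \<Rightarrow> real \<Rightarrow> real \<Rightarrow> real" where
  "bump n p q t = smoothstep (real (Suc n) * (t - p) - 1) * smoothstep (real (Suc n) * (q - t) - 1)"

definition bump' :: "nat \<Rightarrow> real \<Rightarrow> real \<Rightarrow> real \<Rightarrow> real" where
  "bump' n p q t =
     real (Suc n) * smoothstep' (real (Suc n) * (t - p) - 1) * smoothstep (real (Suc n) * (q - t) - 1)
     - smoothstep (real (Suc n) * (t - p) - 1) * (real (Suc n) * smoothstep' (real (Suc n) * (q - t) - 1))"

lemma bump_deriv: "(bump n p q has_real_derivative bump' n p q t) (at t)"
  unfolding bump_def bump'_def by (auto intro!: derivative_eq_intros simp: algebra_simps)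

lemma continuous_bump: "continuous_on UNIV (bump n p q)" "continuous_on UNIV (bump' n p q)"
  unfolding bump_def bump'_def by (intro continuous_intros)+

lemma borel_measurable_bump [measurable]: "bump n p q \<in> borel_measurable borel"
  by (rule borel_measurable_continuous_onI) (rule continuous_bump)

lemma bump_bounds: "0 \<le> bump n p q t" "bump n p q t \<le> 1"
  unfolding bump_def using smoothstep_bounds by (auto intro!: mult_le_one mult_nonneg_nonneg)

lemma bump_outside:
  assumes "t \<notin> {p + 1 / real (Suc n)..q - 1 / real (Suc n)}"
  shows "bump n p q t = 0"
proof -
  consider "t < p + 1 / real (Suc n)" | "t > q - 1 / real (Suc n)" using assms by fastforce
  then show ?thesis
  proof cases
    case 1
    then have "real (Suc n) * (t - p) - 1 \<le> 0" by (simp add: field_simps)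
    then have "smoothstep (real (Suc n) * (t - p) - 1) = 0" by (rule smoothstep_eq_0)
    then show ?thesis unfolding bump_def by simp
  next
    case 2
    then have "real (Suc n) * (q - t) - 1 \<le> 0" by (simp add: field_simps)
    then have "smoothstep (real (Suc n) * (q - t) - 1) = 0" by (rule smoothstep_eq_0)
    then show ?thesis unfolding bump_def by simp
  qed
qed

lemma bump_tendsto: "(\<lambda>n. bump n p q t) \<longlonglongrightarrow> indicator {p<..<q} t"
proof (cases "t \<in> {p<..<q}")
  case True
  have ev: "\<forall>\<^sub>F n in sequentially. real (Suc n) * d - 1 \<ge> 1" if "d > 0" for d :: real
  proof -
    obtain N where N: "2 / d < real N" using reals_Archimedean2 by blast
    have "real (Suc n) * d - 1 \<ge> 1" if "n \<ge> N" for n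
    proof -
      have "2 / d \<le> real (Suc n)" using N that by linarith
      then show ?thesis using \<open>d > 0\<close> by (simp add: field_simps)
    qed
    then show ?thesis by (auto simp: eventually_sequentially)
  qed
  have "\<forall>\<^sub>F n in sequentially. bump n p q t = 1"
    using eventually_conj[OF ev[of "t - p"] ev[of "q - t"]] True
    by (auto elim!: eventually_mono simp: bump_def simp del: of_nat_Suc)
  then show ?thesis using True by (simp add: tendsto_eventually)
next
  case False
  have "bump n p q t = 0" for n
  proof (rule bump_outside)
    have "1 / real (Suc n) > 0" by simp
    moreover have "t \<le> p \<or> q \<le> t" using False by auto
    ultimately show "t \<notin> {p + 1 / real (Suc n)..q - 1 / real (Suc n)}"
      unfolding atLeastAtMost_iff by linarith
  qed
  then show ?thesis using False by simp
qed

lemma test_functionE: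
  assumes "test_function S \<phi> \<psi>"
  obtains K where "compact K" "K \<subseteq> S" "\<And>z. z \<notin> K \<Longrightarrow> \<phi> z = 0" "\<And>z. z \<notin> K \<Longrightarrow> \<psi> z = 0"
proof -
  obtain K where K: "compact K" "K \<subseteq> S" "\<And>z. z \<notin> K \<Longrightarrow> \<phi> z = 0"
    and d: "\<And>z. (\<phi> has_derivative (\<lambda>v. \<psi> z \<bullet> v)) (at z)"
    using assms unfolding test_function_def by metis
  have "\<psi> z = 0" if "z \<notin> K" for z
  proof -
    have "((\<lambda>z. 0) has_derivative (\<lambda>v. 0)) (at z)" by simp
    then have "(\<phi> has_derivative (\<lambda>v. 0)) (at z)"
      by (rule has_derivative_transform_within_open[where s="- K"])
         (use K that compact_imp_closed in auto)
    then have "(\<lambda>v. \<psi> z \<bullet> v) = (\<lambda>v. 0)" using d has_derivative_unique by blast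
    then have "\<psi> z \<bullet> \<psi> z = 0" by meson
    then show ?thesis by simp
  qed
  with K show ?thesis using that by blast
qed

lemma test_function_continuous:
  assumes "test_function S \<phi> \<psi>"
  shows "continuous_on UNIV \<phi>" "continuous_on UNIV \<psi>"
  using assms unfolding test_function_def
  by (auto intro!: continuous_at_imp_continuous_on has_derivative_continuous)

lemma test_function_measurable:
  assumes "test_function S \<phi> \<psi>"
  shows "\<phi> \<in> borel_measurable borel" "\<psi> \<in> borel_measurable borel"
  using test_function_continuous[OF assms] by (auto intro: borel_measurable_continuous_onI)

lemma test_function_bounded:
  assumes "test_function S \<phi> \<psi>"
  obtains B where "B > 0" "\<And>z. \<bar>\<phi> z\<bar> \<le> B" "\<And>z. norm (\<psi> z) \<le> B"
proof -
  obtain K where K: "compact K" "\<And>z. z \<notin> K \<Longrightarrow> \<phi> z = 0" "\<And>z. z \<notin> K \<Longrightarrow> \<psi> z = 0"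
    using test_functionE[OF assms] by metis
  have "compact (\<phi> ` K)" "compact (\<psi> ` K)"
    using test_function_continuous[OF assms] K(1)
    by (auto intro!: compact_continuous_image intro: continuous_on_subset)
  then obtain a b where "a > 0" "b > 0" "\<And>z. z \<in> K \<Longrightarrow> norm (\<phi> z) \<le> a" "\<And>z. z \<in> K \<Longrightarrow> norm (\<psi> z) \<le> b"
    by (metis bounded_pos compact_imp_bounded imageI)
  then have "max a b > 0" "\<bar>\<phi> z\<bar> \<le> max a b" "norm (\<psi> z) \<le> max a b" for z
    using K by (cases "z \<in> K"; force)+
  then show ?thesis using that by blast
qed

lemma test_function_mono: "test_function S \<phi> \<psi> \<Longrightarrow> S \<subseteq> T \<Longrightarrow> test_function T \<phi> \<psi>"
  unfolding test_function_def by blast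

lemma test_function_add:
  assumes "test_function S \<phi>1 \<psi>1" "test_function S \<phi>2 \<psi>2"
  shows "test_function S (\<lambda>z. \<phi>1 z + \<phi>2 z) (\<lambda>z. \<psi>1 z + \<psi>2 z)"
proof -
  obtain K1 K2 where "compact K1" "K1 \<subseteq> S" "\<And>z. z \<notin> K1 \<Longrightarrow> \<phi>1 z = 0"
    "compact K2" "K2 \<subseteq> S" "\<And>z. z \<notin> K2 \<Longrightarrow> \<phi>2 z = 0"
    using assms by (meson test_functionE)
  then have "\<exists>K. compact K \<and> K \<subseteq> S \<and> (\<forall>z. z \<notin> K \<longrightarrow> \<phi>1 z + \<phi>2 z = 0)"
    by (intro exI[of _ "K1 \<union> K2"]) auto
  with assms show ?thesis unfolding test_function_def
    by (auto intro!: continuous_intros derivative_eq_intros simp: inner_add_left)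
qed

lemma test_function_mult:
  assumes "test_function S \<phi> \<psi>" "\<And>z. (f has_derivative (\<lambda>v. f' z \<bullet> v)) (at z)" "continuous_on UNIV f'"
  shows "test_function S (\<lambda>z. \<phi> z * f z) (\<lambda>z. f z *\<^sub>R \<psi> z + \<phi> z *\<^sub>R f' z)"
proof -
  have "continuous_on UNIV f" using assms(2)
    by (auto intro!: continuous_at_imp_continuous_on has_derivative_continuous)
  moreover have "((\<lambda>z. \<phi> z * f z) has_derivative (\<lambda>v. (f z *\<^sub>R \<psi> z + \<phi> z *\<^sub>R f' z) \<bullet> v)) (at z)" for z
    using has_derivative_mult[of \<phi> "\<lambda>v. \<psi> z \<bullet> v" z UNIV f "\<lambda>v. f' z \<bullet> v"] assms
    unfolding test_function_def by (simp add: inner_add_left algebra_simps)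
  moreover obtain K where "compact K" "K \<subseteq> S" "\<And>z. z \<notin> K \<Longrightarrow> \<phi> z = 0"
    using assms(1) by (meson test_functionE)
  ultimately show ?thesis
    using assms test_function_continuous[OF assms(1)] unfolding test_function_def
    by (auto intro!: continuous_intros exI[of _ K])
qed

lemma test_function_scale: "test_function S \<phi> \<psi> \<Longrightarrow> test_function S (\<lambda>z. \<phi> z * c) (\<lambda>z. c *\<^sub>R \<psi> z)"
  using test_function_mult[of S \<phi> \<psi> "\<lambda>_. c" "\<lambda>_. 0"] by simp

text \<open>
  The support misses the boundary of \<open>D\<close>, so the jump of the indicator does not harm smoothness.
\<close>
lemma test_function_cut:
  assumes tf: "test_function S \<phi> \<psi>" and K: "compact K" "K \<subseteq> S" "\<And>z. z \<notin> K \<Longrightarrow> \<phi> z = 0"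
    and D: "K \<inter> frontier D = {}"
  shows "test_function (S \<inter> D) (\<lambda>z. indicator D z * \<phi> z) (\<lambda>z. indicator D z *\<^sub>R \<psi> z)"
proof -
  have cl: "closed K" using K compact_imp_closed by blast
  have \<psi>0: "\<psi> z = 0" if "z \<notin> K" for z
  proof -
    have "((\<lambda>z. 0) has_derivative (\<lambda>v. 0)) (at z)" by simp
    then have "(\<phi> has_derivative (\<lambda>v. 0)) (at z)"
      by (rule has_derivative_transform_within_open[where s="- K"]) (use K that cl in auto)
    then have "(\<lambda>v. \<psi> z \<bullet> v) = (\<lambda>v. 0)" using tf has_derivative_unique
      unfolding test_function_def by blast
    then have "\<psi> z \<bullet> \<psi> z = 0" by meson
    then show ?thesis by simp
  qed
  have loc: "\<exists>U c. open U \<and> z \<in> U \<and> (\<forall>y\<in>U. indicator D y * \<phi> y = c * \<phi> y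
      \<and> indicator D y *\<^sub>R \<psi> y = c *\<^sub>R \<psi> y)" for z
  proof -
    consider "z \<in> interior D" | "z \<in> - closure D" | "z \<notin> K"
      using D by (auto simp: frontier_def)
    then show ?thesis
    proof cases
      case 1
      then show ?thesis
        by (intro exI[of _ "interior D"] exI[of _ 1]) (use interior_subset[of D] in \<open>auto simp: indicator_def\<close>)
    next
      case 2
      then show ?thesis
        by (intro exI[of _ "- closure D"] exI[of _ 0]) (use closure_subset[of D] in \<open>auto simp: indicator_def\<close>)
    next
      case 3
      then show ?thesis
        by (intro exI[of _ "- K"] exI[of _ 0]) (use cl K \<psi>0 in auto)
    qed
  qed
  have *: "((\<lambda>z. indicator D z * \<phi> z) has_derivative (\<lambda>v. (indicator D z *\<^sub>R \<psi> z) \<bullet> v)) (at z)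
     \<and> isCont (\<lambda>z. indicator D z *\<^sub>R \<psi> z) z" for z
  proof -
    obtain U c where U: "open U" "z \<in> U" "\<And>y. y \<in> U \<Longrightarrow> indicator D y * \<phi> y = c * \<phi> y"
        "\<And>y. y \<in> U \<Longrightarrow> indicator D y *\<^sub>R \<psi> y = c *\<^sub>R \<psi> y"
      using loc[of z] by blast
    have "((\<lambda>z. c * \<phi> z) has_derivative (\<lambda>v. c * (\<psi> z \<bullet> v))) (at z)"
      using tf unfolding test_function_def by (auto intro!: derivative_eq_intros)
    then have "((\<lambda>z. indicator D z * \<phi> z) has_derivative (\<lambda>v. c * (\<psi> z \<bullet> v))) (at z)"
      by (rule has_derivative_transform_within_open[OF _ U(1,2)]) (simp add: U)
    moreover have "c * (\<psi> z \<bullet> v) = (indicator D z *\<^sub>R \<psi> z) \<bullet> v" for v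
      using U(4)[OF U(2)] by (metis inner_scaleR_left)
    moreover have cC: "isCont (\<lambda>z. c *\<^sub>R \<psi> z) z"
      using test_function_continuous[OF tf] by (auto simp: continuous_on_eq_continuous_at intro!: continuous_intros)
    moreover have "isCont (\<lambda>z. indicator D z *\<^sub>R \<psi> z) z"
    proof -
      have "\<forall>\<^sub>F y in nhds z. indicator D y *\<^sub>R \<psi> y = c *\<^sub>R \<psi> y"
        unfolding eventually_nhds using U by blast
      from isCont_cong[OF this] cC show ?thesis by blast
    qed
    ultimately show ?thesis by simp
  qed
  have "continuous_on UNIV (\<lambda>z. indicator D z *\<^sub>R \<psi> z)"
    using * by (blast intro: continuous_at_imp_continuous_on)
  moreover have "compact (K \<inter> closure D)" using K by (simp add: compact_Int_closed)
  moreover have "K \<inter> closure D \<subseteq> S \<inter> D"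
    using D K interior_subset[of D] by (auto simp: frontier_def)
  moreover have "indicator D z * \<phi> z = 0" if "z \<notin> K \<inter> closure D" for z
    using that K closure_subset[of D] by (auto simp: indicator_def)
  ultimately show ?thesis unfolding test_function_def using * by blast
qed

lemma test_function_product:
  assumes a: "\<And>t. (a has_real_derivative a' t) (at t)" "continuous_on UNIV a'"
      "\<And>t. t \<notin> {p'..q'} \<Longrightarrow> a t = 0"
    and b: "\<And>t. (b has_real_derivative b' t) (at t)" "continuous_on UNIV b'"
      "\<And>t. t \<notin> {r'..s'} \<Longrightarrow> b t = 0"
    and S: "{p'..q'} \<times> {r'..s'} \<subseteq> S"
  shows "test_function S (\<lambda>z. a (fst z) * b (snd z)) (\<lambda>z. (a' (fst z) * b (snd z), a (fst z) * b' (snd z)))"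
proof -
  have ca: "continuous_on UNIV a" "continuous_on UNIV b" using a b
    by (auto intro!: continuous_at_imp_continuous_on DERIV_isCont)
  have "((\<lambda>z. a (fst z) * b (snd z)) has_derivative
      (\<lambda>v. (a' (fst z) * b (snd z), a (fst z) * b' (snd z)) \<bullet> v)) (at z)" for z
  proof -
    have "((\<lambda>z. a (fst z)) has_derivative (\<lambda>v. a' (fst z) * fst v)) (at z)"
      using DERIV_compose_FDERIV[OF a(1)] has_derivative_fst[OF has_derivative_ident]
      by (fastforce simp: mult.commute)
    moreover have "((\<lambda>z. b (snd z)) has_derivative (\<lambda>v. b' (snd z) * snd v)) (at z)"
      using DERIV_compose_FDERIV[OF b(1)] has_derivative_snd[OF has_derivative_ident]
      by (fastforce simp: mult.commute)
    ultimately show ?thesis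
      by (auto intro!: derivative_eq_intros simp: inner_prod_def algebra_simps fun_eq_iff)
  qed
  moreover have "continuous_on UNIV (\<lambda>z. (a' (fst z) * b (snd z), a (fst z) * b' (snd z)))"
    by (intro continuous_intros continuous_on_compose2[OF ca(1)] continuous_on_compose2[OF ca(2)]
        continuous_on_compose2[OF a(2)] continuous_on_compose2[OF b(2)]) auto
  moreover have "compact ({p'..q'} \<times> {r'..s'})" by (intro compact_Times) auto
  moreover have "a (fst z) * b (snd z) = 0" if "z \<notin> {p'..q'} \<times> {r'..s'}" for z
    using that a(3) b(3) by (cases z) auto
  ultimately show ?thesis using S unfolding test_function_def by blast
qed

section \<open>Square integrable functions\<close>

text \<open>
  Functions are defined on the whole space and vanish off their domain, so that products, limits and
  reflections need no change of measure.
\<close>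
definition L2 :: "('a::euclidean_space \<Rightarrow> real) \<Rightarrow> bool" where
  "L2 f \<longleftrightarrow> f \<in> borel_measurable borel \<and> integrable lborel (\<lambda>z. (f z)\<^sup>2)"

lemma L2_measurable [measurable_dest]: "L2 f \<Longrightarrow> f \<in> borel_measurable borel"
  by (simp add: L2_def)

lemma L2_square: "L2 f \<Longrightarrow> integrable lborel (\<lambda>z. (f z)\<^sup>2)"
  by (simp add: L2_def)

lemma L2_mult:
  assumes "L2 f" "L2 g" shows "integrable lborel (\<lambda>z. f z * g z)"
proof (rule Bochner_Integration.integrable_bound)
  show "integrable lborel (\<lambda>z. (f z)\<^sup>2 + (g z)\<^sup>2)" using assms by (simp add: L2_def)
  note [measurable] = assms[THEN L2_measurable]
  show "(\<lambda>z. f z * g z) \<in> borel_measurable lborel" by measurable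
  have "\<bar>x * y\<bar> \<le> x\<^sup>2 + y\<^sup>2" for x y :: real
  proof -
    have "2 * \<bar>x\<bar> * \<bar>y\<bar> \<le> x\<^sup>2 + y\<^sup>2" using sum_squares_bound[of "\<bar>x\<bar>" "\<bar>y\<bar>"] by simp
    moreover have "0 \<le> \<bar>x\<bar> * \<bar>y\<bar>" by simp
    ultimately show ?thesis unfolding abs_mult by linarith
  qed
  then show "AE z in lborel. norm (f z * g z) \<le> norm ((f z)\<^sup>2 + (g z)\<^sup>2)"
    by (intro always_eventually) (auto intro: order_trans)
qed

lemma L2_bound:
  assumes "f \<in> borel_measurable borel" "L2 g" "\<And>z. \<bar>f z\<bar> \<le> \<bar>g z\<bar>"
  shows "L2 f"
  unfolding L2_def
proof
  show "integrable lborel (\<lambda>z. (f z)\<^sup>2)"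
    by (rule Bochner_Integration.integrable_bound[OF L2_square[OF assms(2)]])
       (use assms abs_le_square_iff in auto)
qed (use assms in auto)

lemma L2_cmult: "L2 f \<Longrightarrow> L2 (\<lambda>z. c * f z)"
  by (auto simp: L2_def power_mult_distrib)

lemma L2_add:
  assumes "L2 f" "L2 g" shows "L2 (\<lambda>z. f z + g z)"
proof -
  have "(\<lambda>z. (f z + g z)\<^sup>2) = (\<lambda>z. (f z)\<^sup>2 + (g z)\<^sup>2 + 2 * (f z * g z))"
    by (simp add: power2_sum mult.assoc)
  then show ?thesis using assms L2_mult[OF assms] by (auto simp: L2_def)
qed

lemma L2_diff: "L2 f \<Longrightarrow> L2 g \<Longrightarrow> L2 (\<lambda>z. f z - g z)"
  using L2_add[of f "\<lambda>z. -1 * g z"] L2_cmult[of g "-1"] by simp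

lemma L2_indicator: "A \<in> sets borel \<Longrightarrow> emeasure lborel A < \<infinity> \<Longrightarrow> L2 (indicator A)"
  by (auto simp: L2_def power2_eq_square indicator_inter_arith[symmetric])

lemma L2_finite_support:
  assumes "f \<in> borel_measurable borel" "A \<in> sets borel" "emeasure lborel A < \<infinity>"
    "\<And>z. \<bar>f z\<bar> \<le> B * indicator A z"
  shows "L2 f"
proof (rule L2_bound)
  show "L2 (\<lambda>z. B * indicator A z)" using assms by (intro L2_cmult L2_indicator)
  show "\<bar>f z\<bar> \<le> \<bar>B * indicator A z\<bar>" for z using assms(4)[of z] by linarith
qed fact

lemma L2_integrable_on:
  assumes "L2 f" "A \<in> sets borel" "emeasure lborel A < \<infinity>"
  shows "integrable lborel (\<lambda>z. indicator A z * f z)"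
  by (rule L2_mult[OF L2_indicator]) (use assms in auto)

lemma Cauchy_Schwarz_L2:
  assumes "L2 f" "L2 g"
  shows "(LINT z|lborel. f z * g z)\<^sup>2 \<le> (LINT z|lborel. (f z)\<^sup>2) * (LINT z|lborel. (g z)\<^sup>2)"
proof -
  define X where "X = (LINT z|lborel. f z * g z)"
  define F where "F = (LINT z|lborel. (f z)\<^sup>2)"
  define H where "H = (LINT z|lborel. (g z)\<^sup>2)"
  have *: "0 \<le> F - 2 * t * X + t\<^sup>2 * H" for t
  proof -
    have "0 \<le> (LINT z|lborel. (f z - t * g z)\<^sup>2)" by simp
    also have "(\<lambda>z. (f z - t * g z)\<^sup>2) = (\<lambda>z. (f z)\<^sup>2 - (2 * t) * (f z * g z) + t\<^sup>2 * (g z)\<^sup>2)"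
      by (auto simp: power2_eq_square algebra_simps)
    also have "(LINT z|lborel. (f z)\<^sup>2 - (2 * t) * (f z * g z) + t\<^sup>2 * (g z)\<^sup>2) = F - 2 * t * X + t\<^sup>2 * H"
      using L2_square[OF assms(1)] L2_square[OF assms(2)] L2_mult[OF assms]
      by (simp add: F_def H_def X_def)
    finally show ?thesis .
  qed
  have "H \<ge> 0" "F \<ge> 0" unfolding H_def F_def by auto
  have "X\<^sup>2 \<le> F * H"
  proof (cases "H = 0")
    case True
    have "X = 0"
    proof (rule ccontr)
      assume "X \<noteq> 0"
      then show False using *[of "(F + 1) / (2 * X)"] True by (simp add: field_simps)
    qed
    with True show ?thesis by simp
  next
    case False
    then have "H > 0" using \<open>H \<ge> 0\<close> by simp
    then show ?thesis using *[of "X / H"] by (simp add: field_simps power2_eq_square)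
  qed
  then show ?thesis by (simp add: X_def F_def H_def)
qed

lemma test_function_L2:
  fixes \<phi> :: "real \<times> real \<Rightarrow> real"
  assumes "test_function S \<phi> \<psi>"
  shows "L2 \<phi>" "L2 (\<lambda>z. \<psi> z \<bullet> e)"
proof -
  obtain K where K: "compact K" "\<And>z. z \<notin> K \<Longrightarrow> \<phi> z = 0" "\<And>z. z \<notin> K \<Longrightarrow> \<psi> z = 0"
    using test_functionE[OF assms] by metis
  obtain B where B: "B > 0" "\<And>z. \<bar>\<phi> z\<bar> \<le> B" "\<And>z. norm (\<psi> z) \<le> B"
    using test_function_bounded[OF assms] by metis
  note [measurable] = test_function_measurable[OF assms]
  have K': "K \<in> sets borel" "emeasure lborel K < \<infinity>"
    using K(1) emeasure_compact_finite[OF K(1)] by (auto simp: compact_imp_closed)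
  show "L2 \<phi>"
    by (rule L2_finite_support[OF _ K', of _ B]) (use K B in \<open>auto simp: indicator_def\<close>)
  have "\<bar>\<psi> z \<bullet> e\<bar> \<le> B * norm e * indicator K z" for z
  proof (cases "z \<in> K")
    case True
    have "\<bar>\<psi> z \<bullet> e\<bar> \<le> norm (\<psi> z) * norm e" by (rule Cauchy_Schwarz_ineq2)
    also have "\<dots> \<le> B * norm e" using B(3) by (intro mult_right_mono) auto
    finally show ?thesis using True by simp
  qed (use K in auto)
  then show "L2 (\<lambda>z. \<psi> z \<bullet> e)"
    by (rule L2_finite_support[OF _ K', rotated]) measurable
qed

section \<open>Integration by parts\<close>

lemma integral_deriv_tail:
  fixes F f :: "real \<Rightarrow> real"
  assumes F: "\<And>y. (F has_real_derivative f y) (at y)" "continuous_on UNIV f"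
    and N: "\<forall>y. y \<notin> {-N..N} \<longrightarrow> F y = 0"
  shows "(LINT y|lborel. indicator {t<..} y * f y) = - F t" "integrable lborel f"
    "(LINT y|lborel. f y) = 0"
proof -
  have f0: "f y = 0" if "y \<notin> {-N..N}" for y
  proof -
    have "((\<lambda>y. 0) has_real_derivative 0) (at y)" by simp
    then have "(F has_real_derivative 0) (at y)"
      by (rule has_field_derivative_transform_within_open[where S="- {-N..N}"])
        (use that N in auto)
    then show ?thesis using F(1) DERIV_unique by blast
  qed
  define M where "M = max \<bar>t\<bar> \<bar>N\<bar> + 1"
  have cont: "isCont f y" for y using F(2) by (simp add: continuous_on_eq_continuous_at)
  have FTC: "has_bochner_integral lborel (\<lambda>y. f y * indicator {a..M} y) (F M - F a)" if "a \<le> M" for a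
    using has_bochner_integral_FTC_Icc_real[OF that F(1) cont] by simp
  have "M \<notin> {-N..N}" "-M \<notin> {-N..N}" unfolding M_def atLeastAtMost_iff by linarith+
  then have FM: "F M = 0" "F (- M) = 0" using N by blast+
  have AE: "AE y in lborel. y \<noteq> t" by (rule AE_lborel_singleton)
  have "(LINT y|lborel. indicator {t<..} y * f y) = (LINT y|lborel. f y * indicator {t..M} y)"
  proof (rule integral_cong_AE)
    have [measurable]: "f \<in> borel_measurable borel" using F(2) by (rule borel_measurable_continuous_onI)
    show "(\<lambda>y. indicator {t<..} y * f y) \<in> borel_measurable lborel"
      "(\<lambda>y. f y * indicator {t..M} y) \<in> borel_measurable lborel" by measurable
    show "AE y in lborel. indicator {t<..} y * f y = f y * indicator {t..M} y"
      using AE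
    proof eventually_elim
      case (elim y)
      have "M < y \<Longrightarrow> y \<notin> {-N..N}" unfolding M_def atLeastAtMost_iff by linarith
      then have "M < y \<Longrightarrow> f y = 0" using f0 by blast
      with elim show ?case by (auto simp: indicator_def)
    qed
  qed
  also have "\<dots> = - F t" using FTC[of t] FM by (auto simp: has_bochner_integral_iff M_def)
  finally show "(LINT y|lborel. indicator {t<..} y * f y) = - F t" .
  have "y \<notin> {-M..M} \<Longrightarrow> y \<notin> {-N..N}" for y unfolding M_def atLeastAtMost_iff by linarith
  then have "(\<lambda>y. f y * indicator {-M..M} y) = f"
    using f0 by (auto simp: fun_eq_iff indicator_def)
  moreover have "- M \<le> M" unfolding M_def by linarith
  ultimately have "has_bochner_integral lborel f 0" using FTC[of "-M"] FM by simp
  then show "integrable lborel f" "(LINT y|lborel. f y) = 0" by (auto simp: has_bochner_integral_iff)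
qed

text \<open>
  The primitive of \<open>G\<close> is only absolutely continuous, so the formula comes from exchanging the order of
  integration.
\<close>
lemma integral_primitive_by_parts:
  fixes F f G :: "real \<Rightarrow> real"
  assumes F: "\<And>y. (F has_real_derivative f y) (at y)" "continuous_on UNIV f"
    and N: "\<forall>y. y \<notin> {-N..N} \<longrightarrow> F y = 0"
    and G: "integrable lborel G"
  shows "(LINT y|lborel. (LINT t|lborel. indicator {..<y} t * G t) * f y) = - (LINT t|lborel. G t * F t)"
proof -
  note tail = integral_deriv_tail[OF F N]
  have [measurable]: "f \<in> borel_measurable borel" using F(2) by (rule borel_measurable_continuous_onI)
  have [measurable]: "G \<in> borel_measurable borel" using G by auto
  have prod: "integrable (lborel \<Otimes>\<^sub>M lborel) (\<lambda>(t, y). G t * f y)"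
  proof (rule lborel_pair.Fubini_integrable)
    show "(\<lambda>(t, y). G t * f y) \<in> borel_measurable (lborel \<Otimes>\<^sub>M lborel)" by measurable
    have "(LINT y|lborel. norm (case (t, y) of (t, y) \<Rightarrow> G t * f y)) = \<bar>G t\<bar> * (LINT y|lborel. \<bar>f y\<bar>)" for t
      by (simp add: abs_mult)
    then show "integrable lborel (\<lambda>t. LINT y|lborel. norm (case (t, y) of (t, y) \<Rightarrow> G t * f y))"
      using G by simp
    show "AE t in lborel. integrable lborel (\<lambda>y. case (t, y) of (t, y) \<Rightarrow> G t * f y)"
      using tail(2) by simp
  qed
  have int: "integrable (lborel \<Otimes>\<^sub>M lborel) (\<lambda>(t, y). indicator {t<..} y * (G t * f y))"
  proof (rule Bochner_Integration.integrable_bound[OF prod])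
    have "(\<lambda>(t, y). indicator {t<..} y * (G t * f y)) = (\<lambda>z. (if fst z < snd z then 1 else 0) * (G (fst z) * f (snd z)))"
      by (auto simp: fun_eq_iff)
    then show "(\<lambda>(t, y). indicator {t<..} y * (G t * f y)) \<in> borel_measurable (lborel \<Otimes>\<^sub>M lborel)"
      by simp
  qed (auto simp: indicator_def)
  have "(LINT y|lborel. (LINT t|lborel. indicator {..<y} t * G t) * f y)
      = (LINT y|lborel. (LINT t|lborel. indicator {t<..} y * (G t * f y)))"
  proof (rule Bochner_Integration.integral_cong[OF refl])
    fix y
    have "(LINT t|lborel. indicator {..<y} t * G t) * f y = (LINT t|lborel. (indicator {..<y} t * G t) * f y)"
      by simp
    also have "\<dots> = (LINT t|lborel. indicator {t<..} y * (G t * f y))"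
      by (rule Bochner_Integration.integral_cong) (auto simp: indicator_def)
    finally show "(LINT t|lborel. indicator {..<y} t * G t) * f y = (LINT t|lborel. indicator {t<..} y * (G t * f y))" .
  qed
  also have "\<dots> = (LINT t|lborel. (LINT y|lborel. indicator {t<..} y * (G t * f y)))"
    using lborel_pair.Fubini_integral[OF int] by simp
  also have "\<dots> = (LINT t|lborel. - (G t * F t))"
  proof (rule Bochner_Integration.integral_cong[OF refl])
    fix t
    have "(LINT y|lborel. indicator {t<..} y * (G t * f y)) = G t * (LINT y|lborel. indicator {t<..} y * f y)"
    proof -
      have "(\<lambda>y. indicator {t<..} y * (G t * f y)) = (\<lambda>y. G t * (indicator {t<..} y * f y))"
        by (auto simp: fun_eq_iff)
      then show ?thesis by simp
    qed
    then show "(LINT y|lborel. indicator {t<..} y * (G t * f y)) = - (G t * F t)"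
      using tail(1)[of t] by simp
  qed
  finally show ?thesis by simp
qed

lemma lborel2_integral_swap:
  fixes f :: "real \<times> real \<Rightarrow> real"
  assumes "f \<in> borel_measurable borel"
  shows "(LINT z|lborel. f (prod.swap z)) = (LINT z|lborel. f z)"
  using lborel_pair.integral_product_swap[of f, unfolded lborel_prod] assms
  by (simp add: prod.swap_def case_prod_unfold)

lemma lborel2_integrable_swap:
  fixes f :: "real \<times> real \<Rightarrow> real"
  shows "integrable lborel (\<lambda>z. f (prod.swap z)) \<longleftrightarrow> integrable lborel f"
  using lborel_pair.integrable_product_swap_iff[of f, unfolded lborel_prod]
  by (simp add: prod.swap_def case_prod_unfold)

lemma lborel2_distr_swap: "distr lborel borel prod.swap = (lborel :: (real \<times> real) measure)"
proof -
  have "distr lborel lborel (\<lambda>(x, y). (y, x)) = (lborel :: (real \<times> real) measure)"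
    using lborel_pair.distr_pair_swap[unfolded lborel_prod, symmetric] by simp
  then show ?thesis by (simp add: prod.swap_def case_prod_unfold cong: distr_cong)
qed

lemma measurable_swap [measurable]: "prod.swap \<in> borel_measurable (borel :: (real \<times> real) measure)"
  unfolding prod.swap_def[abs_def] by (intro borel_measurable_continuous_onI continuous_intros)

lemma AE_lborel2_swap:
  assumes "AE z in lborel. P (prod.swap (z :: real \<times> real))"
  shows "AE z in lborel. P z"
proof -
  have "AE z in distr lborel borel prod.swap. P (prod.swap (z :: real \<times> real))"
    using assms by (subst lborel2_distr_swap)
  then have "AE z in lborel. P (prod.swap (prod.swap (z :: real \<times> real)))"
    by (rule AE_distrD[rotated]) measurable
  then show ?thesis by simp
qed

lemma test_function_slice:
  fixes \<phi> :: "real \<times> real \<Rightarrow> real"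
  assumes "test_function S \<phi> \<psi>"
  obtains N where "\<And>x y. ((\<lambda>y. \<phi> (x, y)) has_real_derivative \<psi> (x, y) \<bullet> (0, 1)) (at y)"
    "\<And>x. continuous_on UNIV (\<lambda>y. \<psi> (x, y) \<bullet> (0, 1))"
    "\<And>x. \<forall>y. y \<notin> {-N..N} \<longrightarrow> \<phi> (x, y) = 0"
proof -
  obtain K where K: "compact K" "\<And>z. z \<notin> K \<Longrightarrow> \<phi> z = 0"
    using test_functionE[OF assms] by metis
  then obtain N where N: "\<And>z. z \<in> K \<Longrightarrow> norm z \<le> N"
    using compact_imp_bounded bounded_pos by metis
  have "\<phi> (x, y) = 0" if "y \<notin> {-N..N}" for x y
  proof (rule K(2), rule notI)
    assume "(x, y) \<in> K"
    then have "\<bar>y\<bar> \<le> N" using N[of "(x, y)"] norm_snd_le[of y x] by simp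
    then show False using that by auto
  qed
  moreover have "((\<lambda>y. \<phi> (x, y)) has_real_derivative \<psi> (x, y) \<bullet> (0, 1)) (at y)" for x y
  proof -
    have "(\<phi> has_derivative (\<lambda>v. \<psi> (x, y) \<bullet> v)) (at (x, y))"
      using assms unfolding test_function_def by blast
    moreover have "((\<lambda>y. (x, y)) has_derivative (\<lambda>h. (0, h))) (at y)"
      by (auto intro!: derivative_eq_intros)
    ultimately have "((\<lambda>y. \<phi> (x, y)) has_derivative (\<lambda>h. \<psi> (x, y) \<bullet> (0, h))) (at y)"
      using has_derivative_compose by blast
    then show ?thesis unfolding has_field_derivative_def
      by (simp add: inner_prod_def)
  qed
  moreover have "continuous_on UNIV (\<lambda>y. \<psi> (x, y) \<bullet> (0, 1))" for x
    by (intro continuous_intros continuous_on_compose2[OF test_function_continuous(2)[OF assms]]) auto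
  ultimately show ?thesis using that by blast
qed

lemma test_function_swap:
  fixes \<phi> :: "real \<times> real \<Rightarrow> real"
  assumes "test_function S \<phi> \<psi>"
  shows "test_function (prod.swap ` S) (\<lambda>z. \<phi> (prod.swap z)) (\<lambda>z. prod.swap (\<psi> (prod.swap z)))"
proof -
  obtain K where K: "compact K" "K \<subseteq> S" "\<And>z. z \<notin> K \<Longrightarrow> \<phi> z = 0"
    using test_functionE[OF assms] by metis
  have cs: "continuous_on A prod.swap" for A :: "(real \<times> real) set"
    unfolding prod.swap_def[abs_def] by (intro continuous_intros)
  have "((\<lambda>z. \<phi> (prod.swap z)) has_derivative (\<lambda>v. prod.swap (\<psi> (prod.swap z)) \<bullet> v)) (at z)" for z
  proof -
    have "(prod.swap has_derivative prod.swap) (at z)" for z :: "real \<times> real"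
      unfolding prod.swap_def[abs_def] by (auto intro!: derivative_eq_intros)
    moreover have "(\<phi> has_derivative (\<lambda>v. \<psi> (prod.swap z) \<bullet> v)) (at (prod.swap z))"
      using assms unfolding test_function_def by blast
    ultimately have "((\<lambda>z. \<phi> (prod.swap z)) has_derivative (\<lambda>v. \<psi> (prod.swap z) \<bullet> prod.swap v)) (at z)"
      using has_derivative_compose by blast
    then show ?thesis by (simp add: inner_prod_def add.commute prod.swap_def)
  qed
  moreover have "continuous_on UNIV (\<lambda>z. prod.swap (\<psi> (prod.swap z)))"
    by (intro continuous_on_compose2[OF cs] continuous_on_compose2[OF test_function_continuous(2)[OF assms]] cs) auto
  moreover have "compact (prod.swap ` K)" using K cs by (intro compact_continuous_image)
  moreover have "\<phi> (prod.swap z) = 0" if "z \<notin> prod.swap ` K" for z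
    using that K(3) by (metis image_eqI swap_swap)
  ultimately show ?thesis using K(2) unfolding test_function_def by blast
qed

text \<open>
  On every line parallel to a coordinate axis the derivative of a compactly supported function
  integrates to zero.
\<close>
lemma test_function_integral_zero:
  fixes \<phi> :: "real \<times> real \<Rightarrow> real"
  assumes tf: "test_function S \<phi> \<psi>"
  shows "(LINT z|lborel. \<psi> z \<bullet> (0, 1)) = 0" "(LINT z|lborel. \<psi> z \<bullet> (1, 0)) = 0"
proof -
  have main: "(LINT z|lborel. \<psi> z \<bullet> (0, 1)) = 0"
    if tf: "test_function S \<phi> \<psi>" for S :: "(real \<times> real) set" and \<phi> \<psi>
  proof -
    obtain K where K: "compact K" "\<And>z. z \<notin> K \<Longrightarrow> \<psi> z = 0"
      using test_functionE[OF tf] by metis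
    have "integrable lborel (\<lambda>z. indicator K z * (\<psi> z \<bullet> (0, 1)))"
      using K emeasure_compact_finite[OF K(1)]
      by (intro L2_integrable_on test_function_L2[OF tf]) (auto simp: compact_imp_closed)
    also have "(\<lambda>z. indicator K z * (\<psi> z \<bullet> (0, 1))) = (\<lambda>z. \<psi> z \<bullet> (0, 1))"
      using K by (auto simp: fun_eq_iff indicator_def)
    finally have int: "integrable (lborel \<Otimes>\<^sub>M lborel) (\<lambda>z. \<psi> z \<bullet> (0, 1))"
      by (simp add: lborel_prod)
    obtain N where N: "\<And>x y. ((\<lambda>y. \<phi> (x, y)) has_real_derivative \<psi> (x, y) \<bullet> (0, 1)) (at y)"
    "\<And>x. continuous_on UNIV (\<lambda>y. \<psi> (x, y) \<bullet> (0, 1))"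
    "\<And>x. \<forall>y. y \<notin> {-N..N} \<longrightarrow> \<phi> (x, y) = 0" using test_function_slice[OF tf] by metis
    have "(LINT z|lborel. \<psi> z \<bullet> (0, 1)) = (LINT x|lborel. LINT y|lborel. \<psi> (x, y) \<bullet> (0, 1))"
      using lborel_pair.integral_fst'[OF int] by (simp add: lborel_prod)
    also have "\<dots> = 0"
      using integral_deriv_tail(3)[OF N] by simp
    finally show ?thesis .
  qed
  show "(LINT z|lborel. \<psi> z \<bullet> (0, 1)) = 0" by (rule main[OF tf])
  have "(LINT z|lborel. prod.swap (\<psi> (prod.swap z)) \<bullet> (0, 1)) = 0"
    by (rule main[OF test_function_swap[OF tf]])
  moreover have "prod.swap p \<bullet> (0, 1) = p \<bullet> (1, 0)" for p :: "real \<times> real"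
    by (simp add: inner_prod_def)
  ultimately have "(LINT z|lborel. \<psi> (prod.swap z) \<bullet> (1, 0)) = 0" by simp
  then show "(LINT z|lborel. \<psi> z \<bullet> (1, 0)) = 0"
    using lborel2_integral_swap[of "\<lambda>z. \<psi> z \<bullet> (1, 0)"] test_function_measurable[OF tf] by simp
qed

section \<open>Weak derivatives in the plane\<close>

lemma borel_measurable_comp_fst_snd [measurable (raw)]:
  fixes f :: "real \<Rightarrow> 'a::topological_space" and g :: "'b \<Rightarrow> real \<times> real"
  assumes "f \<in> borel_measurable borel" "g \<in> borel_measurable M"
  shows "(\<lambda>z. f (fst (g z))) \<in> borel_measurable M" "(\<lambda>z. f (snd (g z))) \<in> borel_measurable M"
proof -
  have "fst \<in> borel_measurable (borel :: (real \<times> real) measure)"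
    "snd \<in> borel_measurable (borel :: (real \<times> real) measure)"
    by (simp_all add: borel_prod[symmetric])
  then show "(\<lambda>z. f (fst (g z))) \<in> borel_measurable M" "(\<lambda>z. f (snd (g z))) \<in> borel_measurable M"
    using assms by (auto intro: measurable_compose[OF measurable_compose[OF assms(2)]])
qed

text \<open>
  Boxes form a generating system stable under intersection, so the integral of \<open>D\<close> over every Borel set
  vanishes.
\<close>
lemma AE_zero_if_box_integrals_zero:
  fixes D :: "real \<times> real \<Rightarrow> real"
  assumes int: "integrable lborel D"
    and box: "\<And>a b. (LINT z|lborel. indicator (box a b) z * D z) = 0"
  shows "AE z in lborel. D z = 0"
proof -
  note [measurable] = borel_measurable_integrable[OF int, simplified]
  have intA: "integrable lborel (\<lambda>z. indicator A z * D z)" if "A \<in> sets borel" for A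
  proof -
    have "integrable lborel (\<lambda>z. indicator A z *\<^sub>R D z)"
      using that by (intro integrable_mult_indicator int) simp
    then show ?thesis by simp
  qed
  have UNIV: "(LINT z|lborel. D z) = 0"
  proof -
    define B where "B n = box (- real n, - real n) (real n, real n)" for n :: nat
    have "(\<lambda>n. LINT z|lborel. indicator (B n) z * D z) \<longlonglongrightarrow> (LINT z|lborel. D z)"
    proof (rule integral_dominated_convergence[where w="\<lambda>z. \<bar>D z\<bar>"])
      show "AE z in lborel. (\<lambda>n. indicator (B n) z * D z) \<longlonglongrightarrow> D z"
      proof (rule AE_I2)
        fix z :: "real \<times> real"
        obtain N where N: "max \<bar>fst z\<bar> \<bar>snd z\<bar> < real N" using reals_Archimedean2 by blast
        have "z \<in> B n" if "n \<ge> N" for n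
        proof -
          have "\<bar>fst z\<bar> < real n" "\<bar>snd z\<bar> < real n" using N that by auto
          then show ?thesis by (cases z) (auto simp: B_def box_def Basis_prod_def)
        qed
        then have "\<forall>\<^sub>F n in sequentially. indicator (B n) z * D z = D z"
          by (auto simp: eventually_sequentially intro!: exI[of _ N])
        then show "(\<lambda>n. indicator (B n) z * D z) \<longlonglongrightarrow> D z" by (rule tendsto_eventually)
      qed
      show "integrable lborel (\<lambda>z. \<bar>D z\<bar>)" using int by simp
      show "AE z in lborel. norm (indicator (B n) z * D z) \<le> \<bar>D z\<bar>" for n
        by (auto simp: indicator_def)
      show "(\<lambda>z. indicator (B n) z * D z) \<in> borel_measurable lborel" for n
        unfolding B_def by measurable
    qed measurable
    then show ?thesis unfolding B_def box LIMSEQ_const_iff by simp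
  qed
  have all: "(LINT z|lborel. indicator A z * D z) = 0" if "A \<in> sets borel" for A
  proof -
    let ?G = "range (\<lambda>(a, b). box a b :: (real \<times> real) set)"
    have A: "A \<in> sigma_sets UNIV ?G" using that unfolding borel_eq_box by simp
    have G: "Int_stable ?G"
    proof (rule Int_stableI, clarify)
      fix a b c d :: "real \<times> real"
      show "box a b \<inter> box c d \<in> range (\<lambda>(a, b). box a b :: (real \<times> real) set)"
        unfolding box_Int_box by (auto simp del: box_Int_box)
    qed
    have sub: "?G \<subseteq> Pow UNIV" by simp
    have meas: "B \<in> sigma_sets UNIV ?G \<Longrightarrow> B \<in> sets borel" for B
      unfolding borel_eq_box by simp
    from G sub A show ?thesis
    proof (induction rule: sigma_sets_induct_disjoint)
      case (basic A)
      then show ?case using box by auto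
    next
      case empty
      then show ?case by simp
    next
      case (compl A)
      have "(LINT z|lborel. indicator (UNIV - A) z * D z) = (LINT z|lborel. D z - indicator A z * D z)"
        by (rule Bochner_Integration.integral_cong) (auto simp: indicator_def)
      also have "\<dots> = 0" using UNIV compl intA[OF meas[OF compl(1)]] int by simp
      finally show ?case .
    next
      case (union A)
      have "(LINT z:(\<Union>i. A i)|lborel. D z) = (\<Sum>i. (LINT z:(A i)|lborel. D z))"
      proof (rule lebesgue_integral_countable_add)
        show "A i \<in> sets lborel" for i using union(2) meas by auto
        show "i \<noteq> j \<Longrightarrow> A i \<inter> A j = {}" for i j using union(1) by (auto simp: disjoint_family_on_def)
        have "(\<Union>i. A i) \<in> sets borel" using union(2) meas by auto
        then show "set_integrable lborel (\<Union>i. A i) D"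
          using intA unfolding set_integrable_def by simp
      qed
      then show ?case using union(3) by (simp add: set_lebesgue_integral_def)
    qed
  qed
  show ?thesis
    using density_unique_real[OF int, of "\<lambda>_. 0"] all by (simp add: set_lebesgue_integral_def)
qed

lemma box_prod_real: "box (a, b) (c, d) = {a<..<c} \<times> {b<..<d :: real}" for a c :: real
  by (auto simp: box_def Basis_prod_def)

text \<open>
  Products of plateaus converge boundedly to indicators of boxes.
\<close>
lemma AE_zero_if_bump_integrals_zero:
  fixes D :: "real \<times> real \<Rightarrow> real"
  assumes int: "integrable lborel D"
    and supp: "\<And>z. z \<notin> {p<..<q} \<times> {r<..<s} \<Longrightarrow> D z = 0"
    and bumps: "\<And>n p' q' r' s'. p \<le> p' \<Longrightarrow> q' \<le> q \<Longrightarrow> r \<le> r' \<Longrightarrow> s' \<le> s \<Longrightarrow>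
      (LINT z|lborel. D z * (bump n p' q' (fst z) * bump n r' s' (snd z))) = 0"
  shows "AE z in lborel. D z = 0"
proof (rule AE_zero_if_box_integrals_zero[OF int])
  fix a b :: "real \<times> real"
  note [measurable] = borel_measurable_integrable[OF int, simplified]
  define p' where "p' = max p (fst a)"
  define q' where "q' = min q (fst b)"
  define r' where "r' = max r (snd a)"
  define s' where "s' = min s (snd b)"
  have "(\<lambda>n. LINT z|lborel. D z * (bump n p' q' (fst z) * bump n r' s' (snd z)))
      \<longlonglongrightarrow> (LINT z|lborel. D z * (indicator {p'<..<q'} (fst z) * indicator {r'<..<s'} (snd z)))"
  proof (rule integral_dominated_convergence[where w="\<lambda>z. \<bar>D z\<bar>"])
    show "AE z in lborel. (\<lambda>n. D z * (bump n p' q' (fst z) * bump n r' s' (snd z)))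
        \<longlonglongrightarrow> D z * (indicator {p'<..<q'} (fst z) * indicator {r'<..<s'} (snd z))"
      by (intro AE_I2 tendsto_intros bump_tendsto)
    show "AE z in lborel. norm (D z * (bump n p' q' (fst z) * bump n r' s' (snd z))) \<le> \<bar>D z\<bar>" for n
    proof (rule AE_I2)
      fix z :: "real \<times> real"
      have "\<bar>bump n p' q' (fst z) * bump n r' s' (snd z)\<bar> \<le> 1"
        using bump_bounds by (auto simp: abs_mult intro!: mult_le_one)
      then show "norm (D z * (bump n p' q' (fst z) * bump n r' s' (snd z))) \<le> \<bar>D z\<bar>"
        using mult_left_mono[of _ 1 "\<bar>D z\<bar>"] by (simp add: abs_mult)
    qed
    show "integrable lborel (\<lambda>z. \<bar>D z\<bar>)" using int by simp
  qed measurable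
  moreover have bz: "(LINT z|lborel. D z * (bump n p' q' (fst z) * bump n r' s' (snd z))) = 0" for n
    by (rule bumps) (auto simp: p'_def q'_def r'_def s'_def)
  ultimately have "(LINT z|lborel. D z * (indicator {p'<..<q'} (fst z) * indicator {r'<..<s'} (snd z))) = 0"
    unfolding bz LIMSEQ_const_iff by simp
  also have "(\<lambda>z. D z * (indicator {p'<..<q'} (fst z) * indicator {r'<..<s'} (snd z)))
      = (\<lambda>z. indicator (box a b) z * D z)"
  proof
    fix z :: "real \<times> real"
    show "D z * (indicator {p'<..<q'} (fst z) * indicator {r'<..<s'} (snd z)) = indicator (box a b) z * D z"
    proof (cases "z \<in> {p<..<q} \<times> {r<..<s}")
      case True
      have "z \<in> box a b \<longleftrightarrow> fst z \<in> {fst a<..<fst b} \<and> snd z \<in> {snd a<..<snd b}"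
        using box_prod_real[of "fst a" "snd a" "fst b" "snd b"] by (simp add: mem_Times_iff)
      moreover have "fst z \<in> {p<..<q}" "snd z \<in> {r<..<s}" using True by (simp_all add: mem_Times_iff)
      ultimately have "z \<in> box a b \<longleftrightarrow> fst z \<in> {p'<..<q'} \<and> snd z \<in> {r'<..<s'}"
        unfolding p'_def q'_def r'_def s'_def by simp
      then show ?thesis by (simp add: indicator_def)
    qed (use supp in simp)
  qed
  finally show "(LINT z|lborel. indicator (box a b) z * D z) = 0" .
qed

text \<open>
  One component of the weak gradient, tested with plain integrals over the plane: the test functions
  already vanish off \<open>S\<close>. Treating the components separately lets the vertical one be studied alone.
\<close>
definition weak_deriv ::
    "(real \<times> real) set \<Rightarrow> real \<times> real \<Rightarrow> (real \<times> real \<Rightarrow> real) \<Rightarrow> (real \<times> real \<Rightarrow> real) \<Rightarrow> bool" where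
  "weak_deriv S e u d \<longleftrightarrow>
     (\<forall>\<phi> \<psi>. test_function S \<phi> \<psi> \<longrightarrow>
        (LINT z|lborel. u z * (\<psi> z \<bullet> e)) = - (LINT z|lborel. d z * \<phi> z))"

lemma weak_deriv_mono: "weak_deriv S e u d \<Longrightarrow> T \<subseteq> S \<Longrightarrow> weak_deriv T e u d"
  unfolding weak_deriv_def using test_function_mono by blast

lemma weak_deriv_cong:
  assumes wd: "weak_deriv S e u d" and S: "S \<in> sets borel"
    and meas[measurable]: "u \<in> borel_measurable borel" "d \<in> borel_measurable borel"
      "u' \<in> borel_measurable borel" "d' \<in> borel_measurable borel"
    and eq: "AE z in lborel. z \<in> S \<longrightarrow> u z = u' z \<and> d z = d' z"
  shows "weak_deriv S e u' d'"
  unfolding weak_deriv_def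
proof (intro allI impI)
  fix \<phi> \<psi> assume tf: "test_function S \<phi> \<psi>"
  obtain K where K: "compact K" "K \<subseteq> S" "\<And>z. z \<notin> K \<Longrightarrow> \<phi> z = 0" "\<And>z. z \<notin> K \<Longrightarrow> \<psi> z = 0"
    using test_functionE[OF tf] by metis
  note [measurable] = test_function_measurable[OF tf]
  have "(LINT z|lborel. u' z * (\<psi> z \<bullet> e)) = (LINT z|lborel. u z * (\<psi> z \<bullet> e))"
  proof (rule integral_cong_AE)
    show "AE z in lborel. u' z * (\<psi> z \<bullet> e) = u z * (\<psi> z \<bullet> e)"
      using eq
    proof eventually_elim
      case (elim z)
      then show ?case using K(2) K(4)[of z] by (cases "z \<in> K") auto
    qed
  qed measurable
  moreover have "(LINT z|lborel. d' z * \<phi> z) = (LINT z|lborel. d z * \<phi> z)"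
  proof (rule integral_cong_AE)
    show "AE z in lborel. d' z * \<phi> z = d z * \<phi> z"
      using eq
    proof eventually_elim
      case (elim z)
      then show ?case using K(2) K(3)[of z] by (cases "z \<in> K") auto
    qed
  qed measurable
  ultimately show "(LINT z|lborel. u' z * (\<psi> z \<bullet> e)) = - (LINT z|lborel. d' z * \<phi> z)"
    using wd tf unfolding weak_deriv_def by simp
qed

lemma test_function_bumps:
  assumes "p \<le> p'" "q' \<le> q" "r \<le> r'" "s' \<le> s"
  obtains \<psi> where "test_function ({p<..<q} \<times> {r<..<s}) (\<lambda>z. bump n p' q' (fst z) * bump n r' s' (snd z)) \<psi>"
proof -
  have pos: "1 / real (Suc n) > 0" by simp
  have "{p' + 1 / real (Suc n)..q' - 1 / real (Suc n)} \<times> {r' + 1 / real (Suc n)..s' - 1 / real (Suc n)}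
      \<subseteq> {p<..<q} \<times> {r<..<s}"
  proof (intro Sigma_mono subsetI)
    show "t \<in> {p<..<q}" if "t \<in> {p' + 1 / real (Suc n)..q' - 1 / real (Suc n)}" for t
      using that assms pos unfolding atLeastAtMost_iff greaterThanLessThan_iff by linarith
    show "t \<in> {r<..<s}" if "t \<in> {r' + 1 / real (Suc n)..s' - 1 / real (Suc n)}" for t
      using that assms pos unfolding atLeastAtMost_iff greaterThanLessThan_iff by linarith
  qed
  then have "test_function ({p<..<q} \<times> {r<..<s}) (\<lambda>z. bump n p' q' (fst z) * bump n r' s' (snd z))
    (\<lambda>z. (bump' n p' q' (fst z) * bump n r' s' (snd z), bump n p' q' (fst z) * bump' n r' s' (snd z)))"
    by (intro test_function_product[where p'="p' + 1 / real (Suc n)" and q'="q' - 1 / real (Suc n)"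
          and r'="r' + 1 / real (Suc n)" and s'="s' - 1 / real (Suc n)"] bump_deriv continuous_bump bump_outside)
  then show ?thesis by (rule that)
qed

text \<open>
  Countably many rectangles cover \<open>S\<close>, and on each of them the plateau functions separate \<open>L\<^sup>2\<close>
  functions.
\<close>
lemma weak_deriv_unique:
  assumes S: "open S" and L: "L2 d1" "L2 d2"
    and wd: "weak_deriv S e u d1" "weak_deriv S e u d2"
  shows "AE z in lborel. z \<in> S \<longrightarrow> d1 z = d2 z"
proof -
  obtain \<D> where D: "countable \<D>" "\<D> \<subseteq> Pow S" "\<And>X. X \<in> \<D> \<Longrightarrow> \<exists>a b. X = box a b" "\<Union>\<D> = S"
    using open_countable_Union_open_box[OF S] by metis
  have "AE z in lborel. z \<in> X \<longrightarrow> d1 z = d2 z" if X: "X \<in> \<D>" for X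
  proof -
    obtain a b where ab: "X = box a b" using D(3) X by blast
    define p q r s where "p = fst a" "q = fst b" "r = snd a" "s = snd b"
    have Xe: "X = {p<..<q} \<times> {r<..<s}" using ab box_prod_real[of p r q s] by (simp add: p_q_r_s_def)
    have "AE z in lborel. indicator X z * (d1 z - d2 z) = 0"
    proof (rule AE_zero_if_bump_integrals_zero)
      show "integrable lborel (\<lambda>z. indicator X z * (d1 z - d2 z))"
        by (rule L2_integrable_on[OF L2_diff]) (use L in \<open>auto simp: ab emeasure_lborel_box_eq\<close>)
      show "z \<notin> {p<..<q} \<times> {r<..<s} \<Longrightarrow> indicator X z * (d1 z - d2 z) = 0" for z
        using Xe by simp
      fix n p' q' r' s' assume le: "p \<le> p'" "q' \<le> q" "r \<le> r'" "s' \<le> s"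
      obtain \<psi> where \<psi>: "test_function X (\<lambda>z. bump n p' q' (fst z) * bump n r' s' (snd z)) \<psi>"
        using test_function_bumps[OF le] unfolding Xe by metis
      let ?\<phi> = "\<lambda>z. bump n p' q' (fst z) * bump n r' s' (snd z)"
      have tfS: "test_function S ?\<phi> \<psi>" using \<psi> X D(2) by (blast intro: test_function_mono)
      have "(LINT z|lborel. d1 z * ?\<phi> z) = (LINT z|lborel. d2 z * ?\<phi> z)"
        using wd(1)[unfolded weak_deriv_def, rule_format, OF tfS]
          wd(2)[unfolded weak_deriv_def, rule_format, OF tfS] by linarith
      moreover have "integrable lborel (\<lambda>z. d1 z * ?\<phi> z)" "integrable lborel (\<lambda>z. d2 z * ?\<phi> z)"
        using L test_function_L2(1)[OF \<psi>] by (auto intro: L2_mult)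
      ultimately have "(LINT z|lborel. d1 z * ?\<phi> z - d2 z * ?\<phi> z) = 0" by simp
      also have "(\<lambda>z. d1 z * ?\<phi> z - d2 z * ?\<phi> z) = (\<lambda>z. indicator X z * (d1 z - d2 z) * ?\<phi> z)"
      proof
        fix z
        obtain K where "K \<subseteq> X" "\<And>z. z \<notin> K \<Longrightarrow> ?\<phi> z = 0" using test_functionE[OF \<psi>] by metis
        then have "z \<notin> X \<Longrightarrow> ?\<phi> z = 0" by blast
        then show "d1 z * ?\<phi> z - d2 z * ?\<phi> z = indicator X z * (d1 z - d2 z) * ?\<phi> z"
          by (cases "z \<in> X") (auto simp: algebra_simps)
      qed
      finally show "(LINT z|lborel. indicator X z * (d1 z - d2 z) * ?\<phi> z) = 0" .
    qed
    then show ?thesis by eventually_elim auto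
  qed
  then have "AE z in lborel. \<forall>X\<in>\<D>. z \<in> X \<longrightarrow> d1 z = d2 z"
    unfolding AE_ball_countable[OF D(1)] by blast
  then show ?thesis
  proof eventually_elim
    case (elim z)
    then show ?case using D(4) by blast
  qed
qed

text \<open>
  The vertical primitive of a function that vanishes below the domain.
\<close>
definition vprim :: "(real \<times> real \<Rightarrow> real) \<Rightarrow> real \<times> real \<Rightarrow> real" where
  "vprim g z = (LINT t|lborel. indicator {..<snd z} t * g (fst z, t))"

lemma borel_measurable_vprim [measurable]:
  assumes [measurable]: "g \<in> borel_measurable borel"
  shows "vprim g \<in> borel_measurable borel"
proof -
  have "(\<lambda>(z, t). (if t < snd z then 1 else 0) * g (fst z, t)) \<in> borel_measurable (borel \<Otimes>\<^sub>M lborel)"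
    by measurable
  then have "(\<lambda>z. LINT t|lborel. (if t < snd z then 1 else 0) * g (fst z, t)) \<in> borel_measurable borel"
    by (rule lborel.borel_measurable_lebesgue_integral)
  moreover have "vprim g = (\<lambda>z. LINT t|lborel. (if t < snd z then 1 else 0) * g (fst z, t))"
    unfolding vprim_def by (auto simp: fun_eq_iff indicator_def intro!: Bochner_Integration.integral_cong)
  ultimately show ?thesis by simp
qed

lemma lborel2_integral_fst:
  fixes f :: "real \<times> real \<Rightarrow> real"
  assumes "integrable lborel f"
  shows "(LINT z|lborel. f z) = (LINT x|lborel. LINT y|lborel. f (x, y))"
  using lborel_pair.integral_fst'[of f] assms by (simp add: lborel_prod)

lemma lborel2_AE_integrable_fst:
  fixes f :: "real \<times> real \<Rightarrow> real"
  assumes "integrable lborel f"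
  shows "AE x in lborel. integrable lborel (\<lambda>y. f (x, y))"
  using lborel_pair.AE_integrable_fst'[of f] assms by (simp add: lborel_prod)

lemma lborel2_integrable_fst:
  fixes f :: "real \<times> real \<Rightarrow> real"
  assumes "integrable lborel f"
  shows "integrable lborel (\<lambda>x. LINT y|lborel. f (x, y))"
  using lborel_pair.integrable_fst'[of f] assms by (simp add: lborel_prod)

lemma lborel2_nn_integral_fst:
  fixes f :: "real \<times> real \<Rightarrow> ennreal"
  assumes "f \<in> borel_measurable borel"
  shows "(\<integral>\<^sup>+z. f z \<partial>lborel) = (\<integral>\<^sup>+x. \<integral>\<^sup>+y. f (x, y) \<partial>lborel \<partial>lborel)"
  using lborel.nn_integral_fst[of f lborel] assms by (simp add: lborel_prod)

lemma vprim_bound: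
  assumes "integrable lborel (\<lambda>y. g (x, y))"
  shows "\<bar>vprim g (x, y)\<bar> \<le> (LINT t|lborel. \<bar>g (x, t)\<bar>)"
proof -
  have "\<bar>vprim g (x, y)\<bar> \<le> (LINT t|lborel. \<bar>indicator {..<y} t * g (x, t)\<bar>)"
    unfolding vprim_def by simp
  also have "\<dots> \<le> (LINT t|lborel. \<bar>g (x, t)\<bar>)"
  proof (rule integral_mono')
    show "integrable lborel (\<lambda>t. \<bar>g (x, t)\<bar>)" using assms by simp
  qed (auto simp: indicator_def)
  finally show ?thesis .
qed

section \<open>Representation on rectangles\<close>

lemma AE_lborel2_fst:
  assumes "AE x in lborel. P (x :: real)"
  shows "AE z in lborel. P (fst (z :: real \<times> real))"
proof -
  obtain N where N: "{x. \<not> P x} \<subseteq> N" "N \<in> sets lborel" "emeasure lborel N = 0"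
    using assms by (auto elim!: AE_E)
  have "emeasure (lborel \<Otimes>\<^sub>M lborel) (N \<times> (UNIV :: real set)) = 0"
    using N by (subst lborel.emeasure_pair_measure_Times) auto
  then have "emeasure lborel (N \<times> (UNIV :: real set)) = 0" by (simp add: lborel_prod)
  moreover have "N \<times> (UNIV :: real set) \<in> sets lborel"
    using N(2) by (metis lborel_prod pair_measureI sets_lborel sets.top space_borel)
  ultimately show ?thesis using N(1) by (intro AE_I[of _ _ "N \<times> UNIV"]) auto
qed

lemma integrable_indicator_interval [simp]:
  "integrable lborel (indicator {r..s} :: real \<Rightarrow> real)"
  "integrable lborel (indicator {r<..<s} :: real \<Rightarrow> real)"
  by (rule integrable_real_indicator[OF _ emeasure_bounded_finite]; simp)+

lemma integrable_tensor:
  fixes a b :: "real \<Rightarrow> real"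
  assumes "integrable lborel a" "integrable lborel b"
  shows "integrable lborel (\<lambda>z. a (fst z) * b (snd z))"
proof -
  have [measurable]: "a \<in> borel_measurable borel" "b \<in> borel_measurable borel" using assms by auto
  have "integrable (lborel \<Otimes>\<^sub>M lborel) (\<lambda>(t, y). a t * b y)"
  proof (rule lborel_pair.Fubini_integrable)
    show "(\<lambda>(t, y). a t * b y) \<in> borel_measurable (lborel \<Otimes>\<^sub>M lborel)" by measurable
    have "(LINT y|lborel. norm (case (t, y) of (t, y) \<Rightarrow> a t * b y)) = \<bar>a t\<bar> * (LINT y|lborel. \<bar>b y\<bar>)" for t
      by (simp add: abs_mult)
    then show "integrable lborel (\<lambda>t. LINT y|lborel. norm (case (t, y) of (t, y) \<Rightarrow> a t * b y))"
      using assms(1) by simp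
    show "AE t in lborel. integrable lborel (\<lambda>y. case (t, y) of (t, y) \<Rightarrow> a t * b y)"
      using assms(2) by simp
  qed
  then show ?thesis by (simp add: lborel_prod case_prod_unfold)
qed

lemma vprim_by_parts:
  assumes tf: "test_function S \<phi> \<psi>" and g: "integrable lborel g"
    and int: "integrable lborel (\<lambda>z. vprim g z * (\<psi> z \<bullet> (0, 1)))"
  shows "(LINT z|lborel. vprim g z * (\<psi> z \<bullet> (0, 1))) = - (LINT z|lborel. g z * \<phi> z)"
proof -
  obtain N where N: "\<And>x y. ((\<lambda>y. \<phi> (x, y)) has_real_derivative \<psi> (x, y) \<bullet> (0, 1)) (at y)"
    "\<And>x. continuous_on UNIV (\<lambda>y. \<psi> (x, y) \<bullet> (0, 1))"
    "\<And>x. \<forall>y. y \<notin> {-N..N} \<longrightarrow> \<phi> (x, y) = 0" using test_function_slice[OF tf] by metis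
  obtain B where B: "B > 0" "\<And>z. \<bar>\<phi> z\<bar> \<le> B" using test_function_bounded[OF tf] by metis
  note [measurable] = test_function_measurable[OF tf]
  have [measurable]: "g \<in> borel_measurable borel" using g by auto
  have gi: "integrable lborel (\<lambda>z. g z * \<phi> z)"
  proof (rule Bochner_Integration.integrable_bound)
    show "integrable lborel (\<lambda>z. B * g z)" using g by simp
    show "(\<lambda>z. g z * \<phi> z) \<in> borel_measurable lborel" by measurable
    show "AE z in lborel. norm (g z * \<phi> z) \<le> norm (B * g z)"
    proof (rule AE_I2)
      fix z
      have "\<bar>\<phi> z\<bar> * \<bar>g z\<bar> \<le> B * \<bar>g z\<bar>" using B(2)[of z] by (intro mult_right_mono) auto
      then show "norm (g z * \<phi> z) \<le> norm (B * g z)" using B(1) by (simp add: abs_mult mult.commute)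
    qed
  qed
  have "(LINT z|lborel. vprim g z * (\<psi> z \<bullet> (0, 1)))
      = (LINT x|lborel. LINT y|lborel. vprim g (x, y) * (\<psi> (x, y) \<bullet> (0, 1)))"
    by (rule lborel2_integral_fst[OF int])
  also have "\<dots> = (LINT x|lborel. - (LINT y|lborel. g (x, y) * \<phi> (x, y)))"
  proof (rule integral_cong_AE)
    show "(\<lambda>x. LINT y|lborel. vprim g (x, y) * (\<psi> (x, y) \<bullet> (0, 1))) \<in> borel_measurable lborel"
      using lborel2_integrable_fst[OF int] by auto
    show "(\<lambda>x. - (LINT y|lborel. g (x, y) * \<phi> (x, y))) \<in> borel_measurable lborel"
      using lborel2_integrable_fst[OF gi] by auto
    show "AE x in lborel. (LINT y|lborel. vprim g (x, y) * (\<psi> (x, y) \<bullet> (0, 1))) =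
        - (LINT y|lborel. g (x, y) * \<phi> (x, y))"
      using lborel2_AE_integrable_fst[OF g]
    proof eventually_elim
      case (elim x)
      show ?case using integral_primitive_by_parts[OF N elim] by (simp add: vprim_def)
    qed
  qed
  also have "\<dots> = - (LINT x|lborel. LINT y|lborel. g (x, y) * \<phi> (x, y))"
    by (rule integral_minus)
  also have "(LINT x|lborel. LINT y|lborel. g (x, y) * \<phi> (x, y)) = (LINT z|lborel. g z * \<phi> z)"
    by (rule lborel2_integral_fst[OF gi, symmetric])
  finally show ?thesis .
qed

lemma integrable_bump: "integrable lborel (bump n r s)"
proof (rule Bochner_Integration.integrable_bound)
  show "integrable lborel (indicator {r..s} :: real \<Rightarrow> real)" by simp
  have "\<bar>bump n r s t\<bar> \<le> indicator {r..s} t" for t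
  proof (cases "t \<in> {r..s}")
    case True
    then show ?thesis using bump_bounds by simp
  next
    case False
    have "1 / real (Suc n) > 0" by simp
    then have "t \<notin> {r + 1 / real (Suc n)..s - 1 / real (Suc n)}" using False
      unfolding atLeastAtMost_iff by linarith
    then show ?thesis using False bump_outside by simp
  qed
  then show "AE t in lborel. norm (bump n r s t) \<le> norm (indicator {r..s} t :: real)" by simp
qed measurable

lemma bump_zero: "t \<notin> {r<..<s} \<Longrightarrow> bump n r s t = 0"
proof (rule bump_outside)
  assume t: "t \<notin> {r<..<s}"
  have "1 / real (Suc n) > 0" by simp
  then show "t \<notin> {r + 1 / real (Suc n)..s - 1 / real (Suc n)}" using t
    unfolding atLeastAtMost_iff greaterThanLessThan_iff by linarith
qed

lemma bump_integral_pos: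
  assumes "r < s" obtains n where "(LINT t|lborel. bump n r s t) > 0"
proof -
  have "(\<lambda>n. LINT t|lborel. bump n r s t) \<longlonglongrightarrow> (LINT t|lborel. indicator {r<..<s} t)"
  proof (rule integral_dominated_convergence[where w="indicator {r..s}"])
    show "AE t in lborel. (\<lambda>n. bump n r s t) \<longlonglongrightarrow> indicator {r<..<s} t"
      by (intro AE_I2 bump_tendsto)
    show "AE t in lborel. norm (bump n r s t) \<le> indicator {r..s} t" for n
    proof (rule AE_I2)
      fix t show "norm (bump n r s t) \<le> indicator {r..s} t"
        using bump_bounds[of n r s t] bump_zero[of t r s n] by (auto simp: indicator_def)
    qed
  qed auto
  also have "(LINT t|lborel. indicator {r<..<s} t) = s - r" using assms by simp
  finally have "\<forall>\<^sub>F n in sequentially. (LINT t|lborel. bump n r s t) > 0"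
    using assms by (intro order_tendstoD(1)[of _ "s - r"]) auto
  then show ?thesis using that by (auto simp: eventually_sequentially)
qed

lemma antiderivative_on_line:
  fixes f :: "real \<Rightarrow> real"
  assumes "continuous_on UNIV f"
  obtains F where "\<And>x. (F has_real_derivative f x) (at x)"
proof -
  define F where "F u = (LBINT y=0..u. f y)" for u :: real
  have "(F has_real_derivative f x) (at x)" for x
  proof -
    define M where "M = \<bar>x\<bar> + 1"
    have "(F has_vector_derivative f x) (at x within {-M..M})"
      unfolding F_def zero_ereal_def
      by (rule interval_integral_FTC2) (use assms continuous_on_subset in \<open>auto simp: M_def\<close>)
    moreover have "at x within {-M..M} = at x"
      by (rule at_within_interior) (auto simp: M_def)
    ultimately show ?thesis by (simp add: has_real_derivative_iff_has_vector_derivative)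
  qed
  then show ?thesis using that by blast
qed

text \<open>
  A weak primitive is a classical one along almost every vertical line: after subtracting the primitive
  of \<open>g\<close> there remains a function with vanishing weak vertical derivative, and such a function depends
  only on the first variable.
\<close>
lemma rectangle_representation:
  assumes rs: "r < s" and Q: "Q = {p<..<q} \<times> {r<..<s}"
    and u: "integrable lborel u" and g: "integrable lborel g" "\<And>z. z \<notin> Q \<Longrightarrow> g z = 0"
    and wd: "weak_deriv Q (0, 1) u g"
  obtains v where "integrable lborel v" "AE z in lborel. z \<in> Q \<longrightarrow> u z = v (fst z) + vprim g z"
proof -
  have [measurable]: "u \<in> borel_measurable borel" "g \<in> borel_measurable borel" using u g by auto
  have Qm [measurable]: "Q \<in> sets borel"
    unfolding Q by (intro borel_open open_Times) auto
  define P where "P z = indicator Q z * vprim g z" for z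
  have [measurable]: "P \<in> borel_measurable borel" unfolding P_def by measurable
  have Pint: "integrable lborel P"
  proof (rule Bochner_Integration.integrable_bound)
    show "integrable lborel (\<lambda>z. (LINT t|lborel. \<bar>g (fst z, t)\<bar>) * indicator {r<..<s} (snd z))"
    proof (rule integrable_tensor)
      have "integrable lborel (\<lambda>z. \<bar>g z\<bar>)" using g by simp
      from lborel2_integrable_fst[OF this] show "integrable lborel (\<lambda>x. LINT t|lborel. \<bar>g (x, t)\<bar>)" .
    qed simp
    have "AE z in (lborel :: (real \<times> real) measure). integrable lborel (\<lambda>y. g (fst z, y))"
      using AE_lborel2_fst[OF lborel2_AE_integrable_fst[OF g(1)]] .
    then show "AE z in lborel. norm (P z) \<le> norm ((LINT t|lborel. \<bar>g (fst z, t)\<bar>) * indicator {r<..<s} (snd z))"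
    proof eventually_elim
      case (elim z)
      show ?case using vprim_bound[OF elim, of "snd z"]
        by (auto simp: P_def Q indicator_def)
    qed
  qed measurable
  define W where "W z = indicator Q z * u z - P z" for z
  have Wint: "integrable lborel W"
    unfolding W_def using u Pint integrable_mult_indicator[of Q lborel u] by simp
  have [measurable]: "W \<in> borel_measurable borel" unfolding W_def by measurable
  have W0: "W z = 0" if "z \<notin> Q" for z using that by (simp add: W_def P_def)
  have bounded: "integrable lborel (\<lambda>z. f z * b z)"
    if "integrable lborel f" "b \<in> borel_measurable borel" "\<And>z. \<bar>b z\<bar> \<le> B" for f b :: "real \<times> real \<Rightarrow> real" and B
  proof (rule Bochner_Integration.integrable_bound)
    show "integrable lborel (\<lambda>z. B * f z)" using that by simp
    show "(\<lambda>z. f z * b z) \<in> borel_measurable lborel"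
      using that borel_measurable_integrable[OF that(1)] by simp
    show "AE z in lborel. norm (f z * b z) \<le> norm (B * f z)"
    proof (rule AE_I2)
      fix z
      have "\<bar>b z\<bar> \<le> \<bar>B\<bar>" using that(3)[of z] by linarith
      then show "norm (f z * b z) \<le> norm (B * f z)"
        using mult_right_mono[of "\<bar>b z\<bar>" "\<bar>B\<bar>" "\<bar>f z\<bar>"] by (simp add: abs_mult mult.commute)
    qed
  qed
  \<comment> \<open>The difference \<open>W\<close> has vanishing weak vertical derivative.\<close>
  have key: "(LINT z|lborel. W z * (\<psi> z \<bullet> (0, 1))) = 0" if tf: "test_function Q \<phi> \<psi>" for \<phi> \<psi>
  proof -
    obtain B where B: "B > 0" "\<And>z. norm (\<psi> z) \<le> B" using test_function_bounded[OF tf] by metis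
    obtain K where K: "K \<subseteq> Q" "\<And>z. z \<notin> K \<Longrightarrow> \<psi> z = 0" using test_functionE[OF tf] by metis
    have \<psi>Q: "\<psi> z = 0" if "z \<notin> Q" for z using K that by blast
    note [measurable] = test_function_measurable[OF tf]
    have b2: "\<bar>\<psi> z \<bullet> (0, 1)\<bar> \<le> B" for z
      using Cauchy_Schwarz_ineq2[of "\<psi> z" "(0, 1)"] B(2)[of z] by simp
    have iu: "integrable lborel (\<lambda>z. u z * (\<psi> z \<bullet> (0, 1)))"
      by (rule bounded[OF u _ b2]) measurable
    have iP: "integrable lborel (\<lambda>z. P z * (\<psi> z \<bullet> (0, 1)))"
      by (rule bounded[OF Pint _ b2]) measurable
    have PQ: "P z * (\<psi> z \<bullet> (0, 1)) = vprim g z * (\<psi> z \<bullet> (0, 1))" for z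
      using \<psi>Q[of z] by (cases "z \<in> Q") (auto simp: P_def)
    have "W z * (\<psi> z \<bullet> (0, 1)) = u z * (\<psi> z \<bullet> (0, 1)) - P z * (\<psi> z \<bullet> (0, 1))" for z
      using \<psi>Q[of z] by (cases "z \<in> Q") (auto simp: W_def algebra_simps)
    then have "(LINT z|lborel. W z * (\<psi> z \<bullet> (0, 1)))
        = (LINT z|lborel. u z * (\<psi> z \<bullet> (0, 1))) - (LINT z|lborel. P z * (\<psi> z \<bullet> (0, 1)))"
      using iu iP by simp
    also have "(LINT z|lborel. P z * (\<psi> z \<bullet> (0, 1))) = - (LINT z|lborel. g z * \<phi> z)"
      using vprim_by_parts[OF tf g(1)] iP unfolding PQ by simp
    also have "(LINT z|lborel. u z * (\<psi> z \<bullet> (0, 1))) = - (LINT z|lborel. g z * \<phi> z)"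
      using wd tf unfolding weak_deriv_def by simp
    finally show ?thesis by simp
  qed
  obtain m where m: "(LINT t|lborel. bump m r s t) > 0" using bump_integral_pos[OF rs] .
  define m0 where "m0 = (LINT t|lborel. bump m r s t)"
  have m0: "m0 > 0" using m m0_def by simp
  \<comment> \<open>A weighted mean of \<open>W\<close> over the vertical line; \<open>W\<close> will turn out to equal it.\<close>
  define v where "v x = (LINT y|lborel. W (x, y) * bump m r s y) / m0" for x
  have babs: "\<bar>bump n a b t\<bar> \<le> 1" for n a b t using bump_bounds by simp
  have Wbump: "integrable lborel (\<lambda>z. W z * bump n r' s' (snd z))" for n r' s'
    by (rule bounded[OF Wint _ babs]) measurable
  have vint: "integrable lborel v"
    unfolding v_def using lborel2_integrable_fst[OF Wbump] by simp
  then have [measurable]: "v \<in> borel_measurable borel" by auto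
  have vtensor: "integrable lborel (\<lambda>z. v (fst z) * b (snd z))" if "integrable lborel b" for b :: "real \<Rightarrow> real"
    using integrable_tensor[OF vint that] .
  have "AE z in lborel. W z - indicator Q z * v (fst z) = 0"
  proof (rule AE_zero_if_bump_integrals_zero)
    have eqQ: "indicator Q z * v (fst z) = indicator {p<..<q} (fst z) * (v (fst z) * indicator {r<..<s} (snd z))" for z
      by (cases z) (auto simp: Q indicator_def)
    moreover have "integrable lborel (\<lambda>z. indicator {p<..<q} (fst z) * (v (fst z) * indicator {r<..<s} (snd z)))"
      using bounded[OF vtensor, of "indicator {r<..<s}" "\<lambda>z. indicator {p<..<q} (fst z)" 1]
      by (simp add: mult.commute)
    ultimately show "integrable lborel (\<lambda>z. W z - indicator Q z * v (fst z))"
      unfolding eqQ using Bochner_Integration.integrable_diff[OF Wint] by blast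
    show "W z - indicator Q z * v (fst z) = 0" if "z \<notin> {p<..<q} \<times> {r<..<s}" for z
      using that W0 Q by simp
    fix n p' q' r' s' assume le: "p \<le> p'" "q' \<le> q" "r \<le> r'" "s' \<le> s"
    define c where "c = (LINT t|lborel. bump n r' s' t) / m0"
    \<comment> \<open>Subtracting a multiple of the weight makes the integral zero, so that the primitive \<open>b\<close> of \<open>\<sigma>\<close> has
      compact support and can be used in a test function.\<close>
    define \<sigma> where "\<sigma> t = bump n r' s' t - c * bump m r s t" for t
    have \<sigma>int: "integrable lborel \<sigma>" "(LINT t|lborel. \<sigma> t) = 0"
      unfolding \<sigma>_def using integrable_bump m0 by (auto simp: c_def m0_def)
    have [measurable]: "\<sigma> \<in> borel_measurable borel" unfolding \<sigma>_def by measurable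
    have \<sigma>cont: "continuous_on UNIV \<sigma>"
      unfolding \<sigma>_def by (intro continuous_intros continuous_bump)
    define \<delta> where "\<delta> = min (1 / real (Suc n)) (1 / real (Suc m))"
    have \<delta>: "\<delta> > 0" "\<delta> \<le> 1 / real (Suc n)" "\<delta> \<le> 1 / real (Suc m)" by (auto simp: \<delta>_def)
    have \<sigma>0: "\<sigma> t = 0" if "t \<notin> {r + \<delta>..s - \<delta>}" for t
    proof -
      have "bump n r' s' t = 0" "bump m r s t = 0"
        by (rule bump_outside; use that le \<delta> in \<open>unfold atLeastAtMost_iff; linarith\<close>)+
      then show ?thesis by (simp add: \<sigma>_def)
    qed
    obtain F where F: "\<And>x. (F has_real_derivative \<sigma> x) (at x)" using antiderivative_on_line[OF \<sigma>cont] by blast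
    define b where "b y = F y - F r" for y
    have bder: "(b has_real_derivative \<sigma> y) (at y)" for y
      unfolding b_def using F by (auto intro!: derivative_eq_intros)
    have FTC: "(LINT t|lborel. \<sigma> t * indicator {x..y} t) = b y - b x" if "x \<le> y" for x y
      using integral_FTC_Icc_real[OF that bder] \<sigma>cont by (simp add: continuous_on_eq_continuous_at)
    have br: "b r = 0" by (simp add: b_def)
    have b0: "b y = 0" if y: "y \<notin> {r + \<delta>..s - \<delta>}" for y
    proof -
      consider "y < r" | "r \<le> y" "y < r + \<delta>" | "y > s - \<delta>" "r \<le> y" using y by fastforce
      then show ?thesis
      proof cases
        case 1
        have "(\<lambda>t. \<sigma> t * indicator {y..r} t) = (\<lambda>t. 0)"
          using \<sigma>0 \<delta>(1) by (auto simp: fun_eq_iff indicator_def)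
        then show ?thesis using FTC[of y r] 1 br by simp
      next
        case 2
        have "(\<lambda>t. \<sigma> t * indicator {r..y} t) = (\<lambda>t. 0)"
          using \<sigma>0 2 by (auto simp: fun_eq_iff indicator_def)
        then show ?thesis using FTC[of r y] 2 br by simp
      next
        case 3
        have "(\<lambda>t. \<sigma> t * indicator {r..y} t) = \<sigma>"
        proof
          fix t
          have "t \<notin> {r..y} \<Longrightarrow> t \<notin> {r + \<delta>..s - \<delta>}"
            using 3 \<delta>(1) unfolding atLeastAtMost_iff by linarith
          then show "\<sigma> t * indicator {r..y} t = \<sigma> t" using \<sigma>0[of t] by (cases "t \<in> {r..y}") auto
        qed
        then show ?thesis using FTC[of r y] 3 br \<sigma>int(2) by simp
      qed
    qed
    have pos: "1 / real (Suc n) > 0" by simp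
    have tf: "test_function Q (\<lambda>z. bump n p' q' (fst z) * b (snd z))
        (\<lambda>z. (bump' n p' q' (fst z) * b (snd z), bump n p' q' (fst z) * \<sigma> (snd z)))"
    proof (rule test_function_product[where p'="p' + 1 / real (Suc n)" and q'="q' - 1 / real (Suc n)"
          and r'="r + \<delta>" and s'="s - \<delta>"])
      show "{p' + 1 / real (Suc n)..q' - 1 / real (Suc n)} \<times> {r + \<delta>..s - \<delta>} \<subseteq> Q"
        unfolding Q
      proof (intro Sigma_mono subsetI)
        show "t \<in> {p<..<q}" if "t \<in> {p' + 1 / real (Suc n)..q' - 1 / real (Suc n)}" for t
          using that le pos unfolding atLeastAtMost_iff greaterThanLessThan_iff by linarith
        show "t \<in> {r<..<s}" if "t \<in> {r + \<delta>..s - \<delta>}" for t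
          using that \<delta>(1) unfolding atLeastAtMost_iff greaterThanLessThan_iff by linarith
      qed
    qed (fact bump_deriv continuous_bump \<sigma>cont bder | erule bump_outside | erule b0)+
    have "(LINT z|lborel. W z * (bump n p' q' (fst z) * \<sigma> (snd z))) = 0"
      using key[OF tf] by (simp add: inner_prod_def)
    moreover define A where "A z = W z * bump n p' q' (fst z)" for z
    have Aint: "integrable lborel A"
      unfolding A_def by (rule bounded[OF Wint _ babs]) measurable
    have [measurable]: "A \<in> borel_measurable borel" unfolding A_def by measurable
    have A1: "integrable lborel (\<lambda>z. A z * bump n r' s' (snd z))"
      by (rule bounded[OF Aint _ babs]) measurable
    have A2: "integrable lborel (\<lambda>z. A z * bump m r s (snd z))"
      by (rule bounded[OF Aint _ babs]) measurable
    moreover have "(\<lambda>z. W z * (bump n p' q' (fst z) * \<sigma> (snd z)))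
        = (\<lambda>z. A z * bump n r' s' (snd z) - c * (A z * bump m r s (snd z)))"
      by (auto simp: A_def \<sigma>_def fun_eq_iff algebra_simps)
    ultimately have eq: "(LINT z|lborel. A z * bump n r' s' (snd z)) = c * (LINT z|lborel. A z * bump m r s (snd z))"
      using A1 A2 by simp
    have "(LINT z|lborel. A z * bump m r s (snd z))
        = (LINT x|lborel. LINT y|lborel. A (x, y) * bump m r s y)"
      using lborel2_integral_fst[OF A2] by simp
    also have "\<dots> = (LINT x|lborel. m0 * (v x * bump n p' q' x))"
    proof (rule Bochner_Integration.integral_cong[OF refl])
      fix x
      have "(LINT y|lborel. A (x, y) * bump m r s y) = (LINT y|lborel. bump n p' q' x * (W (x, y) * bump m r s y))"
        by (rule Bochner_Integration.integral_cong) (auto simp: A_def)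
      also have "\<dots> = bump n p' q' x * (m0 * v x)" using m0 by (simp add: v_def)
      finally show "(LINT y|lborel. A (x, y) * bump m r s y) = m0 * (v x * bump n p' q' x)" by simp
    qed
    finally have e2: "(LINT z|lborel. A z * bump m r s (snd z)) = m0 * (LINT x|lborel. v x * bump n p' q' x)"
      by simp
    have vb: "integrable lborel (\<lambda>x. v x * bump n p' q' x)"
    proof (rule Bochner_Integration.integrable_bound[OF vint])
      show "AE x in lborel. norm (v x * bump n p' q' x) \<le> norm (v x)"
        using babs by (intro AE_I2) (simp add: abs_mult mult_left_le)
    qed measurable
    have T: "integrable lborel (\<lambda>z. (v (fst z) * bump n p' q' (fst z)) * bump n r' s' (snd z))"
      by (rule integrable_tensor[OF vb integrable_bump])
    have "(LINT z|lborel. (v (fst z) * bump n p' q' (fst z)) * bump n r' s' (snd z))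
        = (LINT x|lborel. (v x * bump n p' q' x) * (LINT t|lborel. bump n r' s' t))"
      using lborel2_integral_fst[OF T] by simp
    also have "\<dots> = (LINT x|lborel. v x * bump n p' q' x) * (c * m0)"
      using m0 by (simp add: c_def)
    finally have e3: "(LINT z|lborel. (v (fst z) * bump n p' q' (fst z)) * bump n r' s' (snd z))
        = (LINT z|lborel. A z * bump n r' s' (snd z))" using eq e2 by simp
    have "(\<lambda>z. (W z - indicator Q z * v (fst z)) * (bump n p' q' (fst z) * bump n r' s' (snd z)))
        = (\<lambda>z. A z * bump n r' s' (snd z) - (v (fst z) * bump n p' q' (fst z)) * bump n r' s' (snd z))"
    proof
      fix z
      show "(W z - indicator Q z * v (fst z)) * (bump n p' q' (fst z) * bump n r' s' (snd z))
        = A z * bump n r' s' (snd z) - (v (fst z) * bump n p' q' (fst z)) * bump n r' s' (snd z)"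
      proof (cases "z \<in> Q")
        case True
        then show ?thesis by (simp add: A_def algebra_simps)
      next
        case False
        then have "fst z \<notin> {p'<..<q'} \<or> snd z \<notin> {r'<..<s'}" using le by (auto simp: Q mem_Times_iff)
        then have "bump n p' q' (fst z) * bump n r' s' (snd z) = 0" using bump_zero by auto
        then show ?thesis by (simp add: A_def) (auto)
      qed
    qed
    then show "(LINT z|lborel. (W z - indicator Q z * v (fst z)) * (bump n p' q' (fst z) * bump n r' s' (snd z))) = 0"
      using A1 T e3 by simp
  qed
  then have "AE z in lborel. z \<in> Q \<longrightarrow> u z = v (fst z) + vprim g z"
  proof eventually_elim
    case (elim z)
    then show ?case by (auto simp: W_def P_def)
  qed
  with vint show ?thesis by (rule that)
qed

section \<open>Traces on the bottom edge\<close>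

text \<open>
  The trace condition uses half discs; half squares contain and are contained in them up to a factor
  in the radius, and suit Fubini's theorem better.
\<close>
definition half_square :: "real \<Rightarrow> real \<Rightarrow> (real \<times> real) set" where
  "half_square a r = {a - r<..<a + r} \<times> {0<..<r}"

lemma half_square_sets [measurable]: "half_square a r \<in> sets borel"
  unfolding half_square_def by (intro borel_open open_Times) auto

lemma emeasure_lborel_rect:
  fixes a b c d :: real
  assumes "a \<le> b" "c \<le> d"
  shows "emeasure lborel ({a<..<b} \<times> {c<..<d}) = ennreal ((b - a) * (d - c))"
proof -
  have "emeasure (lborel \<Otimes>\<^sub>M lborel) ({a<..<b} \<times> {c<..<d}) = ennreal ((b - a) * (d - c))"
    using assms by (subst lborel.emeasure_pair_measure_Times) (auto simp: ennreal_mult)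
  then show ?thesis by (simp add: lborel_prod)
qed

lemma emeasure_half_square: "0 \<le> r \<Longrightarrow> emeasure lborel (half_square a r) = ennreal (2 * r\<^sup>2)"
  unfolding half_square_def by (subst emeasure_lborel_rect) (auto simp: power2_eq_square algebra_simps)

lemma ennreal_vprim_le:
  assumes [measurable]: "g \<in> borel_measurable borel"
  shows "ennreal \<bar>vprim g (x, y)\<bar> \<le> (\<integral>\<^sup>+t. indicator {..<y} t * ennreal \<bar>g (x, t)\<bar> \<partial>lborel)"
proof (cases "integrable lborel (\<lambda>t. indicator {..<y} t * g (x, t))")
  case True
  have "ennreal (norm (LINT t|lborel. indicator {..<y} t * g (x, t)))
      \<le> (\<integral>\<^sup>+t. ennreal (norm (indicator {..<y} t * g (x, t))) \<partial>lborel)"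
    by (rule integral_norm_bound_ennreal[OF True])
  also have "\<dots> = (\<integral>\<^sup>+t. indicator {..<y} t * ennreal \<bar>g (x, t)\<bar> \<partial>lborel)"
    by (rule nn_integral_cong) (auto simp: indicator_def)
  finally show ?thesis by (simp add: vprim_def)
next
  case False
  then show ?thesis by (simp add: vprim_def not_integrable_integral_eq)
qed

text \<open>
  On every vertical line of the half square the primitive is at most the integral of \<open>g\<close> over that
  line, and the line has length \<open>r\<close>.
\<close>
lemma nn_integral_vprim_half_square:
  assumes [measurable]: "g \<in> borel_measurable borel" and g0: "\<forall>z. snd z \<le> 0 \<longrightarrow> g z = 0" and "0 \<le> r"
  shows "(\<integral>\<^sup>+z. indicator (half_square a r) z * ennreal \<bar>vprim g z\<bar> \<partial>lborel)
    \<le> ennreal r * (\<integral>\<^sup>+z. indicator (half_square a r) z * ennreal \<bar>g z\<bar> \<partial>lborel)"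
proof -
  define H where "H x = (\<integral>\<^sup>+t. indicator {0<..<r} t * ennreal \<bar>g (x, t)\<bar> \<partial>lborel)" for x
  have [measurable]: "H \<in> borel_measurable borel"
  proof -
    have "(\<lambda>(x, t). indicator {0<..<r} t * ennreal \<bar>g (x, t)\<bar>) \<in> borel_measurable (lborel \<Otimes>\<^sub>M lborel)"
      by (simp add: lborel_prod case_prod_unfold)
    from lborel.borel_measurable_nn_integral_fst[OF this] show ?thesis unfolding H_def by simp
  qed
  have ind: "indicator (half_square a r) (x, y) = (indicator {a - r<..<a + r} x * indicator {0<..<r} y :: ennreal)"
    for x y by (auto simp: half_square_def indicator_def)
  have le: "indicator (half_square a r) (x, y) * ennreal \<bar>vprim g (x, y)\<bar>
      \<le> indicator {a - r<..<a + r} x * H x * indicator {0<..<r} y" for x y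
  proof -
    have "ennreal \<bar>vprim g (x, y)\<bar> \<le> H x" if "y \<in> {0<..<r}"
    proof -
      have "ennreal \<bar>vprim g (x, y)\<bar> \<le> (\<integral>\<^sup>+t. indicator {..<y} t * ennreal \<bar>g (x, t)\<bar> \<partial>lborel)"
        by (rule ennreal_vprim_le) measurable
      also have "\<dots> \<le> H x"
        unfolding H_def
      proof (rule nn_integral_mono)
        fix t show "indicator {..<y} t * ennreal \<bar>g (x, t)\<bar> \<le> indicator {0<..<r} t * ennreal \<bar>g (x, t)\<bar>"
          using that g0[rule_format, of "(x, t)"] by (auto simp: indicator_def)
      qed
      finally show ?thesis .
    qed
    then show ?thesis unfolding ind by (auto simp: indicator_def)
  qed
  have "(\<integral>\<^sup>+z. indicator (half_square a r) z * ennreal \<bar>vprim g z\<bar> \<partial>lborel)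
      = (\<integral>\<^sup>+x. \<integral>\<^sup>+y. indicator (half_square a r) (x, y) * ennreal \<bar>vprim g (x, y)\<bar> \<partial>lborel \<partial>lborel)"
    by (rule lborel2_nn_integral_fst) measurable
  also have "\<dots> \<le> (\<integral>\<^sup>+x. \<integral>\<^sup>+y. indicator {a - r<..<a + r} x * H x * indicator {0<..<r} y \<partial>lborel \<partial>lborel)"
    by (intro nn_integral_mono le)
  also have "\<dots> = (\<integral>\<^sup>+x. ennreal r * (indicator {a - r<..<a + r} x * H x) \<partial>lborel)"
  proof (rule nn_integral_cong)
    fix x
    have "(\<integral>\<^sup>+y. indicator {a - r<..<a + r} x * H x * indicator {0<..<r} y \<partial>lborel)
        = indicator {a - r<..<a + r} x * H x * (\<integral>\<^sup>+y. indicator {0<..<r} y \<partial>lborel)"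
      by (rule nn_integral_cmult) measurable
    then show "(\<integral>\<^sup>+y. indicator {a - r<..<a + r} x * H x * indicator {0<..<r} y \<partial>lborel)
        = ennreal r * (indicator {a - r<..<a + r} x * H x)"
      using \<open>0 \<le> r\<close> by (simp add: mult.commute)
  qed
  also have "\<dots> = ennreal r * (\<integral>\<^sup>+x. indicator {a - r<..<a + r} x * H x \<partial>lborel)"
    by (rule nn_integral_cmult) measurable
  also have "(\<integral>\<^sup>+x. indicator {a - r<..<a + r} x * H x \<partial>lborel)
      = (\<integral>\<^sup>+x. \<integral>\<^sup>+y. indicator (half_square a r) (x, y) * ennreal \<bar>g (x, y)\<bar> \<partial>lborel \<partial>lborel)"
  proof (rule nn_integral_cong)
    fix x
    have "(\<integral>\<^sup>+y. indicator (half_square a r) (x, y) * ennreal \<bar>g (x, y)\<bar> \<partial>lborel)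
        = (\<integral>\<^sup>+y. indicator {a - r<..<a + r} x * (indicator {0<..<r} y * ennreal \<bar>g (x, y)\<bar>) \<partial>lborel)"
      by (simp add: ind mult.assoc)
    also have "\<dots> = indicator {a - r<..<a + r} x * H x"
      unfolding H_def by (rule nn_integral_cmult) measurable
    finally show "indicator {a - r<..<a + r} x * H x
        = (\<integral>\<^sup>+y. indicator (half_square a r) (x, y) * ennreal \<bar>g (x, y)\<bar> \<partial>lborel)" by simp
  qed
  also have "\<dots> = (\<integral>\<^sup>+z. indicator (half_square a r) z * ennreal \<bar>g z\<bar> \<partial>lborel)"
    by (rule lborel2_nn_integral_fst[symmetric]) measurable
  finally show ?thesis .
qed

text \<open>
  By the Cauchy-Schwarz inequality the quotient is at most a constant times the \<open>L\<^sup>2\<close> norm of \<open>g\<close> on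
  the half square, as the area is \<open>2 r\<^sup>2\<close>. That norm tends to zero.
\<close>
lemma half_square_mean_tendsto_0:
  assumes g: "L2 g"
  shows "((\<lambda>r. (LINT z|lborel. indicator (half_square a r) z * \<bar>g z\<bar>) / r) \<longlongrightarrow> 0) (at_right 0)"
proof -
  define X where "X r = (LINT z|lborel. indicator (half_square a r) z * \<bar>g z\<bar>)" for r
  define Y where "Y r = (LINT z|lborel. (indicator (half_square a r) z * g z)\<^sup>2)" for r
  note [measurable] = L2_measurable[OF g]
  have Y0: "(Y \<longlongrightarrow> 0) (at_right 0)"
    unfolding tendsto_at_iff_sequentially comp_def
  proof (intro allI impI)
    fix R :: "nat \<Rightarrow> real" assume R: "\<forall>i. R i \<in> {0<..} - {0}" "R \<longlonglongrightarrow> 0"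
    have "(\<lambda>n. Y (R n)) \<longlonglongrightarrow> (LINT z|(lborel :: (real \<times> real) measure). (0::real))"
      unfolding Y_def
    proof (rule integral_dominated_convergence[where w="\<lambda>z. (g z)\<^sup>2" and f="\<lambda>_. 0" and s="\<lambda>n z. (indicator (half_square a (R n)) z * g z)\<^sup>2"])
      show "AE z in lborel. (\<lambda>n. (indicator (half_square a (R n)) z * g z)\<^sup>2) \<longlonglongrightarrow> 0"
      proof (rule AE_I2)
        fix z :: "real \<times> real"
        have "\<forall>\<^sub>F n in sequentially. z \<notin> half_square a (R n)"
        proof (cases "snd z > 0")
          case True
          from order_tendstoD(2)[OF R(2) this] show ?thesis
            by eventually_elim (auto simp: half_square_def)
        next
          case False then show ?thesis by (intro always_eventually) (auto simp: half_square_def)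
        qed
        then have "\<forall>\<^sub>F n in sequentially. (indicator (half_square a (R n)) z * g z)\<^sup>2 = 0"
          by eventually_elim simp
        then show "(\<lambda>n. (indicator (half_square a (R n)) z * g z)\<^sup>2) \<longlonglongrightarrow> 0" by (rule tendsto_eventually)
      qed
      show "AE z in lborel. norm ((indicator (half_square a (R n)) z * g z)\<^sup>2) \<le> (g z)\<^sup>2" for n
        by (auto simp: indicator_def)
      show "integrable lborel (\<lambda>z. (g z)\<^sup>2)" by (rule L2_square[OF g])
    qed measurable
    then show "(\<lambda>n. Y (R n)) \<longlonglongrightarrow> 0" by simp
  qed
  have bound: "(X r / r)\<^sup>2 \<le> 2 * Y r" if "r > 0" for r
  proof -
    have fin: "emeasure lborel (half_square a r) < \<infinity>" using emeasure_half_square[of r a] that by simp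
    have L: "L2 (indicator (half_square a r))" using fin by (intro L2_indicator) auto
    have Lg: "L2 (\<lambda>z. indicator (half_square a r) z * \<bar>g z\<bar>)"
      by (rule L2_bound[OF _ g]) (auto simp: indicator_def)
    have "(LINT z|lborel. indicator (half_square a r) z * (indicator (half_square a r) z * \<bar>g z\<bar>))\<^sup>2
      \<le> (LINT z|lborel. (indicator (half_square a r) z :: real)\<^sup>2) * (LINT z|lborel. (indicator (half_square a r) z * \<bar>g z\<bar>)\<^sup>2)"
      by (rule Cauchy_Schwarz_L2[OF L Lg])
    also have "(\<lambda>z. indicator (half_square a r) z * (indicator (half_square a r) z * \<bar>g z\<bar>))
        = (\<lambda>z. indicator (half_square a r) z * \<bar>g z\<bar>)" by (auto simp: indicator_def)
    also have "(\<lambda>z. (indicator (half_square a r) z :: real)\<^sup>2) = indicator (half_square a r)"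
      by (auto simp: indicator_def)
    also have "(LINT z|lborel. indicator (half_square a r) z) = 2 * r\<^sup>2"
      using emeasure_half_square[of r a] that by (simp add: measure_def)
    also have "(\<lambda>z. (indicator (half_square a r) z * \<bar>g z\<bar>)\<^sup>2) = (\<lambda>z. (indicator (half_square a r) z * g z)\<^sup>2)"
      by (auto simp: indicator_def)
    finally have "(X r)\<^sup>2 \<le> 2 * r\<^sup>2 * Y r" by (simp add: X_def Y_def)
    then show ?thesis using that by (simp add: power_divide field_simps)
  qed
  have "((\<lambda>r. (X r / r)\<^sup>2) \<longlongrightarrow> 0) (at_right 0)"
  proof (rule Lim_null_comparison)
    show "((\<lambda>r. 2 * Y r) \<longlongrightarrow> 0) (at_right 0)" using tendsto_mult_right_zero[OF Y0] by simp
    show "\<forall>\<^sub>F r in at_right 0. norm ((X r / r)\<^sup>2) \<le> 2 * Y r"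
      using eventually_at_right_less[of 0] by eventually_elim (use bound in simp)
  qed
  then show ?thesis by (simp add: X_def)
qed

lemma integral_vprim_half_square:
  assumes g: "L2 g" and g0: "\<forall>z. snd z \<le> 0 \<longrightarrow> g z = 0" and r: "0 \<le> r"
  shows "integrable lborel (\<lambda>z. indicator (half_square a r) z * \<bar>vprim g z\<bar>)"
    "(LINT z|lborel. indicator (half_square a r) z * \<bar>vprim g z\<bar>)
      \<le> r * (LINT z|lborel. indicator (half_square a r) z * \<bar>g z\<bar>)"
proof -
  note [measurable] = L2_measurable[OF g]
  have fin: "emeasure lborel (half_square a r) < \<infinity>" using emeasure_half_square[OF r, of a] by simp
  have Lg: "L2 (\<lambda>z. \<bar>g z\<bar>)" by (rule L2_bound[OF _ g]) auto
  have ig: "integrable lborel (\<lambda>z. indicator (half_square a r) z * \<bar>g z\<bar>)"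
    by (rule L2_integrable_on[OF Lg]) (use fin in auto)
  define J where "J = (LINT z|lborel. indicator (half_square a r) z * \<bar>g z\<bar>)"
  have J: "J \<ge> 0" unfolding J_def by (intro Bochner_Integration.integral_nonneg) auto
  have "(\<integral>\<^sup>+z. ennreal (indicator (half_square a r) z * \<bar>g z\<bar>) \<partial>lborel) = ennreal J"
    unfolding J_def by (rule nn_integral_eq_integral[OF ig]) auto
  moreover have "ennreal (indicator A z * \<bar>f z\<bar>) = indicator A z * ennreal \<bar>f z\<bar>"
    for A :: "(real \<times> real) set" and f :: "real \<times> real \<Rightarrow> real" and z
    by (simp add: indicator_def)
  ultimately have le: "(\<integral>\<^sup>+z. ennreal (indicator (half_square a r) z * \<bar>vprim g z\<bar>) \<partial>lborel) \<le> ennreal (r * J)"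
    using nn_integral_vprim_half_square[OF _ g0 r, where a=a] r J by (simp add: ennreal_mult)
  show "integrable lborel (\<lambda>z. indicator (half_square a r) z * \<bar>vprim g z\<bar>)"
  proof (rule integrableI_nonneg)
    show "(\<integral>\<^sup>+z. ennreal (indicator (half_square a r) z * \<bar>vprim g z\<bar>) \<partial>lborel) < \<infinity>"
      using le by (rule order.strict_trans1) simp
  qed auto
  show "(LINT z|lborel. indicator (half_square a r) z * \<bar>vprim g z\<bar>) \<le> r * J"
    by (rule integral_real_bounded[OF _ le]) (use r J in simp)
qed

text \<open>
  Near \<open>(a, 0)\<close> the first coordinate differs from \<open>a\<close> by at most \<open>r\<close>, and the primitive contributes
  \<open>r\<close> times the integral of \<open>g\<close> over the half square, which is of smaller order than \<open>r\<^sup>2\<close>.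
\<close>
lemma trace_at_if_representation:
  assumes S: "S \<in> sets borel" "\<And>x y. (x, y) \<in> S \<Longrightarrow> 0 < y"
    and u: "u \<in> borel_measurable borel"
    and g: "L2 g" and g0: "\<forall>z. snd z \<le> 0 \<longrightarrow> g z = 0"
    and rep: "AE z in lborel. z \<in> S \<longrightarrow> u z = fst z + vprim g z"
  shows "trace_at S u (a, 0) a"
proof -
  define J where "J r = (LINT z|lborel. indicator (half_square a r) z * \<bar>g z\<bar>)" for r
  have sub: "S \<inter> ball (a, 0) r \<subseteq> half_square a r" for r
  proof
    fix z assume z: "z \<in> S \<inter> ball (a, 0) r"
    have "\<bar>fst z - a\<bar> \<le> norm (z - (a, 0))" "\<bar>snd z\<bar> \<le> norm (z - (a, 0))"
      using norm_fst_le[of "fst z - a" "snd z"] norm_snd_le[of "snd z" "fst z - a"] by (cases z; simp)+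
    moreover have "norm (z - (a, 0)) < r" using z by (simp add: dist_norm norm_minus_commute)
    moreover have "snd z > 0" using z S(2)[of "fst z" "snd z"] by simp
    ultimately show "z \<in> half_square a r" by (auto simp: half_square_def mem_Times_iff)
  qed
  note [measurable] = S(1) u L2_measurable[OF g]
  have le: "(LINT z:(S \<inter> ball (a, 0) r)|lborel. \<bar>u z - a\<bar>) \<le> 2 * r ^ 3 + r * J r" if r: "r > 0" for r
  proof -
    have fin: "integrable lborel (indicator (half_square a r) :: _ \<Rightarrow> real)"
      using emeasure_half_square[of r a] r by (intro integrable_real_indicator) auto
    note V = integral_vprim_half_square[OF g g0, where r=r and a=a]
    have int: "integrable lborel (\<lambda>z. r * indicator (half_square a r) z + indicator (half_square a r) z * \<bar>vprim g z\<bar>)"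
      using fin V(1) r by simp
    have "(LINT z:(S \<inter> ball (a, 0) r)|lborel. \<bar>u z - a\<bar>)
        \<le> (LINT z|lborel. r * indicator (half_square a r) z + indicator (half_square a r) z * \<bar>vprim g z\<bar>)"
      unfolding set_lebesgue_integral_def
    proof (rule integral_mono_AE')
      show "AE z in lborel. indicator (S \<inter> ball (a, 0) r) z *\<^sub>R \<bar>u z - a\<bar>
          \<le> r * indicator (half_square a r) z + indicator (half_square a r) z * \<bar>vprim g z\<bar>"
        using rep
      proof eventually_elim
        case (elim z)
        show ?case
        proof (cases "z \<in> S \<inter> ball (a, 0) r")
          case True
          then have "z \<in> half_square a r" using sub by blast
          moreover from this have "\<bar>fst z - a\<bar> \<le> r" by (auto simp: half_square_def mem_Times_iff)
          moreover have "u z = fst z + vprim g z" using elim True by simp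
          ultimately show ?thesis using True by simp
        next
          case False
          have "0 \<le> r * indicator (half_square a r) z + indicator (half_square a r) z * \<bar>vprim g z\<bar>"
            using r by simp
          then show ?thesis using False by simp
        qed
      qed
      show "AE z in lborel. 0 \<le> r * indicator (half_square a r) z + indicator (half_square a r) z * \<bar>vprim g z\<bar>"
        using r by simp
    qed (rule int)
    also have "\<dots> = r * (LINT z|lborel. indicator (half_square a r) z)
        + (LINT z|lborel. indicator (half_square a r) z * \<bar>vprim g z\<bar>)"
      using fin V(1) r by simp
    also have "(LINT z|lborel. indicator (half_square a r) z) = 2 * r\<^sup>2"
      using emeasure_half_square[of r a] r by (simp add: measure_def)
    also have "(LINT z|lborel. indicator (half_square a r) z * \<bar>vprim g z\<bar>) \<le> r * J r"
      using V(2) r by (simp add: J_def)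
    finally show ?thesis by (simp add: power3_eq_cube power2_eq_square)
  qed
  show ?thesis unfolding trace_at_def
  proof (rule Lim_null_comparison)
    have "((\<lambda>r. 2 * r + J r / r) \<longlongrightarrow> 2 * 0 + 0) (at_right 0)"
      unfolding J_def by (intro tendsto_intros half_square_mean_tendsto_0 g)
    then show "((\<lambda>r. 2 * r + J r / r) \<longlongrightarrow> 0) (at_right 0)" by simp
    show "\<forall>\<^sub>F r in at_right 0. norm ((LINT z:(S \<inter> ball (a, 0) r)|lborel. \<bar>u z - a\<bar>) / r\<^sup>2) \<le> 2 * r + J r / r"
      using eventually_at_right_less[of 0]
    proof eventually_elim
      case (elim r)
      have nn: "(LINT z:(S \<inter> ball (a, 0) r)|lborel. \<bar>u z - a\<bar>) \<ge> 0"
        unfolding set_lebesgue_integral_def by (intro Bochner_Integration.integral_nonneg) auto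
      have "(LINT z:(S \<inter> ball (a, 0) r)|lborel. \<bar>u z - a\<bar>) / r\<^sup>2 \<le> (2 * r ^ 3 + r * J r) / r\<^sup>2"
        using le[OF elim] by (intro divide_right_mono) auto
      also have "\<dots> = 2 * r + J r / r" using elim by (simp add: field_simps power2_eq_square power3_eq_cube)
      finally show ?case using nn by simp
    qed
  qed
qed

text \<open>
  By Vitali's covering theorem a function whose means over small intervals tend to zero almost
  everywhere integrates to at most \<open>\<eta>\<close> times the length, for every \<open>\<eta> > 0\<close>.
\<close>
lemma AE_zero_if_means_tendsto_0:
  fixes d :: "real \<Rightarrow> real"
  assumes [measurable]: "d \<in> borel_measurable borel" and d0: "\<And>x. 0 \<le> d x"
    and int: "integrable lborel d"
    and means: "AE x in lborel. x \<in> {p<..<q} \<longrightarrow>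
      ((\<lambda>r. (LINT t|lborel. indicator {x - r..x + r} t * d t) / r) \<longlongrightarrow> 0) (at_right 0)"
  shows "AE x in lborel. x \<in> {p<..<q} \<longrightarrow> d x = 0"
proof -
  define \<mu> where "\<mu> = density lborel (\<lambda>x. ennreal (d x))"
  have \<mu>: "emeasure \<mu> A = (\<integral>\<^sup>+x. ennreal (d x) * indicator A x \<partial>lborel)" if "A \<in> sets borel" for A
    unfolding \<mu>_def using that by (intro emeasure_density) auto
  define S where "S = {x \<in> {p<..<q}. ((\<lambda>r. (LINT t|lborel. indicator {x - r..x + r} t * d t) / r) \<longlongrightarrow> 0) (at_right 0)}"
  have le: "emeasure \<mu> {p<..<q} \<le> ennreal (\<eta> * (q - p))" if \<eta>: "\<eta> > 0" and pq: "p < q" for \<eta>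
  proof -
    define K where "K = {(x, r). x \<in> S \<and> 0 < r \<and> {x - r..x + r} \<subseteq> {p<..<q} \<and>
      (LINT t|lborel. indicator {x - r..x + r} t * d t) / r \<le> \<eta>}"
    obtain C where C: "countable C" "C \<subseteq> K"
      "pairwise (\<lambda>i j. disjnt (cball (fst i) (snd i)) (cball (fst j) (snd j))) C"
      "negligible (S - (\<Union>i\<in>C. cball (fst i) (snd i)))"
    proof (rule Vitali_covering_theorem_cballs[of K snd S fst])
      show "0 < snd i" if "i \<in> K" for i using that by (auto simp: K_def)
      fix x e :: real assume x: "x \<in> S" and e: "0 < e"
      have ev1: "\<forall>\<^sub>F r in at_right 0. (LINT t|lborel. indicator {x - r..x + r} t * d t) / r < \<eta>"
        using x \<eta> by (intro order_tendstoD(2)[of _ 0]) (auto simp: S_def)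
      have px: "p < x" "x < q" using x by (auto simp: S_def)
      have ev2: "\<forall>\<^sub>F r in at_right 0. r < min e (min (x - p) (q - x))"
        using e px by (intro order_tendstoD(2)[of "\<lambda>r. r" 0]) (auto intro: tendsto_ident_at)
      have "\<forall>\<^sub>F r in at_right 0. (x, r) \<in> K \<and> r < e \<and> 0 < r"
        using ev1 ev2 eventually_at_right_less[of 0]
        by eventually_elim (use x in \<open>auto simp: K_def\<close>)
      then obtain r where "(x, r) \<in> K" "r < e" "0 < r"
        using eventually_happens'[OF trivial_limit_at_right_real] by blast
      then show "\<exists>i. i \<in> K \<and> x \<in> cball (fst i) (snd i) \<and> snd i < e"
        by (intro exI[of _ "(x, r)"]) auto
    qed blast
    define U where "U = (\<Union>i\<in>C. cball (fst i) (snd i))"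
    have disj: "disjoint_family_on (\<lambda>i. cball (fst i) (snd i)) C"
      using C(3) by (auto simp: disjoint_family_on_def pairwise_def disjnt_def)
    have meas: "(\<lambda>i. cball (fst i) (snd i)) ` C \<subseteq> sets borel" by auto
    have Um [measurable]: "U \<in> sets borel" unfolding U_def using C(1) by (intro sets.countable_UN') auto
    have "AE x in lborel. x \<in> {p<..<q} \<longrightarrow> x \<in> S"
      using means by eventually_elim (auto simp: S_def)
    moreover have "AE x in lborel. x \<notin> S - U"
    proof -
      have "S - U \<in> null_sets lebesgue" using C(4) by (simp add: U_def negligible_iff_null_sets)
      then have "AE x in lebesgue. x \<notin> S - U" by (rule AE_not_in)
      then show ?thesis by (simp add: AE_completion_iff)
    qed
    ultimately have AEU: "AE x in lborel. x \<in> {p<..<q} \<longrightarrow> x \<in> U" by eventually_elim auto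
    have "emeasure \<mu> {p<..<q} \<le> emeasure \<mu> U"
    proof -
      have "(\<integral>\<^sup>+x. ennreal (d x) * indicator {p<..<q} x \<partial>lborel) \<le> (\<integral>\<^sup>+x. ennreal (d x) * indicator U x \<partial>lborel)"
      proof (rule nn_integral_mono_AE)
        show "AE x in lborel. ennreal (d x) * indicator {p<..<q} x \<le> ennreal (d x) * indicator U x"
          using AEU by eventually_elim (auto simp: indicator_def)
      qed
      then show ?thesis by (simp add: \<mu>)
    qed
    also have "\<dots> = (\<integral>\<^sup>+i. emeasure \<mu> (cball (fst i) (snd i)) \<partial>count_space C)"
      unfolding U_def by (rule emeasure_UN_countable) (use C(1) disj in \<open>auto simp: \<mu>_def\<close>)
    also have "\<dots> \<le> (\<integral>\<^sup>+i. ennreal \<eta> * emeasure lborel (cball (fst i) (snd i)) \<partial>count_space C)"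
    proof (rule nn_integral_mono)
      fix i assume "i \<in> space (count_space C)"
      then have i: "i \<in> K" using C(2) by auto
      define x r where "x = fst i" "r = snd i"
      have K': "0 < r" "(LINT t|lborel. indicator {x - r..x + r} t * d t) / r \<le> \<eta>"
        using i by (auto simp: K_def x_r_def)
      have cb: "cball x r = {x - r..x + r}" by (rule cball_eq_atLeastAtMost)
      have "emeasure \<mu> (cball x r) = (\<integral>\<^sup>+t. ennreal (indicator {x - r..x + r} t * d t) \<partial>lborel)"
        by (subst \<mu>) (auto simp: cb indicator_def intro!: nn_integral_cong)
      also have "\<dots> = ennreal (LINT t|lborel. indicator {x - r..x + r} t * d t)"
      proof (rule nn_integral_eq_integral)
        show "integrable lborel (\<lambda>t. indicator {x - r..x + r} t * d t)"
          using integrable_mult_indicator[OF _ int, of "{x - r..x + r}"] by simp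
      qed (use d0 in auto)
      also have "\<dots> \<le> ennreal (\<eta> * r)" using K' by (intro ennreal_leI) (simp add: field_simps)
      also have "\<dots> \<le> ennreal (\<eta> * (2 * r))" using K' \<eta> by (intro ennreal_leI) simp
      also have "\<dots> = ennreal \<eta> * emeasure lborel (cball x r)"
        using K' \<eta> by (simp add: cb ennreal_mult)
      finally show "emeasure \<mu> (cball (fst i) (snd i)) \<le> ennreal \<eta> * emeasure lborel (cball (fst i) (snd i))"
        by (simp add: x_r_def)
    qed
    also have "\<dots> = ennreal \<eta> * (\<integral>\<^sup>+i. emeasure lborel (cball (fst i) (snd i)) \<partial>count_space C)"
      by (rule nn_integral_cmult) simp
    also have "(\<integral>\<^sup>+i. emeasure lborel (cball (fst i) (snd i)) \<partial>count_space C) = emeasure lborel U"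
      unfolding U_def by (rule emeasure_UN_countable[symmetric]) (use C(1) disj in auto)
    also have "\<dots> \<le> emeasure lborel {p<..<q}"
    proof (rule emeasure_mono)
      show "U \<subseteq> {p<..<q}" unfolding U_def using C(2) by (force simp: K_def cball_eq_atLeastAtMost)
    qed simp
    also have "emeasure lborel {p<..<q} = ennreal (q - p)" using pq by simp
    finally show ?thesis using \<eta> pq by (simp add: ennreal_mult mult_left_mono)
  qed
  have "emeasure \<mu> {p<..<q} = 0"
  proof (cases "p < q")
    case True
    have small: "emeasure \<mu> {p<..<q} \<le> 0 + ennreal e" if "e > 0" for e
      using le[of "e / (q - p)"] True that by simp
    have "emeasure \<mu> {p<..<q} \<le> 0" by (rule ennreal_le_epsilon) (rule small)
    then show ?thesis by simp
  qed simp
  then have "AE x in lborel. ennreal (d x) * indicator {p<..<q} x = 0"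
    by (simp add: \<mu> nn_integral_0_iff_AE)
  then show ?thesis
  proof eventually_elim
    case (elim x)
    then show ?case using d0[of x] by (auto simp: indicator_def)
  qed
qed

text \<open>
  On a half square \<open>v\<close> differs from \<open>u\<close> by the primitive of \<open>g\<close>, which is negligible; so the trace
  condition for \<open>u\<close> makes the means of \<open>\<bar>v x - x\<bar>\<close> over small intervals tend to zero.
\<close>
lemma rectangle_trace:
  assumes S [measurable]: "S \<in> sets borel" and b: "0 < b" and QS: "{p<..<q} \<times> {0<..<b} \<subseteq> S"
    and u: "L2 u" and g: "L2 g" and g0: "\<forall>z. snd z \<le> 0 \<longrightarrow> g z = 0"
    and v: "integrable lborel v"
    and rep: "AE z in lborel. z \<in> {p<..<q} \<times> {0<..<b} \<longrightarrow> u z = v (fst z) + vprim g z"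
    and tr: "AE x in lborel. x \<in> {p<..<q} \<longrightarrow> trace_at S u (x, 0) x"
  shows "AE x in lborel. x \<in> {p<..<q} \<longrightarrow> v x = x"
proof -
  note [measurable] = L2_measurable[OF u] L2_measurable[OF g]
  have [measurable]: "v \<in> borel_measurable borel" using v by auto
  define d where "d x = indicator {p<..<q} x * \<bar>v x - x\<bar>" for x
  have [measurable]: "d \<in> borel_measurable borel" unfolding d_def by measurable
  have d0: "0 \<le> d x" for x by (simp add: d_def)
  have dint: "integrable lborel d"
  proof (rule Bochner_Integration.integrable_bound)
    show "integrable lborel (\<lambda>x. \<bar>v x\<bar> + max \<bar>p\<bar> \<bar>q\<bar> * indicator {p<..<q} x)" using v by simp
    show "AE x in lborel. norm (d x) \<le> norm (\<bar>v x\<bar> + max \<bar>p\<bar> \<bar>q\<bar> * indicator {p<..<q} x)"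
      by (intro AE_I2) (auto simp: d_def indicator_def)
  qed measurable
  have "AE x in lborel. x \<in> {p<..<q} \<longrightarrow>
      ((\<lambda>r. (LINT t|lborel. indicator {x - r..x + r} t * d t) / r) \<longlongrightarrow> 0) (at_right 0)"
    using tr
  proof eventually_elim
    case (elim a)
    show ?case
    proof
      assume a: "a \<in> {p<..<q}"
      define T where "T r = (LINT z:(S \<inter> ball (a, 0) r)|lborel. \<bar>u z - a\<bar>)" for r
      define J where "J r = (LINT z|lborel. indicator (half_square a r) z * \<bar>g z\<bar>)" for r
      have T0: "((\<lambda>r. T r / r\<^sup>2) \<longlongrightarrow> 0) (at_right 0)"
        using elim a unfolding trace_at_def T_def by simp
      have J0: "((\<lambda>r. J r / r) \<longlongrightarrow> 0) (at_right 0)"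
        unfolding J_def by (rule half_square_mean_tendsto_0[OF g])
      define r0 where "r0 = min b (min (a - p) (q - a))"
      have r0: "r0 > 0" using a b by (simp add: r0_def)
      have le: "(LINT t|lborel. indicator {a - r..a + r} t * d t) / r
          \<le> 16 * (T (4 * r) / (4 * r)\<^sup>2) + 16 * r + 4 * (J (2 * r) / (2 * r))"
        if r: "0 < r" "2 * r < r0" for r
      proof -
        define HS where "HS = half_square a (2 * r)"
        have HSm [measurable]: "HS \<in> sets borel" by (simp add: HS_def)
        have HSQ: "HS \<subseteq> {p<..<q} \<times> {0<..<b}"
          using r by (auto simp: HS_def half_square_def r0_def)
        have HSball: "HS \<subseteq> S \<inter> ball (a, 0) (4 * r)"
        proof
          fix z assume z: "z \<in> HS"
          have "norm (z - (a, 0)) \<le> \<bar>fst z - a\<bar> + \<bar>snd z\<bar>"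
            using norm_Pair_le[of "fst z - a" "snd z"] by (cases z) simp
          also have "\<dots> < 4 * r" using z by (auto simp: HS_def half_square_def)
          finally show "z \<in> S \<inter> ball (a, 0) (4 * r)"
            using z HSQ QS by (auto simp: dist_norm norm_minus_commute)
        qed
        have fin: "integrable lborel (indicator HS :: _ \<Rightarrow> real)"
          using emeasure_half_square[of "2 * r" a] r unfolding HS_def by (intro integrable_real_indicator) auto
        note V = integral_vprim_half_square[OF g g0, where r="2 * r" and a=a, folded HS_def]
        have finB: "emeasure lborel (S \<inter> ball (a, 0) (4 * r)) < \<infinity>"
          by (rule emeasure_bounded_finite) (simp add: bounded_Int)
        have intT: "integrable lborel (\<lambda>z. indicator (S \<inter> ball (a, 0) (4 * r)) z * \<bar>u z - a\<bar>)"
        proof -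
          have "integrable lborel (\<lambda>z. indicator (S \<inter> ball (a, 0) (4 * r)) z * u z - a * indicator (S \<inter> ball (a, 0) (4 * r)) z)"
            using L2_integrable_on[OF u _ finB] finB
            by (intro Bochner_Integration.integrable_diff integrable_mult_right integrable_real_indicator) auto
          then have "integrable lborel (\<lambda>z. \<bar>indicator (S \<inter> ball (a, 0) (4 * r)) z * u z - a * indicator (S \<inter> ball (a, 0) (4 * r)) z\<bar>)"
            by (rule integrable_abs)
          also have "(\<lambda>z. \<bar>indicator (S \<inter> ball (a, 0) (4 * r)) z * u z - a * indicator (S \<inter> ball (a, 0) (4 * r)) z\<bar>)
            = (\<lambda>z. indicator (S \<inter> ball (a, 0) (4 * r)) z * \<bar>u z - a\<bar>)"
            by (auto simp: fun_eq_iff indicator_def)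
          finally show ?thesis .
        qed
        define R where "R z = indicator (S \<inter> ball (a, 0) (4 * r)) z * \<bar>u z - a\<bar> + 2 * r * indicator HS z
          + indicator HS z * \<bar>vprim g z\<bar>" for z
        have Rint: "integrable lborel R" unfolding R_def using intT fin V(1) r by simp
        define L where "L z = (indicator {a - r..a + r} (fst z) * d (fst z)) * indicator {0<..<r} (snd z)" for z :: "real \<times> real"
        have id: "integrable lborel (\<lambda>t. indicator {a - r..a + r} t * d t)"
          using integrable_mult_indicator[OF _ dint, of "{a - r..a + r}"] by simp
        have Lint: "integrable lborel L"
          unfolding L_def by (intro integrable_tensor id) simp
        have "(LINT z|lborel. L z) \<le> (LINT z|lborel. R z)"
        proof (rule integral_mono_AE[OF Lint Rint])
          show "AE z in lborel. L z \<le> R z"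
            using rep
          proof eventually_elim
            case (elim z)
            show ?case
            proof (cases "z \<in> {a - r..a + r} \<times> {0<..<r}")
              case True
              then have z: "z \<in> HS" using r by (auto simp: HS_def half_square_def)
              then have eq: "u z = v (fst z) + vprim g z" and zS: "z \<in> S \<inter> ball (a, 0) (4 * r)"
                using elim HSQ HSball by blast+
              have "\<bar>fst z - a\<bar> \<le> 2 * r" using True r by (cases z) auto
              then have "\<bar>v (fst z) - fst z\<bar> \<le> \<bar>u z - a\<bar> + 2 * r + \<bar>vprim g z\<bar>" using eq by linarith
              moreover have "L z \<le> \<bar>v (fst z) - fst z\<bar>" by (simp add: L_def d_def indicator_def)
              ultimately show ?thesis using z zS by (simp add: R_def)
            next
              case False
              then have "L z = 0" by (cases z) (auto simp: L_def indicator_def)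
              moreover have "R z \<ge> 0" using r by (simp add: R_def)
              ultimately show ?thesis by simp
            qed
          qed
        qed
        also have "(LINT z|lborel. R z) = T (4 * r) + 2 * r * (LINT z|lborel. indicator HS z)
            + (LINT z|lborel. indicator HS z * \<bar>vprim g z\<bar>)"
          unfolding R_def T_def set_lebesgue_integral_def using intT fin V(1) r by simp
        also have "(LINT z|lborel. indicator HS z) = 8 * r\<^sup>2"
          using emeasure_half_square[of "2 * r" a] r by (simp add: measure_def HS_def)
        also have "(LINT z|lborel. indicator HS z * \<bar>vprim g z\<bar>) \<le> 2 * r * J (2 * r)"
          using V(2) r by (simp add: J_def HS_def)
        finally have "(LINT z|lborel. L z) \<le> T (4 * r) + 2 * r * (8 * r\<^sup>2) + 2 * r * J (2 * r)" by simp
        moreover have "(LINT z|lborel. L z) = (LINT t|lborel. indicator {a - r..a + r} t * d t) * r"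
          using lborel2_integral_fst[OF Lint] r by (simp add: L_def)
        ultimately have "(LINT t|lborel. indicator {a - r..a + r} t * d t) * r / r\<^sup>2
            \<le> (T (4 * r) + 2 * r * (8 * r\<^sup>2) + 2 * r * J (2 * r)) / r\<^sup>2"
          by (intro divide_right_mono) auto
        then show ?thesis using r by (simp add: field_simps power2_eq_square)
      qed
      show "((\<lambda>r. (LINT t|lborel. indicator {a - r..a + r} t * d t) / r) \<longlongrightarrow> 0) (at_right 0)"
      proof (rule Lim_null_comparison)
        have lim: "filterlim (\<lambda>r. c * r) (at_right 0) (at_right 0)" if "c > 0" for c :: real
          by (rule filterlim_times_pos[OF filterlim_ident that]) simp
        have "((\<lambda>r. T (4 * r) / (4 * r)\<^sup>2) \<longlongrightarrow> 0) (at_right 0)"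
          by (rule filterlim_compose[OF T0 lim]) simp
        moreover have "((\<lambda>r. J (2 * r) / (2 * r)) \<longlongrightarrow> 0) (at_right 0)"
          by (rule filterlim_compose[OF J0 lim]) simp
        ultimately have "((\<lambda>r. 16 * (T (4 * r) / (4 * r)\<^sup>2) + 16 * r + 4 * (J (2 * r) / (2 * r)))
            \<longlongrightarrow> 16 * 0 + 16 * 0 + 4 * 0) (at_right 0)"
          by (intro tendsto_intros)
        then show "((\<lambda>r. 16 * (T (4 * r) / (4 * r)\<^sup>2) + 16 * r + 4 * (J (2 * r) / (2 * r))) \<longlongrightarrow> 0) (at_right 0)"
          by simp
        have "\<forall>\<^sub>F r in at_right 0. r < r0 / 2"
          using r0 by (intro order_tendstoD(2)[of "\<lambda>r. r" 0]) (auto intro: tendsto_ident_at)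
        then show "\<forall>\<^sub>F r in at_right 0. norm ((LINT t|lborel. indicator {a - r..a + r} t * d t) / r)
            \<le> 16 * (T (4 * r) / (4 * r)\<^sup>2) + 16 * r + 4 * (J (2 * r) / (2 * r))"
          using eventually_at_right_less[of 0]
        proof eventually_elim
          case (elim r)
          have "0 \<le> (LINT t|lborel. indicator {a - r..a + r} t * d t)"
            using d0 by (intro Bochner_Integration.integral_nonneg) simp
          then have "0 \<le> (LINT t|lborel. indicator {a - r..a + r} t * d t) / r" using elim by simp
          then show ?case using le[of r] elim by simp
        qed
      qed
    qed
  qed
  from AE_zero_if_means_tendsto_0[OF _ d0 dint this] have "AE x in lborel. x \<in> {p<..<q} \<longrightarrow> d x = 0"
    by simp
  then show ?thesis by eventually_elim (auto simp: d_def)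
qed

section \<open>Displacements on subgraphs\<close>

lemma subgraph_open:
  assumes "lower_semicontinuous h" shows "open (subgraph h)"
proof -
  have "subgraph h = (\<Union>b\<in>{0<..}. {x. b < h x} \<times> {0<..<b})"
  proof (intro equalityI subsetI)
    fix z assume "z \<in> subgraph h"
    then have z: "0 < snd z" "snd z < h (fst z)" by (auto simp: subgraph_def)
    then obtain b where "snd z < b" "b < h (fst z)" using dense by blast
    then show "z \<in> (\<Union>b\<in>{0<..}. {x. b < h x} \<times> {0<..<b})"
      using z by (intro UN_I[of b]) (auto simp: mem_Times_iff)
  qed (auto simp: subgraph_def)
  moreover have "open ({x. b < h x} \<times> {0<..<b})" for b
    using assms by (intro open_Times) (auto simp: lower_semicontinuous_def)
  ultimately show ?thesis by (simp add: open_UN)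
qed

text \<open>
  By lower semicontinuity the subgraph is the union of rational rectangles standing on the bottom
  edge. On each of them the representation holds with some \<open>v\<close>, and the trace identifies \<open>v\<close>.
\<close>
lemma displacement_representation:
  assumes h: "lower_semicontinuous h"
    and u: "L2 u" and g: "L2 g" "\<And>z. z \<notin> subgraph h \<Longrightarrow> g z = 0"
    and wd: "weak_deriv (subgraph h) (0, 1) u g"
    and tr: "AE x in lborel. x \<in> closure {t. h t \<noteq> 0} \<longrightarrow> trace_at (subgraph h) u (x, 0) x"
  shows "AE z in lborel. z \<in> subgraph h \<longrightarrow> u z = fst z + vprim g z"
proof -
  let ?S = "subgraph h"
  have Sm: "?S \<in> sets borel" using subgraph_open[OF h] by auto
  note [measurable] = L2_measurable[OF u] L2_measurable[OF g(1)]
  have g0: "\<forall>z. snd z \<le> 0 \<longrightarrow> g z = 0" using g(2) by (auto simp: subgraph_def)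
  define Q where "Q i = (case i of (p, q, b) \<Rightarrow> {real_of_rat p<..<real_of_rat q} \<times> {0<..<real_of_rat b})" for i
  have one: "AE z in lborel. Q i \<subseteq> ?S \<longrightarrow> z \<in> Q i \<longrightarrow> u z = fst z + vprim g z" for i
  proof (cases "Q i \<subseteq> ?S \<and> Q i \<noteq> {}")
    case True
    obtain p q b where i: "i = (p, q, b)" by (cases i)
    define p' q' b' where "p' = real_of_rat p" "q' = real_of_rat q" "b' = real_of_rat b"
    have Q: "Q i = {p'<..<q'} \<times> {0<..<b'}" by (simp add: Q_def i p'_q'_b'_def)
    with True have pq: "p' < q'" "0 < b'" by auto
    have Qm [measurable]: "Q i \<in> sets borel" unfolding Q by (intro borel_open open_Times) auto
    have fin: "emeasure lborel (Q i) < \<infinity>" unfolding Q by (rule emeasure_bounded_finite) (simp add: bounded_Times)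
    define uQ gQ where "uQ z = indicator (Q i) z * u z" "gQ z = indicator (Q i) z * g z" for z
    have iu: "integrable lborel uQ" "integrable lborel gQ"
      unfolding uQ_gQ_def by (intro L2_integrable_on u g fin Qm)+
    have [measurable]: "uQ \<in> borel_measurable borel" "gQ \<in> borel_measurable borel" using iu by auto
    have "weak_deriv (Q i) (0, 1) uQ gQ"
    proof (rule weak_deriv_cong)
      show "weak_deriv (Q i) (0, 1) u g" using wd True weak_deriv_mono by blast
      show "AE z in lborel. z \<in> Q i \<longrightarrow> u z = uQ z \<and> g z = gQ z" by (simp add: uQ_gQ_def)
    qed measurable
    then obtain v where v: "integrable lborel v" "AE z in lborel. z \<in> Q i \<longrightarrow> uQ z = v (fst z) + vprim gQ z"
      using rectangle_representation[OF pq(2) Q iu] by (auto simp: uQ_gQ_def)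
    have vp: "vprim gQ z = vprim g z" if z: "z \<in> Q i" for z
      unfolding vprim_def
    proof (rule Bochner_Integration.integral_cong[OF refl])
      fix t
      have "(fst z, t) \<in> Q i" if "0 < t" "t < snd z" using z that by (auto simp: Q mem_Times_iff)
      then show "indicator {..<snd z} t * gQ (fst z, t) = indicator {..<snd z} t * g (fst z, t)"
        using g0[rule_format, of "(fst z, t)"]
        by (cases "0 < t"; cases "t < snd z") (auto simp: uQ_gQ_def)
    qed
    have rep: "AE z in lborel. z \<in> Q i \<longrightarrow> u z = v (fst z) + vprim g z"
      using v(2)
    proof eventually_elim
      case (elim z)
      then show ?case using vp by (simp add: uQ_gQ_def)
    qed
    have "x \<in> closure {t. h t \<noteq> 0}" if "x \<in> {p'<..<q'}" for x
    proof -
      have "(x, b' / 2) \<in> ?S" using that pq True unfolding Q by auto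
      then have "h x \<noteq> 0" by (auto simp: subgraph_def)
      then show ?thesis using closure_subset by fastforce
    qed
    then have cl: "{p'<..<q'} \<subseteq> closure {t. h t \<noteq> 0}" by blast
    have "AE x in lborel. x \<in> {p'<..<q'} \<longrightarrow> trace_at ?S u (x, 0) x"
      using tr
    proof eventually_elim
      case (elim x)
      then show ?case using cl by blast
    qed
    with rep True have "AE x in lborel. x \<in> {p'<..<q'} \<longrightarrow> v x = x"
      unfolding Q by (intro rectangle_trace[OF Sm pq(2) _ u g(1) g0 v(1)]) auto
    from AE_lborel2_fst[OF this] rep have "AE z in lborel. z \<in> Q i \<longrightarrow> u z = fst z + vprim g z"
      by eventually_elim (auto simp: Q)
    then show ?thesis by simp
  qed auto
  then have "AE z in lborel. \<forall>i. Q i \<subseteq> ?S \<longrightarrow> z \<in> Q i \<longrightarrow> u z = fst z + vprim g z"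
    by (simp add: AE_all_countable)
  then show ?thesis
  proof eventually_elim
    case (elim z)
    show ?case
    proof
      assume "z \<in> ?S"
      then have z: "0 < snd z" "snd z < h (fst z)" by (auto simp: subgraph_def)
      then obtain b where b: "snd z < real_of_rat b" "real_of_rat b < h (fst z)"
        using of_rat_dense by blast
      have "open {x. real_of_rat b < h x}" using h by (simp add: lower_semicontinuous_def)
      then obtain e where e: "e > 0" "ball (fst z) e \<subseteq> {x. real_of_rat b < h x}"
        using b(2) by (auto simp: open_contains_ball)
      obtain p where p: "fst z - e < real_of_rat p" "real_of_rat p < fst z"
        using of_rat_dense[of "fst z - e" "fst z"] e by auto
      obtain q where q: "fst z < real_of_rat q" "real_of_rat q < fst z + e"
        using of_rat_dense[of "fst z" "fst z + e"] e by auto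
      have "x \<in> ball (fst z) e" if "real_of_rat p < x" "x < real_of_rat q" for x
        using that p q by (auto simp: dist_real_def)
      then have "Q (p, q, b) \<subseteq> ?S" using e(2) by (force simp: Q_def subgraph_def)
      moreover have "z \<in> Q (p, q, b)" using p q b z by (simp add: Q_def mem_Times_iff)
      ultimately show "u z = fst z + vprim g z" using elim by blast
    qed
  qed
qed

text \<open>
  A function in \<open>H\<^sup>1 (S)\<close> together with its weak gradient, both extended by zero. Carrying the gradient
  along avoids the choice in the definition of the Dirichlet energy.
\<close>
definition sobolev ::
    "(real \<times> real) set \<Rightarrow> (real \<times> real \<Rightarrow> real) \<Rightarrow> (real \<times> real \<Rightarrow> real) \<Rightarrow> (real \<times> real \<Rightarrow> real) \<Rightarrow> bool" where
  "sobolev S u g1 g2 \<longleftrightarrow> L2 u \<and> L2 g1 \<and> L2 g2 \<and>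
     (\<forall>z. z \<notin> S \<longrightarrow> u z = 0 \<and> g1 z = 0 \<and> g2 z = 0) \<and>
     weak_deriv S (1, 0) u g1 \<and> weak_deriv S (0, 1) u g2"

definition zext :: "'a set \<Rightarrow> ('a \<Rightarrow> real) \<Rightarrow> 'a \<Rightarrow> real" where
  "zext S u z = indicator S z * u z"

lemma zext_simps [simp]: "z \<in> S \<Longrightarrow> zext S u z = u z" "z \<notin> S \<Longrightarrow> zext S u z = 0"
  by (auto simp: zext_def)

lemma zext_eq: "(\<And>z. z \<notin> S \<Longrightarrow> f z = 0) \<Longrightarrow> zext S f = f"
  unfolding zext_def by (rule ext) (metis indicator_simps mult_1 mult_zero_left)

lemma sobolev_outside:
  assumes "sobolev S u g1 g2" "z \<notin> S" shows "u z = 0" "g1 z = 0" "g2 z = 0"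
  using assms unfolding sobolev_def by blast+

lemma set_integral_test_function:
  assumes "\<And>z. z \<notin> S \<Longrightarrow> \<psi> z = 0"
  shows "(LINT z:S|lborel. u z *\<^sub>R \<psi> z) = (LINT z|lborel. zext S u z *\<^sub>R (\<psi> z :: 'b::{banach, second_countable_topology}))"
  unfolding set_lebesgue_integral_def zext_def
  by (rule Bochner_Integration.integral_cong) (auto simp: indicator_def)

lemma L2_on_real_iff: "S \<in> sets borel \<Longrightarrow> L2_on S u \<longleftrightarrow> L2 (zext S u)" for u :: "real \<times> real \<Rightarrow> real"
proof -
  have "(\<lambda>z. (zext S u z)\<^sup>2) = (\<lambda>z. indicator S z * (u z)\<^sup>2)"
    by (auto simp: zext_def indicator_def)
  then show ?thesis
    unfolding L2_on_def L2_def set_borel_measurable_def set_integrable_def zext_def[abs_def] by simp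
qed

lemma L2_on_pair_iff:
  fixes g :: "real \<times> real \<Rightarrow> real \<times> real"
  assumes "S \<in> sets borel"
  shows "L2_on S g \<longleftrightarrow> L2 (zext S (\<lambda>z. fst (g z))) \<and> L2 (zext S (\<lambda>z. snd (g z)))"
proof -
  have eq: "(\<lambda>z. indicator S z *\<^sub>R g z) = (\<lambda>z. (zext S (\<lambda>z. fst (g z)) z, zext S (\<lambda>z. snd (g z)) z))"
    by (auto simp: zext_def indicator_def fun_eq_iff prod_eq_iff)
  have nrm: "(\<lambda>z. indicator S z * (norm (g z))\<^sup>2)
      = (\<lambda>z. (zext S (\<lambda>z. fst (g z)) z)\<^sup>2 + (zext S (\<lambda>z. snd (g z)) z)\<^sup>2)"
    by (auto simp: zext_def indicator_def fun_eq_iff norm_prod_def)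
  show ?thesis
  proof
    assume L: "L2_on S g"
    then have m: "(\<lambda>z. indicator S z *\<^sub>R g z) \<in> borel_measurable borel"
      and i: "integrable lborel (\<lambda>z. indicator S z * (norm (g z))\<^sup>2)"
      by (auto simp: L2_on_def set_borel_measurable_def set_integrable_def)
    have "(\<lambda>z. fst (indicator S z *\<^sub>R g z)) \<in> borel_measurable borel"
      "(\<lambda>z. snd (indicator S z *\<^sub>R g z)) \<in> borel_measurable borel"
      using borel_measurable_comp_fst_snd[of "\<lambda>x. x", OF _ m] by simp_all
    then have m': "zext S (\<lambda>z. fst (g z)) \<in> borel_measurable borel" "zext S (\<lambda>z. snd (g z)) \<in> borel_measurable borel"
      by (simp_all add: zext_def[abs_def])
    have "integrable lborel (\<lambda>z. (zext S (\<lambda>z. fst (g z)) z)\<^sup>2)"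
      by (rule Bochner_Integration.integrable_bound[OF i[unfolded nrm]]) (use m' in auto)
    moreover have "integrable lborel (\<lambda>z. (zext S (\<lambda>z. snd (g z)) z)\<^sup>2)"
      by (rule Bochner_Integration.integrable_bound[OF i[unfolded nrm]]) (use m' in auto)
    ultimately show "L2 (zext S (\<lambda>z. fst (g z))) \<and> L2 (zext S (\<lambda>z. snd (g z)))"
      using m' by (simp add: L2_def)
  next
    assume L: "L2 (zext S (\<lambda>z. fst (g z))) \<and> L2 (zext S (\<lambda>z. snd (g z)))"
    then have "(\<lambda>z. (zext S (\<lambda>z. fst (g z)) z, zext S (\<lambda>z. snd (g z)) z)) \<in> borel_measurable borel"
      unfolding L2_def by (intro borel_measurable_Pair) auto
    then show "L2_on S g"
      using L unfolding L2_on_def set_borel_measurable_def set_integrable_def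
      by (simp add: eq nrm L2_def)
  qed
qed

lemma integral_Pair:
  fixes a b :: "'a \<Rightarrow> real"
  assumes "integrable M a" "integrable M b"
  shows "integrable M (\<lambda>z. (a z, b z))" "(LINT z|M. (a z, b z)) = (LINT z|M. a z, LINT z|M. b z)"
proof -
  have eq: "(\<lambda>z. (a z, b z)) = (\<lambda>z. a z *\<^sub>R (1, 0) + b z *\<^sub>R (0, 1))" by simp
  have i: "integrable M (\<lambda>z. a z *\<^sub>R (1 :: real, 0 :: real))" "integrable M (\<lambda>z. b z *\<^sub>R (0 :: real, 1 :: real))"
    by (intro integrable_scaleR_left assms)+
  show "integrable M (\<lambda>z. (a z, b z))" unfolding eq using i by (rule Bochner_Integration.integrable_add)
  have "(LINT z|M. a z *\<^sub>R (1 :: real, 0 :: real) + b z *\<^sub>R (0, 1))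
      = (LINT z|M. a z *\<^sub>R (1, 0)) + (LINT z|M. b z *\<^sub>R (0, 1))"
    using i by (rule Bochner_Integration.integral_add)
  also have "\<dots> = (LINT z|M. a z) *\<^sub>R (1, 0) + (LINT z|M. b z) *\<^sub>R (0, 1)"
    using integral_scaleR_left[of "(1 :: real, 0 :: real)" M a] integral_scaleR_left[of "(0 :: real, 1 :: real)" M b] assms
    by (simp only:)
  also have "\<dots> = (LINT z|M. a z, LINT z|M. b z)" by simp
  finally show "(LINT z|M. (a z, b z)) = (LINT z|M. a z, LINT z|M. b z)" unfolding eq .
qed

text \<open>
  The vector identity splits into components, and test functions turn integrals over \<open>S\<close> into integrals
  over the plane.
\<close>
lemma weak_gradient_iff:
  fixes g :: "real \<times> real \<Rightarrow> real \<times> real"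
  assumes "S \<in> sets borel" "L2_on S u" "L2_on S g"
  shows "has_weak_gradient S u g \<longleftrightarrow>
    sobolev S (zext S u) (zext S (\<lambda>z. fst (g z))) (zext S (\<lambda>z. snd (g z)))"
proof -
  let ?u = "zext S u" and ?g1 = "zext S (\<lambda>z. fst (g z))" and ?g2 = "zext S (\<lambda>z. snd (g z))"
  have L: "L2 ?u" "L2 ?g1" "L2 ?g2"
    using assms L2_on_real_iff L2_on_pair_iff by auto
  have eqv: "(LINT z:S|lborel. u z *\<^sub>R \<psi> z) = - (LINT z:S|lborel. \<phi> z *\<^sub>R g z) \<longleftrightarrow>
      (LINT z|lborel. ?u z * (\<psi> z \<bullet> (1, 0))) = - (LINT z|lborel. ?g1 z * \<phi> z) \<and>
      (LINT z|lborel. ?u z * (\<psi> z \<bullet> (0, 1))) = - (LINT z|lborel. ?g2 z * \<phi> z)"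
    if tf: "test_function S \<phi> \<psi>" for \<phi> \<psi>
  proof -
    have \<psi>0: "\<psi> z = 0" "\<phi> z = 0" if "z \<notin> S" for z
      using test_functionE[OF tf] that by (metis subsetD)+
    note tL = test_function_L2[OF tf]
    have i1: "integrable lborel (\<lambda>z. ?u z * (\<psi> z \<bullet> e))" for e by (rule L2_mult[OF L(1) tL(2)])
    have i2: "integrable lborel (\<lambda>z. ?g1 z * \<phi> z)" "integrable lborel (\<lambda>z. ?g2 z * \<phi> z)"
      using L2_mult[OF L(2) tL(1)] L2_mult[OF L(3) tL(1)] .
    have f1: "(\<lambda>z. ?u z *\<^sub>R \<psi> z) = (\<lambda>z. (?u z * (\<psi> z \<bullet> (1, 0)), ?u z * (\<psi> z \<bullet> (0, 1))))"
      by (auto simp: fun_eq_iff prod_eq_iff inner_prod_def)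
    have "(LINT z:S|lborel. u z *\<^sub>R \<psi> z) = (LINT z|lborel. ?u z *\<^sub>R \<psi> z)"
      by (rule set_integral_test_function) (rule \<psi>0)
    then have e1: "(LINT z:S|lborel. u z *\<^sub>R \<psi> z)
        = (LINT z|lborel. ?u z * (\<psi> z \<bullet> (1, 0)), LINT z|lborel. ?u z * (\<psi> z \<bullet> (0, 1)))"
      unfolding f1 integral_Pair(2)[OF i1 i1] .
    have f2: "(\<lambda>z. indicator S z *\<^sub>R \<phi> z *\<^sub>R g z) = (\<lambda>z. (?g1 z * \<phi> z, ?g2 z * \<phi> z))"
      by (auto simp: fun_eq_iff prod_eq_iff zext_def indicator_def)
    have e2: "(LINT z:S|lborel. \<phi> z *\<^sub>R g z)
        = (LINT z|lborel. ?g1 z * \<phi> z, LINT z|lborel. ?g2 z * \<phi> z)"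
      unfolding set_lebesgue_integral_def f2 by (rule integral_Pair(2)[OF i2])
    show ?thesis unfolding e1 e2 by (simp add: prod_eq_iff)
  qed
  then show ?thesis
    unfolding has_weak_gradient_def sobolev_def weak_deriv_def using L by auto
qed

definition energy :: "(real \<times> real \<Rightarrow> real) \<Rightarrow> (real \<times> real \<Rightarrow> real) \<Rightarrow> real" where
  "energy g1 g2 = (LINT z|lborel. (g1 z)\<^sup>2 + (g2 z)\<^sup>2)"

text \<open>
  The chosen gradient agrees with the given one by uniqueness of weak derivatives, hence has the same
  energy.
\<close>
lemma sobolev_imp_H1:
  assumes S: "open S" and sob: "sobolev S (zext S u) g1 g2"
  shows "H1_on S u" "dirichlet_energy S u = ennreal (energy g1 g2)"
proof -
  have Sm: "S \<in> sets borel" using S by auto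
  have z: "zext S (\<lambda>z. fst (g1 z, g2 z)) = g1" "zext S (\<lambda>z. snd (g1 z, g2 z)) = g2"
    using sobolev_outside[OF sob] by (simp_all add: zext_eq)
  have Lu: "L2_on S u" using sob L2_on_real_iff[OF Sm] by (simp add: sobolev_def)
  have Lg: "L2_on S (\<lambda>z. (g1 z, g2 z))" unfolding L2_on_pair_iff[OF Sm] z using sob by (simp add: sobolev_def)
  have wg: "has_weak_gradient S u (\<lambda>z. (g1 z, g2 z))"
    unfolding weak_gradient_iff[OF Sm Lu Lg] z by (rule sob)
  show "H1_on S u" using Lu Lg wg unfolding H1_on_def by blast
  define G where "G = weak_gradient S u"
  have G: "L2_on S G" "has_weak_gradient S u G"
  proof -
    have "L2_on S G \<and> has_weak_gradient S u G"
      unfolding G_def weak_gradient_def 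
      by (rule someI[where P="\<lambda>g. L2_on S g \<and> has_weak_gradient S u g", OF conjI[OF Lg wg]])
    then show "L2_on S G" "has_weak_gradient S u G" by auto
  qed
  have sG: "sobolev S (zext S u) (zext S (\<lambda>z. fst (G z))) (zext S (\<lambda>z. snd (G z)))"
    using weak_gradient_iff[OF Sm Lu G(1)] G(2) by simp
  have "AE z in lborel. z \<in> S \<longrightarrow> zext S (\<lambda>z. fst (G z)) z = g1 z"
    using sob sG by (intro weak_deriv_unique[OF S]) (auto simp: sobolev_def)
  moreover have "AE z in lborel. z \<in> S \<longrightarrow> zext S (\<lambda>z. snd (G z)) z = g2 z"
    using sob sG by (intro weak_deriv_unique[OF S]) (auto simp: sobolev_def)
  ultimately have "AE z in lborel. ennreal ((norm (G z))\<^sup>2) * indicator S z = ennreal ((g1 z)\<^sup>2 + (g2 z)\<^sup>2)"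
  proof eventually_elim
    case (elim z)
    have "z \<notin> S \<Longrightarrow> g1 z = 0 \<and> g2 z = 0" using sobolev_outside[OF sob] by blast
    with elim show ?case by (cases "z \<in> S") (auto simp: norm_prod_def)
  qed
  then have "dirichlet_energy S u = (\<integral>\<^sup>+z. ennreal ((g1 z)\<^sup>2 + (g2 z)\<^sup>2) \<partial>lborel)"
    unfolding dirichlet_energy_def G_def[symmetric] by (rule nn_integral_cong_AE)
  also have "\<dots> = ennreal (energy g1 g2)"
    unfolding energy_def using sob by (intro nn_integral_eq_integral) (auto simp: sobolev_def L2_def)
  finally show "dirichlet_energy S u = ennreal (energy g1 g2)" .
qed

lemma H1_imp_sobolev:
  assumes S: "S \<in> sets borel" and u: "H1_on S u"
  obtains g1 g2 where "sobolev S (zext S u) g1 g2"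
proof -
  obtain g where g: "L2_on S u" "L2_on S g" "has_weak_gradient S u g" using u unfolding H1_on_def by blast
  have "sobolev S (zext S u) (zext S (\<lambda>z. fst (g z))) (zext S (\<lambda>z. snd (g z)))"
    using weak_gradient_iff[OF S g(1,2)] g(3) by simp
  then show ?thesis by (rule that)
qed

lemma trace_at_zext: "trace_at S (zext S u) p c = trace_at S u p c"
proof -
  have "(LINT z:(S \<inter> ball p r)|lborel. \<bar>zext S u z - c\<bar>) = (LINT z:(S \<inter> ball p r)|lborel. \<bar>u z - c\<bar>)" for r
    unfolding set_lebesgue_integral_def by (rule Bochner_Integration.integral_cong) (auto simp: indicator_def)
  then show ?thesis by (simp add: trace_at_def)
qed

text \<open>
  The Dirichlet datum is encoded by integrating the vertical derivative up from the bottom edge. In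
  this form it visibly passes to limits of gradients.
\<close>
definition clamped :: "(real \<Rightarrow> real) \<Rightarrow> (real \<times> real \<Rightarrow> real) \<Rightarrow> (real \<times> real \<Rightarrow> real) \<Rightarrow> (real \<times> real \<Rightarrow> real) \<Rightarrow> bool" where
  "clamped h u g1 g2 \<longleftrightarrow> sobolev (subgraph h) u g1 g2 \<and>
     (AE z in lborel. z \<in> subgraph h \<longrightarrow> u z = fst z + vprim g2 z)"

lemma admissible_displacementE:
  assumes h: "lower_semicontinuous h" and u: "admissible_displacement h u"
  obtains g1 g2 where "clamped h (zext (subgraph h) u) g1 g2"
    "dirichlet_energy (subgraph h) u = ennreal (energy g1 g2)"
proof -
  let ?S = "subgraph h"
  have S: "open ?S" "?S \<in> sets borel" using subgraph_open[OF h] by auto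
  obtain g1 g2 where g: "sobolev ?S (zext ?S u) g1 g2"
    using H1_imp_sobolev[OF S(2)] u unfolding admissible_displacement_def by metis
  have "AE x in lborel. x \<in> closure {t. h t \<noteq> 0} \<longrightarrow> trace_at ?S (zext ?S u) (x, 0) x"
    using u unfolding admissible_displacement_def trace_at_zext by blast
  then have "AE z in lborel. z \<in> ?S \<longrightarrow> zext ?S u z = fst z + vprim g2 z"
    using g by (intro displacement_representation[OF h]) (auto simp: sobolev_def)
  then show ?thesis using that g sobolev_imp_H1[OF S(1) g] unfolding clamped_def by blast
qed

lemma clamped_imp_admissible:
  assumes h: "lower_semicontinuous h" and u: "clamped h u g1 g2"
  shows "admissible_displacement h u" "dirichlet_energy (subgraph h) u = ennreal (energy g1 g2)"
proof -
  let ?S = "subgraph h"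
  have S: "open ?S" "?S \<in> sets borel" using subgraph_open[OF h] by auto
  have "sobolev ?S u g1 g2" using u by (simp add: clamped_def)
  from sobolev_outside(1)[OF this] have z: "zext ?S u = u" by (rule zext_eq)
  have sob: "sobolev ?S (zext ?S u) g1 g2" using u z by (simp add: clamped_def)
  have "trace_at ?S u (x, 0) x" for x
  proof (rule trace_at_if_representation[OF S(2)])
    show "L2 g2" "u \<in> borel_measurable borel" using u by (auto simp: clamped_def sobolev_def L2_def)
    show "\<forall>z. snd z \<le> 0 \<longrightarrow> g2 z = 0" using u by (auto simp: clamped_def sobolev_def subgraph_def)
  qed (use u in \<open>auto simp: clamped_def subgraph_def\<close>)
  then show "admissible_displacement h u"
    using sobolev_imp_H1[OF S(1) sob] by (simp add: admissible_displacement_def)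
  show "dirichlet_energy ?S u = ennreal (energy g1 g2)"
    by (rule sobolev_imp_H1[OF S(1) sob])
qed

section \<open>Existence of Dirichlet minimizers\<close>

lemma energy_nonneg: "0 \<le> energy g1 g2"
  unfolding energy_def by (intro Bochner_Integration.integral_nonneg) auto

lemma L2_lincomb: "L2 f \<Longrightarrow> L2 g \<Longrightarrow> L2 (\<lambda>z. a * f z + b * g z)"
  by (intro L2_add L2_cmult)

lemma weak_deriv_lincomb:
  assumes "L2 u" "L2 u'" "L2 d" "L2 d'" "weak_deriv S e u d" "weak_deriv S e u' d'"
  shows "weak_deriv S e (\<lambda>z. a * u z + b * u' z) (\<lambda>z. a * d z + b * d' z)"
  unfolding weak_deriv_def
proof (intro allI impI)
  fix \<phi> \<psi> assume tf: "test_function S \<phi> \<psi>"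
  note tL = test_function_L2[OF tf]
  have "(\<lambda>z. (a * u z + b * u' z) * (\<psi> z \<bullet> e)) = (\<lambda>z. a * (u z * (\<psi> z \<bullet> e)) + b * (u' z * (\<psi> z \<bullet> e)))"
    by (simp add: algebra_simps)
  then have "(LINT z|lborel. (a * u z + b * u' z) * (\<psi> z \<bullet> e))
      = a * (LINT z|lborel. u z * (\<psi> z \<bullet> e)) + b * (LINT z|lborel. u' z * (\<psi> z \<bullet> e))"
    using L2_mult[OF assms(1) tL(2)[of e]] L2_mult[OF assms(2) tL(2)[of e]] by simp
  moreover have "(\<lambda>z. (a * d z + b * d' z) * \<phi> z) = (\<lambda>z. a * (d z * \<phi> z) + b * (d' z * \<phi> z))"
    by (simp add: algebra_simps)
  then have "(LINT z|lborel. (a * d z + b * d' z) * \<phi> z) = a * (LINT z|lborel. d z * \<phi> z) + b * (LINT z|lborel. d' z * \<phi> z)"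
    using L2_mult[OF assms(3) tL(1)] L2_mult[OF assms(4) tL(1)] by simp
  moreover have "(LINT z|lborel. u z * (\<psi> z \<bullet> e)) = - (LINT z|lborel. d z * \<phi> z)"
    "(LINT z|lborel. u' z * (\<psi> z \<bullet> e)) = - (LINT z|lborel. d' z * \<phi> z)"
    using assms(5,6) tf unfolding weak_deriv_def by simp_all
  ultimately show "(LINT z|lborel. (a * u z + b * u' z) * (\<psi> z \<bullet> e)) = - (LINT z|lborel. (a * d z + b * d' z) * \<phi> z)"
    by simp
qed

text \<open>
  Both sides of the defining identity are continuous with respect to convergence in \<open>L\<^sup>2\<close>.
\<close>
lemma weak_deriv_limit:
  assumes L: "L2 u" "L2 d" "\<And>n. L2 (us n)" "\<And>n. L2 (ds n)"
    and wd: "\<And>n. weak_deriv S e (us n) (ds n)"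
    and lim: "(\<lambda>n. LINT z|lborel. (u z - us n z)\<^sup>2) \<longlonglongrightarrow> 0" "(\<lambda>n. LINT z|lborel. (d z - ds n z)\<^sup>2) \<longlonglongrightarrow> 0"
  shows "weak_deriv S e u d"
  unfolding weak_deriv_def
proof (intro allI impI)
  fix \<phi> \<psi> assume tf: "test_function S \<phi> \<psi>"
  note tL = test_function_L2[OF tf]
  have conv: "(\<lambda>n. LINT z|lborel. fs n z * b z) \<longlonglongrightarrow> (LINT z|lborel. f z * b z)"
    if "L2 f" "\<And>n. L2 (fs n)" "L2 b" "(\<lambda>n. LINT z|lborel. (f z - fs n z)\<^sup>2) \<longlonglongrightarrow> 0"
    for f fs and b :: "real \<times> real \<Rightarrow> real"
  proof -
    have eq: "(LINT z|lborel. (f z - fs n z) * b z) = (LINT z|lborel. f z * b z) - (LINT z|lborel. fs n z * b z)" for n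
      using L2_mult[OF that(1,3)] L2_mult[OF that(2)[of n] that(3)] by (simp add: left_diff_distrib)
    have "(\<lambda>n. (LINT z|lborel. (f z - fs n z) * b z)\<^sup>2) \<longlonglongrightarrow> 0"
    proof (rule Lim_null_comparison)
      show "(\<lambda>n. (LINT z|lborel. (f z - fs n z)\<^sup>2) * (LINT z|lborel. (b z)\<^sup>2)) \<longlonglongrightarrow> 0"
        using tendsto_mult_left_zero[OF that(4)] by simp
      show "\<forall>\<^sub>F n in sequentially. norm ((LINT z|lborel. (f z - fs n z) * b z)\<^sup>2)
          \<le> (LINT z|lborel. (f z - fs n z)\<^sup>2) * (LINT z|lborel. (b z)\<^sup>2)"
        using Cauchy_Schwarz_L2[OF L2_diff[OF that(1,2)] that(3)] by simp
    qed
    then have "(\<lambda>n. (LINT z|lborel. f z * b z) - (LINT z|lborel. fs n z * b z)) \<longlonglongrightarrow> 0"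
      by (simp add: eq)
    then have "(\<lambda>n. (LINT z|lborel. f z * b z) - ((LINT z|lborel. f z * b z) - (LINT z|lborel. fs n z * b z)))
        \<longlonglongrightarrow> (LINT z|lborel. f z * b z) - 0" by (intro tendsto_intros)
    then show ?thesis by simp
  qed
  have l1: "(\<lambda>n. LINT z|lborel. us n z * (\<psi> z \<bullet> e)) \<longlonglongrightarrow> (LINT z|lborel. u z * (\<psi> z \<bullet> e))"
    by (rule conv[OF L(1,3) tL(2) lim(1)])
  have l2: "(\<lambda>n. LINT z|lborel. us n z * (\<psi> z \<bullet> e)) = (\<lambda>n. - (LINT z|lborel. ds n z * \<phi> z))"
    using wd tf unfolding weak_deriv_def by simp
  have l3: "(\<lambda>n. - (LINT z|lborel. ds n z * \<phi> z)) \<longlonglongrightarrow> - (LINT z|lborel. d z * \<phi> z)"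
    by (intro tendsto_minus conv[OF L(2,4) tL(1) lim(2)])
  show "(LINT z|lborel. u z * (\<psi> z \<bullet> e)) = - (LINT z|lborel. d z * \<phi> z)"
    by (rule LIMSEQ_unique[OF l1[unfolded l2] l3])
qed

lemma energy_fatou:
  assumes L: "\<And>i. L2 (f1 i)" "\<And>i. L2 (f2 i)"
    and m [measurable]: "F1 \<in> borel_measurable borel" "F2 \<in> borel_measurable borel"
    and lim: "AE z in lborel. (\<lambda>i. f1 i z) \<longlonglongrightarrow> F1 z \<and> (\<lambda>i. f2 i z) \<longlonglongrightarrow> F2 z"
    and bound: "\<forall>\<^sub>F i in sequentially. energy (f1 i) (f2 i) \<le> c"
  shows "L2 F1" "L2 F2" "energy F1 F2 \<le> c"
proof -
  note [measurable] = L[THEN L2_measurable]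
  obtain i where "energy (f1 i) (f2 i) \<le> c"
    using eventually_happens'[OF sequentially_bot bound] by blast
  then have c: "0 \<le> c" using energy_nonneg[of "f1 i" "f2 i"] by linarith
  have "(\<integral>\<^sup>+z. ennreal ((F1 z)\<^sup>2 + (F2 z)\<^sup>2) \<partial>lborel)
      = (\<integral>\<^sup>+z. liminf (\<lambda>i. ennreal ((f1 i z)\<^sup>2 + (f2 i z)\<^sup>2)) \<partial>lborel)"
  proof (rule nn_integral_cong_AE)
    show "AE z in lborel. ennreal ((F1 z)\<^sup>2 + (F2 z)\<^sup>2) = liminf (\<lambda>i. ennreal ((f1 i z)\<^sup>2 + (f2 i z)\<^sup>2))"
      using lim
    proof eventually_elim
      case (elim z)
      then have "(\<lambda>i. ennreal ((f1 i z)\<^sup>2 + (f2 i z)\<^sup>2)) \<longlonglongrightarrow> ennreal ((F1 z)\<^sup>2 + (F2 z)\<^sup>2)"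
        by (intro tendsto_intros) auto
      from lim_imp_Liminf[OF _ this] show ?case by simp
    qed
  qed
  also have "\<dots> \<le> liminf (\<lambda>i. \<integral>\<^sup>+z. ennreal ((f1 i z)\<^sup>2 + (f2 i z)\<^sup>2) \<partial>lborel)"
    by (rule nn_integral_liminf) measurable
  also have "(\<lambda>i. \<integral>\<^sup>+z. ennreal ((f1 i z)\<^sup>2 + (f2 i z)\<^sup>2) \<partial>lborel) = (\<lambda>i. ennreal (energy (f1 i) (f2 i)))"
    unfolding energy_def using L by (intro ext nn_integral_eq_integral) (auto simp: L2_def)
  also have "liminf (\<lambda>i. ennreal (energy (f1 i) (f2 i))) \<le> limsup (\<lambda>i. ennreal (energy (f1 i) (f2 i)))"
    by (rule Liminf_le_Limsup) simp
  also have "\<dots> \<le> ennreal c"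
  proof (rule Limsup_bounded)
    show "\<forall>\<^sub>F i in sequentially. ennreal (energy (f1 i) (f2 i)) \<le> ennreal c"
      using bound by eventually_elim (rule ennreal_leI)
  qed
  finally have le: "(\<integral>\<^sup>+z. ennreal ((F1 z)\<^sup>2 + (F2 z)\<^sup>2) \<partial>lborel) \<le> ennreal c" .
  have int: "integrable lborel (\<lambda>z. (F1 z)\<^sup>2 + (F2 z)\<^sup>2)"
  proof (rule integrableI_nonneg)
    show "(\<integral>\<^sup>+z. ennreal ((F1 z)\<^sup>2 + (F2 z)\<^sup>2) \<partial>lborel) < \<infinity>"
      using le by (rule order.strict_trans1) simp
  qed auto
  have "integrable lborel (\<lambda>z. (F1 z)\<^sup>2)" "integrable lborel (\<lambda>z. (F2 z)\<^sup>2)"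
    by (rule Bochner_Integration.integrable_bound[OF int]; simp)+
  then show "L2 F1" "L2 F2" by (simp_all add: L2_def)
  show "energy F1 F2 \<le> c" unfolding energy_def by (rule integral_real_bounded[OF c le])
qed

lemma subgraph_finite_measure:
  assumes h: "lower_semicontinuous h" "integrable lborel h" "\<And>x. 0 \<le> h x"
  shows "emeasure lborel (subgraph h) = ennreal (LINT x|lborel. h x)"
proof -
  have [measurable]: "subgraph h \<in> sets borel" using subgraph_open[OF h(1)] by auto
  have "emeasure lborel (subgraph h) = (\<integral>\<^sup>+z. indicator (subgraph h) z \<partial>lborel)" by simp
  also have "\<dots> = (\<integral>\<^sup>+x. \<integral>\<^sup>+y. indicator (subgraph h) (x, y) \<partial>lborel \<partial>lborel)"
    by (rule lborel2_nn_integral_fst) measurable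
  also have "\<dots> = (\<integral>\<^sup>+x. ennreal (h x) \<partial>lborel)"
  proof (rule nn_integral_cong)
    fix x
    have "(\<integral>\<^sup>+y. indicator (subgraph h) (x, y) \<partial>lborel) = (\<integral>\<^sup>+y. indicator {0<..<h x} y \<partial>lborel)"
      by (rule nn_integral_cong) (auto simp: subgraph_def indicator_def)
    then show "(\<integral>\<^sup>+y. indicator (subgraph h) (x, y) \<partial>lborel) = ennreal (h x)" using h(3)[of x] by simp
  qed
  also have "\<dots> = ennreal (LINT x|lborel. h x)"
    by (rule nn_integral_eq_integral[OF h(2)]) (use h(3) in auto)
  finally show ?thesis .
qed

text \<open>
  Cauchy-Schwarz on every vertical line, of length at most \<open>s - r\<close>.
\<close>
lemma L2_vprim:
  assumes S [measurable]: "S \<in> sets borel" and sub: "\<And>z. z \<in> S \<Longrightarrow> r < snd z \<and> snd z < s" and rs: "r < s"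
    and g: "L2 g" and g0: "\<And>z. z \<notin> S \<Longrightarrow> g z = 0"
  shows "L2 (zext S (vprim g))"
    "(LINT z|lborel. (zext S (vprim g) z)\<^sup>2) \<le> (s - r)\<^sup>2 * (LINT z|lborel. (g z)\<^sup>2)"
proof -
  note [measurable] = L2_measurable[OF g]
  have meas [measurable]: "zext S (vprim g) \<in> borel_measurable borel"
    unfolding zext_def[abs_def] by measurable
  define H where "H x = (\<integral>\<^sup>+t. ennreal ((g (x, t))\<^sup>2) \<partial>lborel)" for x
  have [measurable]: "H \<in> borel_measurable borel"
  proof -
    have "(\<lambda>(x, t). ennreal ((g (x, t))\<^sup>2)) \<in> borel_measurable (lborel \<Otimes>\<^sub>M lborel)"
      by (simp add: lborel_prod case_prod_unfold)
    from lborel.borel_measurable_nn_integral_fst[OF this] show ?thesis unfolding H_def by simp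
  qed
  have pt: "ennreal ((zext S (vprim g) (x, y))\<^sup>2) \<le> ennreal (s - r) * H x * indicator {r<..<s} y" for x y
  proof (cases "(x, y) \<in> S")
    case True
    have y: "r < y" "y < s" using sub[OF True] by auto
    have "ennreal \<bar>vprim g (x, y)\<bar> \<le> (\<integral>\<^sup>+t. indicator {..<y} t * ennreal \<bar>g (x, t)\<bar> \<partial>lborel)"
      by (rule ennreal_vprim_le) measurable
    also have "\<dots> \<le> (\<integral>\<^sup>+t. indicator {r<..<s} t * ennreal \<bar>g (x, t)\<bar> \<partial>lborel)"
    proof (rule nn_integral_mono)
      fix t
      show "indicator {..<y} t * ennreal \<bar>g (x, t)\<bar> \<le> indicator {r<..<s} t * ennreal \<bar>g (x, t)\<bar>"
      proof (cases "(x, t) \<in> S")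
        case True
        then show ?thesis using sub[OF True] by (auto simp: indicator_def)
      qed (simp add: g0)
    qed
    finally have "(ennreal \<bar>vprim g (x, y)\<bar>)\<^sup>2 \<le> (\<integral>\<^sup>+t. indicator {r<..<s} t * ennreal \<bar>g (x, t)\<bar> \<partial>lborel)\<^sup>2"
      by (rule power_mono) simp
    also have "\<dots> \<le> (\<integral>\<^sup>+t. (indicator {r<..<s} t)\<^sup>2 \<partial>lborel) * (\<integral>\<^sup>+t. (ennreal \<bar>g (x, t)\<bar>)\<^sup>2 \<partial>lborel)"
      by (rule Cauchy_Schwarz_nn_integral) measurable
    also have "(\<lambda>t. (indicator {r<..<s} t :: ennreal)\<^sup>2) = indicator {r<..<s}" by (auto simp: indicator_def)
    also have "(\<integral>\<^sup>+t. indicator {r<..<s} t \<partial>lborel) = ennreal (s - r)" using rs by simp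
    also have "(\<integral>\<^sup>+t. (ennreal \<bar>g (x, t)\<bar>)\<^sup>2 \<partial>lborel) = H x"
      unfolding H_def by (rule nn_integral_cong) (simp add: ennreal_power)
    finally show ?thesis using True y by (simp add: ennreal_power)
  qed simp
  have "(\<integral>\<^sup>+z. ennreal ((zext S (vprim g) z)\<^sup>2) \<partial>lborel)
      = (\<integral>\<^sup>+x. \<integral>\<^sup>+y. ennreal ((zext S (vprim g) (x, y))\<^sup>2) \<partial>lborel \<partial>lborel)"
    by (rule lborel2_nn_integral_fst) measurable
  also have "\<dots> \<le> (\<integral>\<^sup>+x. \<integral>\<^sup>+y. ennreal (s - r) * H x * indicator {r<..<s} y \<partial>lborel \<partial>lborel)"
    by (intro nn_integral_mono pt)
  also have "\<dots> = (\<integral>\<^sup>+x. ennreal ((s - r)\<^sup>2) * H x \<partial>lborel)"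
  proof (rule nn_integral_cong)
    fix x
    have "(\<integral>\<^sup>+y. ennreal (s - r) * H x * indicator {r<..<s} y \<partial>lborel)
        = ennreal (s - r) * H x * (\<integral>\<^sup>+y. indicator {r<..<s} y \<partial>lborel)"
      by (rule nn_integral_cmult) measurable
    then show "(\<integral>\<^sup>+y. ennreal (s - r) * H x * indicator {r<..<s} y \<partial>lborel) = ennreal ((s - r)\<^sup>2) * H x"
      using rs by (simp add: power2_eq_square ennreal_mult mult.assoc mult.commute mult.left_commute)
  qed
  also have "\<dots> = ennreal ((s - r)\<^sup>2) * (\<integral>\<^sup>+x. H x \<partial>lborel)" by (rule nn_integral_cmult) measurable
  also have "(\<integral>\<^sup>+x. H x \<partial>lborel) = (\<integral>\<^sup>+z. ennreal ((g z)\<^sup>2) \<partial>lborel)"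
    unfolding H_def by (rule lborel2_nn_integral_fst[symmetric]) measurable
  also have "\<dots> = ennreal (LINT z|lborel. (g z)\<^sup>2)"
    by (rule nn_integral_eq_integral[OF L2_square[OF g]]) auto
  finally have le: "(\<integral>\<^sup>+z. ennreal ((zext S (vprim g) z)\<^sup>2) \<partial>lborel) \<le> ennreal ((s - r)\<^sup>2 * (LINT z|lborel. (g z)\<^sup>2))"
    by (simp add: ennreal_mult)
  have "integrable lborel (\<lambda>z. (zext S (vprim g) z)\<^sup>2)"
  proof (rule integrableI_nonneg)
    show "(\<integral>\<^sup>+z. ennreal ((zext S (vprim g) z)\<^sup>2) \<partial>lborel) < \<infinity>"
      using le by (rule order.strict_trans1) simp
  qed auto
  then show "L2 (zext S (vprim g))" using meas by (simp add: L2_def)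
  show "(LINT z|lborel. (zext S (vprim g) z)\<^sup>2) \<le> (s - r)\<^sup>2 * (LINT z|lborel. (g z)\<^sup>2)"
    by (rule integral_real_bounded[OF _ le]) simp
qed

lemma vprim_lincomb:
  assumes "integrable lborel g" "integrable lborel g'"
  shows "AE z in lborel. vprim (\<lambda>z. a * g z + b * g' z) z = a * vprim g z + b * vprim g' z"
proof -
  have "AE z in (lborel :: (real \<times> real) measure). integrable lborel (\<lambda>y. g (fst z, y))"
    "AE z in (lborel :: (real \<times> real) measure). integrable lborel (\<lambda>y. g' (fst z, y))"
    by (intro AE_lborel2_fst lborel2_AE_integrable_fst assms)+
  then show ?thesis
  proof eventually_elim
    case (elim z)
    have i: "integrable lborel (\<lambda>t. indicator {..<snd z} t * f t)" if "integrable lborel f" for f :: "real \<Rightarrow> real"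
      using integrable_mult_indicator[OF _ that, of "{..<snd z}"] by simp
    have "(\<lambda>t. indicator {..<snd z} t * (a * g (fst z, t) + b * g' (fst z, t)))
        = (\<lambda>t. a * (indicator {..<snd z} t * g (fst z, t)) + b * (indicator {..<snd z} t * g' (fst z, t)))"
      by (simp add: algebra_simps)
    then show ?case unfolding vprim_def using i[OF elim(1)] i[OF elim(2)] by simp
  qed
qed

lemma L2_cong_AE:
  assumes "L2 f" "g \<in> borel_measurable borel" "AE z in lborel. f z = g z"
  shows "L2 g"
proof -
  have "integrable lborel (\<lambda>z. (g z)\<^sup>2)"
  proof (rule integrable_cong_AE_imp[OF L2_square[OF assms(1)]])
    show "AE z in lborel. (f z)\<^sup>2 = (g z)\<^sup>2" using assms(3) by eventually_elim simp
  qed (use assms(2) in simp)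
  then show ?thesis using assms(2) by (simp add: L2_def)
qed

lemma L2_integrable_if_supported:
  assumes "L2 f" "S \<in> sets borel" "emeasure lborel S < \<infinity>" "\<And>z. z \<notin> S \<Longrightarrow> f z = 0"
  shows "integrable lborel f"
proof -
  have "(\<lambda>z. indicator S z * f z) = f" using assms(4) by (auto simp: fun_eq_iff indicator_def)
  then show ?thesis using L2_integrable_on[OF assms(1-3)] by simp
qed

lemma clamped_convex:
  assumes h: "lower_semicontinuous h" "integrable lborel h" "\<And>x. 0 \<le> h x"
    and u: "clamped h u g1 g2" and v: "clamped h v k1 k2"
  shows "clamped h (\<lambda>z. 1/2 * u z + 1/2 * v z) (\<lambda>z. 1/2 * g1 z + 1/2 * k1 z) (\<lambda>z. 1/2 * g2 z + 1/2 * k2 z)"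
proof -
  let ?S = "subgraph h"
  have S: "?S \<in> sets borel" "emeasure lborel ?S < \<infinity>"
    using subgraph_open[OF h(1)] subgraph_finite_measure[OF h] by auto
  have su: "sobolev ?S u g1 g2" and sv: "sobolev ?S v k1 k2" using u v by (auto simp: clamped_def)
  note L = su[unfolded sobolev_def] sv[unfolded sobolev_def]
  have "sobolev ?S (\<lambda>z. 1/2 * u z + 1/2 * v z) (\<lambda>z. 1/2 * g1 z + 1/2 * k1 z) (\<lambda>z. 1/2 * g2 z + 1/2 * k2 z)"
    unfolding sobolev_def
    using L by (intro conjI L2_lincomb weak_deriv_lincomb) auto
  moreover have "integrable lborel g2" "integrable lborel k2"
    using L2_integrable_if_supported[OF _ S] L sobolev_outside[OF su] sobolev_outside[OF sv] by blast+
  note vprim_lincomb[OF this, of "1/2" "1/2"]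
  then have "AE z in lborel. z \<in> ?S \<longrightarrow> 1/2 * u z + 1/2 * v z = fst z + vprim (\<lambda>z. 1/2 * g2 z + 1/2 * k2 z) z"
    using u[unfolded clamped_def, THEN conjunct2] v[unfolded clamped_def, THEN conjunct2]
    by eventually_elim (auto simp: field_simps)
  ultimately show ?thesis by (simp add: clamped_def)
qed

text \<open>
  This turns minimizing sequences into Cauchy sequences.
\<close>
lemma energy_parallelogram:
  assumes "L2 f1" "L2 f2" "L2 g1" "L2 g2"
  shows "energy (\<lambda>z. f1 z - g1 z) (\<lambda>z. f2 z - g2 z)
    = 2 * energy f1 f2 + 2 * energy g1 g2
      - 4 * energy (\<lambda>z. 1/2 * f1 z + 1/2 * g1 z) (\<lambda>z. 1/2 * f2 z + 1/2 * g2 z)"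
proof -
  have L: "L2 (\<lambda>z. 1/2 * f1 z + 1/2 * g1 z)" "L2 (\<lambda>z. 1/2 * f2 z + 1/2 * g2 z)"
    using L2_lincomb[OF assms(1,3)] L2_lincomb[OF assms(2,4)] by blast+
  have "(\<lambda>z. (f1 z - g1 z)\<^sup>2 + (f2 z - g2 z)\<^sup>2) = (\<lambda>z. 2 * ((f1 z)\<^sup>2 + (f2 z)\<^sup>2) + 2 * ((g1 z)\<^sup>2 + (g2 z)\<^sup>2)
      - 4 * ((1/2 * f1 z + 1/2 * g1 z)\<^sup>2 + (1/2 * f2 z + 1/2 * g2 z)\<^sup>2))"
    by (auto simp: fun_eq_iff power2_eq_square algebra_simps)
  then show ?thesis
    unfolding energy_def using assms[THEN L2_square] L[THEN L2_square] by simp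
qed

lemma energy_ge_part:
  assumes "L2 f1" "L2 f2"
  shows "(LINT z|lborel. (f1 z)\<^sup>2) \<le> energy f1 f2" "(LINT z|lborel. (f2 z)\<^sup>2) \<le> energy f1 f2"
  unfolding energy_def using assms[THEN L2_square] by (auto intro!: integral_mono)

lemma norm_integral_le_energy:
  assumes L: "L2 f1" "L2 f2" and S: "S \<in> sets borel" "emeasure lborel S < \<infinity>"
    and out: "\<And>z. z \<notin> S \<Longrightarrow> f1 z = 0 \<and> f2 z = 0"
  shows "(LINT z|lborel. norm (f1 z, f2 z))\<^sup>2 \<le> measure lborel S * energy f1 f2"
proof -
  note [measurable] = L[THEN L2_measurable]
  have sq: "(\<lambda>z. (norm (f1 z, f2 z))\<^sup>2) = (\<lambda>z. (f1 z)\<^sup>2 + (f2 z)\<^sup>2)"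
    by (simp add: norm_prod_def)
  have "(\<lambda>z. norm (f1 z, f2 z)) = (\<lambda>z. sqrt ((f1 z)\<^sup>2 + (f2 z)\<^sup>2))" by (simp add: norm_prod_def)
  then have meas: "(\<lambda>z. norm (f1 z, f2 z)) \<in> borel_measurable borel" by simp
  have Ln: "L2 (\<lambda>z. norm (f1 z, f2 z))"
    unfolding L2_def sq using meas L[THEN L2_square] by simp
  have "(\<lambda>z. indicator S z * norm (f1 z, f2 z)) = (\<lambda>z. norm (f1 z, f2 z))"
    using out by (auto simp: fun_eq_iff indicator_def zero_prod_def[symmetric])
  moreover have "(\<lambda>z. (indicator S z :: real)\<^sup>2) = indicator S" by (auto simp: indicator_def)
  ultimately show ?thesis
    using Cauchy_Schwarz_L2[OF L2_indicator[OF S] Ln] S unfolding sq energy_def by simp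
qed

text \<open>
  The midpoint of two clamped displacements is clamped, so by the parallelogram identity the gradients
  of a minimizing sequence form a Cauchy sequence in \<open>L\<^sup>2\<close>. A subsequence converges almost everywhere, and
  Fatou's lemma gives the limit gradient the minimal energy. The limit displacement is defined by the
  representation, so it satisfies the boundary condition; the bound \<open>M\<close> on the height makes integration in
  the vertical direction continuous on \<open>L\<^sup>2\<close>.
\<close>
lemma dirichlet_minimizer_exists:
  assumes h: "lower_semicontinuous h" "integrable lborel h" "\<And>x. 0 \<le> h x"
    and M: "0 < M" "\<And>x. h x < M"
    and ne: "clamped h u0 a1 a2"
  shows "\<exists>u. dirichlet_minimizer h u"
proof -
  let ?S = "subgraph h"
  have S: "?S \<in> sets borel" "emeasure lborel ?S < \<infinity>"
    using subgraph_open[OF h(1)] subgraph_finite_measure[OF h] by auto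
  note [measurable] = S(1)
  define E where "E = {energy g1 g2 | u g1 g2. clamped h u g1 g2}"
  define m where "m = Inf E"
  have Ene: "E \<noteq> {}" using ne by (auto simp: E_def)
  have bdd: "bdd_below E" using energy_nonneg by (auto simp: E_def bdd_below_def)
  have m_le: "m \<le> energy g1 g2" if "clamped h u g1 g2" for u g1 g2
    unfolding m_def using that by (intro cInf_lower[OF _ bdd]) (auto simp: E_def)
  have "\<exists>u g1 g2. clamped h u g1 g2 \<and> energy g1 g2 < m + 1 / real (Suc n)" for n
  proof -
    have "Inf E < m + 1 / real (Suc n)" unfolding m_def by simp
    then obtain e where "e \<in> E" "e < m + 1 / real (Suc n)" using cInf_lessD[OF Ene] by blast
    then show ?thesis unfolding E_def by blast
  qed
  then obtain us p q where seq: "\<And>n. clamped h (us n) (p n) (q n)" "\<And>n. energy (p n) (q n) < m + 1 / real (Suc n)"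
    by metis
  have sob: "sobolev ?S (us n) (p n) (q n)" for n using seq(1) by (simp add: clamped_def)
  have L: "L2 (us n)" "L2 (p n)" "L2 (q n)" for n using sob[of n] by (auto simp: sobolev_def)
  note [measurable] = L[THEN L2_measurable]
  have out: "us n z = 0" "p n z = 0" "q n z = 0" if "z \<notin> ?S" for n z
    using sobolev_outside[OF sob that] by blast+
  \<comment> \<open>Convexity makes the gradients a Cauchy sequence.\<close>
  have dist: "energy (\<lambda>z. p i z - p j z) (\<lambda>z. q i z - q j z) \<le> 4 / real (Suc n)" if "n \<le> i" "n \<le> j" for i j n
  proof -
    have "m \<le> energy (\<lambda>z. 1/2 * p i z + 1/2 * p j z) (\<lambda>z. 1/2 * q i z + 1/2 * q j z)"
      by (rule m_le[OF clamped_convex[OF h seq(1) seq(1)]])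
    moreover have "1 / real (Suc i) \<le> 1 / real (Suc n)" "1 / real (Suc j) \<le> 1 / real (Suc n)"
      using that by (simp_all add: frac_le)
    ultimately show ?thesis
      using seq(2)[of i] seq(2)[of j] unfolding energy_parallelogram[OF L(2,3) L(2,3)] by simp
  qed
  define s where "s n z = (p n z, q n z)" for n z
  have sint: "integrable lborel (s n)" for n
    unfolding s_def using L2_integrable_if_supported[OF _ S] L out by (intro integral_Pair(1)) blast+
  \<comment> \<open>The subgraph has finite measure, so convergence in \<open>L\<^sup>1\<close> follows, and with it almost everywhere
    convergence of a subsequence.\<close>
  have cauchyL1: "\<exists>N. \<forall>i\<ge>N. \<forall>j\<ge>N. (LINT z|lborel. norm (s i z - s j z)) < e" if e: "e > 0" for e
  proof -
    define A where "A = measure lborel ?S"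
    have A: "A \<ge> 0" by (simp add: A_def)
    obtain N where N: "4 * A / e\<^sup>2 < real N" using reals_Archimedean2 by blast
    have "(LINT z|lborel. norm (s i z - s j z)) < e" if ij: "i \<ge> N" "j \<ge> N" for i j
    proof -
      have "(LINT z|lborel. norm (s i z - s j z))\<^sup>2 \<le> A * energy (\<lambda>z. p i z - p j z) (\<lambda>z. q i z - q j z)"
        unfolding s_def A_def diff_Pair
        by (rule norm_integral_le_energy[OF L2_diff[OF L(2,2)] L2_diff[OF L(3,3)] S]) (simp add: out)
      also have "\<dots> \<le> A * (4 / real (Suc N))" using A dist[OF ij] by (intro mult_left_mono)
      also have "\<dots> < e\<^sup>2"
      proof -
        have "4 * A / e\<^sup>2 < real (Suc N)" using N by simp
        then show ?thesis using e by (simp add: field_simps)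
      qed
      finally show ?thesis using e by (simp add: power_less_imp_less_base)
    qed
    then show ?thesis by blast
  qed
  obtain r where r: "strict_mono r" "AE z in lborel. Cauchy (\<lambda>i. s (r i) z)"
    using cauchy_L1_AE_cauchy_subseq[OF sint cauchyL1] by blast
  define P where "P z = lim (\<lambda>i. p (r i) z)" for z
  define Q where "Q z = lim (\<lambda>i. q (r i) z)" for z
  have PQm [measurable]: "P \<in> borel_measurable borel" "Q \<in> borel_measurable borel"
    unfolding P_def[abs_def] Q_def[abs_def] by measurable
  have limAE: "AE z in lborel. (\<lambda>i. p (r i) z) \<longlonglongrightarrow> P z \<and> (\<lambda>i. q (r i) z) \<longlonglongrightarrow> Q z"
    using r(2)
  proof eventually_elim
    case (elim z)
    have "Cauchy (\<lambda>i. p (r i) z)" "Cauchy (\<lambda>i. q (r i) z)"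
      using bounded_linear.Cauchy[OF bounded_linear_fst elim] bounded_linear.Cauchy[OF bounded_linear_snd elim]
      by (simp_all add: s_def)
    then show ?case unfolding P_def Q_def by (simp add: Cauchy_convergent_iff convergent_LIMSEQ_iff)
  qed
  have PQ_out: "P z = 0" "Q z = 0" if "z \<notin> ?S" for z
    unfolding P_def Q_def using out(2,3)[OF that] by (simp_all add: limI)
  have ri: "i \<le> r i" for i using r(1) by (rule seq_suble)
  have LPQ: "L2 P" "L2 Q" and ePQ: "energy P Q \<le> m + e" if "e > 0" for e
  proof -
    have "\<forall>\<^sub>F i in sequentially. energy (p (r i)) (q (r i)) \<le> m + e"
    proof -
      obtain N where N: "1 / e < real N" using reals_Archimedean2 by blast
      have "energy (p (r i)) (q (r i)) \<le> m + e" if "i \<ge> N" for i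
      proof -
        have "1 / e < real (Suc (r i))" using N that ri[of i] by linarith
        then have "1 / real (Suc (r i)) < e" using \<open>e > 0\<close> by (simp add: field_simps)
        then show ?thesis using seq(2)[of "r i"] by linarith
      qed
      then show ?thesis by (auto simp: eventually_sequentially)
    qed
    from energy_fatou[OF L(2) L(3) PQm limAE this] show "L2 P" "L2 Q" "energy P Q \<le> m + e" .
  qed
  have LP: "L2 P" and LQ: "L2 Q" using LPQ[of 1] by auto
  have eP: "energy P Q \<le> m" by (rule field_le_epsilon) (rule ePQ)
  have close: "energy (\<lambda>z. P z - p n z) (\<lambda>z. Q z - q n z) \<le> 4 / real (Suc n)" for n
  proof (rule energy_fatou(3)[of "\<lambda>i z. p (r i) z - p n z" "\<lambda>i z. q (r i) z - q n z"])
    show "L2 (\<lambda>z. p (r i) z - p n z)" "L2 (\<lambda>z. q (r i) z - q n z)" for i by (intro L2_diff L)+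
    show "AE z in lborel. (\<lambda>i. p (r i) z - p n z) \<longlonglongrightarrow> P z - p n z \<and> (\<lambda>i. q (r i) z - q n z) \<longlonglongrightarrow> Q z - q n z"
      using limAE by eventually_elim (auto intro!: tendsto_intros)
    show "\<forall>\<^sub>F i in sequentially. energy (\<lambda>z. p (r i) z - p n z) (\<lambda>z. q (r i) z - q n z) \<le> 4 / real (Suc n)"
      unfolding eventually_sequentially
    proof (intro exI[of _ n] allI impI)
      fix i assume "n \<le> i"
      then have "n \<le> r i" using ri[of i] by linarith
      then show "energy (\<lambda>z. p (r i) z - p n z) (\<lambda>z. q (r i) z - q n z) \<le> 4 / real (Suc n)"
        by (rule dist) simp
    qed
  qed measurable
  define U where "U = zext ?S (\<lambda>z. fst z + vprim Q z)"
  have [measurable]: "U \<in> borel_measurable borel" unfolding U_def zext_def[abs_def]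
    using borel_measurable_comp_fst_snd(1)[of "\<lambda>x. x" "\<lambda>z. z" borel] by simp
  \<comment> \<open>The distance between the limit and the \<open>n\<close>-th displacement.\<close>
  define D where "D n = zext ?S (vprim (\<lambda>z. Q z - q n z))" for n
  have strip: "0 < snd z \<and> snd z < M" if "z \<in> ?S" for z
    using that M(2)[of "fst z"] by (auto simp: subgraph_def intro: less_trans)
  have LD: "L2 (D n)" "(LINT z|lborel. (D n z)\<^sup>2) \<le> M\<^sup>2 * (4 / real (Suc n))" for n
  proof -
    have z: "Q z - q n z = 0" if "z \<notin> ?S" for z using that PQ_out out by simp
    note V = L2_vprim[OF S(1) strip M(1) L2_diff[OF LQ L(3)[of n]] z, simplified]
    show "L2 (D n)" unfolding D_def by (rule V(1))
    have "(LINT z|lborel. (D n z)\<^sup>2) \<le> M\<^sup>2 * (LINT z|lborel. (Q z - q n z)\<^sup>2)"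
      unfolding D_def by (rule V(2))
    also have "\<dots> \<le> M\<^sup>2 * (4 / real (Suc n))"
      using energy_ge_part(2)[OF L2_diff[OF LP L(2)[of n]] L2_diff[OF LQ L(3)[of n]]] close[of n]
      by (intro mult_left_mono) auto
    finally show "(LINT z|lborel. (D n z)\<^sup>2) \<le> M\<^sup>2 * (4 / real (Suc n))" .
  qed
  have UD: "AE z in lborel. U z - us n z = D n z" for n
  proof -
    have i: "integrable lborel Q" "integrable lborel (q n)"
      using L2_integrable_if_supported[OF _ S] LQ L(3) PQ_out(2) out(3) by blast+
    have "AE z in lborel. vprim (\<lambda>z. Q z - q n z) z = vprim Q z - vprim (q n) z"
      using vprim_lincomb[OF i, of 1 "-1"] by simp
    then show ?thesis using seq(1)[of n, unfolded clamped_def, THEN conjunct2]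
    proof eventually_elim
      case (elim z)
      then show ?case using out(1)[of z n] by (cases "z \<in> ?S") (auto simp: U_def D_def)
    qed
  qed
  have LU: "L2 U"
  proof (rule L2_cong_AE[OF L2_add[OF LD(1)[of 0] L(1)[of 0]]])
    show "AE z in lborel. D 0 z + us 0 z = U z" using UD[of 0] by eventually_elim simp
  qed measurable
  have shrink: "(\<lambda>n. c * (4 / real (Suc n))) \<longlonglongrightarrow> 0" for c :: real
    using tendsto_mult_right_zero[OF LIMSEQ_inverse_real_of_nat, of "c * 4"] by (simp add: field_simps)
  have limU: "(\<lambda>n. LINT z|lborel. (U z - us n z)\<^sup>2) \<longlonglongrightarrow> 0"
  proof (rule Lim_null_comparison[OF _ shrink[of "M\<^sup>2"]])
    have "(LINT z|lborel. (U z - us n z)\<^sup>2) = (LINT z|lborel. (D n z)\<^sup>2)" for n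
    proof (rule integral_cong_AE)
      show "AE z in lborel. (U z - us n z)\<^sup>2 = (D n z)\<^sup>2" using UD[of n] by eventually_elim simp
      show "(\<lambda>z. (D n z)\<^sup>2) \<in> borel_measurable lborel" using L2_measurable[OF LD(1)] by simp
    qed measurable
    then show "\<forall>\<^sub>F n in sequentially. norm (LINT z|lborel. (U z - us n z)\<^sup>2) \<le> M\<^sup>2 * (4 / real (Suc n))"
      using LD(2) by simp
  qed
  have limP: "(\<lambda>n. LINT z|lborel. (P z - p n z)\<^sup>2) \<longlonglongrightarrow> 0"
  proof (rule Lim_null_comparison[OF _ shrink[of 1]])
    show "\<forall>\<^sub>F n in sequentially. norm (LINT z|lborel. (P z - p n z)\<^sup>2) \<le> 1 * (4 / real (Suc n))"
      using order_trans[OF energy_ge_part(1)[OF L2_diff[OF LP L(2)] L2_diff[OF LQ L(3)]] close] by simp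
  qed
  have limQ: "(\<lambda>n. LINT z|lborel. (Q z - q n z)\<^sup>2) \<longlonglongrightarrow> 0"
  proof (rule Lim_null_comparison[OF _ shrink[of 1]])
    show "\<forall>\<^sub>F n in sequentially. norm (LINT z|lborel. (Q z - q n z)\<^sup>2) \<le> 1 * (4 / real (Suc n))"
      using order_trans[OF energy_ge_part(2)[OF L2_diff[OF LP L(2)] L2_diff[OF LQ L(3)]] close] by simp
  qed
  have w1: "weak_deriv ?S (1, 0) U P"
    by (rule weak_deriv_limit[OF LU LP L(1) L(2) _ limU limP]) (use sob in \<open>simp add: sobolev_def\<close>)
  have w2: "weak_deriv ?S (0, 1) U Q"
    by (rule weak_deriv_limit[OF LU LQ L(1) L(3) _ limU limQ]) (use sob in \<open>simp add: sobolev_def\<close>)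
  have "clamped h U P Q"
    unfolding clamped_def sobolev_def using LU LP LQ w1 w2 PQ_out by (auto simp: U_def)
  note adm = clamped_imp_admissible[OF h(1) this]
  have "dirichlet_minimizer h U"
    unfolding dirichlet_minimizer_def
  proof (intro conjI allI impI)
    fix v assume "admissible_displacement h v"
    then obtain g1 g2 where v: "clamped h (zext ?S v) g1 g2" "dirichlet_energy ?S v = ennreal (energy g1 g2)"
      using admissible_displacementE[OF h(1)] by metis
    have "energy P Q \<le> energy g1 g2" using eP m_le[OF v(1)] by linarith
    then show "dirichlet_energy ?S U \<le> dirichlet_energy ?S v"
      unfolding adm(2) v(2) by (rule ennreal_leI)
  qed (rule adm(1))
  then show ?thesis by blast
qed

section \<open>A Poincare inequality on rectangles\<close>

lemma swap_image_rect: "prod.swap ` (A \<times> B) = B \<times> A"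
  by (auto simp: image_iff)

lemma weak_deriv_swap:
  assumes wd: "weak_deriv S (1, 0) u d"
    and [measurable]: "u \<in> borel_measurable borel" "d \<in> borel_measurable borel"
  shows "weak_deriv (prod.swap ` S) (0, 1) (\<lambda>z. u (prod.swap z)) (\<lambda>z. d (prod.swap z))"
  unfolding weak_deriv_def
proof (intro allI impI)
  fix \<phi> \<psi> assume tf: "test_function (prod.swap ` S) \<phi> \<psi>"
  note [measurable] = test_function_measurable[OF tf]
  let ?\<phi> = "\<lambda>z. \<phi> (prod.swap z)" and ?\<psi> = "\<lambda>z. prod.swap (\<psi> (prod.swap z))"
  have tf': "test_function S ?\<phi> ?\<psi>" using test_function_swap[OF tf] by (simp add: image_image)
  have dot: "prod.swap p \<bullet> (1, 0) = p \<bullet> (0, 1)" for p :: "real \<times> real" by (simp add: inner_prod_def)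
  have "(LINT z|lborel. u (prod.swap z) * (\<psi> z \<bullet> (0, 1)))
      = (LINT z|lborel. u (prod.swap (prod.swap z)) * (\<psi> (prod.swap z) \<bullet> (0, 1)))"
    by (rule lborel2_integral_swap[symmetric]) measurable
  also have "\<dots> = (LINT z|lborel. u z * (?\<psi> z \<bullet> (1, 0)))" by (simp add: dot)
  also have "\<dots> = - (LINT z|lborel. d z * ?\<phi> z)"
    using wd tf' unfolding weak_deriv_def by simp
  also have "(LINT z|lborel. d z * ?\<phi> z) = (LINT z|lborel. d (prod.swap (prod.swap z)) * \<phi> (prod.swap z))" by simp
  also have "\<dots> = (LINT z|lborel. d (prod.swap z) * \<phi> z)"
    by (rule lborel2_integral_swap) measurable
  finally show "(LINT z|lborel. u (prod.swap z) * (\<psi> z \<bullet> (0, 1))) = - (LINT z|lborel. d (prod.swap z) * \<phi> z)" .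
qed

lemma L2_swap: "L2 f \<Longrightarrow> L2 (\<lambda>z. f (prod.swap z))" for f :: "real \<times> real \<Rightarrow> real"
  using lborel2_integrable_swap[of "\<lambda>z. (f z)\<^sup>2"] by (auto simp: L2_def)

lemma nn_integral_lborel2_swap:
  assumes [measurable]: "f \<in> borel_measurable borel"
  shows "(\<integral>\<^sup>+z. f (prod.swap z) \<partial>lborel) = (\<integral>\<^sup>+z. f (z :: real \<times> real) \<partial>lborel)"
proof -
  have "(\<integral>\<^sup>+z. f z \<partial>distr lborel borel prod.swap) = (\<integral>\<^sup>+z. f (prod.swap z) \<partial>lborel)"
    by (rule nn_integral_distr) measurable
  then show ?thesis unfolding lborel2_distr_swap by simp
qed

text \<open>
  By \<open>rectangle_representation\<close> the difference is the vertical primitive of \<open>g\<close>, which \<open>L2_vprim\<close> bounds.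
\<close>
lemma vertical_oscillation:
  assumes rs: "r < s" and Q: "Q = {p<..<q} \<times> {r<..<s}"
    and u: "L2 u" and g: "L2 g" and wd: "weak_deriv Q (0, 1) u g"
  obtains v where "integrable lborel v"
    "(\<integral>\<^sup>+z. indicator Q z * ennreal ((u z - v (fst z))\<^sup>2) \<partial>lborel)
      \<le> ennreal ((s - r)\<^sup>2 * (LINT z|lborel. indicator Q z * (g z)\<^sup>2))"
proof -
  have Qm [measurable]: "Q \<in> sets borel" unfolding Q by (intro borel_open open_Times) auto
  have fin: "emeasure lborel Q < \<infinity>" unfolding Q by (rule emeasure_bounded_finite) (simp add: bounded_Times)
  note [measurable] = L2_measurable[OF u] L2_measurable[OF g]
  have iu: "integrable lborel (zext Q u)" "integrable lborel (zext Q g)"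
    unfolding zext_def by (intro L2_integrable_on u g fin Qm)+
  have [measurable]: "zext Q u \<in> borel_measurable borel" "zext Q g \<in> borel_measurable borel" using iu by auto
  have wd': "weak_deriv Q (0, 1) (zext Q u) (zext Q g)"
  proof (rule weak_deriv_cong[OF wd Qm])
    show "AE z in lborel. z \<in> Q \<longrightarrow> u z = zext Q u z \<and> g z = zext Q g z" by simp
  qed measurable
  have Lg: "L2 (zext Q g)"
  proof (rule L2_bound[OF _ g])
    show "\<bar>zext Q g z\<bar> \<le> \<bar>g z\<bar>" for z by (simp add: zext_def indicator_def)
  qed measurable
  obtain v where v: "integrable lborel v" "AE z in lborel. z \<in> Q \<longrightarrow> zext Q u z = v (fst z) + vprim (zext Q g) z"
    using rectangle_representation[OF rs Q iu _ wd'] by (auto simp: zext_def)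
  have sub: "r < snd z \<and> snd z < s" if "z \<in> Q" for z using that by (auto simp: Q)
  have g0: "zext Q g z = 0" if "z \<notin> Q" for z using that by simp
  note V = L2_vprim[OF Qm sub rs Lg g0]
  have "(\<integral>\<^sup>+z. indicator Q z * ennreal ((u z - v (fst z))\<^sup>2) \<partial>lborel)
      = (\<integral>\<^sup>+z. ennreal ((zext Q (vprim (zext Q g)) z)\<^sup>2) \<partial>lborel)"
  proof (rule nn_integral_cong_AE)
    show "AE z in lborel. indicator Q z * ennreal ((u z - v (fst z))\<^sup>2) = ennreal ((zext Q (vprim (zext Q g)) z)\<^sup>2)"
      using v(2)
    proof eventually_elim
      case (elim z)
      then show ?case by (cases "z \<in> Q") auto
    qed
  qed
  also have "\<dots> = ennreal (LINT z|lborel. (zext Q (vprim (zext Q g)) z)\<^sup>2)"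
    by (rule nn_integral_eq_integral[OF L2_square[OF V(1)]]) simp_all
  also have "\<dots> \<le> ennreal ((s - r)\<^sup>2 * (LINT z|lborel. (zext Q g z)\<^sup>2))"
    by (intro ennreal_leI V(2))
  also have "(\<lambda>z. (zext Q g z)\<^sup>2) = (\<lambda>z. indicator Q z * (g z)\<^sup>2)"
    by (auto simp: zext_def indicator_def)
  finally show ?thesis using that v(1) by blast
qed

text \<open>
  By \<open>vertical_oscillation\<close>, applied in both directions, \<open>u\<close> is close to a function \<open>v\<close> of the first
  and to a function \<open>w\<close> of the second variable. These are then close to each other, so both are close
  to the mean \<open>c\<close> of \<open>v\<close>.
\<close>
lemma rectangle_poincare:
  assumes pq: "p < q" and rs: "r < s" and Q: "Q = {p<..<q} \<times> {r<..<s}"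
    and u: "L2 u" and g: "L2 g1" "L2 g2"
    and wd: "weak_deriv Q (1, 0) u g1" "weak_deriv Q (0, 1) u g2"
    and l: "q - p \<le> l" "s - r \<le> l"
  obtains c where "(LINT z|lborel. indicator Q z * (u z - c)\<^sup>2)
    \<le> 6 * l\<^sup>2 * (LINT z|lborel. indicator Q z * ((g1 z)\<^sup>2 + (g2 z)\<^sup>2))"
proof -
  have Qm [measurable]: "Q \<in> sets borel" unfolding Q by (intro borel_open open_Times) auto
  have fin: "emeasure lborel Q < \<infinity>" unfolding Q by (rule emeasure_bounded_finite) (simp add: bounded_Times)
  note [measurable] = L2_measurable[OF u] g[THEN L2_measurable]
  define A where "A = (q - p)\<^sup>2 * (LINT z|lborel. indicator Q z * (g1 z)\<^sup>2)"
  define B where "B = (s - r)\<^sup>2 * (LINT z|lborel. indicator Q z * (g2 z)\<^sup>2)"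
  have AB: "0 \<le> A" "0 \<le> B"
    unfolding A_def B_def by (auto intro!: mult_nonneg_nonneg Bochner_Integration.integral_nonneg)
  obtain v where v: "integrable lborel v"
    "(\<integral>\<^sup>+z. indicator Q z * ennreal ((u z - v (fst z))\<^sup>2) \<partial>lborel) \<le> ennreal B"
    using vertical_oscillation[OF rs Q u g(2) wd(2)] unfolding B_def by blast
  let ?Q = "{r<..<s} \<times> {p<..<q}"
  have swQ: "prod.swap ` Q = ?Q" unfolding Q by (rule swap_image_rect)
  have indQ: "indicator ?Q (prod.swap z) = indicator Q z" for z :: "real \<times> real"
    by (cases z) (auto simp: Q indicator_def)
  have "weak_deriv ?Q (0, 1) (\<lambda>z. u (prod.swap z)) (\<lambda>z. g1 (prod.swap z))"
    using weak_deriv_swap[OF wd(1)] unfolding swQ by simp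
  from vertical_oscillation[OF pq refl L2_swap[OF u] L2_swap[OF g(1)] this]
  obtain w where w: "integrable lborel w"
    "(\<integral>\<^sup>+z. indicator ?Q z * ennreal ((u (prod.swap z) - w (fst z))\<^sup>2) \<partial>lborel)
      \<le> ennreal ((q - p)\<^sup>2 * (LINT z|lborel. indicator ?Q z * (g1 (prod.swap z))\<^sup>2))" by blast
  have [measurable]: "v \<in> borel_measurable borel" "w \<in> borel_measurable borel" using v w by auto
  have [measurable]: "?Q \<in> sets borel" by (intro borel_open open_Times) auto
  have "(\<integral>\<^sup>+z. indicator ?Q z * ennreal ((u (prod.swap z) - w (fst z))\<^sup>2) \<partial>lborel)
      = (\<integral>\<^sup>+z. indicator ?Q (prod.swap z) * ennreal ((u (prod.swap (prod.swap z)) - w (fst (prod.swap z)))\<^sup>2) \<partial>lborel)"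
    by (rule nn_integral_lborel2_swap[symmetric]) measurable
  also have "\<dots> = (\<integral>\<^sup>+z. indicator Q z * ennreal ((u z - w (snd z))\<^sup>2) \<partial>lborel)"
  proof (rule nn_integral_cong)
    fix z :: "real \<times> real"
    show "indicator ?Q (prod.swap z) * ennreal ((u (prod.swap (prod.swap z)) - w (fst (prod.swap z)))\<^sup>2)
      = indicator Q z * ennreal ((u z - w (snd z))\<^sup>2)"
      by (cases z) (auto simp: Q indicator_def)
  qed
  finally have w1: "(\<integral>\<^sup>+z. indicator Q z * ennreal ((u z - w (snd z))\<^sup>2) \<partial>lborel)
      = (\<integral>\<^sup>+z. indicator ?Q z * ennreal ((u (prod.swap z) - w (fst z))\<^sup>2) \<partial>lborel)" by simp
  have "(LINT z|lborel. indicator ?Q z * (g1 (prod.swap z))\<^sup>2) = (LINT z|lborel. indicator ?Q (prod.swap z) * (g1 (prod.swap (prod.swap z)))\<^sup>2)"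
    by (rule lborel2_integral_swap[symmetric]) measurable
  also have "\<dots> = (LINT z|lborel. indicator Q z * (g1 z)\<^sup>2)" by (simp add: indQ)
  finally have w2: "(\<integral>\<^sup>+z. indicator Q z * ennreal ((u z - w (snd z))\<^sup>2) \<partial>lborel) \<le> ennreal A"
    using w(2) unfolding w1 A_def by simp
  have sq: "ennreal ((a - b)\<^sup>2) \<le> 2 * ennreal ((x - a)\<^sup>2) + 2 * ennreal ((x - b)\<^sup>2)" for a b x :: real
  proof -
    have "0 \<le> ((x - a) + (x - b))\<^sup>2" by simp
    also have "\<dots> = 2 * (x - a)\<^sup>2 + 2 * (x - b)\<^sup>2 - (a - b)\<^sup>2" by (simp add: power2_eq_square algebra_simps)
    finally have "(a - b)\<^sup>2 \<le> 2 * (x - a)\<^sup>2 + 2 * (x - b)\<^sup>2" by simp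
    then have "ennreal ((a - b)\<^sup>2) \<le> ennreal (2 * (x - a)\<^sup>2 + 2 * (x - b)\<^sup>2)" by (rule ennreal_leI)
    also have "\<dots> = 2 * ennreal ((x - a)\<^sup>2) + 2 * ennreal ((x - b)\<^sup>2)"
      by (simp add: ennreal_plus ennreal_mult)
    finally show ?thesis .
  qed
  have sum2: "(\<integral>\<^sup>+z. indicator Q z * ennreal ((f z - k z)\<^sup>2) \<partial>lborel)
      \<le> 2 * a + 2 * b"
    if a: "(\<integral>\<^sup>+z. indicator Q z * ennreal ((x z - f z)\<^sup>2) \<partial>lborel) \<le> a"
      and b: "(\<integral>\<^sup>+z. indicator Q z * ennreal ((x z - k z)\<^sup>2) \<partial>lborel) \<le> b"
      and [measurable]: "f \<in> borel_measurable borel" "k \<in> borel_measurable borel" "x \<in> borel_measurable borel"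
    for f k x :: "real \<times> real \<Rightarrow> real" and a b
  proof -
    have "(\<integral>\<^sup>+z. indicator Q z * ennreal ((f z - k z)\<^sup>2) \<partial>lborel)
      \<le> (\<integral>\<^sup>+z. 2 * (indicator Q z * ennreal ((x z - f z)\<^sup>2)) + 2 * (indicator Q z * ennreal ((x z - k z)\<^sup>2)) \<partial>lborel)"
      by (intro nn_integral_mono) (auto simp: indicator_def intro: sq)
    also have "\<dots> = 2 * (\<integral>\<^sup>+z. indicator Q z * ennreal ((x z - f z)\<^sup>2) \<partial>lborel) + 2 * (\<integral>\<^sup>+z. indicator Q z * ennreal ((x z - k z)\<^sup>2) \<partial>lborel)"
      by (simp add: nn_integral_add nn_integral_cmult)
    also have "\<dots> \<le> 2 * a + 2 * b" by (intro add_mono mult_left_mono a b) auto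
    finally show ?thesis .
  qed
  have wv: "(\<integral>\<^sup>+z. indicator Q z * ennreal ((w (snd z) - v (fst z))\<^sup>2) \<partial>lborel) \<le> ennreal (2 * A + 2 * B)"
  proof -
    have "(\<integral>\<^sup>+z. indicator Q z * ennreal ((w (snd z) - v (fst z))\<^sup>2) \<partial>lborel) \<le> 2 * ennreal A + 2 * ennreal B"
      by (rule sum2[OF w2 v(2)]) measurable
    then show ?thesis using AB by (simp add: ennreal_plus ennreal_mult)
  qed
  define c where "c = (LINT x|lborel. indicator {p<..<q} x * v x) / (q - p)"
  have iv: "integrable lborel (\<lambda>x. indicator {p<..<q} x * v x)"
    using integrable_mult_indicator[OF _ v(1), of "{p<..<q}"] by simp
  \<comment> \<open>Jensen's inequality for the mean \<open>c\<close> of \<open>v\<close>.\<close>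
  have jensen: "ennreal ((q - p) * (a - c)\<^sup>2) \<le> (\<integral>\<^sup>+x. indicator {p<..<q} x * ennreal ((a - v x)\<^sup>2) \<partial>lborel)" for a
  proof -
    have ind: "integrable lborel (\<lambda>x. a * indicator {p<..<q} x - indicator {p<..<q} x * v x)"
      using iv by simp
    have "(q - p) * (a - c) = (LINT x|lborel. a * indicator {p<..<q} x - indicator {p<..<q} x * v x)"
      using iv pq by (simp add: c_def field_simps)
    then have "ennreal \<bar>(q - p) * (a - c)\<bar> \<le> (\<integral>\<^sup>+x. ennreal (norm (a * indicator {p<..<q} x - indicator {p<..<q} x * v x)) \<partial>lborel)"
      using integral_norm_bound_ennreal[OF ind] by simp
    also have "\<dots> = (\<integral>\<^sup>+x. indicator {p<..<q} x * (indicator {p<..<q} x * ennreal \<bar>a - v x\<bar>) \<partial>lborel)"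
      by (rule nn_integral_cong) (auto simp: indicator_def)
    finally have "(ennreal \<bar>(q - p) * (a - c)\<bar>)\<^sup>2
        \<le> (\<integral>\<^sup>+x. indicator {p<..<q} x * (indicator {p<..<q} x * ennreal \<bar>a - v x\<bar>) \<partial>lborel)\<^sup>2"
      by (rule power_mono) simp
    also have "\<dots> \<le> (\<integral>\<^sup>+x. (indicator {p<..<q} x)\<^sup>2 \<partial>lborel) * (\<integral>\<^sup>+x. (indicator {p<..<q} x * ennreal \<bar>a - v x\<bar>)\<^sup>2 \<partial>lborel)"
      by (rule Cauchy_Schwarz_nn_integral) measurable
    also have "(\<lambda>x. (indicator {p<..<q} x :: ennreal)\<^sup>2) = indicator {p<..<q}" by (auto simp: indicator_def)
    also have "(\<integral>\<^sup>+x. indicator {p<..<q} x \<partial>lborel) = ennreal (q - p)" using pq by simp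
    also have "(\<lambda>x. (indicator {p<..<q} x * ennreal \<bar>a - v x\<bar>)\<^sup>2) = (\<lambda>x. indicator {p<..<q} x * ennreal ((a - v x)\<^sup>2))"
      by (auto simp: indicator_def ennreal_power)
    finally have "ennreal (\<bar>(q - p) * (a - c)\<bar>\<^sup>2) \<le> ennreal (q - p) * (\<integral>\<^sup>+x. indicator {p<..<q} x * ennreal ((a - v x)\<^sup>2) \<partial>lborel)"
      by (simp add: ennreal_power)
    moreover have "\<bar>(q - p) * (a - c)\<bar>\<^sup>2 = (q - p) * ((q - p) * (a - c)\<^sup>2)"
      by (simp add: power2_eq_square algebra_simps)
    moreover have "ennreal ((q - p) * ((q - p) * (a - c)\<^sup>2)) = ennreal (q - p) * ennreal ((q - p) * (a - c)\<^sup>2)"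
      using pq by (simp add: ennreal_mult)
    ultimately show ?thesis using pq by (simp add: ennreal_mult_le_mult_iff)
  qed
  have ind_prod: "indicator Q (x, y) = (indicator {p<..<q} x * indicator {r<..<s} y :: ennreal)" for x y
    by (auto simp: Q indicator_def)
  have "(\<integral>\<^sup>+z. indicator Q z * ennreal ((w (snd z) - c)\<^sup>2) \<partial>lborel)
      = (\<integral>\<^sup>+z. indicator Q (prod.swap z) * ennreal ((w (snd (prod.swap z)) - c)\<^sup>2) \<partial>lborel)"
    by (rule nn_integral_lborel2_swap[symmetric]) measurable
  also have "\<dots> = (\<integral>\<^sup>+y. \<integral>\<^sup>+x. indicator Q (x, y) * ennreal ((w y - c)\<^sup>2) \<partial>lborel \<partial>lborel)"
    by (subst lborel2_nn_integral_fst) auto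
  also have "\<dots> \<le> (\<integral>\<^sup>+y. \<integral>\<^sup>+x. indicator Q (x, y) * ennreal ((w y - v x)\<^sup>2) \<partial>lborel \<partial>lborel)"
  proof (rule nn_integral_mono)
    fix y
    have "(\<integral>\<^sup>+x. indicator Q (x, y) * ennreal ((w y - c)\<^sup>2) \<partial>lborel)
        = (\<integral>\<^sup>+x. (indicator {r<..<s} y * ennreal ((w y - c)\<^sup>2)) * indicator {p<..<q} x \<partial>lborel)"
      by (rule nn_integral_cong) (simp add: ind_prod mult_ac)
    also have "\<dots> = indicator {r<..<s} y * ennreal ((w y - c)\<^sup>2) * (\<integral>\<^sup>+x. indicator {p<..<q} x \<partial>lborel)"
      by (rule nn_integral_cmult) measurable
    also have "\<dots> = indicator {r<..<s} y * ennreal ((q - p) * (w y - c)\<^sup>2)"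
      using pq by (simp add: ennreal_mult mult_ac)
    also have "\<dots> \<le> indicator {r<..<s} y * (\<integral>\<^sup>+x. indicator {p<..<q} x * ennreal ((w y - v x)\<^sup>2) \<partial>lborel)"
      by (intro mult_left_mono jensen) simp
    also have "\<dots> = (\<integral>\<^sup>+x. indicator {r<..<s} y * (indicator {p<..<q} x * ennreal ((w y - v x)\<^sup>2)) \<partial>lborel)"
      by (rule nn_integral_cmult[symmetric]) measurable
    also have "\<dots> = (\<integral>\<^sup>+x. indicator Q (x, y) * ennreal ((w y - v x)\<^sup>2) \<partial>lborel)"
      by (rule nn_integral_cong) (simp add: ind_prod mult_ac)
    finally show "(\<integral>\<^sup>+x. indicator Q (x, y) * ennreal ((w y - c)\<^sup>2) \<partial>lborel)
      \<le> (\<integral>\<^sup>+x. indicator Q (x, y) * ennreal ((w y - v x)\<^sup>2) \<partial>lborel)" .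
  qed
  also have "\<dots> = (\<integral>\<^sup>+z. indicator Q (prod.swap z) * ennreal ((w (snd (prod.swap z)) - v (fst (prod.swap z)))\<^sup>2) \<partial>lborel)"
    by (subst lborel2_nn_integral_fst) auto
  also have "\<dots> = (\<integral>\<^sup>+z. indicator Q z * ennreal ((w (snd z) - v (fst z))\<^sup>2) \<partial>lborel)"
    by (rule nn_integral_lborel2_swap) measurable
  finally have wc: "(\<integral>\<^sup>+z. indicator Q z * ennreal ((w (snd z) - c)\<^sup>2) \<partial>lborel) \<le> ennreal (2 * A + 2 * B)"
    using wv by (rule order_trans)
  have uw: "(\<integral>\<^sup>+z. indicator Q z * ennreal ((w (snd z) - u z)\<^sup>2) \<partial>lborel) \<le> ennreal A"
    using w2 by (simp add: power2_commute)
  have "(\<integral>\<^sup>+z. indicator Q z * ennreal ((u z - c)\<^sup>2) \<partial>lborel) \<le> 2 * ennreal A + 2 * ennreal (2 * A + 2 * B)"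
    by (rule sum2[OF uw wc]) measurable
  also have "\<dots> = ennreal (6 * A + 4 * B)"
  proof -
    have two: "2 * ennreal x + 2 * ennreal y = ennreal (2 * x + 2 * y)" if "0 \<le> x" "0 \<le> y" for x y
      using that by (simp add: ennreal_plus ennreal_mult)
    have "2 * A + 2 * (2 * A + 2 * B) = 6 * A + 4 * B" by simp
    moreover have "0 \<le> 2 * A + 2 * B" using AB by simp
    ultimately show ?thesis using two[OF AB(1), of "2 * A + 2 * B"] by (simp only:)
  qed
  also have "(\<lambda>z. indicator Q z * ennreal ((u z - c)\<^sup>2)) = (\<lambda>z. ennreal (indicator Q z * (u z - c)\<^sup>2))"
    by (auto simp: indicator_def)
  finally have nn: "(\<integral>\<^sup>+z. ennreal (indicator Q z * (u z - c)\<^sup>2) \<partial>lborel) \<le> ennreal (6 * A + 4 * B)" .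
  have "(LINT z|lborel. indicator Q z * (u z - c)\<^sup>2) \<le> 6 * A + 4 * B"
    by (rule integral_real_bounded[OF _ nn]) (use AB in simp)
  also have "\<dots> \<le> 6 * l\<^sup>2 * (LINT z|lborel. indicator Q z * ((g1 z)\<^sup>2 + (g2 z)\<^sup>2))"
  proof -
    define a where "a = (LINT z|lborel. indicator Q z * (g1 z)\<^sup>2)"
    define b where "b = (LINT z|lborel. indicator Q z * (g2 z)\<^sup>2)"
    have ab: "0 \<le> a" "0 \<le> b" unfolding a_def b_def by (auto intro!: Bochner_Integration.integral_nonneg)
    have i: "integrable lborel (\<lambda>z. indicator Q z * (g1 z)\<^sup>2)" "integrable lborel (\<lambda>z. indicator Q z * (g2 z)\<^sup>2)"
      using integrable_mult_indicator[OF _ L2_square[OF g(1)], of Q] integrable_mult_indicator[OF _ L2_square[OF g(2)], of Q]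
      by simp_all
    have "(LINT z|lborel. indicator Q z * ((g1 z)\<^sup>2 + (g2 z)\<^sup>2)) = a + b"
      using i by (simp add: a_def b_def distrib_left)
    moreover have "(q - p)\<^sup>2 * a \<le> l\<^sup>2 * a" "(s - r)\<^sup>2 * b \<le> l\<^sup>2 * b"
      using l pq rs ab by (auto intro!: mult_right_mono power_mono)
    moreover have "0 \<le> l\<^sup>2 * b" using ab by simp
    ultimately show ?thesis by (simp add: A_def B_def a_def[symmetric] b_def[symmetric] algebra_simps)
  qed
  finally show ?thesis by (rule that)
qed

section \<open>Replacing a displacement by its reflection\<close>

definition reflect :: "real \<Rightarrow> real \<times> real \<Rightarrow> real \<times> real" where
  "reflect \<tau> z = (fst z, 2 * \<tau> - snd z)"

lemma reflect_simps [simp]: "reflect \<tau> (reflect \<tau> z) = z" "fst (reflect \<tau> z) = fst z" "snd (reflect \<tau> z) = 2 * \<tau> - snd z"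
  by (auto simp: reflect_def)

lemma continuous_reflect: "continuous_on A (reflect \<tau>)"
  unfolding reflect_def[abs_def] by (intro continuous_intros)

lemma measurable_reflect [measurable]: "reflect \<tau> \<in> borel_measurable borel"
  by (rule borel_measurable_continuous_onI) (rule continuous_reflect)

lemma nn_integral_reflect:
  assumes [measurable]: "f \<in> borel_measurable borel"
  shows "(\<integral>\<^sup>+z. f (reflect \<tau> z) \<partial>lborel) = (\<integral>\<^sup>+z. f z \<partial>lborel)"
proof -
  have "(\<integral>\<^sup>+z. f (reflect \<tau> z) \<partial>lborel) = (\<integral>\<^sup>+x. \<integral>\<^sup>+y. f (x, 2 * \<tau> - y) \<partial>lborel \<partial>lborel)"
    by (subst lborel2_nn_integral_fst) (auto simp: reflect_def)
  also have "\<dots> = (\<integral>\<^sup>+x. \<integral>\<^sup>+y. f (x, y) \<partial>lborel \<partial>lborel)"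
  proof (rule nn_integral_cong)
    fix x
    show "(\<integral>\<^sup>+y. f (x, 2 * \<tau> - y) \<partial>lborel) = (\<integral>\<^sup>+y. f (x, y) \<partial>lborel)"
      using nn_integral_real_affine[of "\<lambda>y. f (x, y)" "-1" "2 * \<tau>"] by simp
  qed
  also have "\<dots> = (\<integral>\<^sup>+z. f z \<partial>lborel)" by (subst lborel2_nn_integral_fst) auto
  finally show ?thesis .
qed

lemma distr_reflect: "distr lborel borel (reflect \<tau>) = lborel"
proof (rule measure_eqI)
  fix A assume "A \<in> sets (distr lborel borel (reflect \<tau>))"
  then have A [measurable]: "A \<in> sets borel" by simp
  have "emeasure (distr lborel borel (reflect \<tau>)) A = (\<integral>\<^sup>+z. indicator A z \<partial>distr lborel borel (reflect \<tau>))" by simp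
  also have "\<dots> = (\<integral>\<^sup>+z. indicator A (reflect \<tau> z) \<partial>lborel)" by (rule nn_integral_distr) measurable
  also have "\<dots> = (\<integral>\<^sup>+z. indicator A z \<partial>lborel)" by (rule nn_integral_reflect) measurable
  finally show "emeasure (distr lborel borel (reflect \<tau>)) A = emeasure lborel A" by simp
qed simp

lemma integral_reflect:
  fixes f :: "real \<times> real \<Rightarrow> real"
  assumes "f \<in> borel_measurable borel"
  shows "(LINT z|lborel. f (reflect \<tau> z)) = (LINT z|lborel. f z)"
proof -
  have "(LINT z|distr lborel borel (reflect \<tau>). f z) = (LINT z|lborel. f (reflect \<tau> z))"
    by (rule integral_distr) (use assms in measurable)
  then show ?thesis by (simp add: distr_reflect)
qed

lemma integrable_reflect:
  fixes f :: "real \<times> real \<Rightarrow> real"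
  assumes "integrable lborel f"
  shows "integrable lborel (\<lambda>z. f (reflect \<tau> z))"
proof -
  have "integrable (distr lborel borel (reflect \<tau>)) f" using assms by (simp add: distr_reflect)
  then show ?thesis by (rule integrable_distr[rotated]) measurable
qed

lemma L2_reflect: "L2 f \<Longrightarrow> L2 (\<lambda>z. f (reflect \<tau> z))"
  using integrable_reflect[of "\<lambda>z. (f z)\<^sup>2" \<tau>] measurable_compose[OF measurable_reflect[of \<tau>], of f borel]
  unfolding L2_def by simp

lemma AE_snd_neq: "AE z in (lborel :: (real \<times> real) measure). snd z \<noteq> \<tau>"
proof -
  have "AE x in lborel. x \<noteq> \<tau>" by (rule AE_lborel_singleton)
  then have "AE z in (lborel :: (real \<times> real) measure). fst z \<noteq> \<tau>" by (rule AE_lborel2_fst)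
  then have "AE z in (lborel :: (real \<times> real) measure). snd (prod.swap z) \<noteq> \<tau>" by simp
  then show ?thesis by (rule AE_lborel2_swap)
qed

lemma L2_integral_limit:
  fixes bs :: "nat \<Rightarrow> real \<times> real \<Rightarrow> real"
  assumes f: "L2 f" and K: "compact K"
    and m: "\<And>n. bs n \<in> borel_measurable borel"
    and bound: "\<And>n z. \<bar>bs n z\<bar> \<le> B" "\<And>n z. z \<notin> K \<Longrightarrow> bs n z = 0"
    and lim: "AE z in lborel. (\<lambda>n. bs n z) \<longlonglongrightarrow> c z" and c: "c \<in> borel_measurable borel"
  shows "(\<lambda>n. LINT z|lborel. f z * bs n z) \<longlonglongrightarrow> (LINT z|lborel. f z * c z)"
proof (rule integral_dominated_convergence[where w="\<lambda>z. B * \<bar>indicator K z * f z\<bar>"])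
  note [measurable] = L2_measurable[OF f] m c
  have Km: "K \<in> sets borel" "emeasure lborel K < \<infinity>"
    using emeasure_compact_finite[OF K] compact_imp_closed[OF K] by auto
  show "integrable lborel (\<lambda>z. B * \<bar>indicator K z * f z\<bar>)"
    using L2_integrable_on[OF f Km] by simp
  show "AE z in lborel. (\<lambda>n. f z * bs n z) \<longlonglongrightarrow> f z * c z"
    using lim by eventually_elim (intro tendsto_intros)
  show "AE z in lborel. norm (f z * bs n z) \<le> B * \<bar>indicator K z * f z\<bar>" for n
  proof (rule AE_I2)
    fix z
    show "norm (f z * bs n z) \<le> B * \<bar>indicator K z * f z\<bar>"
    proof (cases "z \<in> K")
      case True
      have "\<bar>f z\<bar> * \<bar>bs n z\<bar> \<le> \<bar>f z\<bar> * B" using bound(1) by (intro mult_left_mono) auto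
      then show ?thesis using True by (simp add: abs_mult mult.commute)
    qed (simp add: bound)
  qed
qed (use L2_measurable[OF f] m c in measurable)

lemma test_function_reflect:
  fixes \<phi> :: "real \<times> real \<Rightarrow> real"
  assumes tf: "test_function S \<phi> \<psi>"
  shows "test_function UNIV (\<lambda>z. \<phi> (reflect \<tau> z))
    (\<lambda>z. (\<psi> (reflect \<tau> z) \<bullet> (1, 0), - (\<psi> (reflect \<tau> z) \<bullet> (0, 1))))"
proof -
  obtain K where K: "compact K" "\<And>z. z \<notin> K \<Longrightarrow> \<phi> z = 0" using test_functionE[OF tf] by metis
  have "((\<lambda>z. \<phi> (reflect \<tau> z)) has_derivative
      (\<lambda>v. (\<psi> (reflect \<tau> z) \<bullet> (1, 0), - (\<psi> (reflect \<tau> z) \<bullet> (0, 1))) \<bullet> v)) (at z)" for z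
  proof -
    have "(reflect \<tau> has_derivative (\<lambda>v. (fst v, - snd v))) (at z)"
      unfolding reflect_def[abs_def] by (auto intro!: derivative_eq_intros)
    moreover have "(\<phi> has_derivative (\<lambda>v. \<psi> (reflect \<tau> z) \<bullet> v)) (at (reflect \<tau> z))"
      using tf unfolding test_function_def by blast
    ultimately have "((\<lambda>z. \<phi> (reflect \<tau> z)) has_derivative (\<lambda>v. \<psi> (reflect \<tau> z) \<bullet> (fst v, - snd v))) (at z)"
      using has_derivative_compose by blast
    then show ?thesis by (simp add: inner_prod_def)
  qed
  moreover have "continuous_on UNIV (\<lambda>z. (\<psi> (reflect \<tau> z) \<bullet> (1, 0), - (\<psi> (reflect \<tau> z) \<bullet> (0, 1))))"
    by (intro continuous_intros continuous_on_compose2[OF test_function_continuous(2)[OF tf]] continuous_reflect) auto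
  moreover have "compact (reflect \<tau> ` K)" using K continuous_reflect by (intro compact_continuous_image)
  moreover have "\<phi> (reflect \<tau> z) = 0" if "z \<notin> reflect \<tau> ` K" for z
    using that K(2) by (metis image_eqI reflect_simps(1))
  ultimately show ?thesis unfolding test_function_def by blast
qed

lemma test_function_mult_snd:
  fixes \<phi> :: "real \<times> real \<Rightarrow> real"
  assumes tf: "test_function S \<phi> \<psi>" and f: "\<And>y. (f has_real_derivative f' y) (at y)" "continuous_on UNIV f'"
  shows "test_function S (\<lambda>z. \<phi> z * f (snd z)) (\<lambda>z. f (snd z) *\<^sub>R \<psi> z + \<phi> z *\<^sub>R (0, f' (snd z)))"
proof (rule test_function_mult[OF tf])
  fix z :: "real \<times> real"
  have "((\<lambda>z. f (snd z)) has_derivative (\<lambda>v. f' (snd z) * snd v)) (at z)"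
    using DERIV_compose_FDERIV[OF f(1)] has_derivative_snd[OF has_derivative_ident]
    by (fastforce simp: mult.commute)
  then show "((\<lambda>z. f (snd z)) has_derivative (\<lambda>v. (0, f' (snd z)) \<bullet> v)) (at z)" by (simp add: inner_prod_def)
next
  show "continuous_on UNIV (\<lambda>z. (0 :: real, f' (snd z)))"
    by (intro continuous_intros continuous_on_compose2[OF f(2)]) auto
qed

text \<open>
  The sets \<open>S\<close> and \<open>T\<close> differ only above height \<open>\<tau>\<close> over the interval \<open>{a<..<b}\<close>. There the
  displacement \<open>u\<close> of \<open>S\<close> is discarded and \<open>T\<close> receives the mirror image of what \<open>u\<close> is in the layer
  \<open>{\<tau> - l..\<tau>}\<close>, cut off to zero at distance \<open>l\<close>. As \<open>T\<close> has no points over \<open>a\<close> and \<open>b\<close> above height \<open>\<tau>\<close>,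
  nothing needs to match there.
\<close>
locale reflection =
  fixes a b \<tau> l :: real and S T :: "(real \<times> real) set" and u g1 g2 :: "real \<times> real \<Rightarrow> real"
  assumes l: "0 < l"
    and openS: "open S" and openT: "open T"
    and sob: "sobolev S u g1 g2"
    and agree: "S - {a<..<b} \<times> {\<tau>..} = T - {a<..<b} \<times> {\<tau>..}"
    and base: "{a<..<b} \<times> {\<tau> - l..\<tau>} \<subseteq> S"
    and sides: "\<And>y. \<tau> \<le> y \<Longrightarrow> (a, y) \<notin> T \<and> (b, y) \<notin> T"
begin

definition P :: "(real \<times> real) set" where "P = {a<..<b} \<times> {\<tau>..}"

text \<open>
  One at height \<open>\<tau>\<close>, zero below the layer; the slope is at most \<open>2 / l\<close>.
\<close>
definition cut :: "real \<Rightarrow> real" where "cut y = smoothstep ((y - \<tau>) / l + 1)"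
definition cut' :: "real \<Rightarrow> real" where "cut' y = smoothstep' ((y - \<tau>) / l + 1) / l"

text \<open>
  The competitor and the gradient it ought to have. The chain rule turns the sign of the vertical
  derivative around.
\<close>
definition w :: "real \<times> real \<Rightarrow> real" where
  "w z = indicator T z * (if z \<in> P then cut (2 * \<tau> - snd z) * u (reflect \<tau> z) else u z)"

definition G1 :: "real \<times> real \<Rightarrow> real" where
  "G1 z = indicator T z * (if z \<in> P then cut (2 * \<tau> - snd z) * g1 (reflect \<tau> z) else g1 z)"

definition G2 :: "real \<times> real \<Rightarrow> real" where
  "G2 z = indicator T z * (if z \<in> P then - cut' (2 * \<tau> - snd z) * u (reflect \<tau> z)
      - cut (2 * \<tau> - snd z) * g2 (reflect \<tau> z) else g2 z)"

lemma L: "L2 u" "L2 g1" "L2 g2" using sob by (auto simp: sobolev_def)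

lemma measurable_setup [measurable]:
  "u \<in> borel_measurable borel" "g1 \<in> borel_measurable borel" "g2 \<in> borel_measurable borel"
  "T \<in> sets borel" "S \<in> sets borel" "P \<in> sets borel" "cut \<in> borel_measurable borel" "cut' \<in> borel_measurable borel"
proof -
  show "u \<in> borel_measurable borel" "g1 \<in> borel_measurable borel" "g2 \<in> borel_measurable borel"
    using L by (auto simp: L2_def)
  show "T \<in> sets borel" "S \<in> sets borel" using openS openT by auto
  have "P = ({a<..<b} \<times> UNIV) \<inter> (UNIV \<times> {\<tau>..})" by (auto simp: P_def)
  moreover have "open ({a<..<b} \<times> (UNIV :: real set))" "closed ((UNIV :: real set) \<times> {\<tau>..})"
    by (auto intro: open_Times closed_Times)
  ultimately show "P \<in> sets borel" by auto
  show "cut \<in> borel_measurable borel" "cut' \<in> borel_measurable borel"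
    unfolding cut_def[abs_def] cut'_def[abs_def] by measurable
qed

lemma cut_deriv: "(cut has_real_derivative cut' y) (at y)"
  unfolding cut_def[abs_def] cut'_def using l by (auto intro!: derivative_eq_intros)

lemma cut_continuous: "continuous_on UNIV cut" "continuous_on UNIV cut'"
  unfolding cut_def[abs_def] cut'_def[abs_def] using l by (intro continuous_intros; simp)+

lemma cut_bounds: "0 \<le> cut y" "cut y \<le> 1" "0 \<le> cut' y" "cut' y \<le> 2 / l"
  using smoothstep_bounds smoothstep'_bounds l by (auto simp: cut_def cut'_def divide_right_mono)

lemma cut_zero: "y \<le> \<tau> - l \<Longrightarrow> cut y = 0" "y \<le> \<tau> - l \<Longrightarrow> cut' y = 0"
proof -
  assume "y \<le> \<tau> - l"
  then have "(y - \<tau>) / l + 1 \<le> 0" using l by (simp add: field_simps)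
  then show "cut y = 0" "cut' y = 0" by (simp_all add: cut_def cut'_def)
qed

lemma cut_one: "\<tau> \<le> y \<Longrightarrow> cut y = 1"
  using l by (simp add: cut_def)

lemma w_L2: "L2 w" "L2 G1" "L2 G2"
proof -
  have sum: "L2 f" if "f \<in> borel_measurable borel" "L2 h1" "L2 h2" "L2 h3"
    "\<And>z. \<bar>f z\<bar> \<le> \<bar>h1 z\<bar> + \<bar>h2 z\<bar> + c * \<bar>h3 z\<bar>" "0 \<le> c" for f h1 h2 h3 :: "real \<times> real \<Rightarrow> real" and c
  proof (rule L2_bound[OF that(1)])
    have abs: "L2 (\<lambda>z. \<bar>h z\<bar>)" if "L2 h" for h :: "real \<times> real \<Rightarrow> real"
      using L2_measurable[OF that] by (intro L2_bound[OF _ that]) auto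
    show "L2 (\<lambda>z. \<bar>h1 z\<bar> + \<bar>h2 z\<bar> + c * \<bar>h3 z\<bar>)" by (intro L2_add L2_cmult abs that)
    show "\<bar>f z\<bar> \<le> \<bar>\<bar>h1 z\<bar> + \<bar>h2 z\<bar> + c * \<bar>h3 z\<bar>\<bar>" for z using that(5)[of z] by linarith
  qed
  have c1: "\<bar>cut y * x\<bar> \<le> \<bar>x\<bar>" for x y
    using cut_bounds(1,2)[of y] by (simp add: abs_mult mult_left_le_one_le)
  have c2: "\<bar>cut' y * x\<bar> \<le> 2 / l * \<bar>x\<bar>" for x y
    using cut_bounds(3,4)[of y] by (simp only: abs_mult) (intro mult_right_mono; simp)
  have l0: "0 \<le> 2 / l" using l by simp
  show "L2 w"
  proof (rule sum[OF _ L(1) L2_reflect[OF L(1), of \<tau>] L(1), of _ 0])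
    show "\<bar>w z\<bar> \<le> \<bar>u z\<bar> + \<bar>u (reflect \<tau> z)\<bar> + 0 * \<bar>u z\<bar>" for z
      using c1[of "2 * \<tau> - snd z" "u (reflect \<tau> z)"] by (auto simp: w_def indicator_def intro: order_trans)
  qed (simp_all add: w_def[abs_def])
  show "L2 G1"
  proof (rule sum[OF _ L(2) L2_reflect[OF L(2), of \<tau>] L(1), of _ 0])
    show "\<bar>G1 z\<bar> \<le> \<bar>g1 z\<bar> + \<bar>g1 (reflect \<tau> z)\<bar> + 0 * \<bar>u z\<bar>" for z
      using c1[of "2 * \<tau> - snd z" "g1 (reflect \<tau> z)"] by (auto simp: G1_def indicator_def intro: order_trans)
  qed (simp_all add: G1_def[abs_def])
  show "L2 G2"
  proof (rule sum[OF _ L(3) L2_reflect[OF L(3), of \<tau>] L2_reflect[OF L(1), of \<tau>] _ l0])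
    show "\<bar>G2 z\<bar> \<le> \<bar>g2 z\<bar> + \<bar>g2 (reflect \<tau> z)\<bar> + 2 / l * \<bar>u (reflect \<tau> z)\<bar>" for z
    proof (cases "z \<in> T \<and> z \<in> P")
      case True
      then have "\<bar>G2 z\<bar> \<le> \<bar>cut' (2 * \<tau> - snd z) * u (reflect \<tau> z)\<bar> + \<bar>cut (2 * \<tau> - snd z) * g2 (reflect \<tau> z)\<bar>"
        by (simp add: G2_def)
      then show ?thesis
        using c1[of "2 * \<tau> - snd z" "g2 (reflect \<tau> z)"] c2[of "2 * \<tau> - snd z" "u (reflect \<tau> z)"] by linarith
    next
      case False
      then have "\<bar>G2 z\<bar> \<le> \<bar>g2 z\<bar>" by (auto simp: G2_def indicator_def)
      moreover have "0 \<le> 2 / l * \<bar>u (reflect \<tau> z)\<bar>" using l by simp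
      ultimately show ?thesis by linarith
    qed
  qed (simp_all add: G2_def[abs_def])
qed

end

lemma test_function_restrict:
  assumes "test_function S \<phi> \<psi>" "compact K" "K \<subseteq> T" "\<And>z. z \<notin> K \<Longrightarrow> \<phi> z = 0"
  shows "test_function T \<phi> \<psi>"
  using assms unfolding test_function_def by blast

lemma closure_strip: "closure ({a<..<b} \<times> (UNIV :: real set)) \<subseteq> {a..b} \<times> UNIV" for a b :: real
  by (rule closure_minimal) (auto intro: closed_Times)

lemma frontier_strip:
  fixes a b :: real and z :: "real \<times> real"
  assumes "z \<in> frontier ({a<..<b} \<times> (UNIV :: real set))"
  shows "fst z = a \<or> fst z = b"
proof -
  have "open ({a<..<b} \<times> (UNIV :: real set))" by (intro open_Times) auto
  then have "z \<notin> {a<..<b} \<times> UNIV" "z \<in> closure ({a<..<b} \<times> (UNIV :: real set))"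
    using assms by (auto simp: frontier_def interior_open)
  then have "fst z \<notin> {a<..<b}" "fst z \<in> {a..b}"
    using closure_strip[of a b] by (auto simp: mem_Times_iff)
  then show ?thesis by auto
qed

context reflection
begin

definition Dstrip :: "(real \<times> real) set" where "Dstrip = {a<..<b} \<times> UNIV"

text \<open>
  Regularizes the jump at height \<open>\<tau>\<close> from below, over the length \<open>1 / \<nu>\<close>.
\<close>
definition step :: "real \<Rightarrow> real \<Rightarrow> real" where "step \<nu> y = smoothstep (\<nu> * (y - \<tau>) + 1)"
definition step' :: "real \<Rightarrow> real \<Rightarrow> real" where "step' \<nu> y = \<nu> * smoothstep' (\<nu> * (y - \<tau>) + 1)"

lemma step_deriv: "(step \<nu> has_real_derivative step' \<nu> y) (at y)"
  unfolding step_def[abs_def] step'_def by (auto intro!: derivative_eq_intros)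

lemma step_continuous: "continuous_on UNIV (step \<nu>)" "continuous_on UNIV (step' \<nu>)"
  unfolding step_def[abs_def] step'_def[abs_def] by (intro continuous_intros)+

lemma step_measurable [measurable]: "step \<nu> \<in> borel_measurable borel" "step' \<nu> \<in> borel_measurable borel"
  using step_continuous by (auto intro: borel_measurable_continuous_onI)

lemma step_bounds: "0 \<le> step \<nu> y" "step \<nu> y \<le> 1"
  using smoothstep_bounds by (auto simp: step_def)

lemma step_below:
  assumes "0 < \<nu>" "y \<le> \<tau> - 1 / \<nu>" shows "step \<nu> y = 0" "step' \<nu> y = 0"
proof -
  have "\<nu> * (y - \<tau>) \<le> \<nu> * (- (1 / \<nu>))" using assms by (intro mult_left_mono) auto
  then have "\<nu> * (y - \<tau>) + 1 \<le> 0" using assms(1) by simp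
  then show "step \<nu> y = 0" "step' \<nu> y = 0" by (simp_all add: step_def step'_def)
qed

lemma step_above:
  assumes "0 < \<nu>" "\<tau> \<le> y" shows "step \<nu> y = 1" "step' \<nu> y = 0"
  using assms by (simp_all add: step_def step'_def)

lemma step'_bound: "0 < \<nu> \<Longrightarrow> \<bar>step' \<nu> y\<bar> \<le> 2 * \<nu>"
  using smoothstep'_bounds[of "\<nu> * (y - \<tau>) + 1"] by (simp add: step'_def abs_mult)

lemma Dstrip_sets [measurable]: "Dstrip \<in> sets borel"
  unfolding Dstrip_def by (intro borel_open open_Times) auto

text \<open>
  The support of a test function on \<open>T\<close> is compact and \<open>T\<close> omits the two closed half lines over \<open>a\<close>
  and \<open>b\<close> from height \<open>\<tau>\<close> on, so the support stays away from them even slightly below \<open>\<tau>\<close>.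
\<close>
lemma support_avoids_sides:
  assumes K: "compact K" "K \<subseteq> T"
  obtains \<kappa> where "\<kappa> > 0" "\<And>z. fst z = a \<or> fst z = b \<Longrightarrow> \<tau> - \<kappa> \<le> snd z \<Longrightarrow> z \<notin> K"
proof -
  define C where "C = {a, b} \<times> {\<tau>..}"
  have clC: "closed C" unfolding C_def by (intro closed_Times) auto
  have KC: "K \<inter> C = {}" using K(2) sides by (auto simp: C_def)
  have "\<exists>d>0. \<forall>x\<in>K. \<forall>y\<in>C. d \<le> dist x y" by (rule separate_compact_closed[OF K(1) clC KC])
  then obtain d where d: "0 < d" "\<forall>x\<in>K. \<forall>y\<in>C. d \<le> dist x y" by (elim exE conjE)
  have "z \<notin> K" if z: "fst z = a \<or> fst z = b" "\<tau> - d / 2 \<le> snd z" for z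
  proof
    assume zK: "z \<in> K"
    have "(fst z, max \<tau> (snd z)) \<in> C" using z(1) by (simp add: C_def)
    then have "d \<le> dist z (fst z, max \<tau> (snd z))" using d(2) zK by (simp only:)
    also have "\<dots> = \<bar>snd z - max \<tau> (snd z)\<bar>"
      using dist_Pair_Pair[of "fst z" "snd z" "fst z" "max \<tau> (snd z)"] by (simp add: dist_real_def)
    also have "\<dots> \<le> d / 2" using z(2) d(1) by (auto simp: max_def)
    finally show False using d(1) by simp
  qed
  then show ?thesis using d(1) that[of "d / 2"] by simp
qed

context
  fixes \<phi> :: "real \<times> real \<Rightarrow> real" and \<psi> K \<kappa> \<nu>
  assumes tf: "test_function T \<phi> \<psi>"
    and K: "compact K" "K \<subseteq> T" "\<And>z. z \<notin> K \<Longrightarrow> \<phi> z = 0"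
    and \<kappa>: "\<And>z. fst z = a \<or> fst z = b \<Longrightarrow> \<tau> - \<kappa> \<le> snd z \<Longrightarrow> z \<notin> K" "\<kappa> > 0"
    and \<nu>: "0 < \<nu>" "1 / \<nu> \<le> \<kappa>"
begin

text \<open>
  A test function on \<open>T\<close> yields two on \<open>S\<close>: this one keeps what lies outside the replaced part, the
  next one carries what lies inside back into the layer by reflection.
\<close>
definition lowered :: "real \<times> real \<Rightarrow> real" where
  "lowered z = \<phi> z * (1 - indicator Dstrip z * step \<nu> (snd z))"

definition lowered' :: "real \<times> real \<Rightarrow> real \<times> real" where
  "lowered' z = (1 - indicator Dstrip z * step \<nu> (snd z)) *\<^sub>R \<psi> z - (indicator Dstrip z * \<phi> z * step' \<nu> (snd z)) *\<^sub>R (0, 1)"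

lemma test_function_lowered: "test_function S lowered lowered'"
proof -
  define F where "F z = \<phi> z * step \<nu> (snd z)" for z
  define F' where "F' z = step \<nu> (snd z) *\<^sub>R \<psi> z + \<phi> z *\<^sub>R (0, step' \<nu> (snd z))" for z
  have tF: "test_function T F F'"
    unfolding F_def F'_def by (rule test_function_mult_snd[OF tf step_deriv step_continuous(2)])
  define K1 where "K1 = K \<inter> {z. \<tau> - 1 / \<nu> \<le> snd z}"
  have "closed {z :: real \<times> real. \<tau> - 1 / \<nu> \<le> snd z}" by (intro closed_Collect_le continuous_intros)
  then have K1: "compact K1" unfolding K1_def using K(1) by (simp add: compact_Int_closed)
  have "test_function (T \<inter> Dstrip) (\<lambda>z. indicator Dstrip z * F z) (\<lambda>z. indicator Dstrip z *\<^sub>R F' z)"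
  proof (rule test_function_cut[OF tF K1])
    show "K1 \<subseteq> T" using K(2) by (auto simp: K1_def)
    show "F z = 0" if "z \<notin> K1" for z
    proof (cases "z \<in> K")
      case True
      with that have "snd z \<le> \<tau> - 1 / \<nu>" by (simp add: K1_def)
      then show ?thesis using step_below(1)[OF \<nu>(1)] by (simp add: F_def)
    qed (simp add: F_def K(3))
    show "K1 \<inter> frontier Dstrip = {}"
    proof -
      have "z \<notin> K1" if "z \<in> frontier Dstrip" for z
      proof
        assume "z \<in> K1"
        then have "z \<in> K" "\<tau> - \<kappa> \<le> snd z" using \<nu>(2) by (auto simp: K1_def)
        then show False using \<kappa>(1) frontier_strip[of z a b] that by (auto simp: Dstrip_def)
      qed
      then show ?thesis by blast
    qed
  qed
  then have "test_function T (\<lambda>z. indicator Dstrip z * F z) (\<lambda>z. indicator Dstrip z *\<^sub>R F' z)"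
    by (rule test_function_mono) blast
  from test_function_add[OF tf test_function_scale[OF this, of "-1"]]
  have "test_function T (\<lambda>z. \<phi> z + indicator Dstrip z * F z * -1) (\<lambda>z. \<psi> z + -1 *\<^sub>R indicator Dstrip z *\<^sub>R F' z)" .
  moreover have "(\<lambda>z. \<phi> z + indicator Dstrip z * F z * -1) = lowered"
    by (auto simp: fun_eq_iff lowered_def F_def algebra_simps)
  moreover have "(\<lambda>z. \<psi> z + -1 *\<^sub>R indicator Dstrip z *\<^sub>R F' z) = lowered'"
    by (auto simp: fun_eq_iff lowered'_def F'_def algebra_simps indicator_def prod_eq_iff)
  ultimately have tT: "test_function T lowered lowered'" by simp
  define K2 where "K2 = K - {a<..<b} \<times> {\<tau><..}"
  show ?thesis
  proof (rule test_function_restrict[OF tT])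
    show "compact K2" unfolding K2_def by (rule compact_diff[OF K(1)]) (auto intro: open_Times)
    show "K2 \<subseteq> S"
    proof
      fix z assume z: "z \<in> K2"
      show "z \<in> S"
      proof (cases "z \<in> {a<..<b} \<times> {\<tau>..}")
        case True
        with z have "z \<in> {a<..<b} \<times> {\<tau> - l..\<tau>}" using l by (cases z) (auto simp: K2_def)
        then show ?thesis using base by blast
      next
        case False
        then have "z \<in> T - {a<..<b} \<times> {\<tau>..}" using z K(2) by (auto simp: K2_def)
        then show ?thesis using agree by blast
      qed
    qed
    show "lowered z = 0" if "z \<notin> K2" for z
    proof (cases "z \<in> K")
      case True
      with that have "z \<in> Dstrip" "\<tau> < snd z" by (auto simp: K2_def Dstrip_def)
      then show ?thesis using step_above(1)[OF \<nu>(1)] by (simp add: lowered_def)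
    qed (simp add: lowered_def K(3))
  qed
qed

definition mirrored :: "real \<times> real \<Rightarrow> real" where
  "mirrored z = indicator Dstrip z * (\<phi> (reflect \<tau> z) * (cut (snd z) * (1 - step \<nu> (snd z))))"

definition mirrored' :: "real \<times> real \<Rightarrow> real \<times> real" where
  "mirrored' z = indicator Dstrip z *\<^sub>R
    ((cut (snd z) * (1 - step \<nu> (snd z))) *\<^sub>R (\<psi> (reflect \<tau> z) \<bullet> (1, 0), - (\<psi> (reflect \<tau> z) \<bullet> (0, 1)))
     + \<phi> (reflect \<tau> z) *\<^sub>R (0, cut' (snd z) * (1 - step \<nu> (snd z)) - cut (snd z) * step' \<nu> (snd z)))"

lemma test_function_mirrored: "test_function S mirrored mirrored'"
proof -
  have fd: "((\<lambda>y. cut y * (1 - step \<nu> y)) has_real_derivative (cut' y * (1 - step \<nu> y) - cut y * step' \<nu> y)) (at y)" for y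
    using cut_deriv step_deriv by (auto intro!: derivative_eq_intros simp: algebra_simps)
  have fc: "continuous_on UNIV (\<lambda>y. cut' y * (1 - step \<nu> y) - cut y * step' \<nu> y)"
    by (intro continuous_intros cut_continuous step_continuous)
  define F where "F z = \<phi> (reflect \<tau> z) * (cut (snd z) * (1 - step \<nu> (snd z)))" for z
  define F' where "F' z = (cut (snd z) * (1 - step \<nu> (snd z))) *\<^sub>R (\<psi> (reflect \<tau> z) \<bullet> (1, 0), - (\<psi> (reflect \<tau> z) \<bullet> (0, 1)))
     + \<phi> (reflect \<tau> z) *\<^sub>R (0, cut' (snd z) * (1 - step \<nu> (snd z)) - cut (snd z) * step' \<nu> (snd z))" for z
  have tF: "test_function UNIV F F'"
    unfolding F_def F'_def by (rule test_function_mult_snd[OF test_function_reflect[OF tf] fd fc])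
  define K3 where "K3 = reflect \<tau> ` K \<inter> {z. \<tau> - l \<le> snd z \<and> snd z \<le> \<tau>}"
  have cl: "closed {z :: real \<times> real. \<tau> - l \<le> snd z \<and> snd z \<le> \<tau>}"
    by (intro closed_Collect_conj closed_Collect_le continuous_intros)
  have cr: "compact (reflect \<tau> ` K)" using K(1) continuous_reflect by (intro compact_continuous_image)
  have K3: "compact K3" unfolding K3_def using cr cl by (simp add: compact_Int_closed)
  have F0: "F z = 0" if zK: "z \<notin> K3" for z
  proof -
    consider "z \<notin> reflect \<tau> ` K" | "snd z < \<tau> - l" | "\<tau> < snd z" 
      using zK unfolding K3_def Int_iff mem_Collect_eq not_le[symmetric] by blast
    then show ?thesis
    proof cases
      case 1
      then have "reflect \<tau> z \<notin> K" by (metis image_eqI reflect_simps(1))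
      then show ?thesis using K(3) by (simp add: F_def)
    qed (use cut_zero(1) step_above(1)[OF \<nu>(1)] in \<open>simp_all add: F_def\<close>)
  qed
  have fr: "K3 \<inter> frontier Dstrip = {}"
  proof -
    have "z \<notin> K3" if "z \<in> frontier Dstrip" for z
    proof
      assume "z \<in> K3"
      then have "reflect \<tau> z \<in> K" "\<tau> \<le> snd (reflect \<tau> z)" by (auto simp: K3_def)
      moreover have "fst (reflect \<tau> z) = a \<or> fst (reflect \<tau> z) = b"
        using frontier_strip[of z a b] that by (simp add: Dstrip_def)
      ultimately show False using \<kappa>(1)[of "reflect \<tau> z"] \<kappa>(2) by auto
    qed
    then show ?thesis by blast
  qed
  have "test_function (UNIV \<inter> Dstrip) (\<lambda>z. indicator Dstrip z * F z) (\<lambda>z. indicator Dstrip z *\<^sub>R F' z)"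
    by (rule test_function_cut[OF tF K3 _ F0 fr]) auto
  then have tD: "test_function (UNIV \<inter> Dstrip) mirrored mirrored'"
    by (simp add: F_def F'_def mirrored_def[abs_def] mirrored'_def[abs_def])
  show ?thesis
  proof (rule test_function_restrict[OF tD])
    show "compact (K3 \<inter> closure Dstrip)" using K3 by (simp add: compact_Int_closed)
    show "K3 \<inter> closure Dstrip \<subseteq> S"
    proof
      fix z assume z: "z \<in> K3 \<inter> closure Dstrip"
      then have "z \<in> Dstrip" using fr interior_subset[of Dstrip] by (auto simp: frontier_def)
      with z have "z \<in> {a<..<b} \<times> {\<tau> - l..\<tau>}" by (cases z) (auto simp: K3_def Dstrip_def)
      then show "z \<in> S" using base by blast
    qed
    show "mirrored z = 0" if "z \<notin> K3 \<inter> closure Dstrip" for z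
      using that F0[of z] closure_subset[of Dstrip] by (auto simp: mirrored_def F_def indicator_def)
  qed
qed

text \<open>
  Near height \<open>\<tau>\<close> the step function has slope of order \<open>\<nu>\<close>, but there \<open>\<phi>\<close> and its mirror image differ
  by at most a multiple of the distance to that height.
\<close>
lemma step_difference_bound:
  assumes B: "\<And>z. \<bar>\<phi> z\<bar> \<le> B" "\<And>z. norm (\<psi> z) \<le> B"
  shows "\<bar>step' \<nu> (snd z) * (\<phi> z - cut (snd z) * \<phi> (reflect \<tau> z))\<bar> \<le> 2 * (2 * B + 2 / l * B)"
proof (cases "snd z \<in> {\<tau> - 1 / \<nu>..\<tau>}")
  case True
  obtain x y where z: "z = (x, y)" by (cases z)
  define M where "M = 2 * B + 2 / l * B"
  have B0: "0 \<le> B" using B(1)[of z] by linarith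
  define m where "m t = \<phi> (x, t) - cut t * \<phi> (x, 2 * \<tau> - t)" for t
  obtain N where N: "\<And>x y. ((\<lambda>y. \<phi> (x, y)) has_real_derivative \<psi> (x, y) \<bullet> (0, 1)) (at y)"
    using test_function_slice[OF tf] by metis
  have d1: "((\<lambda>t. \<phi> (x, 2 * \<tau> - t)) has_real_derivative (\<psi> (x, 2 * \<tau> - t) \<bullet> (0, 1)) * -1) (at t)" for t
    by (rule DERIV_chain2[OF N]) (auto intro!: derivative_eq_intros)
  have md: "(m has_real_derivative \<psi> (x, t) \<bullet> (0, 1)
      - (cut' t * \<phi> (x, 2 * \<tau> - t) + ((\<psi> (x, 2 * \<tau> - t) \<bullet> (0, 1)) * -1) * cut t)) (at t)" for t
    unfolding m_def by (intro DERIV_diff DERIV_mult N cut_deriv d1)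
  have s: "\<bar>\<psi> p \<bullet> (0, 1)\<bar> \<le> B" for p
    using Cauchy_Schwarz_ineq2[of "\<psi> p" "(0, 1)"] B(2)[of p] by simp
  have mb: "norm (\<psi> (x, t) \<bullet> (0, 1)
      - (cut' t * \<phi> (x, 2 * \<tau> - t) + ((\<psi> (x, 2 * \<tau> - t) \<bullet> (0, 1)) * -1) * cut t)) \<le> M" for t
  proof -
    have "\<bar>cut' t * \<phi> (x, 2 * \<tau> - t)\<bar> \<le> 2 / l * B"
      unfolding abs_mult using cut_bounds(3,4)[of t] B(1) l by (intro mult_mono) auto
    moreover have "\<bar>((\<psi> (x, 2 * \<tau> - t) \<bullet> (0, 1)) * -1) * cut t\<bar> \<le> B * 1"
      unfolding abs_mult using cut_bounds(1,2)[of t] s B0 by (intro mult_mono) auto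
    ultimately show ?thesis using s[of "(x, t)"] unfolding M_def real_norm_def by linarith
  qed
  have "norm (m y - m \<tau>) \<le> M * norm (y - \<tau>)"
    by (rule field_differentiable_bound[of UNIV m]) (use md mb in auto)
  moreover have "m \<tau> = 0" using cut_one[of \<tau>] by (simp add: m_def)
  ultimately have "\<bar>m y\<bar> \<le> M * \<bar>y - \<tau>\<bar>" by simp
  also have "\<dots> \<le> M * (1 / \<nu>)"
    using True z B0 l unfolding M_def by (intro mult_left_mono) auto
  finally have "\<bar>step' \<nu> y\<bar> * \<bar>m y\<bar> \<le> (2 * \<nu>) * (M * (1 / \<nu>))"
    using step'_bound[OF \<nu>(1), of y] \<nu>(1) by (intro mult_mono) auto
  then have "\<bar>step' \<nu> y * m y\<bar> \<le> 2 * M" using \<nu>(1) by (simp add: abs_mult)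
  then show ?thesis by (simp add: z m_def reflect_def M_def)
next
  case False
  then have "step' \<nu> (snd z) = 0"
    using step_below(2)[OF \<nu>(1)] step_above(2)[OF \<nu>(1)] by fastforce
  moreover have "0 \<le> B" using B(1)[of z] by linarith
  ultimately show ?thesis using l by simp
qed

end

end

context reflection
begin

lemma step_tendsto:
  assumes "0 < \<nu>0"
  shows "(\<lambda>n. step (real n + \<nu>0) y) \<longlonglongrightarrow> (if \<tau> \<le> y then 1 else 0)"
    "y \<noteq> \<tau> \<Longrightarrow> (\<lambda>n. step' (real n + \<nu>0) y) \<longlonglongrightarrow> 0"
proof -
  have below: "\<forall>\<^sub>F n in sequentially. y \<le> \<tau> - 1 / (real n + \<nu>0)" if "y < \<tau>"
  proof -
    obtain N where N: "1 / (\<tau> - y) < real N" using reals_Archimedean2 by blast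
    have "y \<le> \<tau> - 1 / (real n + \<nu>0)" if "n \<ge> N" for n
    proof -
      have "1 / (\<tau> - y) \<le> real n + \<nu>0" using N that assms by linarith
      then have "1 / (real n + \<nu>0) \<le> \<tau> - y" using \<open>y < \<tau>\<close> assms by (simp add: field_simps)
      then show ?thesis by simp
    qed
    then show ?thesis by (auto simp: eventually_sequentially)
  qed
  have pos: "0 < real n + \<nu>0" for n using assms by simp
  show "(\<lambda>n. step (real n + \<nu>0) y) \<longlonglongrightarrow> (if \<tau> \<le> y then 1 else 0)"
  proof (cases "\<tau> \<le> y")
    case True
    then show ?thesis using step_above(1)[OF pos] by simp
  next
    case False
    then have "\<forall>\<^sub>F n in sequentially. step (real n + \<nu>0) y = 0"
      using below by (auto elim!: eventually_mono intro: step_below(1)[OF pos])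
    then show ?thesis using False by (simp add: tendsto_eventually)
  qed
  assume "y \<noteq> \<tau>"
  then consider "y < \<tau>" | "\<tau> \<le> y" by linarith
  then show "(\<lambda>n. step' (real n + \<nu>0) y) \<longlonglongrightarrow> 0"
  proof cases
    case 1
    then have "\<forall>\<^sub>F n in sequentially. step' (real n + \<nu>0) y = 0"
      using below by (auto elim!: eventually_mono intro: step_below(2)[OF pos])
    then show ?thesis by (rule tendsto_eventually)
  next
    case 2
    then show ?thesis using step_above(2)[OF pos] by simp
  qed
qed

definition Pm :: "(real \<times> real) set" where "Pm = {a<..<b} \<times> {..<\<tau>}"

lemma Pm_sets [measurable]: "Pm \<in> sets borel"
  unfolding Pm_def by (intro borel_open open_Times) auto

lemma Pm_reflect: "snd z \<noteq> \<tau> \<Longrightarrow> reflect \<tau> z \<in> Pm \<longleftrightarrow> z \<in> P"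
  by (cases z) (auto simp: Pm_def P_def reflect_def)

text \<open>
  The identities for \<open>u\<close> on \<open>S\<close> are tested with the functions \<open>lowered\<close> and \<open>mirrored\<close>, and the
  regularization is removed. In the vertical direction the two boundary terms at height \<open>\<tau>\<close> are unbounded
  one by one; their difference stays bounded by \<open>step_difference_bound\<close> and vanishes in the limit, which
  expresses that the reflected function has no jump.
\<close>
lemma weak_identities:
  assumes tf: "test_function T \<phi> \<psi>"
  shows "(LINT z|lborel. w z * (\<psi> z \<bullet> (1, 0))) = - (LINT z|lborel. G1 z * \<phi> z)"
    "(LINT z|lborel. w z * (\<psi> z \<bullet> (0, 1))) = - (LINT z|lborel. G2 z * \<phi> z)"
proof -
  obtain K where K: "compact K" "K \<subseteq> T" "\<And>z. z \<notin> K \<Longrightarrow> \<phi> z = 0" "\<And>z. z \<notin> K \<Longrightarrow> \<psi> z = 0"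
    using test_functionE[OF tf] by metis
  obtain B where B: "B > 0" "\<And>z. \<bar>\<phi> z\<bar> \<le> B" "\<And>z. norm (\<psi> z) \<le> B"
    using test_function_bounded[OF tf] by metis
  obtain \<kappa> where \<kappa>: "\<kappa> > 0" "\<And>z. fst z = a \<or> fst z = b \<Longrightarrow> \<tau> - \<kappa> \<le> snd z \<Longrightarrow> z \<notin> K"
    using support_avoids_sides[OF K(1,2)] by blast
  define \<nu>0 where "\<nu>0 = 1 / \<kappa>"
  have \<nu>0: "0 < \<nu>0" using \<kappa> by (simp add: \<nu>0_def)
  define \<nu> where "\<nu> n = real n + \<nu>0" for n
  have \<nu>: "0 < \<nu> n" "1 / \<nu> n \<le> \<kappa>" for n
  proof -
    show "0 < \<nu> n" using \<nu>0 by (simp add: \<nu>_def)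
    have "1 / \<nu> n \<le> 1 / \<nu>0" using \<nu>0 by (intro divide_left_mono) (auto simp: \<nu>_def)
    then show "1 / \<nu> n \<le> \<kappa>" using \<kappa>(1) by (simp add: \<nu>0_def)
  qed
  note [measurable] = test_function_measurable[OF tf]
  have low: "test_function S (lowered \<phi> (\<nu> n)) (lowered' \<phi> \<psi> (\<nu> n))" for n
    by (rule test_function_lowered[OF tf K(1-3) \<kappa>(2,1) \<nu>])
  have mir: "test_function S (mirrored \<phi> (\<nu> n)) (mirrored' \<phi> \<psi> (\<nu> n))" for n
    by (rule test_function_mirrored[OF tf K(1-3) \<kappa>(2,1) \<nu>])
  have dir: "\<bar>\<psi> z \<bullet> (1, 0)\<bar> \<le> B" "\<bar>\<psi> z \<bullet> (0, 1)\<bar> \<le> B" for z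
    using Cauchy_Schwarz_ineq2[of "\<psi> z" "(1, 0)"] Cauchy_Schwarz_ineq2[of "\<psi> z" "(0, 1)"] B(3)[of z] by simp_all
  define Kb where "Kb = K \<union> reflect \<tau> ` K"
  have Kb: "compact Kb" unfolding Kb_def using K(1) continuous_reflect by (intro compact_Un compact_continuous_image)
  have zero: "\<phi> z = 0" "\<psi> z = 0" "\<phi> (reflect \<tau> z) = 0" "\<psi> (reflect \<tau> z) = 0" if "z \<notin> Kb" for z
  proof -
    have "z \<notin> K" using that by (simp add: Kb_def)
    moreover have "reflect \<tau> z \<notin> K" using that unfolding Kb_def by (metis UnI2 image_eqI reflect_simps(1))
    ultimately show "\<phi> z = 0" "\<psi> z = 0" "\<phi> (reflect \<tau> z) = 0" "\<psi> (reflect \<tau> z) = 0" using K(3,4) by blast+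
  qed
  define \<psi>1 where "\<psi>1 z = \<psi> z \<bullet> (1, 0)" for z
  define \<psi>2 where "\<psi>2 z = \<psi> z \<bullet> (0, 1)" for z
  have [measurable]: "\<psi>1 \<in> borel_measurable borel" "\<psi>2 \<in> borel_measurable borel"
    unfolding \<psi>1_def[abs_def] \<psi>2_def[abs_def] by measurable
  define R :: "real \<times> real \<Rightarrow> real \<times> real" where "R = reflect \<tau>"
  have [measurable]: "R \<in> borel_measurable borel" unfolding R_def by measurable
  define s where "s n z = (indicator Dstrip z * step (\<nu> n) (snd z) :: real)" for n and z :: "real \<times> real"
  define t where "t n z = (indicator Dstrip z * (cut (snd z) * (1 - step (\<nu> n) (snd z))) :: real)" for n and z :: "real \<times> real"
  have sm [measurable]: "s n \<in> borel_measurable borel" "t n \<in> borel_measurable borel" for n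
    unfolding s_def[abs_def] t_def[abs_def]
    using borel_measurable_comp_fst_snd(2)[OF step_measurable(1)[of "\<nu> n"], of "\<lambda>z. z" borel]
      borel_measurable_comp_fst_snd(2)[of cut "\<lambda>z. z" borel] by simp_all
  have sb: "0 \<le> s n z" "s n z \<le> 1" "0 \<le> t n z" "t n z \<le> 1" for n z
    using step_bounds[of "\<nu> n" "snd z"] cut_bounds(1,2)[of "snd z"]
    by (auto simp: s_def t_def indicator_def mult_le_one)
  have slim: "(\<lambda>n. s n z) \<longlonglongrightarrow> indicator P z" for z
  proof -
    have "(\<lambda>n. s n z) \<longlonglongrightarrow> indicator Dstrip z * (if \<tau> \<le> snd z then 1 else 0)"
      unfolding s_def \<nu>_def by (intro tendsto_intros step_tendsto(1)[OF \<nu>0])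
    moreover have "(indicator Dstrip z * (if \<tau> \<le> snd z then 1 else 0) :: real) = indicator P z"
      by (cases z) (auto simp: Dstrip_def P_def indicator_def)
    ultimately show ?thesis by simp
  qed
  have tlim: "(\<lambda>n. t n z) \<longlonglongrightarrow> indicator Pm z * cut (snd z)" for z
  proof -
    have "(\<lambda>n. t n z) \<longlonglongrightarrow> indicator Dstrip z * (cut (snd z) * (1 - (if \<tau> \<le> snd z then 1 else 0)))"
      unfolding t_def \<nu>_def by (intro tendsto_intros step_tendsto(1)[OF \<nu>0])
    moreover have "(indicator Dstrip z * (cut (snd z) * (1 - (if \<tau> \<le> snd z then 1 else 0))) :: real) = indicator Pm z * cut (snd z)"
      by (cases z) (auto simp: Dstrip_def Pm_def indicator_def)
    ultimately show ?thesis by simp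
  qed
  have lim_s: "(\<lambda>n. LINT z|lborel. f z * (h z * (1 - s n z))) \<longlonglongrightarrow> (LINT z|lborel. f z * (h z * (1 - indicator P z)))"
    if f: "L2 f" and [measurable]: "h \<in> borel_measurable borel" and h: "\<And>z. \<bar>h z\<bar> \<le> B" "\<And>z. z \<notin> Kb \<Longrightarrow> h z = 0" for f h
  proof (rule L2_integral_limit[OF f Kb])
    show "\<bar>h z * (1 - s n z)\<bar> \<le> B" for n z
      using mult_mono[OF h(1), of "\<bar>1 - s n z\<bar>" 1 z] sb[of n z] B(1) by (simp add: abs_mult)
    show "AE z in lborel. (\<lambda>n. h z * (1 - s n z)) \<longlonglongrightarrow> h z * (1 - indicator P z)"
      by (intro AE_I2 tendsto_intros slim)
  qed (use h(2) in \<open>simp_all\<close>)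
  have lim_t: "(\<lambda>n. LINT z|lborel. f z * (h z * t n z)) \<longlonglongrightarrow> (LINT z|lborel. f z * (h z * (indicator Pm z * cut (snd z))))"
    if f: "L2 f" and [measurable]: "h \<in> borel_measurable borel" and h: "\<And>z. \<bar>h z\<bar> \<le> B" "\<And>z. z \<notin> Kb \<Longrightarrow> h z = 0" for f h
  proof (rule L2_integral_limit[OF f Kb])
    show "\<bar>h z * t n z\<bar> \<le> B" for n z
      using mult_mono[OF h(1), of "\<bar>t n z\<bar>" 1 z] sb[of n z] B(1) by (simp add: abs_mult)
    show "AE z in lborel. (\<lambda>n. h z * t n z) \<longlonglongrightarrow> h z * (indicator Pm z * cut (snd z))"
      by (intro AE_I2 tendsto_intros tlim)
  qed (use h(2) in \<open>simp_all\<close>)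
  have prod: "integrable lborel (\<lambda>z. f z * h z)"
    if f: "L2 f" and [measurable]: "h \<in> borel_measurable borel" and h: "\<And>z. \<bar>h z\<bar> \<le> C" "\<And>z. z \<notin> Kb \<Longrightarrow> h z = 0"
    for f h :: "real \<times> real \<Rightarrow> real" and C
  proof (rule L2_mult[OF f])
    have "0 \<le> C" using h(1)[of "(0, 0)"] by linarith
    then show "L2 h"
      using h emeasure_compact_finite[OF Kb] compact_imp_closed[OF Kb]
      by (intro L2_finite_support[of h Kb C]) (auto simp: indicator_def)
  qed
  have wdS: "(LINT z|lborel. u z * (\<psi>' z \<bullet> (1, 0))) = - (LINT z|lborel. g1 z * \<phi>' z)"
      "(LINT z|lborel. u z * (\<psi>' z \<bullet> (0, 1))) = - (LINT z|lborel. g2 z * \<phi>' z)"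
    if "test_function S \<phi>' \<psi>'" for \<phi>' \<psi>'
    using sob that unfolding sobolev_def weak_deriv_def by blast+
  note lowered_eqn = lowered_def[OF tf K(1-3) \<kappa>(2,1) \<nu>] and lowered'_eqn = lowered'_def[OF tf K(1-3) \<kappa>(2,1) \<nu>]
    and mirrored_eqn = mirrored_def[OF tf K(1-3) \<kappa>(2,1) \<nu>] and mirrored'_eqn = mirrored'_def[OF tf K(1-3) \<kappa>(2,1) \<nu>]
  have low_eq: "lowered \<phi> (\<nu> n) z = \<phi> z * (1 - s n z)" for n z by (simp add: lowered_eqn s_def)
  have mir_eq: "mirrored \<phi> (\<nu> n) z = \<phi> (R z) * t n z" for n z by (simp add: mirrored_eqn t_def R_def)
  have low1: "lowered' \<phi> \<psi> (\<nu> n) z \<bullet> (1, 0) = \<psi>1 z * (1 - s n z)" for n z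
    by (simp add: lowered'_eqn s_def \<psi>1_def inner_prod_def)
  have mir1: "mirrored' \<phi> \<psi> (\<nu> n) z \<bullet> (1, 0) = \<psi>1 (R z) * t n z" for n z
    by (simp add: mirrored'_eqn t_def \<psi>1_def R_def inner_prod_def)
  define e where "e n z = (indicator Dstrip z * (cut' (snd z) * (1 - step (\<nu> n) (snd z))) :: real)" for n and z :: "real \<times> real"
  define d where "d n z = indicator Dstrip z * (step' (\<nu> n) (snd z) * (\<phi> z - cut (snd z) * \<phi> (R z)))" for n z
  have mix2: "lowered' \<phi> \<psi> (\<nu> n) z \<bullet> (0, 1) - mirrored' \<phi> \<psi> (\<nu> n) z \<bullet> (0, 1)
      = \<psi>2 z * (1 - s n z) + \<psi>2 (R z) * t n z - \<phi> (R z) * e n z - d n z" for n z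
    by (simp add: lowered'_eqn mirrored'_eqn s_def t_def e_def d_def \<psi>2_def R_def inner_prod_def algebra_simps)
  have [measurable]: "e n \<in> borel_measurable borel" "d n \<in> borel_measurable borel" for n
    unfolding e_def[abs_def] d_def[abs_def]
    using borel_measurable_comp_fst_snd(2)[OF step_measurable(1)[of "\<nu> n"], of "\<lambda>z. z" borel]
      borel_measurable_comp_fst_snd(2)[OF step_measurable(2)[of "\<nu> n"], of "\<lambda>z. z" borel]
      borel_measurable_comp_fst_snd(2)[of cut "\<lambda>z. z" borel]
      borel_measurable_comp_fst_snd(2)[of cut' "\<lambda>z. z" borel] by simp_all
  have eb: "\<bar>e n z\<bar> \<le> 2 / l" for n z
  proof -
    have "cut' (snd z) * (1 - step (\<nu> n) (snd z)) \<le> 2 / l * 1"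
      using step_bounds[of "\<nu> n" "snd z"] cut_bounds(3,4)[of "snd z"] l by (intro mult_mono) auto
    moreover have "0 \<le> cut' (snd z) * (1 - step (\<nu> n) (snd z))"
      using step_bounds[of "\<nu> n" "snd z"] cut_bounds(3)[of "snd z"] by simp
    ultimately show ?thesis using l by (simp add: e_def indicator_def)
  qed
  have elim: "(\<lambda>n. e n z) \<longlonglongrightarrow> indicator Pm z * cut' (snd z)" for z
  proof -
    have "(\<lambda>n. e n z) \<longlonglongrightarrow> indicator Dstrip z * (cut' (snd z) * (1 - (if \<tau> \<le> snd z then 1 else 0)))"
      unfolding e_def \<nu>_def by (intro tendsto_intros step_tendsto(1)[OF \<nu>0])
    moreover have "(indicator Dstrip z * (cut' (snd z) * (1 - (if \<tau> \<le> snd z then 1 else 0))) :: real) = indicator Pm z * cut' (snd z)"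
      by (cases z) (auto simp: Dstrip_def Pm_def indicator_def)
    ultimately show ?thesis by simp
  qed
  define M where "M = 2 * (2 * B + 2 / l * B)"
  have db: "\<bar>d n z\<bar> \<le> M" for n z
  proof -
    have "\<bar>step' (\<nu> n) (snd z) * (\<phi> z - cut (snd z) * \<phi> (R z))\<bar> \<le> M"
      unfolding M_def R_def by (rule step_difference_bound[OF tf K(1-3) \<kappa>(2,1) \<nu> B(2,3)])
    then show ?thesis by (auto simp: d_def indicator_def)
  qed
  have dlim: "(\<lambda>n. d n z) \<longlonglongrightarrow> 0" if "snd z \<noteq> \<tau>" for z
  proof -
    have "(\<lambda>n. d n z) \<longlonglongrightarrow> indicator Dstrip z * (0 * (\<phi> z - cut (snd z) * \<phi> (R z)))"
      unfolding d_def \<nu>_def by (intro tendsto_intros step_tendsto(2)[OF \<nu>0 that])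
    then show ?thesis by simp
  qed
  have bnd: "\<bar>\<phi> (R z)\<bar> \<le> B" "\<bar>\<psi>1 z\<bar> \<le> B" "\<bar>\<psi>1 (R z)\<bar> \<le> B" "\<bar>\<psi>2 z\<bar> \<le> B" "\<bar>\<psi>2 (R z)\<bar> \<le> B" for z
    using B(2) dir by (auto simp: \<psi>1_def \<psi>2_def)
  have zer: "\<phi> (R z) = 0" "\<psi>1 z = 0" "\<psi>1 (R z) = 0" "\<psi>2 z = 0" "\<psi>2 (R z) = 0" "d n z = 0" if "z \<notin> Kb" for z n
    using zero[OF that] by (simp_all add: \<psi>1_def \<psi>2_def R_def d_def)
  note [measurable] = L[THEN L2_measurable]
  define nP where "nP z = (1 - indicator P z :: real)" for z
  define cm where "cm z = (indicator Pm z * cut (snd z) :: real)" for z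
  define cm' where "cm' z = (indicator Pm z * cut' (snd z) :: real)" for z
  have [measurable]: "nP \<in> borel_measurable borel" "cm \<in> borel_measurable borel" "cm' \<in> borel_measurable borel"
    unfolding nP_def[abs_def] cm_def[abs_def] cm'_def[abs_def]
    using borel_measurable_comp_fst_snd(2)[of cut "\<lambda>z. z" borel]
      borel_measurable_comp_fst_snd(2)[of cut' "\<lambda>z. z" borel] by simp_all
  have nPb: "\<bar>nP z\<bar> \<le> 1" "\<bar>cm z\<bar> \<le> 1" "\<bar>cm' z\<bar> \<le> 2 / l" for z
    using cut_bounds[of "snd z"] l by (auto simp: nP_def cm_def cm'_def indicator_def)
  have pb: "\<bar>x * y\<bar> \<le> B * C" if "\<bar>x\<bar> \<le> B" "\<bar>y\<bar> \<le> C" for x y C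
    unfolding abs_mult using that B(1) by (intro mult_mono) auto
  \<comment> \<open>Passing to the limit in the two families of test functions on \<open>S\<close>.\<close>
  have A1: "(LINT z|lborel. u z * (\<psi>1 z * nP z)) = - (LINT z|lborel. g1 z * (\<phi> z * nP z))"
  proof (rule LIMSEQ_unique)
    show "(\<lambda>n. LINT z|lborel. u z * (\<psi>1 z * (1 - s n z))) \<longlonglongrightarrow> (LINT z|lborel. u z * (\<psi>1 z * nP z))"
      unfolding nP_def by (rule lim_s[OF L(1)]) (use bnd zer in measurable)
    have "(\<lambda>n. - (LINT z|lborel. g1 z * (\<phi> z * (1 - s n z)))) \<longlonglongrightarrow> - (LINT z|lborel. g1 z * (\<phi> z * nP z))"
      unfolding nP_def by (intro tendsto_minus lim_s[OF L(2)]) (use B zero in measurable)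
    then show "(\<lambda>n. LINT z|lborel. u z * (\<psi>1 z * (1 - s n z))) \<longlonglongrightarrow> - (LINT z|lborel. g1 z * (\<phi> z * nP z))"
      using wdS(1)[OF low] by (simp add: low1 low_eq)
  qed
  have A2: "(LINT z|lborel. u z * (\<psi>1 (R z) * cm z)) = - (LINT z|lborel. g1 z * (\<phi> (R z) * cm z))"
  proof (rule LIMSEQ_unique)
    show "(\<lambda>n. LINT z|lborel. u z * (\<psi>1 (R z) * t n z)) \<longlonglongrightarrow> (LINT z|lborel. u z * (\<psi>1 (R z) * cm z))"
      unfolding cm_def by (rule lim_t[OF L(1)]) (use bnd zer in measurable)
    have "(\<lambda>n. - (LINT z|lborel. g1 z * (\<phi> (R z) * t n z))) \<longlonglongrightarrow> - (LINT z|lborel. g1 z * (\<phi> (R z) * cm z))"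
      unfolding cm_def by (intro tendsto_minus lim_t[OF L(2)]) (use bnd zer in measurable)
    then show "(\<lambda>n. LINT z|lborel. u z * (\<psi>1 (R z) * t n z)) \<longlonglongrightarrow> - (LINT z|lborel. g1 z * (\<phi> (R z) * cm z))"
      using wdS(1)[OF mir] by (simp add: mir1 mir_eq)
  qed
  have intr: "integrable lborel (\<lambda>z. f z * (h z * c z))"
    if "L2 f" "h \<in> borel_measurable borel" "c \<in> borel_measurable borel" "\<And>z. \<bar>h z\<bar> \<le> B" "\<And>z. z \<notin> Kb \<Longrightarrow> h z = 0"
      "\<And>z. \<bar>c z\<bar> \<le> C" for f h c :: "real \<times> real \<Rightarrow> real" and C
    by (rule prod[OF that(1), of _ "B * C"]) (use that pb in auto)
  have A3: "(LINT z|lborel. u z * (\<psi>2 z * nP z)) + (LINT z|lborel. u z * (\<psi>2 (R z) * cm z)) - (LINT z|lborel. u z * (\<phi> (R z) * cm' z))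
      = - (LINT z|lborel. g2 z * (\<phi> z * nP z)) + (LINT z|lborel. g2 z * (\<phi> (R z) * cm z))"
  proof (rule LIMSEQ_unique)
    let ?X = "\<lambda>n. (LINT z|lborel. u z * (\<psi>2 z * (1 - s n z))) + (LINT z|lborel. u z * (\<psi>2 (R z) * t n z))
      - (LINT z|lborel. u z * (\<phi> (R z) * e n z)) - (LINT z|lborel. u z * d n z)"
    have l1: "(\<lambda>n. LINT z|lborel. u z * (\<psi>2 z * (1 - s n z))) \<longlonglongrightarrow> (LINT z|lborel. u z * (\<psi>2 z * nP z))"
      unfolding nP_def by (rule lim_s[OF L(1)]) (use bnd zer in measurable)
    have l2: "(\<lambda>n. LINT z|lborel. u z * (\<psi>2 (R z) * t n z)) \<longlonglongrightarrow> (LINT z|lborel. u z * (\<psi>2 (R z) * cm z))"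
      unfolding cm_def by (rule lim_t[OF L(1)]) (use bnd zer in measurable)
    have l3: "(\<lambda>n. LINT z|lborel. u z * (\<phi> (R z) * e n z)) \<longlonglongrightarrow> (LINT z|lborel. u z * (\<phi> (R z) * cm' z))"
    proof (rule L2_integral_limit[OF L(1) Kb])
      show "\<bar>\<phi> (R z) * e n z\<bar> \<le> B * (2 / l)" for n z by (rule pb[OF bnd(1) eb])
      show "AE z in lborel. (\<lambda>n. \<phi> (R z) * e n z) \<longlonglongrightarrow> \<phi> (R z) * cm' z"
        unfolding cm'_def by (intro AE_I2 tendsto_intros elim)
      show "\<phi> (R z) * e n z = 0" if "z \<notin> Kb" for n z using zer(1)[OF that] by simp
    qed measurable
    have l4: "(\<lambda>n. LINT z|lborel. u z * d n z) \<longlonglongrightarrow> (LINT z|lborel. u z * 0)"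
    proof (rule L2_integral_limit[OF L(1) Kb])
      show "AE z in lborel. (\<lambda>n. d n z) \<longlonglongrightarrow> 0"
        using AE_snd_neq[of \<tau>] by eventually_elim (rule dlim)
      show "\<bar>d n z\<bar> \<le> M" for n z by (rule db)
      show "d n z = 0" if "z \<notin> Kb" for n z using zer(6)[OF that] .
    qed measurable
    have "?X \<longlonglongrightarrow> (LINT z|lborel. u z * (\<psi>2 z * nP z)) + (LINT z|lborel. u z * (\<psi>2 (R z) * cm z)) - (LINT z|lborel. u z * (\<phi> (R z) * cm' z))
      - (LINT z|lborel. u z * 0)"
      by (intro tendsto_add tendsto_diff l1 l2 l3 l4)
    then show "?X \<longlonglongrightarrow> (LINT z|lborel. u z * (\<psi>2 z * nP z)) + (LINT z|lborel. u z * (\<psi>2 (R z) * cm z)) - (LINT z|lborel. u z * (\<phi> (R z) * cm' z))"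
      by simp
    have r1: "(\<lambda>n. LINT z|lborel. g2 z * (\<phi> z * (1 - s n z))) \<longlonglongrightarrow> (LINT z|lborel. g2 z * (\<phi> z * nP z))"
      unfolding nP_def by (rule lim_s[OF L(3)]) (use B zero in measurable)
    have r2: "(\<lambda>n. LINT z|lborel. g2 z * (\<phi> (R z) * t n z)) \<longlonglongrightarrow> (LINT z|lborel. g2 z * (\<phi> (R z) * cm z))"
      unfolding cm_def by (rule lim_t[OF L(3)]) (use bnd zer in measurable)
    have X: "?X n = - (LINT z|lborel. g2 z * (\<phi> z * (1 - s n z))) + (LINT z|lborel. g2 z * (\<phi> (R z) * t n z))" for n
    proof -
      have i1: "integrable lborel (\<lambda>z. u z * (\<psi>2 z * (1 - s n z)))"
        by (rule intr[OF L(1), where C=1]) (use bnd zer sb[of n] in \<open>simp_all add: abs_le_iff\<close>)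
      have i2: "integrable lborel (\<lambda>z. u z * (\<psi>2 (R z) * t n z))"
        by (rule intr[OF L(1), where C=1]) (use bnd zer sb[of n] in \<open>simp_all add: abs_le_iff\<close>)
      have i3: "integrable lborel (\<lambda>z. u z * (\<phi> (R z) * e n z))"
        by (rule intr[OF L(1), where C="2 / l"]) (use bnd zer eb in simp_all)
      have i4: "integrable lborel (\<lambda>z. u z * d n z)"
        by (rule prod[OF L(1), where C=M]) (use db zer in simp_all)
      have j: "integrable lborel (\<lambda>z. u z * (lowered' \<phi> \<psi> (\<nu> n) z \<bullet> (0, 1)))"
        "integrable lborel (\<lambda>z. u z * (mirrored' \<phi> \<psi> (\<nu> n) z \<bullet> (0, 1)))"
        by (intro L2_mult[OF L(1)] test_function_L2(2)[OF low] test_function_L2(2)[OF mir])+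
      have "?X n = (LINT z|lborel. u z * (\<psi>2 z * (1 - s n z)) + u z * (\<psi>2 (R z) * t n z) - u z * (\<phi> (R z) * e n z) - u z * d n z)"
        using i1 i2 i3 i4 by simp
      also have "\<dots> = (LINT z|lborel. u z * (lowered' \<phi> \<psi> (\<nu> n) z \<bullet> (0, 1)) - u z * (mirrored' \<phi> \<psi> (\<nu> n) z \<bullet> (0, 1)))"
      proof (rule Bochner_Integration.integral_cong[OF refl])
        fix z
        show "u z * (\<psi>2 z * (1 - s n z)) + u z * (\<psi>2 (R z) * t n z) - u z * (\<phi> (R z) * e n z) - u z * d n z
          = u z * (lowered' \<phi> \<psi> (\<nu> n) z \<bullet> (0, 1)) - u z * (mirrored' \<phi> \<psi> (\<nu> n) z \<bullet> (0, 1))"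
          unfolding right_diff_distrib[symmetric] distrib_left[symmetric] mix2 by simp
      qed
      also have "\<dots> = (LINT z|lborel. u z * (lowered' \<phi> \<psi> (\<nu> n) z \<bullet> (0, 1))) - (LINT z|lborel. u z * (mirrored' \<phi> \<psi> (\<nu> n) z \<bullet> (0, 1)))"
        using j by (rule Bochner_Integration.integral_diff)
      finally show ?thesis unfolding wdS(2)[OF low] wdS(2)[OF mir] by (simp add: low_eq mir_eq)
    qed
    have "(\<lambda>n. - (LINT z|lborel. g2 z * (\<phi> z * (1 - s n z))) + (LINT z|lborel. g2 z * (\<phi> (R z) * t n z)))
        \<longlonglongrightarrow> - (LINT z|lborel. g2 z * (\<phi> z * nP z)) + (LINT z|lborel. g2 z * (\<phi> (R z) * cm z))"
      by (intro tendsto_add tendsto_minus r1 r2)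
    then show "?X \<longlonglongrightarrow> - (LINT z|lborel. g2 z * (\<phi> z * nP z)) + (LINT z|lborel. g2 z * (\<phi> (R z) * cm z))"
      unfolding X .
  qed
  \<comment> \<open>Reflecting the part below height \<open>\<tau>\<close> to the part above it.\<close>
  have RR: "R (R z) = z" for z by (simp add: R_def)
  have refl: "(LINT z|lborel. f z * (h (R z) * c z)) = (LINT z|lborel. f (R z) * (h z * c (R z)))"
    if "f \<in> borel_measurable borel" "h \<in> borel_measurable borel" "c \<in> borel_measurable borel"
    for f h c :: "real \<times> real \<Rightarrow> real"
    using integral_reflect[of "\<lambda>z. f z * (h (R z) * c z)" \<tau>] that by (simp add: R_def)
  have TP: "\<phi> z = 0" "\<psi>1 z = 0" "\<psi>2 z = 0" if "z \<notin> T" for z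
  proof -
    have "z \<notin> K" using K(2) that by blast
    then show "\<phi> z = 0" "\<psi>1 z = 0" "\<psi>2 z = 0" using K(3,4) by (simp_all add: \<psi>1_def \<psi>2_def)
  qed
  have LR: "L2 (\<lambda>z. f (R z))" if "L2 f" for f unfolding R_def by (rule L2_reflect[OF that])
  have cmR: "cm (R z) = (if z \<in> P then cut (2 * \<tau> - snd z) else 0)"
    "cm' (R z) = (if z \<in> P then cut' (2 * \<tau> - snd z) else 0)" if "snd z \<noteq> \<tau>" for z
    using Pm_reflect[OF that] by (auto simp: cm_def cm'_def R_def)
  have cmRm [measurable]: "(\<lambda>z. cm (R z)) \<in> borel_measurable borel" "(\<lambda>z. cm' (R z)) \<in> borel_measurable borel"
    by measurable
  have combine: "(LINT z|lborel. W z * h z) = (LINT z|lborel. f z * (h z * nP z)) + (LINT z|lborel. k (R z) * (h z * cm (R z))) + (LINT z|lborel. x (R z) * (h z * cm' (R z)))"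
    if f: "L2 f" "L2 k" "L2 x" and h: "h \<in> borel_measurable borel" "\<And>z. \<bar>h z\<bar> \<le> B" "\<And>z. z \<notin> Kb \<Longrightarrow> h z = 0" "\<And>z. z \<notin> T \<Longrightarrow> h z = 0"
      and W: "W \<in> borel_measurable borel" "\<And>z. z \<in> T \<Longrightarrow> snd z \<noteq> \<tau> \<Longrightarrow> W z = f z * nP z + k (R z) * cm (R z) + x (R z) * cm' (R z)"
    for f h k x W :: "real \<times> real \<Rightarrow> real"
  proof -
    have i: "integrable lborel (\<lambda>z. f z * (h z * nP z))" "integrable lborel (\<lambda>z. k (R z) * (h z * cm (R z)))"
      "integrable lborel (\<lambda>z. x (R z) * (h z * cm' (R z)))"
      using intr[OF f(1) h(1) _ h(2,3), of nP 1] intr[OF LR[OF f(2)] h(1) cmRm(1) h(2,3), of 1]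
        intr[OF LR[OF f(3)] h(1) cmRm(2) h(2,3), of "2 / l"] nPb by simp_all
    have "(LINT z|lborel. W z * h z) = (LINT z|lborel. f z * (h z * nP z) + k (R z) * (h z * cm (R z)) + x (R z) * (h z * cm' (R z)))"
    proof (rule integral_cong_AE)
      show "(\<lambda>z. W z * h z) \<in> borel_measurable lborel" using W(1) h(1) by simp
      show "(\<lambda>z. f z * (h z * nP z) + k (R z) * (h z * cm (R z)) + x (R z) * (h z * cm' (R z))) \<in> borel_measurable lborel"
        using i by (intro borel_measurable_add) auto
      show "AE z in lborel. W z * h z = f z * (h z * nP z) + k (R z) * (h z * cm (R z)) + x (R z) * (h z * cm' (R z))"
        using AE_snd_neq[of \<tau>]
      proof eventually_elim
        case (elim z)
        show ?case
        proof (cases "z \<in> T")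
          case True
          then show ?thesis by (simp add: W(2)[OF True elim] algebra_simps)
        qed (simp add: h(4))
      qed
    qed
    also have "\<dots> = (LINT z|lborel. f z * (h z * nP z)) + (LINT z|lborel. k (R z) * (h z * cm (R z))) + (LINT z|lborel. x (R z) * (h z * cm' (R z)))"
      using i by simp
    finally show ?thesis .
  qed
  have L0: "L2 (\<lambda>z :: real \<times> real. 0)" by (simp add: L2_def)
  have wm: "w \<in> borel_measurable borel" "G1 \<in> borel_measurable borel" "G2 \<in> borel_measurable borel"
    using w_L2 by (auto simp: L2_def)
  have w_eq: "w z = u z * nP z + u (R z) * cm (R z) + 0 * cm' (R z)" if "z \<in> T" "snd z \<noteq> \<tau>" for z
    using that by (simp add: w_def nP_def cmR R_def[symmetric])
  have G1_eq: "G1 z = g1 z * nP z + g1 (R z) * cm (R z) + 0 * cm' (R z)" if "z \<in> T" "snd z \<noteq> \<tau>" for z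
    using that by (simp add: G1_def nP_def cmR R_def[symmetric])
  have G2_eq: "G2 z = g2 z * nP z + (- g2 (R z)) * cm (R z) + (- u (R z)) * cm' (R z)" if "z \<in> T" "snd z \<noteq> \<tau>" for z
    using that by (simp add: G2_def nP_def cmR R_def[symmetric])
  have c1: "(LINT z|lborel. w z * \<psi>1 z) = (LINT z|lborel. u z * (\<psi>1 z * nP z)) + (LINT z|lborel. u (R z) * (\<psi>1 z * cm (R z)))"
    using combine[OF L(1) L(1) L0 _ bnd(2) zer(2) TP(2) wm(1) w_eq] by simp
  have c2: "(LINT z|lborel. G1 z * \<phi> z) = (LINT z|lborel. g1 z * (\<phi> z * nP z)) + (LINT z|lborel. g1 (R z) * (\<phi> z * cm (R z)))"
    using combine[OF L(2) L(2) L0 _ B(2) zero(1) TP(1) wm(2) G1_eq] by simp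
  have c3: "(LINT z|lborel. w z * \<psi>2 z) = (LINT z|lborel. u z * (\<psi>2 z * nP z)) + (LINT z|lborel. u (R z) * (\<psi>2 z * cm (R z)))"
    using combine[OF L(1) L(1) L0 _ bnd(4) zer(4) TP(3) wm(1) w_eq] by simp
  have neg: "L2 (\<lambda>z. - f z)" if "L2 f" for f :: "real \<times> real \<Rightarrow> real" using L2_cmult[OF that, of "-1"] by simp
  have c4: "(LINT z|lborel. G2 z * \<phi> z) = (LINT z|lborel. g2 z * (\<phi> z * nP z)) - (LINT z|lborel. g2 (R z) * (\<phi> z * cm (R z)))
      - (LINT z|lborel. u (R z) * (\<phi> z * cm' (R z)))"
    using combine[OF L(3) neg[OF L(3)] neg[OF L(1)] _ B(2) zero(1) TP(1) wm(3) G2_eq] by simp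
  have e1: "(LINT z|lborel. u z * (\<psi>1 (R z) * cm z)) = (LINT z|lborel. u (R z) * (\<psi>1 z * cm (R z)))"
    "(LINT z|lborel. g1 z * (\<phi> (R z) * cm z)) = (LINT z|lborel. g1 (R z) * (\<phi> z * cm (R z)))"
    "(LINT z|lborel. u z * (\<psi>2 (R z) * cm z)) = (LINT z|lborel. u (R z) * (\<psi>2 z * cm (R z)))"
    "(LINT z|lborel. g2 z * (\<phi> (R z) * cm z)) = (LINT z|lborel. g2 (R z) * (\<phi> z * cm (R z)))"
    "(LINT z|lborel. u z * (\<phi> (R z) * cm' z)) = (LINT z|lborel. u (R z) * (\<phi> z * cm' (R z)))"
    by (rule refl; measurable)+
  have "(LINT z|lborel. w z * \<psi>1 z) = - (LINT z|lborel. G1 z * \<phi> z)"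
    using A1 A2 unfolding c1 c2 e1 by linarith
  then show "(LINT z|lborel. w z * (\<psi> z \<bullet> (1, 0))) = - (LINT z|lborel. G1 z * \<phi> z)" by (simp add: \<psi>1_def)
  have "(LINT z|lborel. w z * \<psi>2 z) = - (LINT z|lborel. G2 z * \<phi> z)"
    using A3 unfolding c3 c4 e1 by linarith
  then show "(LINT z|lborel. w z * (\<psi> z \<bullet> (0, 1))) = - (LINT z|lborel. G2 z * \<phi> z)" by (simp add: \<psi>2_def)
qed

lemma sobolev_w: "sobolev T w G1 G2"
  unfolding sobolev_def weak_deriv_def
  using w_L2 weak_identities by (auto simp: w_def G1_def G2_def)

end

lemma weak_deriv_const:
  assumes S: "S \<in> sets borel" and e: "e = (1, 0) \<or> e = (0, 1)"
  shows "weak_deriv S e (\<lambda>z. c * indicator S z) (\<lambda>z. 0)"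
  unfolding weak_deriv_def
proof (intro allI impI)
  fix \<phi> \<psi> assume tf: "test_function S \<phi> \<psi>"
  obtain K where K: "K \<subseteq> S" "\<And>z. z \<notin> K \<Longrightarrow> \<psi> z = 0" using test_functionE[OF tf] by metis
  have eq: "c * indicator S z * (\<psi> z \<bullet> e) = c * (\<psi> z \<bullet> e)" for z
  proof (cases "z \<in> S")
    case False
    then have "z \<notin> K" using K(1) by blast
    then show ?thesis by (simp add: K(2))
  qed simp
  have "(LINT z|lborel. c * indicator S z * (\<psi> z \<bullet> e)) = c * (LINT z|lborel. \<psi> z \<bullet> e)"
    unfolding eq by simp
  also have "(LINT z|lborel. \<psi> z \<bullet> e) = 0" using test_function_integral_zero[OF tf] e by auto
  finally show "(LINT z|lborel. c * indicator S z * (\<psi> z \<bullet> e)) = - (LINT z|lborel. 0 * \<phi> z)" by simp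
qed

lemma sobolev_add_const:
  assumes S: "S \<in> sets borel" "emeasure lborel S < \<infinity>" and sob: "sobolev S u g1 g2"
  shows "sobolev S (\<lambda>z. u z + c * indicator S z) g1 g2"
proof -
  have L: "L2 u" "L2 g1" "L2 g2" using sob by (auto simp: sobolev_def)
  have Lc: "L2 (\<lambda>z. c * indicator S z)" using S by (intro L2_cmult L2_indicator) auto
  have L0: "L2 (\<lambda>z :: real \<times> real. 0)" by (simp add: L2_def)
  have "weak_deriv S (1, 0) (\<lambda>z. 1 * u z + 1 * (c * indicator S z)) (\<lambda>z. 1 * g1 z + 1 * 0)"
    by (rule weak_deriv_lincomb[OF L(1) Lc L(2) L0 _ weak_deriv_const[OF S(1)]]) (use sob in \<open>auto simp: sobolev_def\<close>)
  moreover have "weak_deriv S (0, 1) (\<lambda>z. 1 * u z + 1 * (c * indicator S z)) (\<lambda>z. 1 * g2 z + 1 * 0)"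
    by (rule weak_deriv_lincomb[OF L(1) Lc L(3) L0 _ weak_deriv_const[OF S(1)]]) (use sob in \<open>auto simp: sobolev_def\<close>)
  ultimately show ?thesis
    using L L2_add[OF L(1) Lc] sobolev_outside[OF sob] unfolding sobolev_def by simp
qed

text \<open>
  Above height \<open>\<tau>\<close> the displacement over one component is replaced by its mirror image, cut off to a
  constant over the length \<open>l\<close>. This costs a multiple of the energy in the layer below and saves the
  energy above.
\<close>
lemma energy_comparison:
  assumes h: "lower_semicontinuous h" "integrable lborel h" "\<And>x. 0 \<le> h x"
    and k: "lower_semicontinuous k" "integrable lborel k" "\<And>x. 0 \<le> k x"
    and ab: "a < b" "b - a \<le> l" and l\<tau>: "0 < l" "l < \<tau>"
    and ends: "h a \<le> \<tau>" "h b \<le> \<tau>"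
    and inside: "\<And>x. x \<in> {a<..<b} \<Longrightarrow> \<tau> < h x" "\<And>x. x \<in> {a<..<b} \<Longrightarrow> \<tau> < k x"
    and outside: "\<And>x. x \<notin> {a<..<b} \<Longrightarrow> k x = h x"
    and u: "clamped h u g1 g2"
  shows "\<exists>v k1 k2. clamped k v k1 k2 \<and>
    energy k1 k2 \<le> energy g1 g2
      - (LINT z|lborel. indicator ({a<..<b} \<times> {\<tau>..}) z * ((g1 z)\<^sup>2 + (g2 z)\<^sup>2))
      + 50 * (LINT z|lborel. indicator ({a<..<b} \<times> {\<tau> - l<..<\<tau>}) z * ((g1 z)\<^sup>2 + (g2 z)\<^sup>2))"
proof -
  let ?S = "subgraph h" and ?T = "subgraph k"
  define Q where "Q = {a<..<b} \<times> {\<tau> - l<..<\<tau>}"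
  have So: "open ?S" "?S \<in> sets borel" "emeasure lborel ?S < \<infinity>"
    using subgraph_open[OF h(1)] subgraph_finite_measure[OF h] by auto
  have To: "open ?T" "?T \<in> sets borel" "emeasure lborel ?T < \<infinity>"
    using subgraph_open[OF k(1)] subgraph_finite_measure[OF k] by auto
  have sob: "sobolev ?S u g1 g2" using u by (simp add: clamped_def)
  have L: "L2 u" "L2 g1" "L2 g2" using sob by (auto simp: sobolev_def)
  have QS: "Q \<subseteq> ?S" using inside(1) l\<tau> by (force simp: Q_def subgraph_def)
  have Qm [measurable]: "Q \<in> sets borel" unfolding Q_def by (intro borel_open open_Times) auto
  obtain c where c: "(LINT z|lborel. indicator Q z * (u z - c)\<^sup>2)
      \<le> 6 * l\<^sup>2 * (LINT z|lborel. indicator Q z * ((g1 z)\<^sup>2 + (g2 z)\<^sup>2))"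
  proof (rule rectangle_poincare[OF ab(1) _ Q_def L, of l])
    show "weak_deriv Q (1, 0) u g1" "weak_deriv Q (0, 1) u g2"
      using sob weak_deriv_mono[OF _ QS] by (auto simp: sobolev_def)
  qed (use ab l\<tau> in auto)
  \<comment> \<open>Cutting off to the Poincare constant \<open>c\<close> rather than to zero keeps the cost of the cutoff bounded
    by the energy of the layer.\<close>
  define u' where "u' z = u z + (- c) * indicator ?S z" for z
  have sob': "sobolev ?S u' g1 g2" unfolding u'_def by (rule sobolev_add_const[OF So(2,3) sob])
  interpret reflection a b \<tau> l ?S ?T u' g1 g2
  proof
    show "?S - {a<..<b} \<times> {\<tau>..} = ?T - {a<..<b} \<times> {\<tau>..}"
    proof (rule set_eqI)
      fix z :: "real \<times> real"
      show "z \<in> ?S - {a<..<b} \<times> {\<tau>..} \<longleftrightarrow> z \<in> ?T - {a<..<b} \<times> {\<tau>..}"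
      proof (cases "fst z \<in> {a<..<b}")
        case True
        then show ?thesis using inside[OF True] by (cases z) (auto simp: subgraph_def)
      next
        case False
        then show ?thesis using outside[OF False] by (cases z) (auto simp: subgraph_def)
      qed
    qed
    show "{a<..<b} \<times> {\<tau> - l..\<tau>} \<subseteq> ?S" using inside(1) l\<tau> by (force simp: subgraph_def)
    show "(a, y) \<notin> ?T \<and> (b, y) \<notin> ?T" if "\<tau> \<le> y" for y
      using that ends outside[of a] outside[of b] by (auto simp: subgraph_def)
  qed (use l\<tau> So To sob' in auto)
  define v where "v z = w z + c * indicator ?T z" for z
  have sobv: "sobolev ?T v G1 G2" unfolding v_def by (rule sobolev_add_const[OF To(2,3) sobolev_w])
  have low: "z \<in> ?S \<longleftrightarrow> z \<in> ?T" "z \<in> ?T \<Longrightarrow> v z = u z" if "snd z < \<tau>" for z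
  proof -
    have z: "z \<notin> {a<..<b} \<times> {\<tau>..}" using that by auto
    then show "z \<in> ?S \<longleftrightarrow> z \<in> ?T" using agree by blast
    then show "v z = u z" if "z \<in> ?T" using z that by (simp add: v_def w_def u'_def P_def)
  qed
  have supp: "{t. k t \<noteq> 0} = {t. h t \<noteq> 0}"
  proof (rule set_eqI)
    fix t show "t \<in> {t. k t \<noteq> 0} \<longleftrightarrow> t \<in> {t. h t \<noteq> 0}"
      using inside[of t] outside[of t] l\<tau> by (cases "t \<in> {a<..<b}") auto
  qed
  \<comment> \<open>Nothing changes below height \<open>\<tau>\<close>, so the trace on the bottom edge is preserved.\<close>
  have tr_eq: "trace_at ?T v (x, 0) x \<longleftrightarrow> trace_at ?S u (x, 0) x" for x
    unfolding trace_at_def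
  proof (rule tendsto_cong)
    have "\<forall>\<^sub>F r in at_right 0. r < \<tau>"
      using l\<tau> by (intro order_tendstoD(2)[of "\<lambda>r. r" 0]) (auto intro: tendsto_ident_at)
    then show "\<forall>\<^sub>F r in at_right 0. (LINT z:(?T \<inter> ball (x, 0) r)|lborel. \<bar>v z - x\<bar>) / r\<^sup>2 =
        (LINT z:(?S \<inter> ball (x, 0) r)|lborel. \<bar>u z - x\<bar>) / r\<^sup>2"
    proof eventually_elim
      case (elim r)
      have "indicator (?T \<inter> ball (x, 0) r) z *\<^sub>R \<bar>v z - x\<bar> = indicator (?S \<inter> ball (x, 0) r) z *\<^sub>R \<bar>u z - x\<bar>" for z
      proof (cases "z \<in> ball (x, 0) r")
        case True
        have "\<bar>snd z\<bar> \<le> norm (z - (x, 0))"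
          using norm_snd_le[of "snd z" "fst z - x"] by (cases z) simp
        then have "snd z < \<tau>" using True elim by (auto simp: dist_norm norm_minus_commute)
        then show ?thesis using low[of z] by (auto simp: indicator_def)
      qed simp
      then show ?case unfolding set_lebesgue_integral_def by simp
    qed
  qed
  have "AE x in lborel. x \<in> closure {t. h t \<noteq> 0} \<longrightarrow> trace_at ?S u (x, 0) x"
    using clamped_imp_admissible(1)[OF h(1) u] by (simp add: admissible_displacement_def)
  then have "AE x in lborel. x \<in> closure {t. k t \<noteq> 0} \<longrightarrow> trace_at ?T v (x, 0) x"
    unfolding supp tr_eq .
  then have "AE z in lborel. z \<in> ?T \<longrightarrow> v z = fst z + vprim G2 z"
    using sobv by (intro displacement_representation[OF k(1)]) (auto simp: sobolev_def)
  then have cl: "clamped k v G1 G2" using sobv by (simp add: clamped_def)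
  define g where "g z = (g1 z)\<^sup>2 + (g2 z)\<^sup>2" for z
  have [measurable]: "g \<in> borel_measurable borel" unfolding g_def[abs_def] by measurable
  have gint: "integrable lborel g" unfolding g_def[abs_def] using L[THEN L2_square] by simp
  have ind: "integrable lborel (\<lambda>z. indicator A z * g z)" if "A \<in> sets borel" for A
    using integrable_mult_indicator[OF _ gint, of A] that by simp
  have uint: "integrable lborel (\<lambda>z. indicator Q z * (u' z)\<^sup>2)"
    using integrable_mult_indicator[OF _ L2_square[of u'], of Q] sob' by (simp add: sobolev_def)
  have uQ: "(LINT z|lborel. indicator Q z * (u' z)\<^sup>2) = (LINT z|lborel. indicator Q z * (u z - c)\<^sup>2)"
    by (rule Bochner_Integration.integral_cong) (use QS in \<open>auto simp: u'_def indicator_def\<close>)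
  \<comment> \<open>A bound for the energy density of the reflected displacement. The constant \<open>50 = 2 + 8 * 6\<close> comes
    from the square of a sum, the slope \<open>2 / l\<close> of the cutoff and the Poincare constant \<open>6\<close>.\<close>
  define H where "H z = indicator Q z * (2 * g z + 8 / l\<^sup>2 * (u' z)\<^sup>2)" for z
  have H_eq: "H = (\<lambda>z. 2 * (indicator Q z * g z) + 8 / l\<^sup>2 * (indicator Q z * (u' z)\<^sup>2))"
    by (auto simp: H_def fun_eq_iff algebra_simps)
  have Hint: "integrable lborel H" unfolding H_eq using ind[OF Qm] uint by simp
  have Hval: "(LINT z|lborel. H z) \<le> 50 * (LINT z|lborel. indicator Q z * g z)"
  proof -
    have "(LINT z|lborel. H z) = 2 * (LINT z|lborel. indicator Q z * g z) + 8 / l\<^sup>2 * (LINT z|lborel. indicator Q z * (u' z)\<^sup>2)"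
      unfolding H_eq using ind[OF Qm] uint by simp
    also have "8 / l\<^sup>2 * (LINT z|lborel. indicator Q z * (u' z)\<^sup>2) \<le> 8 / l\<^sup>2 * (6 * l\<^sup>2 * (LINT z|lborel. indicator Q z * g z))"
      unfolding uQ using c l\<tau> by (intro mult_left_mono) (auto simp: g_def)
    finally show ?thesis using l\<tau> by simp
  qed
  have Hm: "H \<in> borel_measurable borel" using Hint by auto
  have "energy G1 G2 \<le> (LINT z|lborel. (g z - indicator P z * g z) + H (reflect \<tau> z))"
    unfolding energy_def
  proof (rule integral_mono_AE)
    show "integrable lborel (\<lambda>z. (G1 z)\<^sup>2 + (G2 z)\<^sup>2)" using w_L2[THEN L2_square] by simp
    show "integrable lborel (\<lambda>z. (g z - indicator P z * g z) + H (reflect \<tau> z))"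
      using gint ind[of P] integrable_reflect[OF Hint] by simp
    show "AE z in lborel. (G1 z)\<^sup>2 + (G2 z)\<^sup>2 \<le> (g z - indicator P z * g z) + H (reflect \<tau> z)"
      using AE_snd_neq[of \<tau>]
    proof eventually_elim
      case (elim z)
      have Hnn: "0 \<le> H z'" for z' by (simp add: H_def g_def)
      show ?case
      proof (cases "z \<in> P")
        case False
        have "(G1 z)\<^sup>2 + (G2 z)\<^sup>2 \<le> g z" using False by (simp add: G1_def G2_def g_def indicator_def)
        then show ?thesis using False Hnn[of "reflect \<tau> z"] by simp
      next
        case True
        define t where "t = 2 * \<tau> - snd z"
        define A where "A = g1 (reflect \<tau> z)"
        define B where "B = g2 (reflect \<tau> z)"
        define C where "C = u' (reflect \<tau> z)"
        show ?thesis
        proof (cases "reflect \<tau> z \<in> Q")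
          case inQ: True
          have t1: "(cut t)\<^sup>2 \<le> 1" using cut_bounds(1,2)[of t] by (simp add: power_le_one)
          have t2: "(cut' t)\<^sup>2 \<le> (2 / l)\<^sup>2" using cut_bounds(3,4)[of t] by (intro power_mono)
          have "(G1 z)\<^sup>2 + (G2 z)\<^sup>2 \<le> (cut t * A)\<^sup>2 + (- cut' t * C - cut t * B)\<^sup>2"
            using True by (simp add: G1_def G2_def t_def A_def B_def C_def indicator_def)
          also have "\<dots> \<le> (cut t * A)\<^sup>2 + (2 * (cut' t * C)\<^sup>2 + 2 * (cut t * B)\<^sup>2)"
          proof -
            have "0 \<le> (cut' t * C - cut t * B)\<^sup>2" by simp
            then show ?thesis by (simp add: power2_eq_square algebra_simps)
          qed
          also have "\<dots> \<le> 1 * A\<^sup>2 + (2 * ((2 / l)\<^sup>2 * C\<^sup>2) + 2 * (1 * B\<^sup>2))"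
            unfolding power_mult_distrib using t1 t2 by (intro add_mono mult_left_mono mult_right_mono) auto
          also have "\<dots> \<le> 2 * (A\<^sup>2 + B\<^sup>2) + 8 / l\<^sup>2 * C\<^sup>2" by (simp add: power_divide)
          also have "\<dots> = H (reflect \<tau> z)" using inQ by (simp add: H_def g_def A_def B_def C_def)
          finally show ?thesis using True by simp
        next
          case notQ: False
          have "t \<le> \<tau> - l"
          proof (rule ccontr)
            assume "\<not> t \<le> \<tau> - l"
            moreover have "t < \<tau>" using True elim by (auto simp: t_def P_def)
            ultimately have "reflect \<tau> z \<in> Q" using True by (cases z) (auto simp: Q_def P_def t_def reflect_def)
            with notQ show False by simp
          qed
          then have "cut t = 0" "cut' t = 0" by (auto intro: cut_zero)
          then have "G1 z = 0" "G2 z = 0" using True by (simp_all add: G1_def G2_def t_def)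
          then show ?thesis using True Hnn[of "reflect \<tau> z"] by simp
        qed
      qed
    qed
  qed
  also have "\<dots> = (LINT z|lborel. g z) - (LINT z|lborel. indicator P z * g z) + (LINT z|lborel. H z)"
    using gint ind[of P] integrable_reflect[OF Hint] integral_reflect[OF Hm] by simp
  also have "\<dots> \<le> (LINT z|lborel. g z) - (LINT z|lborel. indicator P z * g z) + 50 * (LINT z|lborel. indicator Q z * g z)"
    using Hval by simp
  finally have "energy G1 G2 \<le> energy g1 g2 - (LINT z|lborel. indicator P z * g z) + 50 * (LINT z|lborel. indicator Q z * g z)"
    by (simp add: energy_def g_def)
  with cl show ?thesis unfolding P_def Q_def g_def by blast
qed

section \<open>Pointwise variation\<close>

text \<open>
  Insertion of further points is easier to handle for lists than for finite sequences.
\<close>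
fun var_list :: "(real \<Rightarrow> real) \<Rightarrow> real list \<Rightarrow> real" where
  "var_list f (x # y # zs) = \<bar>f y - f x\<bar> + var_list f (y # zs)"
| "var_list f [x] = 0"
| "var_list f [] = 0"

lemma var_list_nonneg: "0 \<le> var_list f xs"
  by (induction f xs rule: var_list.induct) auto

lemma var_list_eq_sum: "var_list f xs = (\<Sum>i<length xs - 1. \<bar>f (xs ! Suc i) - f (xs ! i)\<bar>)"
proof (induction f xs rule: var_list.induct)
  case (1 f x y zs)
  have "(\<Sum>i<length (x # y # zs) - 1. \<bar>f ((x # y # zs) ! Suc i) - f ((x # y # zs) ! i)\<bar>)
      = (\<Sum>i<Suc (length zs). \<bar>f ((x # y # zs) ! Suc i) - f ((x # y # zs) ! i)\<bar>)" by simp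
  also have "\<dots> = \<bar>f y - f x\<bar> + (\<Sum>i<length zs. \<bar>f ((y # zs) ! Suc i) - f ((y # zs) ! i)\<bar>)"
    by (subst sum.lessThan_Suc_shift) simp
  finally show ?case using 1 by simp
qed simp_all

lemma var_list_append: "var_list f (xs @ y # zs) = var_list f (xs @ [y]) + var_list f (y # zs)"
proof (induction xs)
  case (Cons x xs)
  then show ?case by (cases xs) auto
qed simp

text \<open>
  The triangle inequality.
\<close>
lemma var_list_insort: "var_list f xs \<le> var_list f (insort y xs)"
proof (induction f xs rule: var_list.induct)
  case (1 f x z zs)
  then show ?case by auto
qed auto

lemma var_list_insert:
  assumes "finite X" shows "var_list f (sorted_list_of_set X) \<le> var_list f (sorted_list_of_set (insert y X))"
proof (cases "y \<in> X")
  case False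
  then have "sorted_list_of_set (insert y X) = insort y (sorted_list_of_set X)"
    using assms by simp
  then show ?thesis using var_list_insort by simp
qed (simp add: insert_absorb)

lemma var_list_le_variation:
  assumes "sorted_wrt (<) ys" shows "ennreal (var_list h ys) \<le> pointwise_variation h"
proof (cases "ys = []")
  case False
  have "strict_mono_on {..length ys - 1} (\<lambda>i. ys ! i)"
    using assms False by (intro strict_mono_onI) (auto intro!: sorted_wrt_nth_less simp: less_Suc_eq_le[symmetric])
  then show ?thesis
    unfolding pointwise_variation_def var_list_eq_sum
    by (intro SUP_upper2[where i="(length ys - 1, \<lambda>i. ys ! i)"]) auto
qed simp

lemma variation_leI:
  assumes "\<And>ys. sorted_wrt (<) ys \<Longrightarrow> ennreal (var_list h ys) \<le> C"
  shows "pointwise_variation h \<le> C"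
  unfolding pointwise_variation_def
proof (rule SUP_least, clarify)
  fix n :: nat and x :: "nat \<Rightarrow> real" assume x: "strict_mono_on {..n} x"
  define ys where "ys = map x [0..<Suc n]"
  have "sorted_wrt (<) ys"
    unfolding ys_def sorted_wrt_iff_nth_less
    using x by (auto simp del: upt_Suc intro: strict_mono_onD)
  from assms[OF this] have "ennreal (var_list h ys) \<le> C" .
  moreover have "var_list h ys = (\<Sum>i<n. \<bar>h (x (Suc i)) - h (x i)\<bar>)"
    unfolding var_list_eq_sum ys_def by (intro sum.cong) (auto simp del: upt_Suc)
  ultimately show "ennreal (\<Sum>i<n. \<bar>h (x (Suc i)) - h (x i)\<bar>) \<le> C" by simp
qed

lemma var_list_scale: "0 \<le> c \<Longrightarrow> var_list (\<lambda>x. c * h (m * x)) ys = c * var_list h (map ((*) m) ys)"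
proof (induction ys rule: induct_list012)
  case (3 x y zs)
  then show ?case by (simp add: right_diff_distrib[symmetric] abs_mult distrib_left)
qed simp_all

lemma variation_scale_le:
  assumes "0 \<le> c" "0 < m"
  shows "pointwise_variation (\<lambda>x. c * h (m * x)) \<le> ennreal c * pointwise_variation h"
proof (rule variation_leI)
  fix ys :: "real list" assume "sorted_wrt (<) ys"
  then have "sorted_wrt (<) (map ((*) m) ys)" using assms(2) by (simp add: sorted_wrt_map)
  then have "ennreal (var_list h (map ((*) m) ys)) \<le> pointwise_variation h" by (rule var_list_le_variation)
  then show "ennreal (var_list (\<lambda>x. c * h (m * x)) ys) \<le> ennreal c * pointwise_variation h"
    unfolding var_list_scale[OF assms(1)] using assms(1) var_list_nonneg
    by (simp add: ennreal_mult mult_left_mono)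
qed

lemma variation_ge_diff: "ennreal \<bar>h x - h y\<bar> \<le> pointwise_variation h"
proof -
  consider "x < y" | "y < x" | "x = y" by linarith
  then show ?thesis
  proof cases
    case 1
    then show ?thesis using var_list_le_variation[of "[x, y]" h] by (simp add: abs_minus_commute)
  next
    case 2
    then show ?thesis using var_list_le_variation[of "[y, x]" h] by simp
  qed simp
qed

lemma variation_indicator: "pointwise_variation (\<lambda>x. if x \<in> {0<..<1} then 1 else 0) \<le> 2"
proof (rule variation_leI)
  fix ys :: "real list" assume ys: "sorted_wrt (<) ys"
  define f where "f x = (if 0 < x then 1 else 0 :: real)" for x :: real
  define g where "g x = (if 1 \<le> x then 1 else 0 :: real)" for x :: real
  let ?h = "\<lambda>x. if x \<in> {0<..<1} then 1 else 0 :: real"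
  define n where "n = length ys - 1"
  have h: "?h x = f x - g x" for x by (auto simp: f_def g_def)
  have "var_list ?h ys \<le> (\<Sum>i<n. (f (ys ! Suc i) - f (ys ! i)) + (g (ys ! Suc i) - g (ys ! i)))"
    unfolding var_list_eq_sum n_def[symmetric]
  proof (rule sum_mono)
    fix i assume "i \<in> {..<n}"
    then have "ys ! i < ys ! Suc i" using ys by (auto simp: sorted_wrt_iff_nth_less n_def)
    then have "f (ys ! i) \<le> f (ys ! Suc i)" "g (ys ! i) \<le> g (ys ! Suc i)" by (auto simp: f_def g_def)
    then show "\<bar>?h (ys ! Suc i) - ?h (ys ! i)\<bar> \<le> (f (ys ! Suc i) - f (ys ! i)) + (g (ys ! Suc i) - g (ys ! i))"
      unfolding h by linarith
  qed
  also have "\<dots> = (f (ys ! n) - f (ys ! 0)) + (g (ys ! n) - g (ys ! 0))"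
    using sum_lessThan_telescope[of "\<lambda>i. f (ys ! i)" n] sum_lessThan_telescope[of "\<lambda>i. g (ys ! i)" n]
    by (simp add: sum.distrib)
  also have "\<dots> \<le> 2" by (auto simp: f_def g_def)
  finally have "ennreal (var_list ?h ys) \<le> ennreal 2" by (rule ennreal_leI)
  then show "ennreal (var_list ?h ys) \<le> 2" by simp
qed

lemma var_list_cong: "(\<And>x. x \<in> set xs \<Longrightarrow> f x = g x) \<Longrightarrow> var_list f xs = var_list g xs"
  by (induction xs rule: induct_list012) auto

lemma var_list_const: "(\<And>x. x \<in> set xs \<Longrightarrow> f x = c) \<Longrightarrow> var_list f xs = 0"
  by (induction xs rule: induct_list012) auto

text \<open>
  Every partition can be refined by the end points of the interval and by \<open>p\<close>. Between \<open>a\<close> and \<open>b\<close> the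
  levelled function rises once to \<open>A\<close> and falls once, whereas \<open>g\<close> also climbs from \<open>A\<close> to \<open>g p\<close> and back.
\<close>
lemma variation_levelled:
  assumes ab: "a < b" and p: "p \<in> {a<..<b}"
    and g: "\<And>x. x \<notin> {a<..<b} \<Longrightarrow> g x = k x" and A: "k a \<le> A" "k b \<le> A" "A \<le> g p"
  shows "pointwise_variation (\<lambda>x. if x \<in> {a<..<b} then A else k x) + ennreal (2 * (g p - A)) \<le> pointwise_variation g"
proof -
  let ?k = "\<lambda>x. if x \<in> {a<..<b} then A else k x"
  have le: "ennreal (var_list ?k ys) + ennreal (2 * (g p - A)) \<le> pointwise_variation g"
    if ys: "sorted_wrt (<) ys" for ys
  proof -
    define X where "X = set ys"
    have fin: "finite X" by (simp add: X_def)
    have ysX: "ys = sorted_list_of_set X"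
      unfolding X_def using ys by (simp add: sorted_list_of_set.idem_if_sorted_distinct strict_sorted_iff)
    \<comment> \<open>On the outer pieces \<open>g\<close> and the levelled function agree.\<close>
    define Ll where "Ll = sorted_list_of_set {x \<in> X. x < a}"
    define Ml where "Ml = sorted_list_of_set {x \<in> X. a < x \<and> x < b}"
    define Rl where "Rl = sorted_list_of_set {x \<in> X. b < x}"
    have sets: "set Ll = {x \<in> X. x < a}" "set Ml = {x \<in> X. a < x \<and> x < b}" "set Rl = {x \<in> X. b < x}"
      using fin by (simp_all add: Ll_def Ml_def Rl_def)
    have sorted: "sorted_wrt (<) Ll" "sorted_wrt (<) Ml" "sorted_wrt (<) Rl"
      by (simp_all add: Ll_def Ml_def Rl_def)
    have srt: "sorted_wrt (<) (Ll @ a # Ml @ b # Rl)"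
      using sorted sets ab by (auto simp: sorted_wrt_append)
    have "set (Ll @ a # Ml @ b # Rl) = insert a (insert b X)"
      using sets ab by auto
    then have split: "sorted_list_of_set (insert a (insert b X)) = Ll @ a # Ml @ b # Rl"
      using srt by (metis sorted_list_of_set.idem_if_sorted_distinct strict_sorted_iff)
    have "var_list ?k ys \<le> var_list ?k (Ll @ a # Ml @ b # Rl)"
      unfolding ysX split[symmetric] using var_list_insert fin by (meson finite_insert order_trans)
    also have "\<dots> = var_list ?k (Ll @ [a]) + var_list ?k (a # Ml @ [b]) + var_list ?k (b # Rl)"
      using var_list_append[of ?k Ll a "Ml @ b # Rl"] var_list_append[of ?k "a # Ml" b Rl] by simp
    also have "var_list ?k (Ll @ [a]) = var_list g (Ll @ [a])"
      by (rule var_list_cong) (use sets g in auto)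
    also have "var_list ?k (b # Rl) = var_list g (b # Rl)"
      by (rule var_list_cong) (use sets g in auto)
    also have "var_list ?k (a # Ml @ [b]) \<le> (A - k a) + (A - k b)"
    proof (cases Ml)
      case Nil
      then show ?thesis using A by simp
    next
      case (Cons m ms)
      have cst: "var_list ?k (m # ms) = 0"
        by (rule var_list_const[where c=A]) (use sets(2) Cons in auto)
      define z where "z = last (m # ms)"
      have zin: "z \<in> set Ml" unfolding Cons z_def by (rule last_in_set) simp
      have kz: "?k z = A" using zin sets(2) by auto
      have "var_list ?k (m # ms @ [b]) = var_list ?k (m # ms) + \<bar>?k b - ?k z\<bar>"
      proof -
        define bl where "bl = butlast (m # ms)"
        have "bl @ [z] = m # ms" unfolding bl_def z_def by (rule append_butlast_last_id) simp
        note e = this[symmetric]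
        have f1: "m # ms @ [b] = bl @ z # [b]" using arg_cong[OF e, of "\<lambda>l. l @ [b]"] by simp
        show ?thesis unfolding f1 e using var_list_append[of ?k bl z "[b]"] by simp
      qed
      moreover have "?k m = A" using sets(2) Cons by auto
      ultimately show ?thesis using Cons cst kz A ab by (simp add: abs_if)
    qed
    finally have v: "var_list ?k ys \<le> var_list g (Ll @ [a]) + ((A - k a) + (A - k b)) + var_list g (b # Rl)" by simp
    have gab: "g a = k a" "g b = k b" using g by auto
    have vg: "var_list g (Ll @ a # p # b # Rl) = var_list g (Ll @ [a]) + \<bar>g p - g a\<bar> + \<bar>g b - g p\<bar> + var_list g (b # Rl)"
      using var_list_append[of g Ll a "p # b # Rl"] by simp
    have "\<bar>g p - g a\<bar> = g p - k a" "\<bar>g b - g p\<bar> = g p - k b" using gab A by auto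
    then have "var_list g (Ll @ a # p # b # Rl) = var_list g (Ll @ [a]) + (g p - k a) + (g p - k b) + var_list g (b # Rl)"
      using vg by (simp only:)
    then have "var_list ?k ys + 2 * (g p - A) \<le> var_list g (Ll @ a # p # b # Rl)"
      using v by (simp only:) simp
    moreover have "sorted_wrt (<) (Ll @ a # p # b # Rl)"
      using sorted sets ab p by (auto simp: sorted_wrt_append)
    then have "ennreal (var_list g (Ll @ a # p # b # Rl)) \<le> pointwise_variation g" by (rule var_list_le_variation)
    ultimately have "ennreal (var_list ?k ys + 2 * (g p - A)) \<le> pointwise_variation g"
      by (meson ennreal_leI order_trans)
    then show ?thesis using A var_list_nonneg by (simp add: ennreal_plus)
  qed
  show ?thesis
  proof (cases "pointwise_variation g = \<infinity>")
    case False
    have kle: "pointwise_variation ?k \<le> pointwise_variation g - ennreal (2 * (g p - A))"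
    proof (rule variation_leI)
      fix ys :: "real list" assume "sorted_wrt (<) ys"
      from le[OF this] have "ennreal (var_list ?k ys) + ennreal (2 * (g p - A)) - ennreal (2 * (g p - A))
        \<le> pointwise_variation g - ennreal (2 * (g p - A))" by (rule ennreal_minus_mono) simp
      then show "ennreal (var_list ?k ys) \<le> pointwise_variation g - ennreal (2 * (g p - A))" by simp
    qed
    have "ennreal (2 * (g p - A)) \<le> pointwise_variation g"
      using le[of "[]"] by simp
    then have "(pointwise_variation g - ennreal (2 * (g p - A))) + ennreal (2 * (g p - A)) = pointwise_variation g"
      by (rule diff_add_cancel_ennreal)
    moreover have "pointwise_variation ?k + ennreal (2 * (g p - A))
        \<le> (pointwise_variation g - ennreal (2 * (g p - A))) + ennreal (2 * (g p - A))"
      using kle by (rule add_right_mono)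
    ultimately show ?thesis by simp
  qed simp
qed

text \<open>
  The integral over \<open>m\<close> adjacent intervals of length \<open>t\<close> folds into one interval, where the integrand is a
  sum of increments along an arithmetic progression.
\<close>
lemma variation_translation:
  assumes [measurable]: "h \<in> borel_measurable borel" and t: "0 < t"
  shows "(\<integral>\<^sup>+x. indicator {c..<c + real m * t} x * ennreal \<bar>h (x + t) - h x\<bar> \<partial>lborel) \<le> ennreal t * pointwise_variation h"
proof -
  define f where "f x = ennreal \<bar>h (x + t) - h x\<bar>" for x
  have [measurable]: "f \<in> borel_measurable borel" unfolding f_def[abs_def] by measurable
  have eq: "(\<integral>\<^sup>+x. indicator {c..<c + real m * t} x * f x \<partial>lborel)
      = (\<integral>\<^sup>+x. indicator {c..<c + t} x * (\<Sum>i<m. f (x + real i * t)) \<partial>lborel)"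
  proof (induction m)
    case (Suc m)
    have "(indicator {c..<c + real (Suc m) * t} x :: ennreal)
        = indicator {c..<c + real m * t} x + indicator {c + real m * t..<c + real (Suc m) * t} x" for x
    proof -
      define v where "v = real m * t"
      have v: "0 \<le> v" "real (Suc m) * t = v + t" using t by (simp_all add: v_def distrib_right)
      show ?thesis unfolding v(2) v_def[symmetric] using t v(1) by (auto simp: indicator_def)
    qed
    then have "(\<integral>\<^sup>+x. indicator {c..<c + real (Suc m) * t} x * f x \<partial>lborel)
        = (\<integral>\<^sup>+x. indicator {c..<c + real m * t} x * f x + indicator {c + real m * t..<c + real (Suc m) * t} x * f x \<partial>lborel)"
      by (simp add: distrib_right)
    also have "\<dots> = (\<integral>\<^sup>+x. indicator {c..<c + real m * t} x * f x \<partial>lborel)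
        + (\<integral>\<^sup>+x. indicator {c + real m * t..<c + real (Suc m) * t} x * f x \<partial>lborel)"
      by (rule nn_integral_add) measurable
    also have "(\<integral>\<^sup>+x. indicator {c + real m * t..<c + real (Suc m) * t} x * f x \<partial>lborel)
        = (\<integral>\<^sup>+x. indicator {c..<c + t} x * f (x + real m * t) \<partial>lborel)"
    proof -
      have "(\<integral>\<^sup>+x. indicator {c + real m * t..<c + real (Suc m) * t} x * f x \<partial>lborel)
          = (\<integral>\<^sup>+x. indicator {c + real m * t..<c + real (Suc m) * t} (real m * t + 1 * x) * f (real m * t + 1 * x) \<partial>lborel)"
        by (subst nn_integral_real_affine[of _ 1 "real m * t"]) auto
      also have "\<dots> = (\<integral>\<^sup>+x. indicator {c..<c + t} x * f (x + real m * t) \<partial>lborel)"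
        by (rule nn_integral_cong) (auto simp: indicator_def distrib_right add.commute)
      finally show ?thesis .
    qed
    also have "(\<integral>\<^sup>+x. indicator {c..<c + real m * t} x * f x \<partial>lborel) + (\<integral>\<^sup>+x. indicator {c..<c + t} x * f (x + real m * t) \<partial>lborel)
        = (\<integral>\<^sup>+x. indicator {c..<c + t} x * (\<Sum>i<m. f (x + real i * t)) + indicator {c..<c + t} x * f (x + real m * t) \<partial>lborel)"
      unfolding Suc by (rule nn_integral_add[symmetric]) measurable
    finally show ?case by (simp add: distrib_left)
  qed simp
  have "(\<Sum>i<m. f (x + real i * t)) \<le> pointwise_variation h" for x
  proof -
    define ys where "ys = map (\<lambda>i. x + real i * t) [0..<Suc m]"
    have "sorted_wrt (<) ys" unfolding ys_def sorted_wrt_iff_nth_less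
      using t by (auto simp del: upt_Suc)
    from var_list_le_variation[OF this, of h]
    have "ennreal (var_list h ys) \<le> pointwise_variation h" .
    moreover have "var_list h ys = (\<Sum>i<m. \<bar>h (x + real i * t + t) - h (x + real i * t)\<bar>)"
      unfolding var_list_eq_sum ys_def by (intro sum.cong) (auto simp del: upt_Suc simp: algebra_simps)
    ultimately show ?thesis by (simp add: f_def sum_ennreal)
  qed
  then have "(\<integral>\<^sup>+x. indicator {c..<c + t} x * (\<Sum>i<m. f (x + real i * t)) \<partial>lborel)
      \<le> (\<integral>\<^sup>+x. pointwise_variation h * indicator {c..<c + t} x \<partial>lborel)"
    by (intro nn_integral_mono) (auto simp: indicator_def)
  also have "\<dots> = pointwise_variation h * ennreal t"
    using t by (subst nn_integral_cmult) auto
  finally show ?thesis using eq by (simp add: f_def mult.commute)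
qed

text \<open>
  The derivative of the test function is a limit of difference quotients, and a translation moves the
  difference to \<open>h\<close>.
\<close>
lemma BV_if_finite_variation:
  assumes h: "integrable lborel h" and pv: "pointwise_variation h < \<infinity>"
  shows "BV h"
proof -
  have [measurable]: "h \<in> borel_measurable borel" using h by auto
  define C where "C = enn2real (pointwise_variation h)"
  have C: "pointwise_variation h = ennreal C" "0 \<le> C" using pv by (simp_all add: C_def)
  have "(LINT x|lborel. h x * \<psi> x) \<le> C"
    if tf: "test_function UNIV \<phi> \<psi>" and \<phi>1: "\<And>x. \<bar>\<phi> x\<bar> \<le> 1" for \<phi> \<psi> :: "real \<Rightarrow> real"
  proof -
    obtain K where K: "compact K" "\<And>z. z \<notin> K \<Longrightarrow> \<phi> z = 0" using test_functionE[OF tf] by metis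
    obtain N where N: "N > 0" "\<And>z. z \<in> K \<Longrightarrow> \<bar>z\<bar> \<le> N"
      using compact_imp_bounded[OF K(1)] by (auto simp: bounded_pos)
    obtain B where B: "B > 0" "\<And>z. norm (\<psi> z) \<le> B" using test_function_bounded[OF tf] by metis
    note [measurable] = test_function_measurable[OF tf]
    have d: "(\<phi> has_real_derivative \<psi> x) (at x)" for x
      using tf unfolding test_function_def has_field_derivative_def by (simp add: inner_real_def)
    define t where "t n = 1 / real (Suc n)" for n
    have t: "0 < t n" for n by (simp add: t_def)
    have t0: "t \<longlonglongrightarrow> 0" unfolding t_def using LIMSEQ_inverse_real_of_nat by (simp add: field_simps)
    define q where "q n x = (\<phi> (x + t n) - \<phi> x) / t n" for n x
    have qm [measurable]: "q n \<in> borel_measurable borel" for n unfolding q_def[abs_def] by measurable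
    have qb: "\<bar>q n x\<bar> \<le> B" for n x
    proof -
      have "norm (\<phi> (x + t n) - \<phi> x) \<le> B * norm (x + t n - x)"
        by (rule field_differentiable_bound[of UNIV \<phi> \<psi>]) (use d B(2) in auto)
      then show ?thesis using t[of n] by (simp add: q_def field_simps)
    qed
    have lim: "(\<lambda>n. LINT x|lborel. h x * q n x) \<longlonglongrightarrow> (LINT x|lborel. h x * \<psi> x)"
    proof (rule integral_dominated_convergence[where w="\<lambda>x. B * \<bar>h x\<bar>"])
      show "AE x in lborel. (\<lambda>n. h x * q n x) \<longlonglongrightarrow> h x * \<psi> x"
      proof (rule AE_I2)
        fix x
        have "((\<lambda>s. (\<phi> (x + s) - \<phi> x) / s) \<longlongrightarrow> \<psi> x) (at 0)" using d[of x] by (simp add: DERIV_def)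
        moreover have "filterlim t (at 0) sequentially"
          using t0 t by (auto simp: filterlim_at intro!: always_eventually) (metis less_irrefl)
        ultimately have "(\<lambda>n. q n x) \<longlonglongrightarrow> \<psi> x" unfolding q_def by (rule filterlim_compose)
        then show "(\<lambda>n. h x * q n x) \<longlonglongrightarrow> h x * \<psi> x" by (intro tendsto_intros)
      qed
      show "AE x in lborel. norm (h x * q n x) \<le> B * \<bar>h x\<bar>" for n
        using mult_left_mono[OF qb, of "\<bar>h _\<bar>"] by (intro AE_I2) (simp add: abs_mult mult.commute)
      show "integrable lborel (\<lambda>x. B * \<bar>h x\<bar>)" using h by simp
    qed measurable
    have bd: "(LINT x|lborel. h x * q n x) \<le> C" for n
    proof -
      have sh: "integrable lborel (\<lambda>x. h (x + t n))"
        using lborel_integrable_real_affine[OF h, of 1 "t n"] by (simp add: add.commute)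
      have bb: "integrable lborel (\<lambda>x. f x * g x)"
        if "integrable lborel f" "g \<in> borel_measurable borel" "\<And>x. \<bar>g x\<bar> \<le> 1" for f g :: "real \<Rightarrow> real"
      proof (rule Bochner_Integration.integrable_bound[OF that(1)])
        show "(\<lambda>x. f x * g x) \<in> borel_measurable lborel" using that(1,2) by simp
        show "AE x in lborel. norm (f x * g x) \<le> norm (f x)"
          using that(3) by (intro AE_I2) (simp add: abs_mult mult_left_le)
      qed
      have i1: "integrable lborel (\<lambda>x. h x * \<phi> (x + t n))" by (rule bb[OF h]) (use \<phi>1 in measurable)
      have i2: "integrable lborel (\<lambda>x. h x * \<phi> x)" by (rule bb[OF h]) (use \<phi>1 in measurable)
      have i3: "integrable lborel (\<lambda>x. h (x + t n) * \<phi> (x + t n))" by (rule bb[OF sh]) (use \<phi>1 in measurable)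
      have "(LINT x|lborel. h x * q n x) * t n = (LINT x|lborel. h x * \<phi> (x + t n) - h x * \<phi> x)"
      proof -
        have "(LINT x|lborel. h x * q n x) * t n = (LINT x|lborel. (h x * q n x) * t n)" by simp
        also have "\<dots> = (LINT x|lborel. h x * \<phi> (x + t n) - h x * \<phi> x)"
          by (rule Bochner_Integration.integral_cong) (use t[of n] in \<open>auto simp: q_def field_simps\<close>)
        finally show ?thesis .
      qed
      also have "\<dots> = (LINT x|lborel. h x * \<phi> (x + t n)) - (LINT x|lborel. h x * \<phi> x)" using i1 i2 by simp
      also have "(LINT x|lborel. h x * \<phi> x) = (LINT x|lborel. h (x + t n) * \<phi> (x + t n))"
        using lborel_integral_real_affine[of 1 "\<lambda>x. h x * \<phi> x" "t n"] by (simp add: add.commute)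
      also have "(LINT x|lborel. h x * \<phi> (x + t n)) - (LINT x|lborel. h (x + t n) * \<phi> (x + t n))
          = (LINT x|lborel. (h x - h (x + t n)) * \<phi> (x + t n))"
        using i1 i3 by (simp add: left_diff_distrib)
      also have "\<dots> \<le> C * t n"
      proof (rule integral_real_bounded)
        obtain m :: nat where m: "(2 * (N + t n)) / t n \<le> real m" using real_arch_simple by blast
        define c where "c = - (N + t n)"
        have cover: "x \<in> {c..<c + real m * t n} \<or> \<phi> (x + t n) = 0" for x
        proof (cases "x + t n \<in> K")
          case True
          then have x: "- N - t n \<le> x" "x \<le> N - t n" using N(2)[of "x + t n"] by linarith+
          have "2 * (N + t n) \<le> real m * t n" using m t[of n] by (simp add: field_simps)
          then have "x < c + real m * t n" using x t[of n] by (simp add: c_def)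
          then show ?thesis using x by (simp add: c_def)
        qed (simp add: K(2))
        have "(\<integral>\<^sup>+x. ennreal ((h x - h (x + t n)) * \<phi> (x + t n)) \<partial>lborel)
            \<le> (\<integral>\<^sup>+x. indicator {c..<c + real m * t n} x * ennreal \<bar>h (x + t n) - h x\<bar> \<partial>lborel)"
        proof (rule nn_integral_mono)
          fix x
          have "(h x - h (x + t n)) * \<phi> (x + t n) \<le> \<bar>h (x + t n) - h x\<bar> * 1"
          proof -
            have "(h x - h (x + t n)) * \<phi> (x + t n) \<le> \<bar>h x - h (x + t n)\<bar> * \<bar>\<phi> (x + t n)\<bar>"
              by (metis abs_ge_self abs_mult)
            also have "\<dots> \<le> \<bar>h x - h (x + t n)\<bar> * 1" using \<phi>1 by (intro mult_left_mono) auto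
            finally show ?thesis by (simp add: abs_minus_commute)
          qed
          then show "ennreal ((h x - h (x + t n)) * \<phi> (x + t n))
            \<le> indicator {c..<c + real m * t n} x * ennreal \<bar>h (x + t n) - h x\<bar>"
            using cover[of x] by (auto simp: indicator_def ennreal_leI)
        qed
        also have "\<dots> \<le> ennreal (t n) * pointwise_variation h" by (rule variation_translation[OF _ t]) measurable
        also have "\<dots> = ennreal (C * t n)" using C t[of n] by (simp add: ennreal_mult mult.commute)
        finally show "(\<integral>\<^sup>+x. ennreal ((h x - h (x + t n)) * \<phi> (x + t n)) \<partial>lborel) \<le> ennreal (C * t n)" .
      qed (use C t[of n] in simp)
      finally show ?thesis using t[of n] by simp
    qed
    show ?thesis by (rule LIMSEQ_le_const2[OF lim]) (use bd in blast)
  qed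
  then show ?thesis unfolding BV_def using h by blast
qed

section \<open>Components of superlevel sets\<close>

text \<open>
  Chebyshev's inequality bounds the length, so the component is a bounded open interval; its end points
  lie outside the open superlevel set.
\<close>
lemma component_interval:
  assumes k: "lower_semicontinuous k" "integrable lborel k" "\<And>x. 0 \<le> k x" and t: "0 < t"
    and I: "I \<in> components {x. t < k x}"
  obtains a b where "a < b" "I = {a<..<b}" "k a \<le> t" "k b \<le> t" "t * (b - a) \<le> (LINT x|lborel. k x)"
proof -
  let ?U = "{x. t < k x}"
  have U: "open ?U" using k(1) by (simp add: lower_semicontinuous_def)
  have Io: "open I" using open_components[OF U I] .
  have sub: "I \<subseteq> ?U" by (rule in_components_subset[OF I])
  have ivl: "is_interval I" using in_components_connected[OF I] by (simp add: is_interval_connected_1)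
  obtain x0 where x0: "x0 \<in> I" using in_components_nonempty[OF I] by blast
  define K where "K = (LINT x|lborel. k x)"
  have len: "t * (y - x) \<le> K" if "{x<..<y} \<subseteq> I" "x < y" for x y
  proof -
    have "t * (y - x) = (LINT z|lborel. t * indicator {x<..<y} z)" using that(2) by simp
    also have "\<dots> \<le> K" unfolding K_def
    proof (rule integral_mono)
      show "integrable lborel (\<lambda>z. t * indicator {x<..<y} z)" by simp
      show "t * indicator {x<..<y} z \<le> k z" for z
      proof (cases "z \<in> {x<..<y}")
        case True
        then have "t < k z" using that(1) sub by blast
        then show ?thesis using True by simp
      qed (simp add: k(3))
    qed (rule k(2))
    finally show ?thesis .
  qed
  have between: "{x..y} \<subseteq> I" if "x \<in> I" "y \<in> I" for x y
  proof
    fix z assume "z \<in> {x..y}"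
    then show "z \<in> I" using mem_is_interval_1_I[OF ivl that, of z] by simp
  qed
  have bound: "\<bar>y - x0\<bar> \<le> K / t" if y: "y \<in> I" for y
  proof -
    have 1: "t * (y - x0) \<le> K" if "x0 < y"
    proof (rule len[OF _ that])
      show "{x0<..<y} \<subseteq> I" by (rule subset_trans[OF _ between[OF x0 y]]) auto
    qed
    have 2: "t * (x0 - y) \<le> K" if "y < x0"
    proof (rule len[OF _ that])
      show "{y<..<x0} \<subseteq> I" by (rule subset_trans[OF _ between[OF y x0]]) auto
    qed
    have 3: "0 \<le> K" unfolding K_def using k(3) by (intro Bochner_Integration.integral_nonneg) auto
    consider "x0 < y" | "y < x0" | "y = x0" by linarith
    then have "t * \<bar>y - x0\<bar> \<le> K"
    proof cases
      case 1
      then show ?thesis using \<open>x0 < y \<Longrightarrow> t * (y - x0) \<le> K\<close> by simp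
    next
      case 2
      then show ?thesis using \<open>y < x0 \<Longrightarrow> t * (x0 - y) \<le> K\<close> by simp
    qed (use 3 in simp)
    then show ?thesis using t by (simp add: field_simps)
  qed
  have bd: "bdd_above I" "bdd_below I"
  proof -
    have "y \<le> x0 + K / t" "x0 - K / t \<le> y" if "y \<in> I" for y using bound[OF that] by linarith+
    note est = this
    show "bdd_above I" by (rule bdd_aboveI[of I "x0 + K / t"]) (rule est)
    show "bdd_below I" by (rule bdd_belowI[of I "x0 - K / t"]) (rule est)
  qed
  define a where "a = Inf I"
  define b where "b = Sup I"
  have ne: "I \<noteq> {}" using x0 by auto
  have near: "\<exists>e>0. {x - e<..<x + e} \<subseteq> I" if "x \<in> I" for x
    using openE[OF Io that] unfolding ball_eq_greaterThanLessThan by metis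
  have I_eq: "I = {a<..<b}"
  proof (intro equalityI subsetI)
    fix x assume x: "x \<in> I"
    then obtain e where e: "e > 0" "{x - e<..<x + e} \<subseteq> I" using near by blast
    have "x - e / 2 \<in> I" "x + e / 2 \<in> I" using e by auto
    then have "a \<le> x - e / 2" "x + e / 2 \<le> b" unfolding a_def b_def using bd by (auto intro: cInf_lower cSup_upper)
    then show "x \<in> {a<..<b}" using e(1) by auto
  next
    fix x assume x: "x \<in> {a<..<b}"
    then obtain y z where "y \<in> I" "y < x" "z \<in> I" "x < z"
      unfolding a_def b_def using cInf_lessD[OF ne] less_cSupD[OF ne] by fastforce
    then show "x \<in> I" using between[of y z] by auto
  qed
  have ab: "a < b" using ne I_eq by auto
  have ends: "k x \<le> t" if x: "x = a \<or> x = b" for x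
  proof (rule ccontr)
    assume "\<not> k x \<le> t"
    then have "x \<in> ?U" by simp
    with U obtain e where e: "e > 0" "ball x e \<subseteq> ?U" by (rule openE)
    have "ball x e \<inter> I \<noteq> {}"
    proof -
      define d where "d = min (e / 2) ((b - a) / 2)"
      have d: "0 < d" "d < e" "d < b - a" using e(1) ab by (auto simp: d_def min_def)
      have "x + d \<in> ball x e \<inter> I \<or> x - d \<in> ball x e \<inter> I"
        using x d by (auto simp: I_eq dist_real_def)
      then show ?thesis by blast
    qed
    then have "ball x e \<subseteq> I" using components_maximal[OF I _ e(2)] by auto
    then have "x \<in> I" using e(1) by auto
    then show False using x by (auto simp: I_eq)
  qed
  have "t * (b - a) \<le> K" using len[of a b] I_eq ab by simp
  then show ?thesis using that[OF ab I_eq] ends K_def by blast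
qed

lemma component_at:
  assumes k: "lower_semicontinuous k" "integrable lborel k" "\<And>x. 0 \<le> k x" and t: "0 < t" and x: "t < k x"
  obtains a b where "a < b" "connected_component_set {y. t < k y} x = {a<..<b}" "k a \<le> t" "k b \<le> t"
    "t * (b - a) \<le> (LINT x|lborel. k x)"
proof -
  have "connected_component_set {y. t < k y} x \<in> components {y. t < k y}"
    using x by (auto simp: components_def)
  from component_interval[OF k t this] show ?thesis using that by metis
qed

section \<open>Levelling a profile\<close>

definition level :: "(real \<Rightarrow> real) \<Rightarrow> real \<Rightarrow> real \<Rightarrow> real \<Rightarrow> real \<Rightarrow> real" where
  "level k a b A x = (if x \<in> {a<..<b} then A else k x)"

lemma level_lower_semicontinuous:
  assumes k: "lower_semicontinuous k" and A: "k a \<le> A" "k b \<le> A"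
  shows "lower_semicontinuous (level k a b A)"
  unfolding lower_semicontinuous_def
proof
  fix c
  have ok: "open {x. c < k x}" using k by (simp add: lower_semicontinuous_def)
  show "open {x. c < level k a b A x}"
  proof (cases "c < A")
    case True
    have sub: "\<exists>e>0. ball x e \<subseteq> {x. c < level k a b A x}" if x: "c < level k a b A x" for x
    proof (cases "x \<in> {a<..<b}")
      case inI: True
      have "open {a<..<b}" by simp
      then obtain e where e: "e > 0" "ball x e \<subseteq> {a<..<b}" using inI by (rule openE)
      have "c < level k a b A y" if "y \<in> ball x e" for y
      proof -
        have "y \<in> {a<..<b}" using e(2) that by blast
        then show ?thesis using True by (simp add: level_def)
      qed
      then show ?thesis using e(1) by blast
    next
      case False
      then have "x \<in> {x. c < k x}" using x by (auto simp: level_def split: if_splits)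
      with ok obtain e where e: "e > 0" "ball x e \<subseteq> {x. c < k x}" by (rule openE)
      have "c < level k a b A y" if "y \<in> ball x e" for y
      proof -
        have "c < k y" using e(2) that by blast
        then show ?thesis using True by (simp add: level_def)
      qed
      then show ?thesis using e(1) by blast
    qed
    then show ?thesis unfolding open_contains_ball by blast
  next
    case False
    have "{x. c < level k a b A x} = {x. c < k x} \<inter> - {a..b}"
    proof (intro equalityI subsetI)
      fix x assume x: "x \<in> {x. c < level k a b A x}"
      then have nin: "x \<notin> {a<..<b}" using False by (auto simp: level_def split: if_splits)
      then have "c < k x" using x by (auto simp: level_def split: if_splits)
      moreover from this have "x \<noteq> a" "x \<noteq> b" using False A by auto
      ultimately show "x \<in> {x. c < k x} \<inter> - {a..b}" using nin by auto
    qed (auto simp: level_def)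
    then show ?thesis using ok by auto
  qed
qed

lemma level_integrable:
  assumes k: "integrable lborel k"
  shows "integrable lborel (level k a b A)"
    "(LINT x|lborel. level k a b A x) = (LINT x|lborel. k x) - (LINT x|lborel. indicator {a<..<b} x * (k x - A))"
proof -
  have i: "integrable lborel (\<lambda>x. indicator {a<..<b} x * k x)"
    using integrable_mult_indicator[OF _ k, of "{a<..<b}"] by simp
  have j: "integrable lborel (\<lambda>x. indicator {a<..<b} x * (k x - A))"
  proof -
    have "(\<lambda>x. indicator {a<..<b} x * (k x - A)) = (\<lambda>x. indicator {a<..<b} x * k x - A * indicator {a<..<b} x)"
      by (auto simp: algebra_simps)
    then show ?thesis using i by simp
  qed
  have eq: "level k a b A = (\<lambda>x. k x - indicator {a<..<b} x * (k x - A))"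
    by (auto simp: level_def fun_eq_iff)
  show "integrable lborel (level k a b A)" unfolding eq using k j by simp
  show "(LINT x|lborel. level k a b A x) = (LINT x|lborel. k x) - (LINT x|lborel. indicator {a<..<b} x * (k x - A))"
    unfolding eq using k j by simp
qed

text \<open>
  The positive and the negative part of \<open>g - A\<close> have the same integral, and the positive part is at most
  \<open>D / 2\<close>.
\<close>
lemma L1_distance_to_level:
  fixes g :: "real \<Rightarrow> real" and a b A D :: real
  assumes g: "integrable lborel g" and ab: "a < b" and D: "0 \<le> D"
    and above: "\<And>x. x \<in> {a<..<b} \<Longrightarrow> 2 * (g x - A) \<le> D"
    and mean: "(LINT x|lborel. indicator {a<..<b} x * (g x - A)) = 0"
  shows "(LINT x|lborel. indicator {a<..<b} x * \<bar>g x - A\<bar>) \<le> D * (b - a)"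
    "integrable lborel (\<lambda>x. indicator {a<..<b} x * \<bar>g x - A\<bar>)"
proof -
  have [measurable]: "g \<in> borel_measurable borel" using g by auto
  have i: "integrable lborel (\<lambda>x. indicator {a<..<b} x * g x)"
    using integrable_mult_indicator[OF _ g, of "{a<..<b}"] by simp
  have j: "integrable lborel (\<lambda>x. indicator {a<..<b} x * (g x - A))"
  proof -
    have "(\<lambda>x. indicator {a<..<b} x * (g x - A)) = (\<lambda>x. indicator {a<..<b} x * g x - A * indicator {a<..<b} x)"
      by (auto simp: algebra_simps)
    then show ?thesis using i by simp
  qed
  have "(\<lambda>x. indicator {a<..<b} x * \<bar>g x - A\<bar>) = (\<lambda>x. \<bar>indicator {a<..<b} x * (g x - A)\<bar>)"
    by (auto simp: indicator_def)
  then show abs: "integrable lborel (\<lambda>x. indicator {a<..<b} x * \<bar>g x - A\<bar>)" using j by simp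
  have "(LINT x|lborel. indicator {a<..<b} x * \<bar>g x - A\<bar>)
      = (LINT x|lborel. indicator {a<..<b} x * \<bar>g x - A\<bar> + indicator {a<..<b} x * (g x - A))"
    using abs j mean by simp
  also have "\<dots> \<le> (LINT x|lborel. D * indicator {a<..<b} x)"
  proof (rule integral_mono)
    show "integrable lborel (\<lambda>x. indicator {a<..<b} x * \<bar>g x - A\<bar> + indicator {a<..<b} x * (g x - A))"
      using abs j by simp
    show "indicator {a<..<b} x * \<bar>g x - A\<bar> + indicator {a<..<b} x * (g x - A) \<le> D * indicator {a<..<b} x" for x
      using above[of x] D by (auto simp: indicator_def)
  qed simp
  also have "\<dots> = D * (b - a)" using ab by simp
  finally show "(LINT x|lborel. indicator {a<..<b} x * \<bar>g x - A\<bar>) \<le> D * (b - a)" .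
qed

section \<open>Exponential decay of the elastic energy\<close>

text \<open>
  Here \<open>f i\<close> stands for the energy above the \<open>i\<close>-th level and \<open>B i\<close> for the energy of the layer below it.
  If replacing the displacement cost more than the bound \<open>\<delta>\<close> at each of the \<open>N\<close> levels, then \<open>f i + \<delta>\<close>
  would grow by the factor \<open>51/50\<close> in each step and exceed \<open>E + \<delta>\<close>.
\<close>
lemma good_level:
  fixes f B :: "nat \<Rightarrow> real"
  assumes N: "0 < N" and f: "0 \<le> f 0" "f N \<le> E"
    and grow: "\<And>i. i < N \<Longrightarrow> f i + B i \<le> f (Suc i)"
  obtains i where "i < N" "50 * B i - f i \<le> E / ((51/50) ^ N - 1)"
proof (rule ccontr)
  define q where "q = (51/50 :: real)"
  define \<delta> where "\<delta> = E / (q ^ N - 1)"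
  assume nt: "\<not> thesis"
  note obt = that
  have bad: "\<delta> < 50 * B i - f i" if "i < N" for i
  proof (rule ccontr)
    assume "\<not> \<delta> < 50 * B i - f i"
    then have "50 * B i - f i \<le> E / ((51/50) ^ N - 1)" by (simp add: \<delta>_def q_def)
    from obt[OF \<open>i < N\<close> this] nt show False by simp
  qed
  have step: "q * (f i + \<delta>) < f (Suc i) + \<delta>" if "i < N" for i
    using bad[OF that] grow[OF that] by (simp add: q_def)
  have "q ^ Suc i * (f 0 + \<delta>) < f (Suc i) + \<delta>" if "i < N" for i
    using that
  proof (induction i)
    case 0
    then show ?case using step[of 0] by simp
  next
    case (Suc i)
    have "q * (q ^ Suc i * (f 0 + \<delta>)) < q * (f (Suc i) + \<delta>)"
      using Suc by (intro mult_strict_left_mono) (auto simp: q_def)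
    then show ?case using step[OF Suc.prems] by (simp add: mult.assoc)
  qed
  from this[of "N - 1"] have 1: "q ^ N * (f 0 + \<delta>) < f N + \<delta>" using N by simp
  have q: "1 < q ^ N" using N by (simp add: q_def one_less_power)
  have "q ^ N * \<delta> \<le> q ^ N * (f 0 + \<delta>)" using f(1) q by (intro mult_left_mono) auto
  then have "q ^ N * \<delta> < E + \<delta>" using 1 f(2) by linarith
  then have "\<delta> * (q ^ N - 1) < E" by (simp add: algebra_simps)
  then show False using q by (simp add: \<delta>_def)
qed

text \<open>
  The levels \<open>\<tau> i\<close> descend in steps of \<open>l = 2 X / \<epsilon>\<close> from three quarters to half of the height
  \<open>\<epsilon> X\<^sup>2\<close>, which leaves room for \<open>\<epsilon>\<^sup>2 X / 8\<close> of them. By the volume the components at these heights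
  have width at most \<open>X\<^sup>3 / (\<epsilon> X\<^sup>2 / 2) = l\<close>, so each layer is at least as high as the component above it
  is wide, as \<open>energy_comparison\<close> requires.
\<close>
lemma elastic_cost_of_levelling:
  fixes X \<epsilon> s a b A :: real and N :: nat
  assumes pos: "0 < X" "0 < \<epsilon>" and N: "0 < N" "real N \<le> \<epsilon>\<^sup>2 * X / 8"
    and h: "lower_semicontinuous h" "integrable lborel h" "\<And>x. 0 \<le> h x" and vol: "(LINT x|lborel. h x) = X ^ 3"
    and s: "\<epsilon> * X\<^sup>2 \<le> s" and ab: "a < b" and inside: "\<And>x. x \<in> {a<..<b} \<Longrightarrow> s < h x"
    and ends: "h a \<le> s" "h b \<le> s" and A: "s \<le> A"
    and u: "clamped h u g1 g2"
  obtains v k1 k2 where "clamped (level h a b A) v k1 k2"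
    "energy k1 k2 \<le> energy g1 g2 + energy g1 g2 / ((51/50) ^ N - 1)"
proof -
  define l where "l = 2 * X / \<epsilon>"
  have l: "0 < l" using pos by (simp add: l_def)
  define T where "T = 3/4 * (\<epsilon> * X\<^sup>2)"
  define \<tau> where "\<tau> i = T - real i * l" for i :: nat
  have eX: "0 < \<epsilon> * X\<^sup>2" using pos by simp
  have \<tau>_low: "\<epsilon> * X\<^sup>2 / 2 \<le> \<tau> i" if "i \<le> N" for i
  proof -
    have "real i * l \<le> (\<epsilon>\<^sup>2 * X / 8) * l" using that N(2) l by (intro mult_right_mono) auto
    also have "\<dots> = \<epsilon> * X\<^sup>2 / 4" using pos by (simp add: l_def power2_eq_square)
    finally show ?thesis by (simp add: \<tau>_def T_def)
  qed
  have \<tau>_high: "\<tau> i < s" for i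
  proof -
    have "\<tau> i \<le> T" using l by (simp add: \<tau>_def)
    also have "T < s" using s eX by (simp add: T_def)
    finally show ?thesis .
  qed
  have \<tau>_Suc: "\<tau> (Suc i) = \<tau> i - l" for i by (simp add: \<tau>_def algebra_simps)
  define x0 where "x0 = (a + b) / 2"
  have x0: "x0 \<in> {a<..<b}" using ab by (simp add: x0_def)
  have "\<exists>p q. i \<le> N \<longrightarrow> p < q \<and> connected_component_set {y. \<tau> i < h y} x0 = {p<..<q} \<and> h p \<le> \<tau> i \<and> h q \<le> \<tau> i
      \<and> \<tau> i * (q - p) \<le> X ^ 3" for i
  proof (cases "i \<le> N")
    case True
    have t: "0 < \<tau> i" using \<tau>_low[OF True] eX by linarith
    have "\<tau> i < h x0" using inside[OF x0] \<tau>_high[of i] by linarith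
    from component_at[OF h t this] show ?thesis unfolding vol by blast
  qed simp
  then obtain p q where pq: "\<And>i. i \<le> N \<Longrightarrow> p i < q i \<and> connected_component_set {y. \<tau> i < h y} x0 = {p i<..<q i}
      \<and> h (p i) \<le> \<tau> i \<and> h (q i) \<le> \<tau> i \<and> \<tau> i * (q i - p i) \<le> X ^ 3" by metis
  have width: "q i - p i \<le> l" if "i \<le> N" for i
  proof -
    have "\<epsilon> * X\<^sup>2 / 2 * (q i - p i) \<le> \<tau> i * (q i - p i)"
      using \<tau>_low[OF that] pq[OF that] by (intro mult_right_mono) auto
    also have "\<dots> \<le> X ^ 3" using pq[OF that] by blast
    finally have "(q i - p i) * (\<epsilon> * X\<^sup>2 / 2) \<le> l * (\<epsilon> * X\<^sup>2 / 2)"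
      using pos by (simp add: l_def power2_eq_square power3_eq_cube mult.commute)
    then show ?thesis using eX by (simp add: mult_le_cancel_right)
  qed
  have sup: "\<tau> i < h x" if "i \<le> N" "x \<in> {p i<..<q i}" for i x
    using that pq[OF that(1)] connected_component_subset[of "{y. \<tau> i < h y}" x0] by auto
  have nested: "{p i<..<q i} \<subseteq> {p (Suc i)<..<q (Suc i)}" if "Suc i \<le> N" for i
  proof -
    have "{y. \<tau> i < h y} \<subseteq> {y. \<tau> (Suc i) < h y}" using l by (auto simp: \<tau>_Suc)
    then have "connected_component_set {y. \<tau> i < h y} x0 \<subseteq> connected_component_set {y. \<tau> (Suc i) < h y} x0"
      by (rule connected_component_mono)
    then show ?thesis using pq[of i] pq[OF that] that by simp
  qed
  have core: "{a<..<b} \<subseteq> {p i<..<q i}" if "i \<le> N" for i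
  proof -
    have "{a<..<b} \<subseteq> {y. \<tau> i < h y}" using inside \<tau>_high[of i] by (force intro: less_trans)
    then have "{a<..<b} \<subseteq> connected_component_set {y. \<tau> i < h y} x0"
      using x0 by (intro connected_component_maximal) auto
    then show ?thesis using pq[OF that] by simp
  qed
  define g where "g z = (g1 z)\<^sup>2 + (g2 z)\<^sup>2" for z
  have Lg: "L2 g1" "L2 g2" using u by (auto simp: clamped_def sobolev_def)
  have gint: "integrable lborel g" unfolding g_def using Lg[THEN L2_square] by simp
  have ind: "integrable lborel (\<lambda>z. indicator C z * g z)" if "C \<in> sets borel" for C
    using integrable_mult_indicator[OF _ gint, of C] that by simp
  define P where "P i = {p i<..<q i} \<times> {\<tau> i..}" for i
  define Q where "Q i = {p i<..<q i} \<times> {\<tau> i - l<..<\<tau> i}" for i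
  have sets: "P i \<in> sets borel" "Q i \<in> sets borel" for i
  proof -
    have "P i = ({p i<..<q i} \<times> UNIV) \<inter> (UNIV \<times> {\<tau> i..})" by (auto simp: P_def)
    moreover have "open ({p i<..<q i} \<times> (UNIV :: real set))" "closed ((UNIV :: real set) \<times> {\<tau> i..})"
      by (auto intro: open_Times closed_Times)
    ultimately show "P i \<in> sets borel" by auto
    show "Q i \<in> sets borel" unfolding Q_def by (intro borel_open open_Times) auto
  qed
  define f where "f i = (LINT z|lborel. indicator (P i) z * g z)" for i
  define B where "B i = (LINT z|lborel. indicator (Q i) z * g z)" for i
  have f0: "0 \<le> f 0" unfolding f_def by (intro Bochner_Integration.integral_nonneg) (simp add: g_def)
  have fN: "f N \<le> energy g1 g2"
    unfolding f_def energy_def g_def[symmetric]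
    by (rule integral_mono[OF ind[OF sets(1)] gint]) (simp add: indicator_def g_def)
  \<comment> \<open>The components widen downwards, so the region above the next level contains the layer as well.\<close>
  have grow: "f i + B i \<le> f (Suc i)" if "i < N" for i
  proof -
    have "f i + B i = (LINT z|lborel. indicator (P i) z * g z + indicator (Q i) z * g z)"
      unfolding f_def B_def using ind sets by simp
    also have "\<dots> \<le> f (Suc i)" unfolding f_def
    proof (rule integral_mono)
      fix z
      have "P i \<subseteq> P (Suc i)" "Q i \<subseteq> P (Suc i)" "P i \<inter> Q i = {}"
        using nested[of i] that l by (force simp: P_def Q_def \<tau>_Suc)+
      moreover have "0 \<le> g z" by (simp add: g_def)
      ultimately show "indicator (P i) z * g z + indicator (Q i) z * g z \<le> indicator (P (Suc i)) z * g z"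
        by (cases "z \<in> P i"; cases "z \<in> Q i") (auto simp: indicator_def)
    qed (use ind sets in simp_all)
    finally show ?thesis .
  qed
  obtain i where i: "i < N" "50 * B i - f i \<le> energy g1 g2 / ((51/50) ^ N - 1)"
    using good_level[OF N(1) f0 fN grow] by blast
  let ?k = "level h a b A"
  have iN: "i \<le> N" using i(1) by simp
  have k: "lower_semicontinuous ?k" "integrable lborel ?k" "\<And>x. 0 \<le> ?k x"
  proof -
    show "lower_semicontinuous ?k" using level_lower_semicontinuous[OF h(1)] ends A by auto
    show "integrable lborel ?k" by (rule level_integrable(1)[OF h(2)])
    show "0 \<le> ?k x" for x using h(3)[of x] A s eX by (simp add: level_def)
  qed
  have "\<exists>v k1 k2. clamped ?k v k1 k2 \<and>
    energy k1 k2 \<le> energy g1 g2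
      - (LINT z|lborel. indicator ({p i<..<q i} \<times> {\<tau> i..}) z * ((g1 z)\<^sup>2 + (g2 z)\<^sup>2))
      + 50 * (LINT z|lborel. indicator ({p i<..<q i} \<times> {\<tau> i - l<..<\<tau> i}) z * ((g1 z)\<^sup>2 + (g2 z)\<^sup>2))"
  proof (rule energy_comparison[OF h k _ width[OF iN] l _ _ _ _ _ _ u])
    show "p i < q i" "h (p i) \<le> \<tau> i" "h (q i) \<le> \<tau> i" using pq[OF iN] by auto
    have "0 < \<tau> (Suc i)" using \<tau>_low[of "Suc i"] i(1) eX by linarith
    then show "l < \<tau> i" by (simp add: \<tau>_Suc)
    show "\<tau> i < h x" if "x \<in> {p i<..<q i}" for x by (rule sup[OF iN that])
    show "\<tau> i < ?k x" if "x \<in> {p i<..<q i}" for x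
      using sup[OF iN that] \<tau>_high[of i] A by (auto simp: level_def)
    \<comment> \<open>The cut lies below the levelled part, so levelling happens inside the replaced component.\<close>
    show "?k x = h x" if "x \<notin> {p i<..<q i}" for x
      using core[OF iN] that by (auto simp: level_def)
  qed
  then obtain v k1 k2 where v: "clamped ?k v k1 k2" "energy k1 k2 \<le> energy g1 g2 - f i + 50 * B i"
    unfolding f_def B_def P_def Q_def g_def by blast
  show ?thesis using that[OF v(1)] v(2) i(2) by linarith
qed

section \<open>Rescaled profiles and the energy functional\<close>

lemma powr_thirds:
  fixes V :: real
  assumes V: "0 < V" and X: "X = V powr (1/3)"
  shows "0 < X" "V = X ^ 3" "V powr (2/3) = X\<^sup>2" "V powr (- 1/3) = 1 / X" "V powr (- 2/3) = 1 / X\<^sup>2"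
proof -
  show X0: "0 < X" using V X by simp
  have X2: "X\<^sup>2 = V powr (2/3)" unfolding X power2_eq_square powr_add[symmetric] by simp
  show "V = X ^ 3" unfolding X power3_eq_cube powr_add[symmetric] using V by simp
  show "V powr (2/3) = X\<^sup>2" using X2 by simp
  show "V powr (- 1/3) = 1 / X" unfolding X by (simp add: powr_minus_divide)
  show "V powr (- 2/3) = 1 / X\<^sup>2" unfolding X2 by (simp add: powr_minus_divide)
qed

lemma unrescale_alt:
  assumes "0 < V" "X = V powr (1/3)"
  shows "unrescale V k = (\<lambda>x. X\<^sup>2 * k (1 / X * x))"
  unfolding unrescale_def fun_eq_iff using powr_thirds[OF assms] by simp

lemma unrescale_props:
  assumes V: "0 < V" and k: "lower_semicontinuous k" "integrable lborel k" "\<And>x. 0 \<le> k x"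
  shows "lower_semicontinuous (unrescale V k)" "integrable lborel (unrescale V k)" "\<And>x. 0 \<le> unrescale V k x"
    "(LINT x|lborel. unrescale V k x) = V * (LINT x|lborel. k x)"
proof -
  define X where "X = V powr (1/3)"
  note p = powr_thirds[OF V X_def]
  note eq = unrescale_alt[OF V X_def]
  show "lower_semicontinuous (unrescale V k)"
    unfolding lower_semicontinuous_def
  proof
    fix c
    have "open ((\<lambda>x. 1 / X * x) -` {x. c / X\<^sup>2 < k x})"
      using k(1) p(1) by (intro open_vimage) (auto simp: lower_semicontinuous_def intro!: continuous_intros)
    moreover have "(\<lambda>x. 1 / X * x) -` {x. c / X\<^sup>2 < k x} = {x. c < unrescale V k x}"
      using p(1) by (auto simp: eq field_simps)
    ultimately show "open {x. c < unrescale V k x}" by simp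
  qed
  have i: "integrable lborel (\<lambda>x. k (0 + 1 / X * x))"
    by (rule lborel_integrable_real_affine[OF k(2)]) (use p(1) in simp)
  then show "integrable lborel (unrescale V k)" unfolding eq by simp
  show "0 \<le> unrescale V k x" for x using k(3) by (simp add: eq)
  have "(LINT x|lborel. k x) = \<bar>1 / X\<bar> *\<^sub>R (LINT x|lborel. k (0 + 1 / X * x))"
    by (rule lborel_integral_real_affine) (use p(1) in simp)
  then have "(LINT x|lborel. k (1 / X * x)) = X * (LINT x|lborel. k x)"
    using p(1) by (simp add: field_simps)
  note sc = this
  have "(LINT x|lborel. unrescale V k x) = X\<^sup>2 * (LINT x|lborel. k (1 / X * x))"
    unfolding eq by simp
  also have "\<dots> = X ^ 3 * (LINT x|lborel. k x)"
    unfolding sc by (simp add: power2_eq_square power3_eq_cube)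
  finally show "(LINT x|lborel. unrescale V k x) = V * (LINT x|lborel. k x)"
    by (simp only: p(2)[symmetric])
qed

lemma unrescale_variation:
  assumes V: "0 < V" and k: "pointwise_variation k < \<infinity>"
  shows "pointwise_variation (unrescale V k) < \<infinity>"
proof -
  define X where "X = V powr (1/3)"
  note p = powr_thirds[OF V X_def]
  have "pointwise_variation (unrescale V k) \<le> ennreal (X\<^sup>2) * pointwise_variation k"
    unfolding unrescale_alt[OF V X_def] by (rule variation_scale_le) (use p(1) in auto)
  also have "\<dots> < \<infinity>" using k by (simp add: ennreal_mult_less_top)
  finally show ?thesis .
qed

lemma minimizer_energy:
  assumes h: "lower_semicontinuous h" and u: "dirichlet_minimizer h u"
  obtains g1 g2 where "clamped h (zext (subgraph h) u) g1 g2"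
    "dirichlet_energy (subgraph h) u = ennreal (energy g1 g2)"
    "\<And>v k1 k2. clamped h v k1 k2 \<Longrightarrow> energy g1 g2 \<le> energy k1 k2"
proof -
  have adm: "admissible_displacement h u" using u by (simp add: dirichlet_minimizer_def)
  obtain g1 g2 where g: "clamped h (zext (subgraph h) u) g1 g2"
    "dirichlet_energy (subgraph h) u = ennreal (energy g1 g2)"
    using admissible_displacementE[OF h adm] by blast
  have "energy g1 g2 \<le> energy k1 k2" if v: "clamped h v k1 k2" for v k1 k2
  proof -
    note c = clamped_imp_admissible[OF h v]
    have "dirichlet_energy (subgraph h) u \<le> dirichlet_energy (subgraph h) v"
      using u c(1) unfolding dirichlet_minimizer_def by blast
    then have "ennreal (energy g1 g2) \<le> ennreal (energy k1 k2)" unfolding g(2) c(2) .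
    then show ?thesis using energy_nonneg by (simp add: ennreal_le_iff)
  qed
  with g show ?thesis by (rule that)
qed

text \<open>
  The energy in \<open>G\<close> is that of an arbitrarily chosen minimizer, and all minimizers have the same energy.
\<close>
lemma G_alt:
  assumes V: "0 < V" and X: "X = V powr (1/3)" and h: "h = unrescale V k" "lower_semicontinuous h"
    and ex: "dirichlet_minimizer h u0"
  obtains u g1 g2 where "clamped h u g1 g2" "G V k = ennreal (energy g1 g2 / X\<^sup>2) + pointwise_variation k"
    "\<And>v k1 k2. clamped h v k1 k2 \<Longrightarrow> energy g1 g2 \<le> energy k1 k2"
proof -
  define u where "u = (SOME u. dirichlet_minimizer h u)"
  have "dirichlet_minimizer h u" unfolding u_def by (rule someI[of _ u0]) (rule ex)
  then obtain g1 g2 where g: "clamped h (zext (subgraph h) u) g1 g2"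
    "dirichlet_energy (subgraph h) u = ennreal (energy g1 g2)"
    "\<And>v k1 k2. clamped h v k1 k2 \<Longrightarrow> energy g1 g2 \<le> energy k1 k2"
    using minimizer_energy[OF h(2)] by blast
  note p = powr_thirds[OF V X]
  have "G V k = ennreal (V powr (- 2/3)) * ennreal (energy g1 g2) + pointwise_variation k"
    unfolding G_def Let_def h(1)[symmetric] u_def[symmetric] g(2) by simp
  also have "ennreal (V powr (- 2/3)) * ennreal (energy g1 g2) = ennreal (energy g1 g2 / X\<^sup>2)"
    unfolding p(5) using energy_nonneg[of g1 g2] by (simp add: ennreal_mult[symmetric])
  finally show ?thesis using that g by blast
qed

text \<open>
  A profile of finite variation is bounded, so \<open>dirichlet_minimizer_exists\<close> provides the minimizer that
  membership and the value of \<open>G\<close> call for.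
\<close>
lemma rescaled_profileI:
  assumes V: "0 < V" and X: "X = V powr (1/3)"
    and k: "lower_semicontinuous k" "integrable lborel k" "\<And>x. 0 \<le> k x" "(LINT x|lborel. k x) = 1"
    and pv: "pointwise_variation k < \<infinity>" and v: "clamped (unrescale V k) v k1 k2"
  shows "k \<in> rescaled_profiles V" "G V k \<le> ennreal (energy k1 k2 / X\<^sup>2) + pointwise_variation k"
proof -
  let ?h = "unrescale V k"
  note p = powr_thirds[OF V X] and h = unrescale_props[OF V k(1-3)]
  define M where "M = k 0 + enn2real (pointwise_variation k)"
  have kM: "k x \<le> M" for x
  proof -
    have "ennreal \<bar>k x - k 0\<bar> \<le> ennreal (enn2real (pointwise_variation k))"
      using variation_ge_diff[of k x 0] pv by simp
    then have "\<bar>k x - k 0\<bar> \<le> enn2real (pointwise_variation k)" by (simp add: ennreal_le_iff)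
    then show ?thesis unfolding M_def by linarith
  qed
  have hM: "?h x < X\<^sup>2 * M + 1" for x
    using mult_left_mono[OF kM[of "1 / X * x"], of "X\<^sup>2"] by (simp add: unrescale_alt[OF V X])
  have "0 < X\<^sup>2 * M + 1" using hM[of 0] h(3)[of 0] by linarith
  from dirichlet_minimizer_exists[OF h(1-3) this hM v] obtain u where u: "dirichlet_minimizer ?h u" by blast
  have "profile ?h"
    unfolding profile_def using BV_if_finite_variation[OF h(2) unrescale_variation[OF V pv]] h(1,3) by blast
  moreover have "admissible_displacement ?h u" using u by (simp add: dirichlet_minimizer_def)
  ultimately have "(u, ?h) \<in> admissible_pairs V" using h(4) k(4) by (simp add: admissible_pairs_def)
  then have "rescale V ?h \<in> rescaled_profiles V" using u unfolding rescaled_profiles_def by blast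
  then show "k \<in> rescaled_profiles V" by (simp add: rescale_unrescale[OF V])
  obtain w g1 g2 where g: "clamped ?h w g1 g2" "G V k = ennreal (energy g1 g2 / X\<^sup>2) + pointwise_variation k"
    "\<And>v k1 k2. clamped ?h v k1 k2 \<Longrightarrow> energy g1 g2 \<le> energy k1 k2"
    using G_alt[OF V X refl h(1) u] by blast
  have "energy g1 g2 / X\<^sup>2 \<le> energy k1 k2 / X\<^sup>2" using g(3)[OF v] by (intro divide_right_mono) auto
  then show "G V k \<le> ennreal (energy k1 k2 / X\<^sup>2) + pointwise_variation k"
    unfolding g(2) by (intro add_right_mono ennreal_leI)
qed

text \<open>
  The rescaled unit square with the undisturbed displacement \<open>(x, y) \<mapsto> x\<close>: the energy density is one,
  so the elastic energy is the area \<open>X\<^sup>3\<close>, and the two jumps give the variation \<open>2\<close>.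
\<close>
lemma rectangular_island:
  assumes V: "0 < V" and X: "X = V powr (1/3)"
  obtains k where "k \<in> rescaled_profiles V" "G V k \<le> ennreal (X + 2)"
proof -
  define k where "k x = (if x \<in> {0<..<1} then 1 else 0 :: real)" for x :: real
  note p = powr_thirds[OF V X]
  have keq: "k = indicator {0<..<1}" by (auto simp: k_def fun_eq_iff)
  have k: "lower_semicontinuous k" "integrable lborel k" "\<And>x. 0 \<le> k x" "(LINT x|lborel. k x) = 1"
  proof -
    show "lower_semicontinuous k" unfolding lower_semicontinuous_def
    proof
      fix c :: real
      consider "c < 0" | "0 \<le> c" "c < 1" | "1 \<le> c" by linarith
      then show "open {x. c < k x}"
      proof cases
        case 1
        then have "{x. c < k x} = UNIV" by (auto simp: k_def)
        then show ?thesis by simp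
      next
        case 2
        then have "{x. c < k x} = {0<..<1}" by (auto simp: k_def)
        then show ?thesis by simp
      next
        case 3
        then have "{x. c < k x} = {}" by (auto simp: k_def)
        then show ?thesis by simp
      qed
    qed
    show "integrable lborel k" "(LINT x|lborel. k x) = 1" by (simp_all add: keq)
    show "0 \<le> k x" for x by (simp add: k_def)
  qed
  have pv: "pointwise_variation k \<le> 2" using variation_indicator by (simp add: k_def[abs_def])
  let ?h = "unrescale V k"
  note h = unrescale_props[OF V k(1-3)]
  define S where "S = subgraph ?h"
  have S: "S \<in> sets borel" "emeasure lborel S = ennreal V"
    using subgraph_open[OF h(1)] subgraph_finite_measure[OF h(1-3)] h(4) k(4) by (auto simp: S_def)
  have Sx: "0 < fst z \<and> fst z < X" if "z \<in> S" for z
  proof -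
    have "k (1 / X * fst z) \<noteq> 0" using that p(1) by (cases z) (auto simp: S_def subgraph_def unrescale_alt[OF V X])
    then have "0 < 1 / X * fst z" "1 / X * fst z < 1" by (auto simp: k_def split: if_splits)
    then show ?thesis using p(1) by (auto simp: field_simps zero_less_divide_iff)
  qed
  have fin: "emeasure lborel S < \<infinity>" using S(2) by simp
  have m: "(\<lambda>z. indicator S z * fst z) \<in> borel_measurable borel"
    using borel_measurable_comp_fst_snd(1)[of "\<lambda>x. x" "\<lambda>z. z" borel] S(1) by simp
  have Lu: "L2 (zext S fst)"
    unfolding zext_def[abs_def]
  proof (rule L2_finite_support[OF m S(1) fin, of X])
    show "\<bar>indicator S z * fst z\<bar> \<le> X * indicator S z" for z using Sx[of z] by (cases "z \<in> S") auto
  qed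
  have L1: "L2 (indicator S :: real \<times> real \<Rightarrow> real)" by (rule L2_indicator[OF S(1) fin])
  have L0: "L2 (\<lambda>z :: real \<times> real. 0)" by (simp add: L2_def)
  have parts: "(LINT z|lborel. zext S fst z * (\<psi> z \<bullet> (1, 0))) = - (LINT z|lborel. indicator S z * \<phi> z)"
    "(LINT z|lborel. zext S fst z * (\<psi> z \<bullet> (0, 1))) = - (LINT z|lborel. 0 * \<phi> z)"
    if tf: "test_function S \<phi> \<psi>" for \<phi> \<psi>
  proof -
    obtain K where K: "K \<subseteq> S" "\<And>z. z \<notin> K \<Longrightarrow> \<phi> z = 0" "\<And>z. z \<notin> K \<Longrightarrow> \<psi> z = 0" using test_functionE[OF tf] by metis
    have out: "\<phi> z = 0" "\<psi> z = 0" if "z \<notin> S" for z using K that by blast+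
    have d: "(fst has_derivative (\<lambda>v. (1, 0) \<bullet> v)) (at z)" for z :: "real \<times> real"
    proof -
      have "(fst has_derivative fst) (at z)"
        by (rule bounded_linear_imp_has_derivative[OF bounded_linear_fst])
      moreover have "(\<lambda>v :: real \<times> real. (1, 0) \<bullet> v) = fst" by (auto simp: fun_eq_iff inner_prod_def)
      ultimately show ?thesis by simp
    qed
    have tf': "test_function S (\<lambda>z. \<phi> z * fst z) (\<lambda>z. fst z *\<^sub>R \<psi> z + \<phi> z *\<^sub>R (1, 0))"
      by (rule test_function_mult[OF tf d]) simp
    note z0 = test_function_integral_zero[OF tf']
    have e1: "(fst z *\<^sub>R \<psi> z + \<phi> z *\<^sub>R (1, 0)) \<bullet> (1, 0) = zext S fst z * (\<psi> z \<bullet> (1, 0)) + indicator S z * \<phi> z" for z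
      using out[of z] by (cases "z \<in> S") (auto simp: inner_add_left inner_prod_def)
    have e2: "(fst z *\<^sub>R \<psi> z + \<phi> z *\<^sub>R (1, 0)) \<bullet> (0, 1) = zext S fst z * (\<psi> z \<bullet> (0, 1))" for z
      using out[of z] by (cases "z \<in> S") (auto simp: inner_add_left inner_prod_def)
    have i: "integrable lborel (\<lambda>z. zext S fst z * (\<psi> z \<bullet> (1, 0)))" "integrable lborel (\<lambda>z. indicator S z * \<phi> z)"
      using L2_mult[OF Lu test_function_L2(2)[OF tf]] L2_mult[OF L1 test_function_L2(1)[OF tf]] by auto
    show "(LINT z|lborel. zext S fst z * (\<psi> z \<bullet> (1, 0))) = - (LINT z|lborel. indicator S z * \<phi> z)"
      using z0(2) i unfolding e1 by simp
    show "(LINT z|lborel. zext S fst z * (\<psi> z \<bullet> (0, 1))) = - (LINT z|lborel. 0 * \<phi> z)"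
      using z0(1) unfolding e2 by simp
  qed
  have cl: "clamped ?h (zext S fst) (indicator S) (\<lambda>z. 0)"
    unfolding clamped_def sobolev_def S_def[symmetric] weak_deriv_def
    using Lu L1 L0 parts by (auto simp: vprim_def)
  have "energy (indicator S) (\<lambda>z. 0) = (LINT z|lborel. indicator S z)"
    unfolding energy_def by (rule Bochner_Integration.integral_cong) (auto simp: indicator_def)
  also have "\<dots> = X ^ 3" using S V by (simp add: measure_def p(2)[symmetric])
  finally have en: "energy (indicator S) (\<lambda>z. 0) / X\<^sup>2 = X" using p(1) by (simp add: power2_eq_square power3_eq_cube)
  have pvf: "pointwise_variation k < \<infinity>" using pv by (rule order.strict_trans1) simp
  note R = rescaled_profileI[OF V X k pvf cl]
  have "G V k \<le> ennreal X + 2" using R(2) pv unfolding en by (meson add_left_mono order_trans)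
  also have "ennreal X + 2 = ennreal (X + 2)" using p(1) by (simp add: ennreal_plus)
  finally show ?thesis using that R(1) by blast
qed

lemma G_minimizer_facts:
  assumes V: "0 < V" and X: "X = V powr (1/3)" and k: "G_minimizer V k"
  obtains u g1 g2 where "lower_semicontinuous k" "integrable lborel k" "\<And>x. 0 \<le> k x" "(LINT x|lborel. k x) = 1"
    "pointwise_variation k < \<infinity>" "clamped (unrescale V k) u g1 g2"
    "G V k = ennreal (energy g1 g2 / X\<^sup>2) + pointwise_variation k" "energy g1 g2 \<le> X\<^sup>2 * (X + 2)"
proof -
  note p = powr_thirds[OF V X]
  obtain h u where hu: "k = rescale V h" "(u, h) \<in> admissible_pairs V" "dirichlet_minimizer h u"
    using k unfolding G_minimizer_def rescaled_profiles_def by blast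
  have hk: "h = unrescale V k" unfolding hu(1) by (rule unrescale_rescale[OF V, symmetric])
  have h: "lower_semicontinuous h" "integrable lborel h" "\<And>x. 0 \<le> h x" "(LINT x|lborel. h x) = V"
    using hu(2) by (auto simp: admissible_pairs_def profile_def BV_def)
  have keq: "k = (\<lambda>x. 1 / X\<^sup>2 * h (X * x))"
    unfolding hu(1) rescale_def fun_eq_iff p(5) X[symmetric] by simp
  have klsc: "lower_semicontinuous k" unfolding lower_semicontinuous_def
  proof
    fix c
    have "open ((\<lambda>x. X * x) -` {x. c * X\<^sup>2 < h x})"
      using h(1) by (intro open_vimage) (auto simp: lower_semicontinuous_def intro!: continuous_intros)
    moreover have "(\<lambda>x. X * x) -` {x. c * X\<^sup>2 < h x} = {x. c < k x}"
      using p(1) by (auto simp: keq field_simps)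
    ultimately show "open {x. c < k x}" by simp
  qed
  have i: "integrable lborel (\<lambda>x. h (0 + X * x))"
    by (rule lborel_integrable_real_affine[OF h(2)]) (use p(1) in simp)
  have kint: "integrable lborel k" unfolding keq using i by simp
  have k0: "0 \<le> k x" for x using h(3) by (simp add: keq)
  have "V * (LINT x|lborel. k x) = V" using unrescale_props(4)[OF V klsc kint k0] h(4) hk by simp
  then have k1: "(LINT x|lborel. k x) = 1" using V by simp
  obtain w g1 g2 where g: "clamped h w g1 g2" "G V k = ennreal (energy g1 g2 / X\<^sup>2) + pointwise_variation k"
    using G_alt[OF V X hk h(1) hu(3)] by metis
  obtain r where r: "r \<in> rescaled_profiles V" "G V r \<le> ennreal (X + 2)" using rectangular_island[OF V X] .
  have "G V k \<le> G V r" using k r(1) unfolding G_minimizer_def by blast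
  then have le: "ennreal (energy g1 g2 / X\<^sup>2) + pointwise_variation k \<le> ennreal (X + 2)"
    using r(2) g(2) by (metis order_trans)
  have "pointwise_variation k \<le> ennreal (energy g1 g2 / X\<^sup>2) + pointwise_variation k" by simp
  then have pv: "pointwise_variation k < \<infinity>" using le by (metis order.strict_trans1 order_trans ennreal_less_top infinity_ennreal_def)
  have "ennreal (energy g1 g2 / X\<^sup>2) \<le> ennreal (energy g1 g2 / X\<^sup>2) + pointwise_variation k" by simp
  then have "ennreal (energy g1 g2 / X\<^sup>2) \<le> ennreal (X + 2)" using le by (rule order_trans)
  then have "energy g1 g2 / X\<^sup>2 \<le> X + 2"
    by (rule ennreal_le_iff[THEN iffD1, rotated]) (use p(1) in simp)
  then have "energy g1 g2 \<le> X\<^sup>2 * (X + 2)" using p(1) by (simp add: field_simps)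
  then show ?thesis using that[OF klsc kint k0 k1 pv] g hk by blast
qed

section \<open>The distance between the profile and the surface minimizer\<close>

lemma exists_ge_mean:
  fixes g :: "real \<Rightarrow> real"
  assumes g: "integrable lborel g" and ab: "a < b"
    and mean: "(LINT x|lborel. indicator {a<..<b} x * (g x - A)) = 0"
  obtains p where "p \<in> {a<..<b}" "A \<le> g p"
proof (rule ccontr)
  assume "\<not> thesis"
  then have lt: "g x < A" if "x \<in> {a<..<b}" for x using \<open>\<And>p. p \<in> {a<..<b} \<Longrightarrow> A \<le> g p \<Longrightarrow> thesis\<close> that
    by (meson not_le)
  have i: "integrable lborel (\<lambda>x. indicator {a<..<b} x * g x)"
    using integrable_mult_indicator[OF _ g, of "{a<..<b}"] by simp
  have j: "integrable lborel (\<lambda>x. indicator {a<..<b} x * (A - g x))"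
  proof -
    have "(\<lambda>x. indicator {a<..<b} x * (A - g x)) = (\<lambda>x. A * indicator {a<..<b} x - indicator {a<..<b} x * g x)"
      by (auto simp: algebra_simps)
    moreover have "integrable lborel (\<lambda>x. A * indicator {a<..<b} x - indicator {a<..<b} x * g x)"
      by (intro Bochner_Integration.integrable_diff i integrable_mult_right) (use ab in \<open>simp add: integrable_indicator_iff\<close>)
    ultimately show ?thesis by simp
  qed
  have "(LINT x|lborel. indicator {a<..<b} x * (A - g x)) = (LINT x|lborel. - (indicator {a<..<b} x * (g x - A)))"
    by (rule Bochner_Integration.integral_cong) (auto simp: algebra_simps)
  then have z: "(LINT x|lborel. indicator {a<..<b} x * (A - g x)) = 0" using mean by simp
  have "AE x in lborel. 0 \<le> indicator {a<..<b} x * (A - g x)"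
    by (rule AE_I2) (use lt less_imp_le in \<open>fastforce simp: indicator_def\<close>)
  then have "AE x in lborel. indicator {a<..<b} x * (A - g x) = 0"
    using integral_nonneg_eq_0_iff_AE[OF j] z by simp
  then have "AE x in lborel. x \<notin> {a<..<b}"
    by (rule AE_mp) (use lt in \<open>force intro!: AE_I2 simp: indicator_def\<close>)
  then have "emeasure lborel {a<..<b} = 0"
    by (subst (asm) AE_iff_measurable[OF _ refl]) (auto simp: greaterThanLessThan_eq greaterThan_def lessThan_def Collect_conj_eq)
  then show False using ab by simp
qed

text \<open>
  The levelled profile competes, and a peak above \<open>A\<close> would make \<open>hb\<close> worse by \<open>variation_levelled\<close>.
  Comparison with \<open>k\<close> itself, which reaches its mean \<open>A\<close> somewhere, shows that the levelled profile has
  finite variation.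
\<close>
lemma surface_minimizer_le_mean:
  assumes k: "lower_semicontinuous k" "integrable lborel k" "\<And>x. 0 \<le> k x" "pointwise_variation k < \<infinity>"
    and ab: "a < b" and ends: "k a \<le> A" "k b \<le> A" and A: "0 \<le> A"
    and mean: "(LINT x|lborel. indicator {a<..<b} x * (k x - A)) = 0"
    and hb: "surface_minimizer k {a<..<b} hb"
  shows "profile (level k a b A)" "x \<in> {a<..<b} \<Longrightarrow> hb x \<le> A"
    "pointwise_variation (level k a b A) < \<infinity>"
proof -
  let ?l = "level k a b A"
  have leq: "?l = (\<lambda>x. if x \<in> {a<..<b} then A else k x)" by (auto simp: level_def)
  obtain p where p: "p \<in> {a<..<b}" "A \<le> k p" using exists_ge_mean[OF k(2) ab mean] .
  have "pointwise_variation ?l + ennreal (2 * (k p - A)) \<le> pointwise_variation k"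
    unfolding leq by (rule variation_levelled[OF ab p(1) refl ends p(2)])
  moreover have "pointwise_variation ?l \<le> pointwise_variation ?l + ennreal (2 * (k p - A))" by simp
  ultimately show pvl: "pointwise_variation ?l < \<infinity>" using k(4) by (meson order.strict_trans1 order_trans)
  have lint: "integrable lborel ?l" by (rule level_integrable(1)[OF k(2)])
  show prof: "profile ?l"
    unfolding profile_def
    using BV_if_finite_variation[OF lint pvl] level_lower_semicontinuous[OF k(1) ends] k(3) A by (auto simp: level_def)
  have comp: "?l \<in> surface_competitors k {a<..<b}"
    unfolding surface_competitors_def using prof level_integrable(2)[OF k(2), of a b A] mean
    by simp (simp add: level_def)
  have le: "pointwise_variation hb \<le> pointwise_variation ?l"
    using hb comp unfolding surface_minimizer_def by blast
  have off: "hb x = k x" if "x \<notin> {a<..<b}" for x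
    using hb that unfolding surface_minimizer_def surface_competitors_def by blast
  show "hb x \<le> A" if x: "x \<in> {a<..<b}"
  proof (rule ccontr)
    assume "\<not> hb x \<le> A"
    then have gt: "A < hb x" by simp
    have "pointwise_variation ?l + ennreal (2 * (hb x - A)) \<le> pointwise_variation hb"
      unfolding leq by (rule variation_levelled[OF ab x off ends]) (use gt in simp_all)
    also note le
    finally have "pointwise_variation ?l + ennreal (2 * (hb x - A)) \<le> pointwise_variation ?l + 0" by simp
    then have "ennreal (2 * (hb x - A)) \<le> 0"
      using pvl by (subst (asm) ennreal_add_left_cancel_le) auto
    then show False using gt by (simp add: ennreal_eq_0_iff)
  qed
qed

lemma level_unrescale:
  assumes V: "0 < V" and X: "X = V powr (1/3)"
  shows "level (unrescale V k) (X * a) (X * b) (X\<^sup>2 * A) = unrescale V (level k a b A)"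
proof -
  note p = powr_thirds[OF V X]
  have "X * a < x \<and> x < X * b \<longleftrightarrow> a < 1 / X * x \<and> 1 / X * x < b" for x
    using p(1) by (simp add: field_simps)
  then show ?thesis unfolding unrescale_alt[OF V X] level_def fun_eq_iff by (auto simp: unrescale_alt[OF V X])
qed

text \<open>
  Minimality of \<open>k\<close> against the levelled profile bounds the excess of \<open>k\<close> over \<open>A\<close> by the elastic cost of
  levelling; the surface minimizer has no excess at all. Hence both are close to \<open>A\<close> in \<open>L\<^sup>1\<close>.
\<close>
lemma minimizer_close_to_mean:
  assumes V: "0 < V" and X: "X = V powr (1/3)" and k: "G_minimizer V k"
    and e: "0 < \<epsilon>" "\<epsilon> \<le> s" and I: "largest_component k s I" and hb: "surface_minimizer k I hb"
    and N: "0 < N" "real N \<le> \<epsilon>\<^sup>2 * X / 8"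
  shows "(LINT x:I|lborel. \<bar>k x - hb x\<bar>) \<le> (X + 2) / ((51/50) ^ N - 1) / \<epsilon>"
proof -
  note p = powr_thirds[OF V X]
  obtain u g1 g2 where K: "lower_semicontinuous k" "integrable lborel k" "\<And>x. 0 \<le> k x" "(LINT x|lborel. k x) = 1"
    "pointwise_variation k < \<infinity>" and cl: "clamped (unrescale V k) u g1 g2"
    and GV: "G V k = ennreal (energy g1 g2 / X\<^sup>2) + pointwise_variation k" and E: "energy g1 g2 \<le> X\<^sup>2 * (X + 2)"
    using G_minimizer_facts[OF V X k] by metis
  have s: "0 < s" using e by simp
  have Ic: "I \<in> components {x. s < k x}" using I by (simp add: largest_component_def)
  obtain a b where ab: "a < b" and Iab: "I = {a<..<b}" and ends: "k a \<le> s" "k b \<le> s"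
    and len: "s * (b - a) \<le> (LINT x|lborel. k x)"
    using component_interval[OF K(1-3) s Ic] .
  have gt: "s < k x" if "x \<in> {a<..<b}" for x using in_components_subset[OF Ic] that Iab by auto
  have i: "integrable lborel (\<lambda>x. indicator {a<..<b} x * k x)"
    using integrable_mult_indicator[OF _ K(2), of "{a<..<b}"] by simp
  have ione: "integrable lborel (indicator {a<..<b} :: real \<Rightarrow> real)" using ab by (simp add: integrable_indicator_iff)
  have one: "(LINT x|lborel. indicator {a<..<b} x) = b - a" using ab by simp
  define A where "A = (LINT x|lborel. indicator {a<..<b} x * k x) / (b - a)"
  have meq: "indicator {a<..<b} x * (k x - c) = indicator {a<..<b} x * k x - c * indicator {a<..<b} x" for x c
    by (simp add: algebra_simps)
  have mean_c: "(LINT x|lborel. indicator {a<..<b} x * (k x - c)) = (LINT x|lborel. indicator {a<..<b} x * k x) - c * (b - a)" for c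
    unfolding meq using i ione one by (simp add: ab less_imp_le)
  have mean: "(LINT x|lborel. indicator {a<..<b} x * (k x - A)) = 0"
    unfolding mean_c A_def using ab by simp
  have "0 \<le> (LINT x|lborel. indicator {a<..<b} x * (k x - s))"
    by (rule integral_nonneg_AE, rule AE_I2) (use gt less_imp_le in \<open>fastforce simp: indicator_def\<close>)
  then have sA: "s \<le> A" unfolding mean_c A_def using ab by (simp add: field_simps)
  have endA: "k a \<le> A" "k b \<le> A" using ends sA by auto
  let ?l = "level k a b A"
  note SM = surface_minimizer_le_mean[OF K(1-3,5) ab endA _ mean hb[unfolded Iab]]
  have A0: "0 \<le> A" using s sA by simp
  have prof: "profile ?l" and hbA: "\<And>x. x \<in> {a<..<b} \<Longrightarrow> hb x \<le> A" and pvl: "pointwise_variation ?l < \<infinity>"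
    using SM[OF A0] by blast+
  have lprops: "lower_semicontinuous ?l" "integrable lborel ?l" "\<And>x. 0 \<le> ?l x"
    using prof by (auto simp: profile_def BV_def)
  have l1: "(LINT x|lborel. ?l x) = 1" using level_integrable(2)[OF K(2), of a b A] mean K(4) by simp
  define \<delta> where "\<delta> = energy g1 g2 / ((51/50) ^ N - 1)"
  have qN: "1 < (51/50 :: real) ^ N" using N(1) by (intro one_less_power) auto
  have d0: "0 \<le> \<delta>" unfolding \<delta>_def using energy_nonneg qN by (intro divide_nonneg_pos) auto
  \<comment> \<open>Levelling costs little elastic energy, so minimality bounds the gain in variation.\<close>
  have gain: "pointwise_variation k \<le> pointwise_variation ?l + ennreal (\<delta> / X\<^sup>2)"
  proof -
    let ?h = "unrescale V k"
    note H = unrescale_props[OF V K(1-3)]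
    have vol: "(LINT x|lborel. ?h x) = X ^ 3" using H(4) K(4) p(2) by simp
    have at: "?h (X * y) = X\<^sup>2 * k y" for y using p(1) by (simp add: unrescale_alt[OF V X])
    have in': "X\<^sup>2 * s < ?h x" if "x \<in> {X * a<..<X * b}" for x
    proof -
      have "1 / X * x \<in> {a<..<b}" using that p(1) by (simp add: field_simps)
      from gt[OF this] show ?thesis using p(1) by (simp add: unrescale_alt[OF V X])
    qed
    have 1: "\<epsilon> * X\<^sup>2 \<le> X\<^sup>2 * s" using e(2) p(1) by simp
    have 2: "X * a < X * b" using ab p(1) by simp
    have 3: "?h (X * a) \<le> X\<^sup>2 * s" "?h (X * b) \<le> X\<^sup>2 * s" unfolding at using ends p(1) by simp_all
    have 4: "X\<^sup>2 * s \<le> X\<^sup>2 * A" using sA p(1) by simp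
    obtain v k1 k2 where v: "clamped (level ?h (X * a) (X * b) (X\<^sup>2 * A)) v k1 k2"
      "energy k1 k2 \<le> energy g1 g2 + energy g1 g2 / ((51/50) ^ N - 1)"
      using elastic_cost_of_levelling[OF p(1) e(1) N H(1-3) vol 1 2 in' 3 4 cl] by metis
    note R = rescaled_profileI[OF V X lprops l1 pvl v(1)[unfolded level_unrescale[OF V X]]]
    have "G V k \<le> G V ?l" using k R(1) unfolding G_minimizer_def by blast
    also have "\<dots> \<le> ennreal (energy k1 k2 / X\<^sup>2) + pointwise_variation ?l" by (rule R(2))
    also have "\<dots> \<le> ennreal ((energy g1 g2 + \<delta>) / X\<^sup>2) + pointwise_variation ?l"
      using v(2) p(1) unfolding \<delta>_def by (intro add_right_mono ennreal_leI divide_right_mono) auto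
    also have "ennreal ((energy g1 g2 + \<delta>) / X\<^sup>2) = ennreal (energy g1 g2 / X\<^sup>2) + ennreal (\<delta> / X\<^sup>2)"
      using d0 energy_nonneg[of g1 g2] by (simp add: add_divide_distrib ennreal_plus)
    finally have "ennreal (energy g1 g2 / X\<^sup>2) + pointwise_variation k
        \<le> ennreal (energy g1 g2 / X\<^sup>2) + (pointwise_variation ?l + ennreal (\<delta> / X\<^sup>2))"
      unfolding GV by (simp add: ac_simps)
    then show ?thesis by (subst (asm) ennreal_add_left_cancel_le) auto
  qed
  have above: "2 * (k x - A) \<le> \<delta> / X\<^sup>2" if x: "x \<in> {a<..<b}" for x
  proof (cases "A \<le> k x")
    case True
    have "pointwise_variation ?l + ennreal (2 * (k x - A)) \<le> pointwise_variation k"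
      using variation_levelled[OF ab x refl endA True] by (simp add: level_def[abs_def])
    also note gain
    finally have "ennreal (2 * (k x - A)) \<le> ennreal (\<delta> / X\<^sup>2)"
      using pvl by (subst (asm) ennreal_add_left_cancel_le) auto
    then show ?thesis using d0 by (subst (asm) ennreal_le_iff) auto
  next
    case False
    then have "2 * (k x - A) \<le> 0" by simp
    also have "0 \<le> \<delta> / X\<^sup>2" using d0 by simp
    finally show ?thesis .
  qed
  have D0: "0 \<le> \<delta> / X\<^sup>2" using d0 by simp
  note Lk = L1_distance_to_level[OF K(2) ab D0 above mean]
  have hbp: "integrable lborel hb" "\<And>x. x \<notin> {a<..<b} \<Longrightarrow> hb x = k x" "(LINT x|lborel. hb x) = 1"
    using hb K(4) unfolding Iab surface_minimizer_def surface_competitors_def profile_def BV_def by auto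
  have hbi: "integrable lborel (\<lambda>x. indicator {a<..<b} x * hb x)"
    using integrable_mult_indicator[OF _ hbp(1), of "{a<..<b}"] by simp
  have "(LINT x|lborel. indicator {a<..<b} x * (hb x - A)) = (LINT x|lborel. indicator {a<..<b} x * (k x - A) + (hb x - k x))"
    by (rule Bochner_Integration.integral_cong) (auto simp: indicator_def hbp(2))
  also have "\<dots> = 0"
  proof -
    have j: "integrable lborel (\<lambda>x. indicator {a<..<b} x * (k x - A))"
      unfolding meq using i ione by (intro Bochner_Integration.integrable_diff integrable_mult_right) auto
    show ?thesis using j hbp(1,3) K(2,4) mean by simp
  qed
  finally have hbm: "(LINT x|lborel. indicator {a<..<b} x * (hb x - A)) = 0" .
  have "2 * (hb x - A) \<le> 0" if "x \<in> {a<..<b}" for x using hbA[OF that] by simp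
  note Lh = L1_distance_to_level[OF hbp(1) ab order_refl this hbm]
  have "(LINT x:I|lborel. \<bar>k x - hb x\<bar>) = (LINT x|lborel. indicator {a<..<b} x * \<bar>k x - hb x\<bar>)"
    by (simp add: set_lebesgue_integral_def Iab)
  also have "\<dots> \<le> (LINT x|lborel. indicator {a<..<b} x * \<bar>k x - A\<bar> + indicator {a<..<b} x * \<bar>hb x - A\<bar>)"
  proof (rule integral_mono)
    have "integrable lborel (\<lambda>x. \<bar>k x - hb x\<bar>)" using K(2) hbp(1) by simp
    from integrable_mult_indicator[OF _ this, of "{a<..<b}"]
    show "integrable lborel (\<lambda>x. indicator {a<..<b} x * \<bar>k x - hb x\<bar>)" by simp
    show "integrable lborel (\<lambda>x. indicator {a<..<b} x * \<bar>k x - A\<bar> + indicator {a<..<b} x * \<bar>hb x - A\<bar>)"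
      using Lk(2) Lh(2) by simp
    show "indicator {a<..<b} x * \<bar>k x - hb x\<bar> \<le> indicator {a<..<b} x * \<bar>k x - A\<bar> + indicator {a<..<b} x * \<bar>hb x - A\<bar>" for x
      by (auto simp: indicator_def)
  qed
  also have "\<dots> \<le> \<delta> / X\<^sup>2 * (b - a)" using Lk Lh by simp
  also have "\<dots> \<le> \<delta> / X\<^sup>2 * (1 / \<epsilon>)"
  proof (rule mult_left_mono[OF _ D0])
    have "\<epsilon> * (b - a) \<le> s * (b - a)" using e(2) ab by (intro mult_right_mono) auto
    then show "b - a \<le> 1 / \<epsilon>" using len K(4) e(1) by (simp add: field_simps)
  qed
  also have "\<dots> \<le> (X + 2) / ((51/50) ^ N - 1) * (1 / \<epsilon>)"
  proof (rule mult_right_mono)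
    have "energy g1 g2 / X\<^sup>2 \<le> X + 2" using E p(1) by (simp add: field_simps)
    then have "energy g1 g2 / X\<^sup>2 / ((51/50) ^ N - 1) \<le> (X + 2) / ((51/50) ^ N - 1)"
      using qN by (intro divide_right_mono) auto
    then show "\<delta> / X\<^sup>2 \<le> (X + 2) / ((51/50) ^ N - 1)" unfolding \<delta>_def by (simp add: mult.commute)
  qed (use e in simp)
  finally show ?thesis by simp
qed

lemma distance_le_two:
  assumes k: "integrable lborel k" "\<And>x. 0 \<le> k x" "(LINT x|lborel. k x) = 1"
    and hb: "surface_minimizer k I hb" and I: "I \<in> sets borel"
  shows "(LINT x:I|lborel. \<bar>k x - hb x\<bar>) \<le> 2"
proof -
  have h: "integrable lborel hb" "\<And>x. 0 \<le> hb x" "(LINT x|lborel. hb x) = 1"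
    using hb k(3) unfolding surface_minimizer_def surface_competitors_def profile_def BV_def by auto
  have "integrable lborel (\<lambda>x. \<bar>k x - hb x\<bar>)" using k(1) h(1) by simp
  from integrable_mult_indicator[OF _ this, of I] I
  have "integrable lborel (\<lambda>x. indicator I x * \<bar>k x - hb x\<bar>)" by simp
  then have "(LINT x|lborel. indicator I x * \<bar>k x - hb x\<bar>) \<le> (LINT x|lborel. k x + hb x)"
    using k(1) h(1)
  proof (intro integral_mono)
    show "indicator I x * \<bar>k x - hb x\<bar> \<le> k x + hb x" for x
      using k(2)[of x] h(2)[of x] by (auto simp: indicator_def)
  qed auto
  also have "\<dots> = 2" using k h by simp
  finally show ?thesis by (simp add: set_lebesgue_integral_def)
qed

text \<open>
  With \<open>q = 51/50\<close> the constant \<open>c\<close> is chosen so that \<open>q\<close> to the power \<open>\<epsilon>\<^sup>2 X / 8\<close> is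
  \<open>exp (c * X)\<close>; rounding the exponent down costs one factor \<open>q\<close>. The factor \<open>X + 2\<close> is absorbed by giving
  away half of the decay. The threshold for \<open>X\<close> ensures \<open>N \<ge> 37\<close>, hence \<open>q ^ N \<ge> 2\<close>, so that subtracting
  one loses at most a factor two.
\<close>
lemma exponential_bound:
  fixes X \<epsilon> :: real
  assumes e: "0 < \<epsilon>" and c: "c = ln (51/50) * \<epsilon>\<^sup>2 / 8" and X: "8 * 37 / \<epsilon>\<^sup>2 \<le> X"
  defines "N \<equiv> nat \<lfloor>\<epsilon>\<^sup>2 * X / 8\<rfloor>"
  shows "0 < N" "real N \<le> \<epsilon>\<^sup>2 * X / 8"
    "(X + 2) / ((51/50) ^ N - 1) / \<epsilon> \<le> 2 * (51/50) / \<epsilon> * (2 / c + 2) * exp (- (c / 2) * X)"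
proof -
  let ?q = "51/50 :: real"
  have c0: "0 < c" unfolding c using e by simp
  have "37 \<le> \<epsilon>\<^sup>2 * X / 8" using X e by (simp add: field_simps)
  then have N: "37 \<le> N" and N1: "real N \<le> \<epsilon>\<^sup>2 * X / 8" "\<epsilon>\<^sup>2 * X / 8 < real N + 1"
    unfolding N_def by linarith+
  show "0 < N" "real N \<le> \<epsilon>\<^sup>2 * X / 8" using N N1 by auto
  have "0 < 8 * 37 / \<epsilon>\<^sup>2" using e by simp
  then have X0: "0 < X" using X by linarith
  have "(2 :: real) \<le> ?q ^ 37" by (simp add: power_divide field_simps)
  also have "\<dots> \<le> ?q ^ N" using N by (intro power_increasing) auto
  finally have two: "2 \<le> ?q ^ N" .
  have qe: "exp (c * X) \<le> ?q * ?q ^ N"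
  proof -
    have "c * X = ln ?q * (\<epsilon>\<^sup>2 * X / 8)" unfolding c by simp
    also have "\<dots> \<le> ln ?q * (real N + 1)" using N1(2) by (intro mult_left_mono) auto
    finally have "exp (c * X) \<le> exp (real (Suc N) * ln ?q)" by (simp add: mult.commute add.commute)
    also have "\<dots> = ?q ^ Suc N" by (subst exp_of_nat_mult) simp
    finally show ?thesis by simp
  qed
  have "(X + 2) / (?q ^ N - 1) \<le> (X + 2) / (?q ^ N / 2)"
    using two X0 by (intro divide_left_mono) auto
  also have "\<dots> \<le> (X + 2) / (exp (c * X) / (2 * ?q))"
    using qe X0 two by (intro divide_left_mono) (auto intro!: mult_pos_pos)
  also have "\<dots> = 2 * ?q * (X + 2) * exp (- (c * X))" by (simp add: exp_minus field_simps)
  also have "\<dots> \<le> 2 * ?q * ((2 / c + 2) * exp (- (c / 2) * X))"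
  proof -
    have "c / 2 * X \<le> exp (c / 2 * X)" using exp_ge_add_one_self[of "c / 2 * X"] by linarith
    then have "X \<le> 2 / c * exp (c / 2 * X)" using c0 by (simp add: field_simps)
    moreover have "1 \<le> exp (c / 2 * X)" using c0 X0 by simp
    ultimately have "X + 2 \<le> 2 / c * exp (c / 2 * X) + 2 * exp (c / 2 * X)" by linarith
    then have "X + 2 \<le> (2 / c + 2) * exp (c / 2 * X)" by (simp only: distrib_right)
    then have "(X + 2) * exp (- (c * X)) \<le> (2 / c + 2) * exp (c / 2 * X) * exp (- (c * X))"
      by (rule mult_right_mono) simp
    also have "\<dots> = (2 / c + 2) * exp (- (c / 2) * X)" by (simp add: mult_exp_exp algebra_simps)
    finally have f: "(X + 2) * exp (- (c * X)) \<le> (2 / c + 2) * exp (- (c / 2) * X)" .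
    have "2 * ?q * ((X + 2) * exp (- (c * X))) \<le> 2 * ?q * ((2 / c + 2) * exp (- (c / 2) * X))"
      by (rule mult_left_mono[OF f]) simp
    then show ?thesis by (simp only: mult.assoc)
  qed
  finally have "(X + 2) / (?q ^ N - 1) \<le> 2 * ?q * ((2 / c + 2) * exp (- (c / 2) * X))" .
  then have "(X + 2) / (?q ^ N - 1) / \<epsilon> \<le> 2 * ?q * ((2 / c + 2) * exp (- (c / 2) * X)) / \<epsilon>"
    using e by (intro divide_right_mono) auto
  moreover have "r * (t * w) / \<epsilon> = r / \<epsilon> * t * w" for r t w :: real by simp
  ultimately show "(X + 2) / (?q ^ N - 1) / \<epsilon> \<le> 2 * ?q / \<epsilon> * (2 / c + 2) * exp (- (c / 2) * X)" by (simp only:)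
qed

theorem proposition4p15:
  fixes \<epsilon> :: real
  assumes "\<epsilon> > 0"
  shows "\<exists>C\<^sub>0 > 0. \<exists>C\<^sub>1 > 0. \<forall>V k s I hb.
           V_bar < ennreal V \<and> G_minimizer V k \<and> s \<ge> \<epsilon> \<and>
           largest_component k s I \<and> surface_minimizer k I hb \<longrightarrow>
           (LINT x:I|lborel. \<bar>k x - hb x\<bar>) \<le> C\<^sub>0 * exp (- C\<^sub>1 * V powr (1 / 3))"
proof -
  define c where "c = ln (51/50) * \<epsilon>\<^sup>2 / 8"
  define X\<^sub>0 where "X\<^sub>0 = 8 * 37 / \<epsilon>\<^sup>2"
  define C where "C = 2 * (51/50) / \<epsilon> * (2 / c + 2)"
  define C\<^sub>0 where "C\<^sub>0 = 2 * exp (c / 2 * X\<^sub>0) + C"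
  have c: "0 < c" unfolding c_def using assms by simp
  have C: "0 < C" unfolding C_def using assms c by (intro mult_pos_pos add_pos_pos) auto
  have C0: "0 < C\<^sub>0" unfolding C\<^sub>0_def using C by (intro add_pos_pos) auto
  have "(LINT x:I|lborel. \<bar>k x - hb x\<bar>) \<le> C\<^sub>0 * exp (- (c / 2) * V powr (1 / 3))"
    if H: "V_bar < ennreal V" "G_minimizer V k" "s \<ge> \<epsilon>" "largest_component k s I" "surface_minimizer k I hb" for V k s I hb
  proof -
    have "0 < ennreal V" using H(1) by (rule order.strict_trans1[OF zero_le])
    then have V: "0 < V" by simp
    define X where "X = V powr (1/3)"
    \<comment> \<open>For small \<open>X\<close> there are too few layers, but then the trivial bound by the two volumes suffices.\<close>
    show ?thesis
    proof (cases "X\<^sub>0 \<le> X")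
      case True
      note B = exponential_bound[OF assms c_def True[unfolded X\<^sub>0_def]]
      have "(LINT x:I|lborel. \<bar>k x - hb x\<bar>) \<le> (X + 2) / ((51/50) ^ nat \<lfloor>\<epsilon>\<^sup>2 * X / 8\<rfloor> - 1) / \<epsilon>"
        by (rule minimizer_close_to_mean[OF V X_def H(2) assms H(3-5) B(1,2)])
      also have "\<dots> \<le> C * exp (- (c / 2) * X)" unfolding C_def by (rule B(3))
      also have "\<dots> \<le> C\<^sub>0 * exp (- (c / 2) * X)" unfolding C\<^sub>0_def by (intro mult_right_mono) auto
      finally show ?thesis by (simp add: X_def)
    next
      case False
      obtain u g1 g2 where K: "lower_semicontinuous k" "integrable lborel k" "\<And>x. 0 \<le> k x" "(LINT x|lborel. k x) = 1"
        using G_minimizer_facts[OF V X_def H(2)] by metis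
      have "open I"
        using K(1) H(4) open_components unfolding lower_semicontinuous_def largest_component_def by blast
      then have "(LINT x:I|lborel. \<bar>k x - hb x\<bar>) \<le> 2"
        by (intro distance_le_two[OF K(2-4) H(5)]) simp
      also have "2 \<le> 2 * exp (c / 2 * X\<^sub>0) * exp (- (c / 2) * X)"
      proof -
        have "0 \<le> c / 2 * X\<^sub>0 - c / 2 * X" using False c by (simp add: mult_left_mono)
        then have "1 \<le> exp (c / 2 * X\<^sub>0 - c / 2 * X)" by simp
        then show ?thesis by (simp add: exp_diff exp_minus field_simps)
      qed
      also have "\<dots> \<le> C\<^sub>0 * exp (- (c / 2) * X)" unfolding C\<^sub>0_def using C by (intro mult_right_mono) auto
      finally show ?thesis by (simp add: X_def)
    qed
  qed
  moreover have "0 < c / 2" using c by simp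
  ultimately show ?thesis using C0 by (intro exI[of _ C\<^sub>0] exI[of _ "c / 2"] conjI) auto
qed

end
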